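(* Let $n\ge 3$ be an integer and let $$p_n:=\frac{\operatorname{Vol}\widetilde{\mathrm{Sos}}^{(n)}_{\mathcal Q}}{\operatorname{Vol}\widetilde{\mathrm{Pos}}^{(n)}_{\mathcal Q}}$$ be the probability that a cross-positive map $\Phi:M_n(\mathbb R)\to M_n(\mathbb R)$ is completely cross-positive (the probability being defined as this ratio of volumes). Then $$p_n<\left(\frac{2^{5}\cdot 2^{1/2}\cdot 5^{2}\cdot 10^{2/9}}{3^{3/2}\cdot\sqrt n}\right)^{D_{\mathcal M}},\qquad D_{\mathcal M}=\binom{n+1}{2}^2-n^2-1.$$ In particular, $\lim_{n\to\infty}p_n=0$.
   Context: Let $x=(x_1,\dots,x_n)$, $y=(y_1,\dots,y_n)$ be tuples of commuting variables, $\mathbb R[x,y]_{k_1,k_2}$ the space of polynomials homogeneous of degree $k_1$ in $x$ and of degree $k_2$ in $y$ (biforms), $I\subseteq\mathbb R[x,y]$ the ideal generated by $\sum_{i=1}^n x_iy_i$, and $V(I)=\{(x,y)\in\mathbb R^n\times\mathbb R^n: y^Tx=0\}$. Put $\mathcal Q=\mathbb R[x,y]_{2,2}/(I\cap\mathbb R[x,y]_{2,2})$; elements of $\mathcal Q$ are functions on $V(I)$. $\mathrm{Pos}^{(n)}_{\mathcal Q}=\{p\in\mathcal Q: p(x,y)\ge 0 \text{ for all }(x,y)\in V(I)\}$ and $\mathrm{Sos}^{(n)}_{\mathcal Q}=\{p\in\mathcal Q: p-\sum_{i=1}^k p_i^2\in I\text{ for some }k\in\mathbb N,\ p_i\in\mathbb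 R[x,y]_{1,1}\}$. Let $T=(\mathbb S^{n-1}\times \mathbb S^{n-1})\cap V(I)$ be the set of pairs of orthonormal vectors in $\mathbb R^n$, and let $\sigma$ be the unique normalized (total mass $1$) Borel measure on $T$ invariant under the action $g(x,y)=(gx,gy)$ of $SO(n)$. Let $\mathcal H=\{f\in\mathcal Q:\int_T f\,d\sigma=1\}$ and $\mathcal M=\{f\in\mathcal Q:\int_T f\,d\sigma=0\}$. Set $\widetilde{\mathrm{Pos}}^{(n)}_{\mathcal Q}=\{f\in\mathcal Q: f+(\sum_i x_i^2)(\sum_i y_i^2)\in \mathrm{Pos}^{(n)}_{\mathcal Q}\cap\mathcal H\}$ and $\widetilde{\mathrm{Sos}}^{(n)}_{\mathcal Q}=\{f\in\mathcal Q: f+(\sum_i x_i^2)(\sum_i y_i^2)\in \mathrm{Sos}^{(n)}_{\mathcal Q}\cap\mathcal H\}$; both are subsets of $\mathcal M$. $\mathcal M$ carries the inner product $\langle f,g\rangle=\int_T fg\,d\sigma$ and has dimension $D_{\mathcal M}$. $\operatorname{Vol}$ denotes the pushforward to $\mathcal M$ of Lebesgue measure on $\mathbb R^{D_{\mathcal M}}$ under any linear isometry $\mathbb R^{D_{\mathcal M}}\to\mathcal M$ (independent of the choice). For orientation: a linear map $A:M_n(\mathbb R)\to M_n(\mathbb R)$ with $A(U^T)=A(U)^T$ is cross-positive if $\operatorname{tr}(A(U)V)\ge0$ for all positive semidefinite $U,V$ with $\operatorname{tr}(UV)=0$, and completely cross-positive if all $I_k\otimes A$, $k\in\mathbb N$,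 are cross-positive; such an $A$ corresponds to the biform $p_A=y^TA(xx^T)y$. *)

theory Defs
  imports
    "HOL-Analysis.Analysis"
    "HOL-Library.Poly_Mapping"
    "Jordan_Normal_Form.VS_Connect"
begin

section \<open>Biforms modulo the ideal of the orthogonality relation\<close>

text \<open>Polynomials are finitely supported maps from monomials to coefficients, monomials being
  finitely supported exponent maps; the product on the outer type is convolution. The variables
  $x_1,\dots,x_n,y_1,\dots,y_n$ are numbered from 0, in agreement with \<^const>\<open>vec_index\<close>.\<close>

datatype var = Xvar nat | Yvar nat

type_synonym rpoly = "(var \<Rightarrow>\<^sub>0 nat) \<Rightarrow>\<^sub>0 real"

definition var_poly :: "var \<Rightarrow> rpoly" where
  "var_poly v = Poly_Mapping.single (Poly_Mapping.single v 1) 1"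

definition const_poly :: "real \<Rightarrow> rpoly" where
  "const_poly c = Poly_Mapping.single 0 c"

definition polys :: "nat \<Rightarrow> rpoly set" where
  "polys n = {p. \<forall>m\<in>Poly_Mapping.keys p. Poly_Mapping.keys m \<subseteq> Xvar ` {..<n} \<union> Yvar ` {..<n}}"

definition biforms :: "nat \<Rightarrow> nat \<Rightarrow> nat \<Rightarrow> rpoly set" where
  "biforms n k1 k2 = {p \<in> polys n. \<forall>m\<in>Poly_Mapping.keys p.
     (\<Sum>i<n. Poly_Mapping.lookup m (Xvar i)) = k1 \<and> (\<Sum>i<n. Poly_Mapping.lookup m (Yvar i)) = k2}"

definition ortho_ideal :: "nat \<Rightarrow> rpoly set" where
  "ortho_ideal n = {g * (\<Sum>i<n. var_poly (Xvar i) * var_poly (Yvar i)) | g. g \<in> polys n}"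

definition biform_rel :: "nat \<Rightarrow> (rpoly \<times> rpoly) set" where
  "biform_rel n = {(p, q). p \<in> biforms n 2 2 \<and> q \<in> biforms n 2 2 \<and> p - q \<in> ortho_ideal n}"

definition biform_class :: "nat \<Rightarrow> rpoly \<Rightarrow> rpoly set" where
  "biform_class n p = biform_rel n `` {p}"

definition biform_quotient :: "nat \<Rightarrow> rpoly set set" where
  "biform_quotient n = biforms n 2 2 // biform_rel n"

definition Q_add :: "nat \<Rightarrow> rpoly set \<Rightarrow> rpoly set \<Rightarrow> rpoly set" where
  "Q_add n f g = (\<Union>p\<in>f. \<Union>q\<in>g. biform_class n (p + q))"

definition Q_smult :: "nat \<Rightarrow> real \<Rightarrow> rpoly set \<Rightarrow> rpoly set" where
  "Q_smult n c f = (\<Union>p\<in>f. biform_class n (const_poly c * p))"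

section \<open>Elements of the quotient as functions\<close>

fun var_value :: "real vec \<times> real vec \<Rightarrow> var \<Rightarrow> real" where
  "var_value (x, y) (Xvar i) = x $ i"
| "var_value (x, y) (Yvar i) = y $ i"

definition poly_eval :: "rpoly \<Rightarrow> real vec \<times> real vec \<Rightarrow> real" where
  "poly_eval p z = (\<Sum>m\<in>Poly_Mapping.keys p. Poly_Mapping.lookup p m *
     (\<Prod>v\<in>Poly_Mapping.keys m. var_value z v ^ Poly_Mapping.lookup m v))"

text \<open>All representatives of a class take the same value at a point of the variety, which is
  what \<^const>\<open>the_elem\<close> extracts; the value is meaningless at other points.\<close>

definition Q_eval :: "rpoly set \<Rightarrow> real vec \<times> real vec \<Rightarrow> real" where
  "Q_eval f z = the_elem ((\<lambda>p. poly_eval p z) ` f)"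

definition ortho_variety :: "nat \<Rightarrow> (real vec \<times> real vec) set" where
  "ortho_variety n = {(x, y). x \<in> carrier_vec n \<and> y \<in> carrier_vec n \<and> scalar_prod y x = 0}"

definition Pos_Q :: "nat \<Rightarrow> rpoly set set" where
  "Pos_Q n = {f \<in> biform_quotient n. \<forall>z\<in>ortho_variety n. Q_eval f z \<ge> 0}"

definition Sos_Q :: "nat \<Rightarrow> rpoly set set" where
  "Sos_Q n = {f \<in> biform_quotient n. \<exists>p\<in>f. \<exists>(k::nat) q. (\<forall>i<k. q i \<in> biforms n 1 1) \<and>
     p - (\<Sum>i<k. (q i)\<^sup>2) \<in> ortho_ideal n}"

section \<open>The invariant measure on orthonormal pairs\<close>

definition SO_mats :: "nat \<Rightarrow> real mat set" where
  "SO_mats n = {g \<in> carrier_mat n n. transpose_mat g * g = 1\<^sub>m n \<and> Determinant.det g = 1}"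

definition orthonormal_pairs :: "nat \<Rightarrow> (real vec \<times> real vec) set" where
  "orthonormal_pairs n =
     {(x, y) \<in> ortho_variety n. scalar_prod x x = 1 \<and> scalar_prod y y = 1}"

text \<open>The Borel sigma-algebra of $\mathbb{R}^n$, carried over from the product sigma-algebra on
  extensional functions.\<close>

definition borel_vec :: "nat \<Rightarrow> real vec measure" where
  "borel_vec n = vimage_algebra (carrier_vec n) (\<lambda>v. \<lambda>i\<in>{..<n}. v $ i) (\<Pi>\<^sub>M i\<in>{..<n}. borel)"

definition is_invariant_measure :: "nat \<Rightarrow> (real vec \<times> real vec) measure \<Rightarrow> bool" where
  "is_invariant_measure n \<mu> \<longleftrightarrow>
     sets \<mu> = sets (restrict_space (borel_vec n \<Otimes>\<^sub>M borel_vec n) (orthonormal_pairs n)) \<and>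
     emeasure \<mu> (orthonormal_pairs n) = 1 \<and>
     (\<forall>g\<in>SO_mats n. distr \<mu> \<mu> (\<lambda>(x, y). (g *\<^sub>v x, g *\<^sub>v y)) = \<mu>)"

definition stiefel_measure :: "nat \<Rightarrow> (real vec \<times> real vec) measure" where
  "stiefel_measure n = (THE \<mu>. is_invariant_measure n \<mu>)"

definition Q_integral :: "nat \<Rightarrow> rpoly set \<Rightarrow> real" where
  "Q_integral n f = (\<integral>z. Q_eval f z \<partial>stiefel_measure n)"

definition H_plane :: "nat \<Rightarrow> rpoly set set" where
  "H_plane n = {f \<in> biform_quotient n. Q_integral n f = 1}"

definition M_set :: "nat \<Rightarrow> rpoly set set" where
  "M_set n = {f \<in> biform_quotient n. Q_integral n f = 0}"

definition M_inner :: "nat \<Rightarrow> rpoly set \<Rightarrow> rpoly set \<Rightarrow> real" where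
  "M_inner n f g = (\<integral>z. Q_eval f z * Q_eval g z \<partial>stiefel_measure n)"

text \<open>The fields \<^verbatim>\<open>mult\<close> and \<^verbatim>\<open>one\<close> of the module record are not part
  of the module structure.\<close>

definition M_space :: "nat \<Rightarrow> (real, rpoly set) module" where
  "M_space n = \<lparr>carrier = M_set n, mult = undefined, one = undefined,
     zero = biform_class n 0, add = Q_add n, smult = Q_smult n\<rparr>"

definition dim_M :: "nat \<Rightarrow> nat" where
  "dim_M n = vectorspace.dim class_ring (M_space n)"

section \<open>Volume\<close>

definition lebesgue_vec :: "nat \<Rightarrow> real vec measure" where
  "lebesgue_vec d = completion (distr (\<Pi>\<^sub>M i\<in>{..<d}. lborel) (borel_vec d) (vec d))"

definition is_linear_isometry :: "nat \<Rightarrow> (real vec \<Rightarrow> rpoly set) \<Rightarrow> bool" where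
  "is_linear_isometry n \<phi> \<longleftrightarrow>
     linear_map class_ring (module_vec TYPE(real) (dim_M n)) (M_space n) \<phi> \<and>
     (\<forall>u\<in>carrier_vec (dim_M n). \<forall>v\<in>carrier_vec (dim_M n).
        M_inner n (\<phi> u) (\<phi> v) = scalar_prod u v)"

text \<open>Any two linear isometries differ by an orthogonal map of the source, so the choice made
  here does not affect the volume.\<close>

definition Vol :: "nat \<Rightarrow> rpoly set set \<Rightarrow> real" where
  "Vol n A = (let \<phi> = (SOME \<phi>. is_linear_isometry n \<phi>) in
     measure (lebesgue_vec (dim_M n)) (\<phi> -` A \<inter> carrier_vec (dim_M n)))"

definition norm_biform :: "nat \<Rightarrow> rpoly set" where
  "norm_biform n =
     biform_class n ((\<Sum>i<n. (var_poly (Xvar i))\<^sup>2) * (\<Sum>i<n. (var_poly (Yvar i))\<^sup>2))"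

definition Pos_tilde :: "nat \<Rightarrow> rpoly set set" where
  "Pos_tilde n = {f \<in> biform_quotient n. Q_add n f (norm_biform n) \<in> Pos_Q n \<inter> H_plane n}"

definition Sos_tilde :: "nat \<Rightarrow> rpoly set set" where
  "Sos_tilde n = {f \<in> biform_quotient n. Q_add n f (norm_biform n) \<in> Sos_Q n \<inter> H_plane n}"

text \<open>The probability that a cross-positive map on real $n\times n$ matrices is completely
  cross-positive is by definition this ratio, via the correspondence between such maps and
  biforms modulo the orthogonality relation.\<close>

definition ccp_prob :: "nat \<Rightarrow> real" where
  "ccp_prob n = Vol n (Sos_tilde n) / Vol n (Pos_tilde n)"

end

theory Submission
  imports Defs "HOL-Probability.Distributions"
begin

text \<open>
  Both \<^const>\<open>Sos_tilde\<close> and \<^const>\<open>Pos_tilde\<close> live in a Euclidean space of dimension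
  $D = \dim\mathcal M$, about $n^4/4$, so their volume ratio is the $D$-th power of a ratio of
  volume radii. The volume radius of the nonnegative biforms is at least of the order $n^{-1/2}$
  and that of the sums of squares at most of the order $n^{-1}$; the quotient is of the order
  $n^{-1/2}$, and all constants are small enough.

  Passing to functions. By homogeneity in $x$ and in $y$, a biform modulo the ideal is determined
  by its values on the set $T$ of orthonormal pairs; that a biform vanishing on $T$ lies in the
  ideal is \<open>vanishing_imp_ideal\<close>. The reason is that modulo $\sum_i x_iy_i$ every biform is a
  combination of monomials not divisible by $x_0y_0$, and that these are linearly independent on
  $T$, as substitution of a monomial curve shows. Counting them gives the dimension.

  The measure. Uniqueness of the invariant measure (\<open>invariant_measure_unique\<close>) follows from
  transitivity of $SO(n)$ on $T$: averaging a Lipschitz function against an invariant kernel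
  concentrated near the diagonal compares its integrals under two invariant measures. Existence
  comes from applying Gram--Schmidt to two independent Gaussian vectors; any rotation invariant
  weight that vanishes on dependent pairs may be inserted, and by uniqueness the resulting measure
  is always the same. Choosing the weight so that it cancels the denominators of Gram--Schmidt
  turns moments of a bilinear form $q(x,y)=\sum b_{ij}x_iy_j$ over $T$ into Gaussian moments
  (\<open>bilform_fourth_moment_nn\<close>, \<open>bilform_second_moment_lower_nn\<close>).

  Nonnegative biforms (\<open>Pos_volume_lower_bound\<close>). Evaluation at a point of $T$ is a linear
  functional on $\mathcal M$ of norm at most $\sqrt D$, because the reproducing kernel is constant
  on the diagonal. A linear functional of norm $\sqrt D$ on a ball of radius $r$ in dimension $D$
  has moments like a Gaussian variable of deviation $r$. Hence for at least half of the ball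
  $\int_T f^{2n}$ is at most $4\,n!\,(2r^2)^n$. As $f^n$ belongs to a rotation invariant space of
  dimension at most $2^{6n-2}$, its supremum is controlled by its second moment, and the $n$-th
  root makes this cost only a constant factor. For $r = 1/(8\sqrt{n+1})$ the result is
  $|f|\le 1$ on $T$, so that $f$ lies in \<^const>\<open>Pos_tilde\<close>.

  Sums of squares (\<open>Sos_volume_upper_bound\<close>). Write $f+1=\sum_l q_l^2$ on $T$ with traceless
  bilinear forms $q_l$. Integrating and using the lower bound for the second moment of a traceless
  form bounds the total squared Frobenius norm of the $q_l$, so $f$ lies in a multiple of the hull
  of $0$ and the projections of the squares $q^2$ to $\mathcal M$. A net of the unit ball of bilinear forms
  has only $21^{n^2}$ points, and its squares are enough to bound any linear functional from below
  (\<open>quadratic_form_net\<close>); by the fourth moment bound these finitely many vertices have norm at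
  most a constant $R$. A point dominated by the vertices in every direction is within $R/\sqrt m$ of
  the mean of $m$ of them (\<open>greedy_average\<close>), so the set is covered by $(2\cdot 21^{n^2})^m$ balls of radius
  $R/\sqrt m$ (\<open>greedy_volume_bound\<close>). With $m$ about $n^2/24$ the number of balls is only
  exponential in $D$.

  For $n\ge 100$ these estimates give the claim (\<open>ratio_bound_numeric\<close>); for smaller $n$ the
  claimed bound exceeds $1$, whereas the ratio is at most $1$ because sums of squares are
  nonnegative.
\<close>

text \<open>From here on, the indexing and scalar product symbols denote the operations on vectors
  whose length is a term.\<close>

unbundle no vec_syntax
no_notation inner (infix "\<bullet>" 70)

section \<open>Vectors as a measurable space\<close>

lemma space_borel_vec [simp]: "space (borel_vec n) = carrier_vec n"
  by (simp add: borel_vec_def)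

lemma measurable_borel_vecI:
  assumes "\<And>x. x \<in> space M \<Longrightarrow> f x \<in> carrier_vec n"
    and "\<And>i. i < n \<Longrightarrow> (\<lambda>x. f x $ i) \<in> borel_measurable M"
  shows "f \<in> measurable M (borel_vec n)"
  unfolding borel_vec_def
proof (rule measurable_vimage_algebra2)
  show "(\<lambda>x. \<lambda>i\<in>{..<n}. f x $ i) \<in> measurable M (\<Pi>\<^sub>M i\<in>{..<n}. borel)"
    by (rule measurable_restrict) (use assms in auto)
qed (use assms in auto)

lemma measurable_vec_index:
  assumes "i < n"
  shows "(\<lambda>v. v $ i) \<in> borel_measurable (borel_vec n)"
proof -
  have "(\<lambda>v. \<lambda>i\<in>{..<n}. v $ i) \<in> measurable (borel_vec n) (\<Pi>\<^sub>M i\<in>{..<n}. (borel :: real measure))"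
    unfolding borel_vec_def by (rule measurable_vimage_algebra1) (auto simp: space_PiM)
  from measurable_compose[OF this measurable_component_singleton[of i]] assms
  show ?thesis by simp
qed

lemma measurable_vec_index' [measurable (raw)]:
  assumes "f \<in> measurable M (borel_vec n)" "i < n"
  shows "(\<lambda>x. f x $ i) \<in> borel_measurable M"
  using measurable_compose[OF assms(1) measurable_vec_index[OF assms(2)]] .

lemma carrier_of_measurable:
  assumes "f \<in> measurable M (borel_vec n)" "x \<in> space M"
  shows "f x \<in> carrier_vec n"
  using measurable_space[OF assms] by simp

lemma measurable_vec [measurable]: "Matrix.vec n \<in> measurable (\<Pi>\<^sub>M i\<in>{..<n}. (lborel :: real measure)) (borel_vec n)"
proof (rule measurable_borel_vecI)
  fix i assume i: "i < n"
  have "(\<lambda>x. x i) \<in> borel_measurable (\<Pi>\<^sub>M i\<in>{..<n}. (lborel :: real measure))"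
    using measurable_component_singleton[of i "{..<n}" "\<lambda>_. lborel :: real measure"] i by simp
  then show "(\<lambda>x. Matrix.vec n x $ i) \<in> borel_measurable (\<Pi>\<^sub>M i\<in>{..<n}. (lborel :: real measure))"
    using i by (subst index_vec) simp_all
qed simp

lemma measurable_vec_add [measurable (raw)]:
  assumes "f \<in> measurable M (borel_vec n)" "g \<in> measurable M (borel_vec n)"
  shows "(\<lambda>x. f x + g x) \<in> measurable M (borel_vec n)"
proof (rule measurable_borel_vecI)
  fix i assume i: "i < n"
  have "(\<lambda>x. f x $ i + g x $ i) \<in> borel_measurable M"
    using assms i by measurable
  moreover have "(f x + g x) $ i = f x $ i + g x $ i" if "x \<in> space M" for x
    using carrier_of_measurable[OF assms(2) that] i by auto
  ultimately show "(\<lambda>x. (f x + g x) $ i) \<in> borel_measurable M"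
    by (subst measurable_cong) auto
qed (use carrier_of_measurable[OF assms(1)] carrier_of_measurable[OF assms(2)] in auto)

lemma measurable_vec_minus [measurable (raw)]:
  assumes "f \<in> measurable M (borel_vec n)" "g \<in> measurable M (borel_vec n)"
  shows "(\<lambda>x. f x - g x) \<in> measurable M (borel_vec n)"
proof (rule measurable_borel_vecI)
  fix i assume i: "i < n"
  have "(\<lambda>x. f x $ i - g x $ i) \<in> borel_measurable M"
    using assms i by measurable
  moreover have "(f x - g x) $ i = f x $ i - g x $ i" if "x \<in> space M" for x
    using carrier_of_measurable[OF assms(2) that] i by auto
  ultimately show "(\<lambda>x. (f x - g x) $ i) \<in> borel_measurable M"
    by (subst measurable_cong) auto
qed (use carrier_of_measurable[OF assms(1)] carrier_of_measurable[OF assms(2)] in auto)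

lemma measurable_vec_smult [measurable (raw)]:
  assumes "f \<in> measurable M (borel_vec n)" "c \<in> borel_measurable M"
  shows "(\<lambda>x. c x \<cdot>\<^sub>v f x) \<in> measurable M (borel_vec n)"
proof (rule measurable_borel_vecI)
  fix i assume i: "i < n"
  have "(\<lambda>x. c x * f x $ i) \<in> borel_measurable M"
    using assms i by measurable
  moreover have "(c x \<cdot>\<^sub>v f x) $ i = c x * f x $ i" if "x \<in> space M" for x
    using carrier_of_measurable[OF assms(1) that] i by auto
  ultimately show "(\<lambda>x. (c x \<cdot>\<^sub>v f x) $ i) \<in> borel_measurable M"
    by (subst measurable_cong) auto
qed (use carrier_of_measurable[OF assms(1)] in auto)

lemma scalar_prod_sum: "w \<in> carrier_vec n \<Longrightarrow> v \<bullet> w = (\<Sum>i<n. v $ i * w $ i)"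
  by (auto simp: scalar_prod_def atLeast0LessThan)

lemma measurable_scalar_prod [measurable (raw)]:
  assumes "f \<in> measurable M (borel_vec n)" "g \<in> measurable M (borel_vec n)"
  shows "(\<lambda>x. f x \<bullet> g x) \<in> borel_measurable M"
proof -
  have "(\<lambda>x. \<Sum>i<n. f x $ i * g x $ i) \<in> borel_measurable M"
    using assms by measurable
  moreover have "f x \<bullet> g x = (\<Sum>i<n. f x $ i * g x $ i)" if "x \<in> space M" for x
    using carrier_of_measurable[OF assms(2) that] by (auto simp: scalar_prod_sum)
  ultimately show ?thesis by (subst measurable_cong) auto
qed

lemma measurable_mult_mat_vec [measurable (raw)]:
  assumes "f \<in> measurable M (borel_vec n)" "A \<in> carrier_mat m n"
  shows "(\<lambda>x. A *\<^sub>v f x) \<in> measurable M (borel_vec m)"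
proof (rule measurable_borel_vecI)
  fix i assume i: "i < m"
  have r: "(\<lambda>x. row A i) \<in> measurable M (borel_vec n)"
    by (rule measurable_const) (use assms i in auto)
  have "(\<lambda>x. row A i \<bullet> f x) \<in> borel_measurable M"
    by (rule measurable_scalar_prod[OF r assms(1)])
  moreover have "(A *\<^sub>v f x) $ i = row A i \<bullet> f x" if "x \<in> space M" for x
    using assms(2) i by (simp add: index_mult_mat_vec)
  ultimately show "(\<lambda>x. (A *\<^sub>v f x) $ i) \<in> borel_measurable M"
    by (subst measurable_cong) auto
qed (use mult_mat_vec_carrier[OF assms(2) carrier_of_measurable[OF assms(1)]] in auto)

section \<open>Lebesgue measure on vectors\<close>

definition lborel_vec :: "nat \<Rightarrow> real vec measure" where
  "lborel_vec n = distr (\<Pi>\<^sub>M i\<in>{..<n}. lborel) (borel_vec n) (Matrix.vec n)"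

lemma lebesgue_vec_eq: "lebesgue_vec n = completion (lborel_vec n)"
  by (simp add: lebesgue_vec_def lborel_vec_def)

lemma sets_lborel_vec [simp, measurable_cong]: "sets (lborel_vec n) = sets (borel_vec n)"
  by (simp add: lborel_vec_def)

lemma space_lborel_vec [simp]: "space (lborel_vec n) = carrier_vec n"
  by (simp add: lborel_vec_def)

interpretation lborel_product: product_sigma_finite "\<lambda>_::nat. lborel :: real measure"
  by standard

lemma nn_integral_lborel_vec:
  assumes "f \<in> borel_measurable (borel_vec n)"
  shows "(\<integral>\<^sup>+ x. f x \<partial>lborel_vec n) = (\<integral>\<^sup>+ x. f (Matrix.vec n x) \<partial>(\<Pi>\<^sub>M i\<in>{..<n}. lborel))"
  unfolding lborel_vec_def using assms by (subst nn_integral_distr) auto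

lemma vec_add_minus_cancel:
  fixes x c :: "real vec"
  assumes "x \<in> carrier_vec n" "c \<in> carrier_vec n"
  shows "x + c - c = x"
  using assms by (intro eq_vecI) auto

lemma sum_sq_ball_iff:
  fixes v c :: "real vec"
  assumes "v \<in> carrier_vec n" "c \<in> carrier_vec n"
  shows "(v - c) \<bullet> (v - c) = (\<Sum>i<n. (v $ i - c $ i)\<^sup>2)"
  using assms by (auto simp: scalar_prod_sum[of _ n] power2_eq_square intro!: sum.cong)

text \<open>On boxes this is translation invariance in each coordinate.\<close>
lemma PiM_translation:
  fixes a :: "nat \<Rightarrow> real"
  shows "distr (\<Pi>\<^sub>M i\<in>{..<n}. lborel) (\<Pi>\<^sub>M i\<in>{..<n}. lborel) (\<lambda>x. \<lambda>i\<in>{..<n}. x i + a i)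
    = (\<Pi>\<^sub>M i\<in>{..<n}. (lborel :: real measure))" (is "distr ?P ?P ?f = _")
proof (rule lborel_product.PiM_eqI)
  fix A :: "nat \<Rightarrow> real set" assume A: "\<And>i. i \<in> {..<n} \<Longrightarrow> A i \<in> sets lborel"
  have m: "?f \<in> measurable ?P ?P" by measurable
  have e: "?f -` (Pi\<^sub>E {..<n} A) \<inter> space ?P = Pi\<^sub>E {..<n} (\<lambda>i. (\<lambda>x. x + a i) -` A i)"
    by (auto simp: space_PiM PiE_iff)
  have s: "(\<lambda>x. x + a i) -` A i \<in> sets borel" if "i < n" for i
  proof -
    have "(\<lambda>x. x + a i) \<in> borel_measurable (borel :: real measure)" by measurable
    from measurable_sets[OF this, of "A i"] A[of i] that show ?thesis by auto
  qed
  have "emeasure (distr ?P ?P ?f) (Pi\<^sub>E {..<n} A) = emeasure ?P (Pi\<^sub>E {..<n} (\<lambda>i. (\<lambda>x. x + a i) -` A i))"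
    using A m by (subst emeasure_distr) (auto simp: e intro!: sets_PiM_I_finite)
  also have "\<dots> = (\<Prod>i<n. emeasure lborel ((\<lambda>x. x + a i) -` A i))"
    using s by (subst lborel_product.emeasure_PiM) auto
  also have "\<dots> = (\<Prod>i<n. emeasure lborel (A i))"
  proof (rule prod.cong)
    fix i assume "i \<in> {..<n}"
    then have "A i \<in> sets borel" using A[of i] by auto
    then have "emeasure lborel (A i) = emeasure (distr lborel borel ((+) (a i))) (A i)"
      by (simp add: lborel_distr_plus)
    also have "\<dots> = emeasure lborel ((\<lambda>x. x + a i) -` A i)"
      using \<open>A i \<in> sets borel\<close> by (subst emeasure_distr) (auto simp: add.commute intro!: arg_cong[where f="emeasure lborel"])
    finally show "emeasure lborel ((\<lambda>x. x + a i) -` A i) = emeasure lborel (A i)" by simp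
  qed auto
  finally show "emeasure (distr ?P ?P ?f) (Pi\<^sub>E {..<n} A) = (\<Prod>i<n. emeasure lborel (A i))" .
qed auto

lemma nn_integral_translate:
  fixes a :: "real vec"
  assumes f: "f \<in> borel_measurable (borel_vec n)" and a: "a \<in> carrier_vec n"
  shows "(\<integral>\<^sup>+ x. f (x + a) \<partial>lborel_vec n) = (\<integral>\<^sup>+ x. f x \<partial>lborel_vec n)"
proof -
  let ?P = "\<Pi>\<^sub>M i\<in>{..<n}. (lborel :: real measure)"
  note a [simp]
  have "(\<lambda>x. f (x + a)) \<in> borel_measurable (borel_vec n)"
    by (intro measurable_compose[OF _ f] measurable_vec_add measurable_const) auto
  then have "(\<integral>\<^sup>+ x. f (x + a) \<partial>lborel_vec n) = (\<integral>\<^sup>+ x. f (Matrix.vec n x + a) \<partial>?P)"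
    by (rule nn_integral_lborel_vec)
  also have "\<dots> = (\<integral>\<^sup>+ x. f (Matrix.vec n (\<lambda>i\<in>{..<n}. x i + a $ i)) \<partial>?P)"
    using a by (intro nn_integral_cong arg_cong[where f=f] eq_vecI) (auto simp: index_add_vec(1) carrier_vecD[OF a])
  also have "\<dots> = (\<integral>\<^sup>+ x. f (Matrix.vec n x) \<partial>distr ?P ?P (\<lambda>x. \<lambda>i\<in>{..<n}. x i + a $ i))"
    using f by (subst nn_integral_distr) (auto intro!: measurable_compose[OF measurable_vec])
  also have "\<dots> = (\<integral>\<^sup>+ x. f x \<partial>lborel_vec n)"
    by (subst PiM_translation) (rule nn_integral_lborel_vec[OF f, symmetric])
  finally show ?thesis .
qed

definition vball :: "nat \<Rightarrow> real vec \<Rightarrow> real \<Rightarrow> real vec set" where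
  "vball n c r = {v \<in> carrier_vec n. (v - c) \<bullet> (v - c) \<le> r\<^sup>2}"

lemma vball_sets [measurable]:
  assumes "c \<in> carrier_vec n"
  shows "vball n c r \<in> sets (borel_vec n)"
proof -
  note assms [simp]
  have "{v \<in> space (borel_vec n). (v - c) \<bullet> (v - c) \<le> r\<^sup>2} \<in> sets (borel_vec n)" by measurable
  then show ?thesis by (simp add: vball_def)
qed

lemma emeasure_vball:
  assumes "c \<in> carrier_vec n" and r: "r > 0"
  shows "emeasure (lborel_vec n) (vball n c r) = ennreal (unit_ball_vol (real n) * r ^ n)"
proof -
  let ?P = "\<Pi>\<^sub>M i\<in>{..<n}. (lborel :: real measure)"
  have "emeasure (lborel_vec n) (vball n (0\<^sub>v n) r) = emeasure ?P (Matrix.vec n -` vball n (0\<^sub>v n) r \<inter> space ?P)"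
    unfolding lborel_vec_def by (rule emeasure_distr) auto
  also have "Matrix.vec n -` vball n (0\<^sub>v n) r \<inter> space ?P = {f. sqrt (\<Sum>i\<in>{..<n}. (f i)\<^sup>2) \<le> r} \<inter> space ?P"
  proof -
    have "Matrix.vec n x \<in> vball n (0\<^sub>v n) r \<longleftrightarrow> sqrt (\<Sum>i\<in>{..<n}. (x i)\<^sup>2) \<le> r" for x
    proof -
      have "(Matrix.vec n x - 0\<^sub>v n) \<bullet> (Matrix.vec n x - 0\<^sub>v n) = (\<Sum>i<n. (x i)\<^sup>2)"
        by (subst sum_sq_ball_iff[of _ n]) auto
      then show ?thesis using r by (auto simp: vball_def intro: real_le_lsqrt dest: sqrt_le_D simp del: minus_zero_vec)
    qed
    then show ?thesis by auto
  qed
  also have "emeasure ?P \<dots> = ennreal (unit_ball_vol (real n) * r ^ n)"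
    using emeasure_cball_aux[of "{..<n}" r] r by simp
  finally have 1: "emeasure (lborel_vec n) (vball n (0\<^sub>v n) r) = ennreal (unit_ball_vol (real n) * r ^ n)" .
  have "emeasure (lborel_vec n) (vball n c r) = (\<integral>\<^sup>+ x. indicator (vball n c r) x \<partial>lborel_vec n)"
    using assms by simp
  also have "\<dots> = (\<integral>\<^sup>+ x. indicator (vball n c r) (x + c) \<partial>lborel_vec n)"
    using assms by (subst nn_integral_translate) auto
  also have "\<dots> = (\<integral>\<^sup>+ x. indicator (vball n (0\<^sub>v n) r) x \<partial>lborel_vec n)"
    using assms by (intro nn_integral_cong) (auto simp: indicator_def vball_def vec_add_minus_cancel)
  finally show ?thesis using 1 by simp
qed

lemma sigma_finite_lborel_vec: "sigma_finite_measure (lborel_vec n)"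
proof
  let ?A = "range (\<lambda>k. vball n (0\<^sub>v n) (real (Suc k)))"
  have "v \<in> \<Union> ?A" if v: "v \<in> carrier_vec n" for v
  proof -
    obtain k where k: "v \<bullet> v \<le> real k" using real_arch_simple by blast
    have "real k \<le> (real (Suc k))\<^sup>2" by (simp add: power2_eq_square algebra_simps)
    then have "v \<in> vball n (0\<^sub>v n) (real (Suc k))" using v k by (auto simp: vball_def)
    then show ?thesis by blast
  qed
  then have "\<Union> ?A = space (lborel_vec n)" by (auto simp: vball_def)
  moreover have "countable ?A" by auto
  moreover have "?A \<subseteq> sets (lborel_vec n)" by auto
  moreover have "\<forall>a\<in>?A. emeasure (lborel_vec n) a \<noteq> \<infinity>" by (auto simp: emeasure_vball)
  ultimately show "\<exists>A. countable A \<and> A \<subseteq> sets (lborel_vec n) \<and> \<Union> A = space (lborel_vec n) \<and>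
     (\<forall>a\<in>A. emeasure (lborel_vec n) a \<noteq> \<infinity>)" by blast
qed

section \<open>Orthogonal invariance of Lebesgue measure\<close>

definition orth_mats :: "nat \<Rightarrow> real mat set" where
  "orth_mats n = {g \<in> carrier_mat n n. transpose_mat g * g = 1\<^sub>m n}"

lemma orth_matsD:
  assumes "g \<in> orth_mats n"
  shows "g \<in> carrier_mat n n" "transpose_mat g * g = 1\<^sub>m n" "g * transpose_mat g = 1\<^sub>m n"
  using assms mat_mult_left_right_inverse[of "transpose_mat g" n g] by (auto simp: orth_mats_def)

lemma orth_mats_transpose: "g \<in> orth_mats n \<Longrightarrow> transpose_mat g \<in> orth_mats n"
  using orth_matsD(1,3)[of g n] by (simp add: orth_mats_def[of n])

lemma orth_mats_apply:
  assumes "g \<in> orth_mats n" "v \<in> carrier_vec n"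
  shows "transpose_mat g *\<^sub>v (g *\<^sub>v v) = v" "g *\<^sub>v (transpose_mat g *\<^sub>v v) = v" "g *\<^sub>v v \<in> carrier_vec n"
proof -
  note g = orth_matsD[OF assms(1)]
  show "transpose_mat g *\<^sub>v (g *\<^sub>v v) = v"
    using g assms(2) by (subst assoc_mult_mat_vec[symmetric]) auto
  show "g *\<^sub>v (transpose_mat g *\<^sub>v v) = v"
    using g assms(2) by (subst assoc_mult_mat_vec[symmetric]) auto
qed (use assms orth_matsD[OF assms(1)] in auto)

lemma scalar_prod_transpose_mat:
  fixes v w :: "real vec"
  assumes "A \<in> carrier_mat m n" "v \<in> carrier_vec m" "w \<in> carrier_vec n"
  shows "v \<bullet> (A *\<^sub>v w) = (transpose_mat A *\<^sub>v v) \<bullet> w"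
  using transpose_vec_mult_scalar[of "transpose_mat A" n m v w] assms
  by (simp add: comm_scalar_prod[of v m] comm_scalar_prod[of w n])

lemma orth_mats_scalar_prod:
  assumes "g \<in> orth_mats n" "v \<in> carrier_vec n" "w \<in> carrier_vec n"
  shows "(g *\<^sub>v v) \<bullet> (g *\<^sub>v w) = v \<bullet> w"
  using assms orth_matsD[OF assms(1)] by (simp add: scalar_prod_transpose_mat[of g n n] orth_mats_apply)

text \<open>Let $B$ be the indicator of the unit ball. By translation invariance
  $\int f(gy)\,dy$ times the volume of the ball is $\iint f(gy)\,B(x-gy)\,dx\,dy$; translating $y$ by
  $g^Tx$ turns this into $\iint f(x+gy)\,B(gy)\,dx\,dy$. Since $B(gy)=B(y)$, the last integral
  is $\int f$ times the volume of the ball.\<close>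
lemma nn_integral_orth:
  assumes g: "g \<in> orth_mats n" and f: "f \<in> borel_measurable (borel_vec n)"
  shows "(\<integral>\<^sup>+ x. f (g *\<^sub>v x) \<partial>lborel_vec n) = (\<integral>\<^sup>+ x. f x \<partial>lborel_vec n)"
proof -
  interpret sigma_finite_measure "lborel_vec n" by (rule sigma_finite_lborel_vec)
  interpret P: pair_sigma_finite "lborel_vec n" "lborel_vec n" ..
  note gc [measurable] = orth_matsD(1)[OF g]
  note f [measurable]
  let ?L = "lborel_vec n" and ?B = "indicator (vball n (0\<^sub>v n) 1) :: real vec \<Rightarrow> ennreal"
  have [measurable]: "(\<lambda>x. f (g *\<^sub>v x)) \<in> borel_measurable (borel_vec n)" by measurable
  have mB [measurable]: "?B \<in> borel_measurable (borel_vec n)" by measurable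
  let ?w = "emeasure ?L (vball n (0\<^sub>v n) 1)"
  have w: "?w \<noteq> 0" "?w \<noteq> \<infinity>"
    using unit_ball_vol_pos[of "real n"] by (simp_all add: emeasure_vball del: unit_ball_vol_pos)
  have wB: "(\<integral>\<^sup>+ x. ?B x \<partial>?L) = ?w" by simp
  have "(\<integral>\<^sup>+ y. f (g *\<^sub>v y) \<partial>?L) * ?w = (\<integral>\<^sup>+ y. f (g *\<^sub>v y) * (\<integral>\<^sup>+ x. ?B x \<partial>?L) \<partial>?L)"
    unfolding wB by (rule nn_integral_multc[symmetric]) measurable
  also have "\<dots> = (\<integral>\<^sup>+ y. (\<integral>\<^sup>+ x. f (g *\<^sub>v y) * ?B (x - g *\<^sub>v y) \<partial>?L) \<partial>?L)"
  proof (rule nn_integral_cong)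
    fix y assume "y \<in> space ?L"
    then have gy: "g *\<^sub>v y \<in> carrier_vec n" using orth_mats_apply[OF g] by simp
    note gy [simp]
    have "(\<integral>\<^sup>+ x. ?B (x - g *\<^sub>v y) \<partial>?L) = (\<integral>\<^sup>+ x. ?B ((x + g *\<^sub>v y) - g *\<^sub>v y) \<partial>?L)"
      by (rule nn_integral_translate[OF _ gy, symmetric]) measurable
    also have "\<dots> = (\<integral>\<^sup>+ x. ?B x \<partial>?L)"
      using gy by (intro nn_integral_cong arg_cong[where f="?B"]) (auto simp: vec_add_minus_cancel)
    finally have "(\<integral>\<^sup>+ x. ?B x \<partial>?L) = (\<integral>\<^sup>+ x. ?B (x - g *\<^sub>v y) \<partial>?L)" ..
    then show "f (g *\<^sub>v y) * (\<integral>\<^sup>+ x. ?B x \<partial>?L) = (\<integral>\<^sup>+ x. f (g *\<^sub>v y) * ?B (x - g *\<^sub>v y) \<partial>?L)"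
      by (subst nn_integral_cmult) auto
  qed
  also have "\<dots> = (\<integral>\<^sup>+ x. (\<integral>\<^sup>+ y. f (g *\<^sub>v y) * ?B (x - g *\<^sub>v y) \<partial>?L) \<partial>?L)"
    by (rule P.Fubini'[symmetric]) measurable
  also have "\<dots> = (\<integral>\<^sup>+ x. (\<integral>\<^sup>+ y. f (x + g *\<^sub>v y) * ?B (g *\<^sub>v y) \<partial>?L) \<partial>?L)"
  proof (rule nn_integral_cong)
    fix x assume "x \<in> space ?L"
    then have x: "x \<in> carrier_vec n" by simp
    let ?a = "transpose_mat g *\<^sub>v x"
    have a: "?a \<in> carrier_vec n" "g *\<^sub>v ?a = x" using x gc orth_mats_apply[OF g x] by auto
    note x [simp] and a(1) [simp]
    have "(\<integral>\<^sup>+ y. f (g *\<^sub>v y) * ?B (x - g *\<^sub>v y) \<partial>?L) = (\<integral>\<^sup>+ y. f (g *\<^sub>v (y + ?a)) * ?B (x - g *\<^sub>v (y + ?a)) \<partial>?L)"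
      by (rule nn_integral_translate[OF _ a(1), symmetric]) measurable
    also have "\<dots> = (\<integral>\<^sup>+ y. f (x + g *\<^sub>v y) * ?B (g *\<^sub>v y) \<partial>?L)"
    proof (rule nn_integral_cong)
      fix y assume "y \<in> space ?L"
      then have y: "y \<in> carrier_vec n" by simp
      have 1: "g *\<^sub>v (y + ?a) = x + g *\<^sub>v y"
        using y a gc x by (subst mult_add_distrib_mat_vec[of g n n]) (auto intro: comm_add_vec[of _ n])
      have gy: "g *\<^sub>v y \<in> carrier_vec n" using gc y by auto
      have 2: "x - (x + g *\<^sub>v y) = - (g *\<^sub>v y)"
        using x gy by auto
      have "?B (- (g *\<^sub>v y)) = ?B (g *\<^sub>v y)"
        using gy by (auto simp: indicator_def vball_def)
      then show "f (g *\<^sub>v (y + ?a)) * ?B (x - g *\<^sub>v (y + ?a)) = f (x + g *\<^sub>v y) * ?B (g *\<^sub>v y)"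
        unfolding 1 2 by simp
    qed
    finally show "(\<integral>\<^sup>+ y. f (g *\<^sub>v y) * ?B (x - g *\<^sub>v y) \<partial>?L) = (\<integral>\<^sup>+ y. f (x + g *\<^sub>v y) * ?B (g *\<^sub>v y) \<partial>?L)" .
  qed
  also have "\<dots> = (\<integral>\<^sup>+ y. (\<integral>\<^sup>+ x. f (x + g *\<^sub>v y) * ?B (g *\<^sub>v y) \<partial>?L) \<partial>?L)"
    by (rule P.Fubini'[symmetric]) measurable
  also have "\<dots> = (\<integral>\<^sup>+ y. (\<integral>\<^sup>+ x. f x \<partial>?L) * ?B y \<partial>?L)"
  proof (rule nn_integral_cong)
    fix y assume "y \<in> space ?L"
    then have y: "y \<in> carrier_vec n" and gy: "g *\<^sub>v y \<in> carrier_vec n" using orth_mats_apply[OF g] by auto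
    note gy [simp]
    have "(\<integral>\<^sup>+ x. f (x + g *\<^sub>v y) * ?B (g *\<^sub>v y) \<partial>?L) = (\<integral>\<^sup>+ x. f (x + g *\<^sub>v y) \<partial>?L) * ?B (g *\<^sub>v y)"
      by (rule nn_integral_multc) measurable
    moreover have "(\<integral>\<^sup>+ x. f (x + g *\<^sub>v y) \<partial>?L) = (\<integral>\<^sup>+ x. f x \<partial>?L)"
      by (rule nn_integral_translate[OF f gy])
    moreover have "?B (g *\<^sub>v y) = ?B y"
      using y gy by (auto simp: indicator_def vball_def orth_mats_scalar_prod[OF g])
    ultimately show "(\<integral>\<^sup>+ x. f (x + g *\<^sub>v y) * ?B (g *\<^sub>v y) \<partial>?L) = (\<integral>\<^sup>+ x. f x \<partial>?L) * ?B y"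
      by simp
  qed
  also have "\<dots> = (\<integral>\<^sup>+ x. f x \<partial>?L) * ?w"
    unfolding wB[symmetric] by (rule nn_integral_cmult) measurable
  finally show ?thesis using w ennreal_mult_divide_eq[of ?w] by (metis infinity_ennreal_def)
qed

section \<open>Householder reflections\<close>

definition reflection :: "nat \<Rightarrow> real vec \<Rightarrow> real mat" where
  "reflection n u = mat n n (\<lambda>(i, j). (if i = j then 1 else 0) - 2 / (u \<bullet> u) * u $ i * u $ j)"

lemma reflection_carrier [simp]: "reflection n u \<in> carrier_mat n n"
  by (simp add: reflection_def)

lemma reflection_apply:
  assumes "u \<in> carrier_vec n" "v \<in> carrier_vec n"
  shows "reflection n u *\<^sub>v v = v - (2 * (u \<bullet> v) / (u \<bullet> u)) \<cdot>\<^sub>v u"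
proof (rule eq_vecI)
  fix i assume "i < dim_vec (v - (2 * (u \<bullet> v) / (u \<bullet> u)) \<cdot>\<^sub>v u)"
  then have i: "i < n" using assms by simp
  have "(reflection n u *\<^sub>v v) $ i = (\<Sum>j<n. ((if i = j then 1 else 0) - 2 / (u \<bullet> u) * u $ i * u $ j) * v $ j)"
    using assms i by (simp add: reflection_def scalar_prod_sum[of _ n])
  also have "\<dots> = (\<Sum>j<n. (if i = j then v $ j else 0)) - (\<Sum>j<n. 2 / (u \<bullet> u) * u $ i * (u $ j * v $ j))"
    unfolding sum_subtractf[symmetric] by (rule sum.cong) (auto simp: algebra_simps)
  also have "\<dots> = v $ i - 2 / (u \<bullet> u) * u $ i * (u \<bullet> v)"
    using assms i by (simp add: scalar_prod_sum[of v n] sum_distrib_left)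
  finally show "(reflection n u *\<^sub>v v) $ i = (v - (2 * (u \<bullet> v) / (u \<bullet> u)) \<cdot>\<^sub>v u) $ i"
    using assms i by simp
qed (use assms in \<open>auto simp: reflection_def\<close>)

lemma transpose_reflection: "transpose_mat (reflection n u) = reflection n u"
  by (rule eq_matI) (auto simp: reflection_def)

lemma real_scalar_prod_eq_0_iff:
  fixes u :: "real vec"
  assumes "u \<in> carrier_vec n"
  shows "u \<bullet> u = 0 \<longleftrightarrow> u = 0\<^sub>v n"
proof
  assume "u \<bullet> u = 0"
  then have "\<forall>i\<in>{..<n}. u $ i * u $ i = 0"
    unfolding scalar_prod_sum[OF assms] by (subst (asm) sum_nonneg_eq_0_iff) auto
  then show "u = 0\<^sub>v n" using assms by (intro eq_vecI) auto
qed simp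

lemma real_scalar_prod_ge_0: "(u :: real vec) \<bullet> u \<ge> 0"
  by (auto simp: scalar_prod_def intro!: sum_nonneg)

lemma reflection_involution:
  assumes u: "u \<in> carrier_vec n" and v: "v \<in> carrier_vec n"
  shows "reflection n u *\<^sub>v (reflection n u *\<^sub>v v) = v"
proof (cases "u \<bullet> u = 0")
  case True
  then show ?thesis using assms by (auto simp: reflection_apply intro!: eq_vecI)
next
  case False
  define c where "c = 2 * (u \<bullet> v) / (u \<bullet> u)"
  have 1: "reflection n u *\<^sub>v v = v - c \<cdot>\<^sub>v u" unfolding c_def using assms by (rule reflection_apply)
  have "u \<bullet> (v - c \<cdot>\<^sub>v u) = u \<bullet> v - c * (u \<bullet> u)"
    using assms by (simp add: scalar_prod_minus_distrib[of u n])
  also have "\<dots> = - (u \<bullet> v)" using False by (simp add: c_def)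
  finally have 2: "u \<bullet> (v - c \<cdot>\<^sub>v u) = - (u \<bullet> v)" .
  have "reflection n u *\<^sub>v (v - c \<cdot>\<^sub>v u) = (v - c \<cdot>\<^sub>v u) - (- c) \<cdot>\<^sub>v u"
    using assms by (subst reflection_apply) (auto simp: 2, simp add: c_def)
  also have "\<dots> = v" using assms by (intro eq_vecI) auto
  finally show ?thesis unfolding 1 .
qed

lemma mat_eq_1_of_fixes:
  fixes A :: "real mat"
  assumes A: "A \<in> carrier_mat n n" and A1: "\<And>v. v \<in> carrier_vec n \<Longrightarrow> A *\<^sub>v v = v"
  shows "A = 1\<^sub>m n"
proof (rule eq_matI)
  fix i j assume "i < dim_row (1\<^sub>m n :: real mat)" "j < dim_col (1\<^sub>m n :: real mat)"
  then have ij: "i < n" "j < n" by auto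
  have "A $$ (i, j) = (A *\<^sub>v unit_vec n j) $ i"
    using A ij by (simp add: scalar_prod_right_unit)
  also have "\<dots> = (unit_vec n j :: real vec) $ i" using A1 by simp
  finally show "A $$ (i, j) = 1\<^sub>m n $$ (i, j)" using ij by (simp add: unit_vec_def)
qed (use A in auto)

lemma reflection_orth:
  assumes "u \<in> carrier_vec n"
  shows "reflection n u \<in> orth_mats n"
proof -
  have "reflection n u * reflection n u = 1\<^sub>m n"
    by (rule mat_eq_1_of_fixes)
      (simp_all add: assoc_mult_mat_vec[OF reflection_carrier reflection_carrier] reflection_involution[OF assms]
        mult_carrier_mat[OF reflection_carrier reflection_carrier])
  then show ?thesis by (simp add: orth_mats_def transpose_reflection)
qed

lemma reflection_maps:
  assumes u: "u \<in> carrier_vec n" and v: "v \<in> carrier_vec n" and eq: "u \<bullet> u = v \<bullet> v"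
  shows "reflection n (u - v) *\<^sub>v u = v"
proof (cases "u = v")
  case True
  then show ?thesis using u v by (subst reflection_apply) (auto intro!: eq_vecI)
next
  case False
  have ne: "(u - v) \<bullet> (u - v) \<noteq> 0"
  proof
    assume "(u - v) \<bullet> (u - v) = 0"
    then have "u - v = 0\<^sub>v n" using u v real_scalar_prod_eq_0_iff[of "u - v" n] by auto
    then have "\<forall>i<n. u $ i = v $ i" using u v by (metis carrier_vecD eq_iff_diff_eq_0 index_minus_vec(1) index_zero_vec(1))
    then show False using False u v by (auto intro: eq_vecI)
  qed
  have "(u - v) \<bullet> u = u \<bullet> u - v \<bullet> u" "(u - v) \<bullet> (u - v) = 2 * (u \<bullet> u - v \<bullet> u)"
    using u v eq by (simp_all add: minus_scalar_prod_distrib[of _ n] scalar_prod_minus_distrib[of _ n] comm_scalar_prod[of u n v])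
  then have "2 * ((u - v) \<bullet> u) / ((u - v) \<bullet> (u - v)) = 1" using ne by simp
  then show ?thesis using u v
    by (subst reflection_apply) (auto intro!: eq_vecI)
qed

lemma orth_mats_mult: "g \<in> orth_mats n \<Longrightarrow> h \<in> orth_mats n \<Longrightarrow> g * h \<in> orth_mats n"
proof -
  assume g: "g \<in> orth_mats n" and h: "h \<in> orth_mats n"
  note gc = orth_matsD[OF g] and hc = orth_matsD[OF h]
  have "transpose_mat (g * h) * (g * h) = 1\<^sub>m n"
  proof (rule mat_eq_1_of_fixes)
    fix v :: "real vec" assume v: "v \<in> carrier_vec n"
    have "(transpose_mat (g * h) * (g * h)) *\<^sub>v v = transpose_mat h *\<^sub>v (transpose_mat g *\<^sub>v (g *\<^sub>v (h *\<^sub>v v)))"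
      using gc hc v by (simp add: transpose_mult[of g n n h n] assoc_mult_mat_vec[of _ n n _ n])
    then show "(transpose_mat (g * h) * (g * h)) *\<^sub>v v = v"
      using orth_mats_apply[OF h v] orth_mats_apply[OF g] by simp
  qed (use gc hc in auto)
  then show ?thesis using gc hc by (simp add: orth_mats_def)
qed

lemma det_orth_sq:
  assumes "g \<in> orth_mats n"
  shows "Determinant.det g * Determinant.det g = 1"
proof -
  note g = orth_matsD[OF assms]
  have "Determinant.det (transpose_mat g * g) = 1" using g by simp
  then show ?thesis using g det_mult[of "transpose_mat g" n g] det_transpose[of g n] by simp
qed

text \<open>The reflection that exchanges $u$ with a multiple of $v$ of the same length
  conjugates the two reflections into each other.\<close>
lemma det_reflection_eq:
  assumes u: "u \<in> carrier_vec n" "u \<bullet> u \<noteq> 0" and v: "v \<in> carrier_vec n" "v \<bullet> v \<noteq> 0"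
  shows "Determinant.det (reflection n u) = Determinant.det (reflection n v)"
proof -
  define a where "a = sqrt (u \<bullet> u / (v \<bullet> v))"
  have a: "a \<noteq> 0" "a\<^sup>2 = u \<bullet> u / (v \<bullet> v)"
    using u v real_scalar_prod_ge_0[of u] real_scalar_prod_ge_0[of v] by (auto simp: a_def)
  define w where "w = a \<cdot>\<^sub>v v"
  have w: "w \<in> carrier_vec n" using v by (simp add: w_def)
  have ww: "u \<bullet> u = w \<bullet> w"
    using v a by (simp add: w_def power2_eq_square[symmetric] mult.assoc[symmetric])
  define h where "h = reflection n (u - w)"
  have h: "h \<in> orth_mats n" "h *\<^sub>v u = w" "transpose_mat h = h" "h \<in> carrier_mat n n"
    unfolding h_def using reflection_orth reflection_maps[OF u(1) w ww] u(1) w by (auto simp: transpose_reflection)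
  note R = mult_carrier_mat[OF reflection_carrier[of n u] h(4)]
  have eq: "reflection n v = h * (reflection n u * h)"
  proof -
    have "reflection n v *\<^sub>v x = h *\<^sub>v (reflection n u *\<^sub>v (h *\<^sub>v x))" if x: "x \<in> carrier_vec n" for x
    proof -
      have hx: "h *\<^sub>v x \<in> carrier_vec n" using h x by auto
      have hh: "h *\<^sub>v (h *\<^sub>v x) = x" using orth_mats_apply(1)[OF h(1) x] h(3) by simp
      have "u \<bullet> (h *\<^sub>v x) = w \<bullet> x"
        using scalar_prod_transpose_mat[OF h(4) u(1) x] h by simp
      then have "h *\<^sub>v (reflection n u *\<^sub>v (h *\<^sub>v x)) = h *\<^sub>v (h *\<^sub>v x - (2 * (w \<bullet> x) / (w \<bullet> w)) \<cdot>\<^sub>v u)"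
        using u hx ww by (simp add: reflection_apply)
      also have "\<dots> = x - (2 * (w \<bullet> x) / (w \<bullet> w)) \<cdot>\<^sub>v w"
        using h hx hh u x by (subst mult_minus_distrib_mat_vec[of _ n n]) (auto simp: mult_mat_vec[of _ n n])
      also have "\<dots> = reflection n v *\<^sub>v x"
        using v x a u by (simp add: reflection_apply w_def smult_smult_assoc power2_eq_square[symmetric])
      finally show ?thesis ..
    qed
    then have e: "reflection n v *\<^sub>v x = (h * (reflection n u * h)) *\<^sub>v x" if "x \<in> carrier_vec n" for x
      using that by (simp add: assoc_mult_mat_vec[OF h(4) R] assoc_mult_mat_vec[OF reflection_carrier h(4)])
    show ?thesis
    proof (rule eq_matI)
      fix i j assume "i < dim_row (h * (reflection n u * h))" "j < dim_col (h * (reflection n u * h))"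
      then have ij: "i < n" "j < n" using h by auto
      have "(reflection n v *\<^sub>v unit_vec n j) $ i = ((h * (reflection n u * h)) *\<^sub>v unit_vec n j) $ i"
        using e[of "unit_vec n j"] by simp
      then show "reflection n v $$ (i, j) = (h * (reflection n u * h)) $$ (i, j)"
        using ij h carrier_matD[OF reflection_carrier[of n v]] carrier_matD[OF reflection_carrier[of n u]]
        by (simp add: scalar_prod_right_unit index_mult_mat_vec row_def)
    qed (use h carrier_matD[OF reflection_carrier[of n v]] in auto)
  qed
  show ?thesis unfolding eq using h det_orth_sq[OF h(1)]
    by (simp add: det_mult[OF h(4) R] det_mult[OF reflection_carrier h(4)])
qed

section \<open>The standard Gaussian measure\<close>

definition gauss :: "nat \<Rightarrow> real vec measure" where
  "gauss n = density (lborel_vec n) (\<lambda>x. ennreal (\<Prod>i<n. std_normal_density (x $ i)))"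

lemma sets_gauss [simp, measurable_cong]: "sets (gauss n) = sets (borel_vec n)"
  by (simp add: gauss_def)

lemma space_gauss [simp]: "space (gauss n) = carrier_vec n"
  by (simp add: gauss_def)

lemma gauss_density_rot:
  assumes "x \<in> carrier_vec n"
  shows "(\<Prod>i<n. std_normal_density (x $ i)) = (1 / sqrt (2 * pi)) ^ n * exp (- (x \<bullet> x) / 2)"
proof -
  have "(\<Prod>i<n. std_normal_density (x $ i)) = (\<Prod>i<n. 1 / sqrt (2 * pi)) * (\<Prod>i<n. exp (- (x $ i)\<^sup>2 / 2))"
    unfolding prod.distrib[symmetric] std_normal_density_def by simp
  also have "(\<Prod>i<n. exp (- (x $ i)\<^sup>2 / 2)) = exp (\<Sum>i<n. - (x $ i)\<^sup>2 / 2)"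
    by (rule exp_sum[symmetric]) simp
  also have "(\<Sum>i<n. - (x $ i)\<^sup>2 / 2) = - (x \<bullet> x) / 2"
    using assms by (simp add: scalar_prod_sum[of _ n] power2_eq_square sum_negf sum_divide_distrib)
  finally show ?thesis by simp
qed

lemma nn_integral_gauss:
  assumes "f \<in> borel_measurable (borel_vec n)"
  shows "(\<integral>\<^sup>+ x. f x \<partial>gauss n) = (\<integral>\<^sup>+ x. ennreal (\<Prod>i<n. std_normal_density (x $ i)) * f x \<partial>lborel_vec n)"
  unfolding gauss_def using assms by (subst nn_integral_density) auto

lemma nn_integral_gauss_orth:
  assumes g: "g \<in> orth_mats n" and f: "f \<in> borel_measurable (borel_vec n)"
  shows "(\<integral>\<^sup>+ x. f (g *\<^sub>v x) \<partial>gauss n) = (\<integral>\<^sup>+ x. f x \<partial>gauss n)"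
proof -
  note f [measurable] and orth_matsD(1)[OF g, simp]
  let ?d = "\<lambda>x. ennreal (\<Prod>i<n. std_normal_density (x $ i)) * f x"
  have "(\<lambda>x. f (g *\<^sub>v x)) \<in> borel_measurable (borel_vec n)" by measurable
  then have "(\<integral>\<^sup>+ x. f (g *\<^sub>v x) \<partial>gauss n) = (\<integral>\<^sup>+ x. ennreal (\<Prod>i<n. std_normal_density (x $ i)) * f (g *\<^sub>v x) \<partial>lborel_vec n)"
    by (rule nn_integral_gauss)
  also have "\<dots> = (\<integral>\<^sup>+ x. ?d (g *\<^sub>v x) \<partial>lborel_vec n)"
    using orth_mats_apply(3)[OF g] by (intro nn_integral_cong) (simp add: gauss_density_rot orth_mats_scalar_prod[OF g])
  also have "\<dots> = (\<integral>\<^sup>+ x. ?d x \<partial>lborel_vec n)"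
    by (rule nn_integral_orth[OF g]) measurable
  also have "\<dots> = (\<integral>\<^sup>+ x. f x \<partial>gauss n)" using f by (rule nn_integral_gauss[symmetric])
  finally show ?thesis .
qed

lemma nn_integral_gauss_prod:
  assumes f: "\<And>i. i < n \<Longrightarrow> f i \<in> borel_measurable borel"
  shows "(\<integral>\<^sup>+ x. (\<Prod>i<n. f i (x $ i)) \<partial>gauss n) = (\<Prod>i<n. \<integral>\<^sup>+ t. ennreal (std_normal_density t) * f i t \<partial>lborel)"
proof -
  have fm [measurable]: "(\<lambda>x. f i (x $ i)) \<in> borel_measurable (borel_vec n)" if "i < n" for i
    using measurable_compose[OF measurable_vec_index[OF that] f[OF that]] .
  have [measurable]: "(\<lambda>x. (\<Prod>i<n. f i (x $ i))) \<in> borel_measurable (borel_vec n)"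
    by (rule borel_measurable_prod_ennreal) (use fm in auto)
  have "(\<integral>\<^sup>+ x. (\<Prod>i<n. f i (x $ i)) \<partial>gauss n) =
     (\<integral>\<^sup>+ x. ennreal (\<Prod>i<n. std_normal_density (x $ i)) * (\<Prod>i<n. f i (x $ i)) \<partial>lborel_vec n)"
    by (rule nn_integral_gauss) measurable
  also have "\<dots> = (\<integral>\<^sup>+ x. (\<Prod>i<n. ennreal (std_normal_density (x $ i)) * f i (x $ i)) \<partial>lborel_vec n)"
    by (intro nn_integral_cong) (simp add: prod.distrib prod_ennreal)
  also have "\<dots> = (\<integral>\<^sup>+ x. (\<Prod>i<n. ennreal (std_normal_density (Matrix.vec n x $ i)) * f i (Matrix.vec n x $ i)) \<partial>(\<Pi>\<^sub>M i\<in>{..<n}. lborel))"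
  proof (rule nn_integral_lborel_vec)
    show "(\<lambda>x. (\<Prod>i<n. ennreal (std_normal_density (x $ i)) * f i (x $ i))) \<in> borel_measurable (borel_vec n)"
      by (intro borel_measurable_prod_ennreal borel_measurable_times_ennreal fm
          measurable_compose[OF measurable_vec_index measurable_compose[OF borel_measurable_normal_density measurable_ennreal]]) auto
  qed
  also have "\<dots> = (\<integral>\<^sup>+ x. (\<Prod>i<n. ennreal (std_normal_density (x i)) * f i (x i)) \<partial>(\<Pi>\<^sub>M i\<in>{..<n}. lborel))"
    by (intro nn_integral_cong prod.cong) auto
  also have "\<dots> = (\<Prod>i<n. \<integral>\<^sup>+ t. ennreal (std_normal_density t) * f i t \<partial>lborel)"
  proof (rule lborel_product.product_nn_integral_prod)
    fix i assume "i \<in> {..<n}"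
    then have [measurable]: "f i \<in> borel_measurable borel" using f by simp
    show "(\<lambda>t. ennreal (std_normal_density t) * f i t) \<in> borel_measurable lborel" by measurable
  qed simp
  finally show ?thesis .
qed

lemma nn_integral_std_normal: "(\<integral>\<^sup>+ t. ennreal (std_normal_density t) \<partial>lborel) = 1"
  using std_normal_moment_even[of 0]
  by (subst nn_integral_eq_integral) (auto simp: has_bochner_integral_iff)

lemma nn_integral_std_normal_even:
  "(\<integral>\<^sup>+ t. ennreal (std_normal_density t) * ennreal (t ^ (2 * k)) \<partial>lborel) = ennreal (fact (2 * k) / (2 ^ k * fact k))"
proof -
  have "(\<integral>\<^sup>+ t. ennreal (std_normal_density t) * ennreal (t ^ (2 * k)) \<partial>lborel) = (\<integral>\<^sup>+ t. ennreal (std_normal_density t * t ^ (2 * k)) \<partial>lborel)"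
    by (intro nn_integral_cong) (simp add: ennreal_mult)
  also have "\<dots> = ennreal (fact (2 * k) / (2 ^ k * fact k))"
    using std_normal_moment_even[of k]
    by (subst nn_integral_eq_integral) (auto simp: has_bochner_integral_iff)
  finally show ?thesis .
qed

interpretation gauss: prob_space "gauss n" for n
proof
  have "emeasure (gauss n) (space (gauss n)) = (\<integral>\<^sup>+ x. (\<Prod>i<n. 1) \<partial>gauss n)" by simp
  also have "\<dots> = 1"
    by (subst nn_integral_gauss_prod) (auto simp: nn_integral_std_normal)
  finally show "emeasure (gauss n) (space (gauss n)) = 1" .
qed

lemma nn_integral_gauss_linear:
  assumes c: "c \<in> carrier_vec n"
  shows "(\<integral>\<^sup>+ x. ennreal ((c \<bullet> x) ^ (2 * k)) \<partial>gauss n) = ennreal ((c \<bullet> c) ^ k * (fact (2 * k) / (2 ^ k * fact k)))"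
proof (cases "n = 0")
  case True
  then have 0: "c \<bullet> x = 0" if "x \<in> carrier_vec n" for x using that by (simp add: scalar_prod_def)
  have "(\<integral>\<^sup>+ x. ennreal ((c \<bullet> x) ^ (2 * k)) \<partial>gauss n) = (\<integral>\<^sup>+ x. ennreal (0 ^ (2 * k)) \<partial>gauss n)"
    by (intro nn_integral_cong) (simp add: 0)
  then show ?thesis using gauss.emeasure_space_1[of n] 0[OF c] by (cases "k = 0") (auto simp: power_0_left)
next
  case False
  define e where "e = sqrt (c \<bullet> c) \<cdot>\<^sub>v (unit_vec n 0 :: real vec)"
  have e: "e \<in> carrier_vec n" by (simp add: e_def)
  have ce: "c \<bullet> c = e \<bullet> e" using False real_scalar_prod_ge_0[of c]
    by (simp add: e_def)
  define g where "g = reflection n (c - e)"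
  have g: "g \<in> orth_mats n" "g *\<^sub>v c = e" "g \<in> carrier_mat n n"
    unfolding g_def using reflection_orth reflection_maps[OF c e ce] c e by auto
  have "(\<integral>\<^sup>+ x. ennreal ((c \<bullet> x) ^ (2 * k)) \<partial>gauss n) = (\<integral>\<^sup>+ x. ennreal ((e \<bullet> (g *\<^sub>v x)) ^ (2 * k)) \<partial>gauss n)"
    using g c by (intro nn_integral_cong) (simp flip: g(2) add: orth_mats_scalar_prod[OF g(1)])
  also have "\<dots> = (\<integral>\<^sup>+ x. ennreal ((e \<bullet> x) ^ (2 * k)) \<partial>gauss n)"
    using e by (intro nn_integral_gauss_orth[OF g(1)]) measurable
  also have "\<dots> = (\<integral>\<^sup>+ x. (\<Prod>i<n. if i = 0 then ennreal ((c \<bullet> c) ^ k) * ennreal ((x $ i) ^ (2 * k)) else 1) \<partial>gauss n)"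
  proof (rule nn_integral_cong)
    fix x assume "x \<in> space (gauss n)"
    then have x: "x \<in> carrier_vec n" by simp
    have "e \<bullet> x = sqrt (c \<bullet> c) * x $ 0" using x False by (simp add: e_def)
    then have "(e \<bullet> x) ^ (2 * k) = (c \<bullet> c) ^ k * (x $ 0) ^ (2 * k)"
      using real_scalar_prod_ge_0[of c] by (simp add: power_mult_distrib power_mult)
    then show "ennreal ((e \<bullet> x) ^ (2 * k)) = (\<Prod>i<n. if i = 0 then ennreal ((c \<bullet> c) ^ k) * ennreal ((x $ i) ^ (2 * k)) else 1)"
      using False real_scalar_prod_ge_0[of c] by (simp add: ennreal_mult)
  qed
  also have "\<dots> = (\<Prod>i<n. \<integral>\<^sup>+ t. ennreal (std_normal_density t) * (if i = 0 then ennreal ((c \<bullet> c) ^ k) * ennreal (t ^ (2 * k)) else 1) \<partial>lborel)"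
    by (rule nn_integral_gauss_prod[where f = "\<lambda>i t. if i = 0 then ennreal ((c \<bullet> c) ^ k) * ennreal (t ^ (2 * k)) else 1"]) auto
  also have "\<dots> = (\<Prod>i<n. if i = 0 then (\<integral>\<^sup>+ t. ennreal ((c \<bullet> c) ^ k) * (ennreal (std_normal_density t) * ennreal (t ^ (2 * k))) \<partial>lborel) else 1)"
    by (intro prod.cong refl) (auto simp: nn_integral_std_normal mult_ac)
  also have "\<dots> = ennreal ((c \<bullet> c) ^ k) * ennreal (fact (2 * k) / (2 ^ k * fact k))"
    using False by (simp add: nn_integral_cmult nn_integral_std_normal_even)
  also have "\<dots> = ennreal ((c \<bullet> c) ^ k * (fact (2 * k) / (2 ^ k * fact k)))"
    by (rule ennreal_mult[symmetric]) (use real_scalar_prod_ge_0[of c] in auto)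
  finally show ?thesis .
qed

lemma gauss_linear_moment:
  assumes c: "c \<in> carrier_vec n"
  shows "has_bochner_integral (gauss n) (\<lambda>x. (c \<bullet> x) ^ (2 * k)) ((c \<bullet> c) ^ k * (fact (2 * k) / (2 ^ k * fact k)))"
proof (rule has_bochner_integral_nn_integral)
  show "(\<lambda>x. (c \<bullet> x) ^ (2 * k)) \<in> borel_measurable (gauss n)"
    by (intro borel_measurable_power measurable_scalar_prod[of _ _ n] measurable_const measurable_ident_sets) (use c in auto)
qed (use nn_integral_gauss_linear[OF c] real_scalar_prod_ge_0[of c] in \<open>auto simp: power_mult\<close>)

lemma gauss_linear_2:
  assumes "c \<in> carrier_vec n"
  shows "integrable (gauss n) (\<lambda>x. (c \<bullet> x)\<^sup>2)" "(\<integral>x. (c \<bullet> x)\<^sup>2 \<partial>gauss n) = c \<bullet> c"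
  using gauss_linear_moment[OF assms, of 1] by (auto simp: has_bochner_integral_iff)

lemma gauss_linear_4:
  assumes "c \<in> carrier_vec n"
  shows "integrable (gauss n) (\<lambda>x. (c \<bullet> x) ^ 4)" "(\<integral>x. (c \<bullet> x) ^ 4 \<partial>gauss n) = 3 * (c \<bullet> c)\<^sup>2"
  using gauss_linear_moment[OF assms, of 2] by (auto simp: has_bochner_integral_iff fact_numeral)

section \<open>Orthonormal pairs\<close>

lemma orthonormal_pairs_iff:
  "(x, y) \<in> orthonormal_pairs n \<longleftrightarrow> x \<in> carrier_vec n \<and> y \<in> carrier_vec n \<and> x \<bullet> y = 0 \<and> x \<bullet> x = 1 \<and> y \<bullet> y = 1"
  by (auto simp: orthonormal_pairs_def ortho_variety_def comm_scalar_prod)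

abbreviation rot :: "real mat \<Rightarrow> real vec \<times> real vec \<Rightarrow> real vec \<times> real vec" where
  "rot g \<equiv> (\<lambda>(x, y). (g *\<^sub>v x, g *\<^sub>v y))"

lemma SO_mats_iff: "g \<in> SO_mats n \<longleftrightarrow> g \<in> orth_mats n \<and> Determinant.det g = 1"
  by (auto simp: SO_mats_def orth_mats_def)

lemma rot_orthonormal_pairs:
  assumes "g \<in> orth_mats n" "z \<in> orthonormal_pairs n"
  shows "rot g z \<in> orthonormal_pairs n"
  using assms orth_mats_apply(3)[OF assms(1)]
  by (cases z) (auto simp: orthonormal_pairs_iff orth_mats_scalar_prod)

text \<open>The projections of the standard unit vectors to the orthogonal complement
  of $x$ and $y$ have squared lengths adding up to $n-2$, so not all of them vanish.\<close>
lemma exists_orthogonal_vector: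
  assumes n: "n \<ge> 3" and z: "(x, y) \<in> orthonormal_pairs n"
  obtains u where "u \<in> carrier_vec n" "u \<bullet> u \<noteq> 0" "u \<bullet> x = 0" "u \<bullet> y = 0"
proof -
  have c: "x \<in> carrier_vec n" "y \<in> carrier_vec n" and p: "x \<bullet> y = 0" "y \<bullet> x = 0" "x \<bullet> x = 1" "y \<bullet> y = 1"
    using z by (auto simp: orthonormal_pairs_iff comm_scalar_prod)
  define u :: "nat \<Rightarrow> real vec" where "u i = unit_vec n i - (x $ i \<cdot>\<^sub>v x + y $ i \<cdot>\<^sub>v y)" for i
  have uc: "u i \<in> carrier_vec n" for i using c by (simp add: u_def)
  have ux: "u i \<bullet> x = 0" "u i \<bullet> y = 0" if "i < n" for i
    using c p that by (auto simp: u_def minus_scalar_prod_distrib[of _ n] add_scalar_prod_distrib[of _ n])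
  have uu: "u i \<bullet> u i = 1 - (x $ i)\<^sup>2 - (y $ i)\<^sup>2" if "i < n" for i
  proof -
    have "u i \<bullet> u i = u i \<bullet> unit_vec n i - u i \<bullet> (x $ i \<cdot>\<^sub>v x + y $ i \<cdot>\<^sub>v y)"
      using c uc by (subst (2) u_def) (auto simp: scalar_prod_minus_distrib[of _ n])
    also have "u i \<bullet> (x $ i \<cdot>\<^sub>v x + y $ i \<cdot>\<^sub>v y) = 0"
      using c uc ux[OF that] by (subst scalar_prod_add_distrib[of _ n]) auto
    also have "u i \<bullet> unit_vec n i = u i $ i" using uc that by simp
    also have "\<dots> = 1 - (x $ i)\<^sup>2 - (y $ i)\<^sup>2" using c that by (simp add: u_def power2_eq_square)
    finally show ?thesis by simp
  qed
  have "(\<Sum>i<n. u i \<bullet> u i) = (\<Sum>i<n. 1 - (x $ i * x $ i) - (y $ i * y $ i))"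
    by (intro sum.cong) (auto simp: uu power2_eq_square)
  also have "\<dots> = real n - x \<bullet> x - y \<bullet> y" using c by (simp add: sum_subtractf scalar_prod_sum[of _ n])
  finally have "(\<Sum>i<n. u i \<bullet> u i) \<noteq> 0" using p n by simp
  then obtain i where "i < n" "u i \<bullet> u i \<noteq> 0" by (metis (no_types, lifting) lessThan_iff sum.neutral)
  then show thesis using that[of "u i"] uc ux by auto
qed

lemma reflection_fixes: "u \<in> carrier_vec n \<Longrightarrow> v \<in> carrier_vec n \<Longrightarrow> u \<bullet> v = 0 \<Longrightarrow> reflection n u *\<^sub>v v = v"
  by (subst reflection_apply) (auto intro!: eq_vecI)

lemma det_reflection_0:
  assumes "u \<in> carrier_vec n" "u \<bullet> u = 0"
  shows "Determinant.det (reflection n u) = 1"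
proof -
  have "reflection n u = 1\<^sub>m n"
    using assms by (intro mat_eq_1_of_fixes) (auto simp: reflection_apply intro!: eq_vecI)
  then show ?thesis by simp
qed

text \<open>Two reflections carry the first pair to the second one. If their product has
  determinant $-1$, one of them has determinant $-1$; then so has the reflection in a vector
  orthogonal to the target pair, and composing with it repairs the determinant.\<close>
lemma SO_transitive:
  assumes n: "n \<ge> 3" and z: "z \<in> orthonormal_pairs n" and w: "w \<in> orthonormal_pairs n"
  obtains g where "g \<in> SO_mats n" "rot g z = w"
proof -
  obtain x y x' y' where zw: "z = (x, y)" "w = (x', y')" by (cases z, cases w)
  have c: "x \<in> carrier_vec n" "y \<in> carrier_vec n" "x' \<in> carrier_vec n" "y' \<in> carrier_vec n"
    and p: "x \<bullet> y = 0" "x \<bullet> x = 1" "y \<bullet> y = 1" "x' \<bullet> y' = 0" "x' \<bullet> x' = 1" "y' \<bullet> y' = 1"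
    using z w by (auto simp: zw orthonormal_pairs_iff)
  define r1 where "r1 = reflection n (x - x')"
  have r1: "r1 \<in> orth_mats n" "r1 *\<^sub>v x = x'" "r1 \<in> carrier_mat n n"
    unfolding r1_def using reflection_orth reflection_maps[OF c(1) c(3)] c p by auto
  define y1 where "y1 = r1 *\<^sub>v y"
  have y1: "y1 \<in> carrier_vec n" "x' \<bullet> y1 = 0" "y1 \<bullet> y1 = 1"
    using orth_mats_apply(3)[OF r1(1) c(2)] orth_mats_scalar_prod[OF r1(1) c(1) c(2)]
      orth_mats_scalar_prod[OF r1(1) c(2) c(2)] p r1(2) by (simp_all add: y1_def)
  define r2 where "r2 = reflection n (y1 - y')"
  have "(y1 - y') \<bullet> x' = 0"
    using y1 c p comm_scalar_prod[OF y1(1) c(3)] comm_scalar_prod[OF c(4) c(3)]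
    by (simp add: minus_scalar_prod_distrib[of _ n])
  moreover have yy: "y1 - y' \<in> carrier_vec n" "y1 \<bullet> y1 = y' \<bullet> y'" using y1 c p by simp_all
  ultimately have r2: "r2 \<in> orth_mats n" "r2 *\<^sub>v y1 = y'" "r2 *\<^sub>v x' = x'" "r2 \<in> carrier_mat n n"
    unfolding r2_def using reflection_orth[OF yy(1)] reflection_maps[OF y1(1) c(4) yy(2)] reflection_fixes[OF yy(1) c(3)]
    by (simp_all only: reflection_carrier)
  define g0 where "g0 = r2 * r1"
  have g0: "g0 \<in> orth_mats n" unfolding g0_def by (rule orth_mats_mult[OF r2(1) r1(1)])
  have g0x: "g0 *\<^sub>v x = x'" and g0y: "g0 *\<^sub>v y = y'"
    unfolding g0_def using r1 r2 c y1_def by (simp_all add: assoc_mult_mat_vec[OF r2(4) r1(3)])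
  have det0: "Determinant.det g0 = Determinant.det r2 * Determinant.det r1"
    unfolding g0_def by (rule det_mult[OF r2(4) r1(3)])
  show thesis
  proof (cases "Determinant.det g0 = 1")
    case True
    then show thesis using g0 g0x g0y by (intro that[of g0]) (auto simp: SO_mats_iff zw)
  next
    case False
    have sq: "a = 1 \<or> a = -1" if "a * a = 1" for a :: real using that square_eq_1_iff by blast
    have d0: "Determinant.det g0 = -1" using sq[OF det_orth_sq[OF g0]] False by simp
    obtain u where u: "u \<in> carrier_vec n" "u \<bullet> u \<noteq> 0" "u \<bullet> x' = 0" "u \<bullet> y' = 0"
      using exists_orthogonal_vector[OF n, of x' y'] w zw by metis
    define r3 where "r3 = reflection n u"
    have r3: "r3 \<in> orth_mats n" "r3 *\<^sub>v x' = x'" "r3 *\<^sub>v y' = y'" "r3 \<in> carrier_mat n n"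
      unfolding r3_def using reflection_orth reflection_fixes u c by auto
    have neg: "Determinant.det r3 = -1" if v: "v \<in> carrier_vec n" "Determinant.det (reflection n v) \<noteq> 1" for v
    proof -
      have "v \<bullet> v \<noteq> 0" using det_reflection_0 v by blast
      then have "Determinant.det r3 = Determinant.det (reflection n v)"
        unfolding r3_def by (intro det_reflection_eq u v)
      then show ?thesis using v(2) sq[OF det_orth_sq[OF reflection_orth[OF v(1)]]] by simp
    qed
    have "Determinant.det r1 \<noteq> 1 \<or> Determinant.det r2 \<noteq> 1" using d0 det0 by auto
    then have d3: "Determinant.det r3 = -1"
      using neg[of "x - x'"] neg[of "y1 - y'"] c y1 by (auto simp: r1_def r2_def)
    have "Determinant.det (r3 * g0) = 1"
      using det_mult[OF r3(4) orth_matsD(1)[OF g0]] d3 d0 by simp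
    moreover have "r3 * g0 \<in> orth_mats n" by (rule orth_mats_mult[OF r3(1) g0])
    moreover have "(r3 * g0) *\<^sub>v x = x'" "(r3 * g0) *\<^sub>v y = y'"
      using c g0x g0y r3 by (simp_all add: assoc_mult_mat_vec[OF r3(4) orth_matsD(1)[OF g0]])
    ultimately show thesis by (intro that[of "r3 * g0"]) (auto simp: SO_mats_iff zw)
  qed
qed

section \<open>Uniqueness of the invariant measure\<close>

abbreviation pairs_algebra :: "nat \<Rightarrow> (real vec \<times> real vec) measure" where
  "pairs_algebra n \<equiv> restrict_space (borel_vec n \<Otimes>\<^sub>M borel_vec n) (orthonormal_pairs n)"

lemma orthonormal_pairs_subset: "orthonormal_pairs n \<subseteq> carrier_vec n \<times> carrier_vec n"
  by (auto simp: orthonormal_pairs_iff)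

lemma space_pairs_algebra [simp]: "space (pairs_algebra n) = orthonormal_pairs n"
  using orthonormal_pairs_subset[of n] by (auto simp: space_restrict_space space_pair_measure)

lemma measurable_fst_pairs [measurable]: "fst \<in> measurable (pairs_algebra n) (borel_vec n)"
  by (rule measurable_restrict_space1) simp
lemma measurable_snd_pairs [measurable]: "snd \<in> measurable (pairs_algebra n) (borel_vec n)"
  by (rule measurable_restrict_space1) simp

lemma measurable_pairs_algebraI:
  assumes "(\<lambda>x. fst (f x)) \<in> measurable M (borel_vec n)" "(\<lambda>x. snd (f x)) \<in> measurable M (borel_vec n)"
    and "\<And>x. x \<in> space M \<Longrightarrow> f x \<in> orthonormal_pairs n"
  shows "f \<in> measurable M (pairs_algebra n)"
proof (rule measurable_restrict_space2)
  have "(\<lambda>x. (fst (f x), snd (f x))) \<in> measurable M (borel_vec n \<Otimes>\<^sub>M borel_vec n)"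
    by (rule measurable_Pair[OF assms(1,2)])
  then show "f \<in> measurable M (borel_vec n \<Otimes>\<^sub>M borel_vec n)" by simp
qed (use assms in auto)

lemma measurable_rot:
  assumes "g \<in> orth_mats n"
  shows "rot g \<in> measurable (pairs_algebra n) (pairs_algebra n)"
proof (rule measurable_pairs_algebraI)
  have g: "g \<in> carrier_mat n n" using orth_matsD[OF assms] by simp
  show "(\<lambda>z. fst (rot g z)) \<in> measurable (pairs_algebra n) (borel_vec n)"
    using measurable_mult_mat_vec[OF measurable_fst_pairs g] by (simp add: case_prod_beta)
  show "(\<lambda>z. snd (rot g z)) \<in> measurable (pairs_algebra n) (borel_vec n)"
    using measurable_mult_mat_vec[OF measurable_snd_pairs g] by (simp add: case_prod_beta)
qed (use rot_orthonormal_pairs[OF assms] in auto)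

definition sqdist :: "real vec \<times> real vec \<Rightarrow> real vec \<times> real vec \<Rightarrow> real" where
  "sqdist z w = (fst z - fst w) \<bullet> (fst z - fst w) + (snd z - snd w) \<bullet> (snd z - snd w)"

lemma measurable_sqdist:
  "(\<lambda>(z, w). sqdist z w) \<in> borel_measurable (pairs_algebra n \<Otimes>\<^sub>M pairs_algebra n)"
proof -
  have 1: "(\<lambda>p. fst (fst p)) \<in> measurable (pairs_algebra n \<Otimes>\<^sub>M pairs_algebra n) (borel_vec n)"
    "(\<lambda>p. snd (fst p)) \<in> measurable (pairs_algebra n \<Otimes>\<^sub>M pairs_algebra n) (borel_vec n)"
    "(\<lambda>p. fst (snd p)) \<in> measurable (pairs_algebra n \<Otimes>\<^sub>M pairs_algebra n) (borel_vec n)"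
    "(\<lambda>p. snd (snd p)) \<in> measurable (pairs_algebra n \<Otimes>\<^sub>M pairs_algebra n) (borel_vec n)"
    by (rule measurable_compose[OF measurable_fst] measurable_compose[OF measurable_snd], rule measurable_fst_pairs measurable_snd_pairs)+
  show ?thesis unfolding sqdist_def case_prod_beta
    by (intro borel_measurable_add measurable_scalar_prod[of _ _ n] measurable_vec_minus 1)
qed

lemma sqdist_sum:
  assumes "z \<in> orthonormal_pairs n" "w \<in> orthonormal_pairs n"
  shows "sqdist z w = (\<Sum>i<n. (fst z $ i - fst w $ i)\<^sup>2) + (\<Sum>i<n. (snd z $ i - snd w $ i)\<^sup>2)"
  using assms by (cases z; cases w) (auto simp: orthonormal_pairs_iff sqdist_def sum_sq_ball_iff[of _ n])

lemma sqdist_rot: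
  assumes "g \<in> orth_mats n" "z \<in> orthonormal_pairs n" "w \<in> orthonormal_pairs n"
  shows "sqdist (rot g z) (rot g w) = sqdist z w"
proof -
  note g = orth_matsD[OF assms(1)]
  have "(g *\<^sub>v x - g *\<^sub>v y) \<bullet> (g *\<^sub>v x - g *\<^sub>v y) = (x - y) \<bullet> (x - y)" if "x \<in> carrier_vec n" "y \<in> carrier_vec n" for x y
    using that g by (subst (1 2) mult_minus_distrib_mat_vec[symmetric, of _ n n]) (auto simp: orth_mats_scalar_prod[OF assms(1)])
  then show ?thesis using assms by (cases z; cases w) (auto simp: sqdist_def orthonormal_pairs_iff)
qed

lemma sqdist_sym: "z \<in> orthonormal_pairs n \<Longrightarrow> w \<in> orthonormal_pairs n \<Longrightarrow> sqdist z w = sqdist w z"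
  by (simp add: sqdist_sum[of _ n] power2_commute)

locale invariant_measure =
  fixes n :: nat and \<mu> :: "(real vec \<times> real vec) measure"
  assumes inv: "is_invariant_measure n \<mu>"
begin

lemma sets_mu [simp, measurable_cong]: "sets \<mu> = sets (pairs_algebra n)"
  using inv by (simp add: is_invariant_measure_def)

lemma space_mu [simp]: "space \<mu> = orthonormal_pairs n"
  using sets_eq_imp_space_eq[OF sets_mu] by simp

sublocale prob_space \<mu>
  by standard (use inv in \<open>simp add: is_invariant_measure_def\<close>)

lemma nn_integral_rot:
  assumes g: "g \<in> SO_mats n" and f: "f \<in> borel_measurable (pairs_algebra n)"
  shows "(\<integral>\<^sup>+ z. f (rot g z) \<partial>\<mu>) = (\<integral>\<^sup>+ z. f z \<partial>\<mu>)"
proof -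
  have m: "rot g \<in> measurable \<mu> \<mu>"
    using measurable_rot[of g n] g by (simp add: SO_mats_iff cong: measurable_cong_sets)
  have "(\<integral>\<^sup>+ z. f z \<partial>\<mu>) = (\<integral>\<^sup>+ z. f z \<partial>distr \<mu> \<mu> (rot g))"
    using inv g by (simp add: is_invariant_measure_def)
  also have "\<dots> = (\<integral>\<^sup>+ z. f (rot g z) \<partial>\<mu>)"
    using f by (subst nn_integral_distr[OF m]) (auto cong: measurable_cong_sets)
  finally show ?thesis by simp
qed

text \<open>The mass of the ball of squared radius $e$; the indicator is written as a kernel in two variables
  because it is integrated in either of them.\<close>
definition kernel_mass :: "real \<Rightarrow> real vec \<times> real vec \<Rightarrow> ennreal" where
  "kernel_mass e z = (\<integral>\<^sup>+ w. (if sqdist z w < e then 1 else 0) \<partial>\<mu>)"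

lemma measurable_kernel_section:
  assumes "z \<in> orthonormal_pairs n"
  shows "(\<lambda>w. (if sqdist z w < e then 1 else 0) :: ennreal) \<in> borel_measurable (pairs_algebra n)"
proof -
  have "(\<lambda>w. (\<lambda>(z, w). sqdist z w) (z, w)) \<in> borel_measurable (pairs_algebra n)"
    by (rule measurable_compose[OF measurable_Pair1' measurable_sqdist]) (use assms in simp)
  then have [measurable]: "(\<lambda>w. sqdist z w) \<in> borel_measurable (pairs_algebra n)" by simp
  show ?thesis by measurable
qed

lemma kernel_mass_const:
  assumes "n \<ge> 3" and z: "z \<in> orthonormal_pairs n" and w: "w \<in> orthonormal_pairs n"
  shows "kernel_mass e z = kernel_mass e w"
proof -
  obtain g where g: "g \<in> SO_mats n" "rot g z = w" by (rule SO_transitive[OF assms])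
  have "kernel_mass e w = (\<integral>\<^sup>+ v. (if sqdist w (rot g v) < e then 1 else 0) \<partial>\<mu>)"
    unfolding kernel_mass_def using w by (subst nn_integral_rot[OF g(1)]) (auto intro: measurable_kernel_section)
  also have "\<dots> = kernel_mass e z"
    unfolding kernel_mass_def using g z
    by (intro nn_integral_cong) (auto simp flip: g(2) simp: SO_mats_iff sqdist_rot[of g n] simp del: split_paired_All)
  finally show ?thesis ..
qed

lemma kernel_mass_le_1: "kernel_mass e z \<le> 1"
proof -
  have "kernel_mass e z \<le> (\<integral>\<^sup>+ w. 1 \<partial>\<mu>)" unfolding kernel_mass_def by (intro nn_integral_mono) auto
  then show ?thesis using emeasure_space_1 by simp
qed

text \<open>Rounding all coordinates to multiples of a small number splits the orthonormal
  pairs into countably many classes of small diameter. As all balls of radius $e$ have the same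
  mass, mass $0$ would make the whole space a countable union of null sets.\<close>
lemma kernel_mass_pos:
  assumes n: "n \<ge> 3" and z: "z \<in> orthonormal_pairs n" and e: "e > 0"
  shows "kernel_mass e z > 0"
proof (rule ccontr)
  assume "\<not> kernel_mass e z > 0"
  then have 0: "kernel_mass e w = 0" if "w \<in> orthonormal_pairs n" for w
    using kernel_mass_const[OF n z that, of e] by (simp add: zero_less_iff_neq_zero)
  obtain L :: nat where L: "real L > 2 * real n / e + 1" using reals_Archimedean2 by blast
  have "2 * real n / e \<ge> 0" using e by simp
  then have "real L \<ge> 1" using L by linarith
  moreover have "2 * real n < e * real L" using L e by (simp add: field_simps)
  ultimately have Lp: "real L \<ge> 1" "2 * real n < e * real L" by auto
  define \<kappa> :: "real vec \<times> real vec \<Rightarrow> nat \<Rightarrow> int \<times> int" where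
    "\<kappa> w = (\<lambda>i\<in>{..<n}. (\<lfloor>L * fst w $ i\<rfloor>, \<lfloor>L * snd w $ i\<rfloor>))" for w
  have near: "sqdist v w < e" if vw: "v \<in> orthonormal_pairs n" "w \<in> orthonormal_pairs n" "\<kappa> v = \<kappa> w" for v w
  proof -
    have eq: "\<lfloor>L * fst v $ i\<rfloor> = \<lfloor>L * fst w $ i\<rfloor>" "\<lfloor>L * snd v $ i\<rfloor> = \<lfloor>L * snd w $ i\<rfloor>" if "i < n" for i
      using fun_cong[OF vw(3), of i] that by (auto simp: \<kappa>_def)
    have sm: "(a - b)\<^sup>2 \<le> 1 / L" if "\<lfloor>L * a\<rfloor> = \<lfloor>L * b\<rfloor>" for a b :: real
    proof -
      have "\<bar>L * a - L * b\<bar> < 1" using that by linarith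
      then have "L * \<bar>a - b\<bar> < 1" using Lp by (simp add: abs_mult flip: right_diff_distrib)
      then have "(L * \<bar>a - b\<bar>)\<^sup>2 \<le> 1" using Lp by (intro power_le_one) auto
      then have "L * (L * (a - b)\<^sup>2) \<le> 1" by (simp add: power_mult_distrib power2_eq_square[of "real L"])
      moreover have "L * (a - b)\<^sup>2 \<le> L * (L * (a - b)\<^sup>2)" using Lp by (intro mult_left_mono) (auto simp: mult_le_cancel_right1)
      ultimately have "L * (a - b)\<^sup>2 \<le> 1" by linarith
      then show ?thesis using Lp by (simp add: field_simps)
    qed
    have "sqdist v w \<le> (\<Sum>i<n. 1 / real L) + (\<Sum>i<n. 1 / real L)"
      unfolding sqdist_sum[OF vw(1,2)] by (intro add_mono sum_mono sm eq) auto
    also have "\<dots> = 2 * real n / real L" by simp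
    also have "\<dots> < e" using Lp by (simp add: divide_less_eq)
    finally show ?thesis .
  qed
  define K where "K = \<kappa> ` orthonormal_pairs n"
  have "K \<subseteq> (\<Pi>\<^sub>E i\<in>{..<n}. UNIV)" unfolding K_def \<kappa>_def by (intro image_subsetI restrict_PiE_iff[THEN iffD2]) simp
  then have cK: "countable K" by (rule countable_subset) (auto intro: countable_PiE)
  define s where "s k = (SOME w. w \<in> orthonormal_pairs n \<and> \<kappa> w = k)" for k
  have s: "s k \<in> orthonormal_pairs n" "\<kappa> (s k) = k" if "k \<in> K" for k
    unfolding s_def using someI_ex[of "\<lambda>w. w \<in> orthonormal_pairs n \<and> \<kappa> w = k"] that by (auto simp: K_def)
  let ?B = "\<lambda>k. {w \<in> space \<mu>. sqdist (s k) w < e}"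
  have nul: "?B k \<in> null_sets \<mu>" if "k \<in> K" for k
  proof -
    have "(\<lambda>w. (\<lambda>(z, w). sqdist z w) (s k, w)) \<in> borel_measurable (pairs_algebra n)"
      by (rule measurable_compose[OF measurable_Pair1' measurable_sqdist]) (use s that in simp)
    then have [measurable]: "(\<lambda>w. sqdist (s k) w) \<in> borel_measurable \<mu>" by (simp cong: measurable_cong_sets)
    have m: "?B k \<in> sets \<mu>" by measurable
    have "emeasure \<mu> (?B k) = (\<integral>\<^sup>+ w. indicator (?B k) w \<partial>\<mu>)" using m by simp
    also have "\<dots> = kernel_mass e (s k)"
      unfolding kernel_mass_def by (intro nn_integral_cong) (auto simp: indicator_def)
    also have "\<dots> = 0" using 0 s that by simp
    finally show ?thesis using m by (auto intro: null_setsI)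
  qed
  have "space \<mu> \<subseteq> (\<Union>k\<in>K. ?B k)"
  proof
    fix w assume "w \<in> space \<mu>"
    then have w: "w \<in> orthonormal_pairs n" by simp
    then have k: "\<kappa> w \<in> K" by (auto simp: K_def)
    have "sqdist (s (\<kappa> w)) w < e" by (rule near) (use s[OF k] w in auto)
    then show "w \<in> (\<Union>k\<in>K. ?B k)" using k w by auto
  qed
  moreover have "(\<Union>k\<in>K. ?B k) \<in> null_sets \<mu>" using cK nul by (intro null_sets_UN') auto
  ultimately have "space \<mu> \<in> null_sets \<mu>" using null_sets_subset by blast
  then show False using emeasure_space_1 by (auto simp: null_sets_def)
qed

end

definition lipschitz_pairs :: "nat \<Rightarrow> (real vec \<times> real vec \<Rightarrow> real) \<Rightarrow> bool" where
  "lipschitz_pairs n f \<longleftrightarrow> f \<in> borel_measurable (pairs_algebra n) \<and>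
     (\<exists>C\<ge>0. \<forall>z\<in>orthonormal_pairs n. \<forall>w\<in>orthonormal_pairs n. \<bar>f z - f w\<bar> \<le> C * sqrt (sqdist z w))"

lemma lipschitz_pairs_const: "lipschitz_pairs n (\<lambda>_. c)"
  by (auto simp: lipschitz_pairs_def intro!: exI[of _ 0])

lemma lipschitz_pairs_min:
  assumes "lipschitz_pairs n f" "lipschitz_pairs n g"
  shows "lipschitz_pairs n (\<lambda>z. min (f z) (g z))"
proof -
  obtain C D where C: "C \<ge> 0" "\<And>z w. z\<in>orthonormal_pairs n \<Longrightarrow> w\<in>orthonormal_pairs n \<Longrightarrow> \<bar>f z - f w\<bar> \<le> C * sqrt (sqdist z w)"
    and D: "D \<ge> 0" "\<And>z w. z\<in>orthonormal_pairs n \<Longrightarrow> w\<in>orthonormal_pairs n \<Longrightarrow> \<bar>g z - g w\<bar> \<le> D * sqrt (sqdist z w)"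
    using assms by (auto simp: lipschitz_pairs_def)
  have "\<bar>min (f z) (g z) - min (f w) (g w)\<bar> \<le> max C D * sqrt (sqdist z w)"
    if zw: "z\<in>orthonormal_pairs n" "w\<in>orthonormal_pairs n" for z w
  proof -
    have "sqrt (sqdist z w) \<ge> 0" by (simp add: sqdist_def real_scalar_prod_ge_0)
    then have "C * sqrt (sqdist z w) \<le> max C D * sqrt (sqdist z w)" "D * sqrt (sqdist z w) \<le> max C D * sqrt (sqdist z w)"
      by (auto intro: mult_right_mono)
    then show ?thesis using C(2)[OF zw] D(2)[OF zw] by linarith
  qed
  then show ?thesis using assms C(1) by (auto simp: lipschitz_pairs_def intro!: exI[of _ "max C D"])
qed

lemma lipschitz_pairs_cmult:
  assumes "lipschitz_pairs n f"
  shows "lipschitz_pairs n (\<lambda>z. a * f z)"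
proof -
  obtain C where C: "C \<ge> 0" "\<And>z w. z\<in>orthonormal_pairs n \<Longrightarrow> w\<in>orthonormal_pairs n \<Longrightarrow> \<bar>f z - f w\<bar> \<le> C * sqrt (sqdist z w)"
    using assms by (auto simp: lipschitz_pairs_def)
  have "\<bar>a * f z - a * f w\<bar> \<le> \<bar>a\<bar> * C * sqrt (sqdist z w)"
    if zw: "z\<in>orthonormal_pairs n" "w\<in>orthonormal_pairs n" for z w
    using mult_left_mono[OF C(2)[OF zw], of "\<bar>a\<bar>"] by (simp add: abs_mult mult.assoc flip: right_diff_distrib)
  then show ?thesis using assms C(1) by (auto simp: lipschitz_pairs_def intro!: exI[of _ "\<bar>a\<bar> * C"])
qed

lemma lipschitz_pairs_max0:
  assumes "lipschitz_pairs n f"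
  shows "lipschitz_pairs n (\<lambda>z. max 0 (f z))"
proof -
  have "(\<lambda>z. max 0 (f z)) = (\<lambda>z. (-1) * min 0 ((-1) * f z))" by (auto simp: fun_eq_iff min_def max_def)
  then show ?thesis using lipschitz_pairs_cmult[OF lipschitz_pairs_min[OF lipschitz_pairs_const lipschitz_pairs_cmult[OF assms]]] by metis
qed

lemma lipschitz_pairs_coord:
  assumes i: "i < n"
  shows "lipschitz_pairs n (\<lambda>z. a - fst z $ i)" "lipschitz_pairs n (\<lambda>z. a - snd z $ i)"
proof -
  have le: "\<bar>fst z $ i - fst w $ i\<bar> \<le> sqrt (sqdist z w)" "\<bar>snd z $ i - snd w $ i\<bar> \<le> sqrt (sqdist z w)"
    if zw: "z\<in>orthonormal_pairs n" "w\<in>orthonormal_pairs n" for z w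
  proof -
    have "(fst z $ i - fst w $ i)\<^sup>2 \<le> (\<Sum>i<n. (fst z $ i - fst w $ i)\<^sup>2)" "(snd z $ i - snd w $ i)\<^sup>2 \<le> (\<Sum>i<n. (snd z $ i - snd w $ i)\<^sup>2)"
      by (rule member_le_sum; use i in auto)+
    moreover have "(\<Sum>i<n. (fst z $ i - fst w $ i)\<^sup>2) \<ge> 0" "(\<Sum>i<n. (snd z $ i - snd w $ i)\<^sup>2) \<ge> 0" by (auto intro: sum_nonneg)
    ultimately have "(fst z $ i - fst w $ i)\<^sup>2 \<le> sqdist z w" "(snd z $ i - snd w $ i)\<^sup>2 \<le> sqdist z w"
      unfolding sqdist_sum[OF zw] by linarith+
    then show "\<bar>fst z $ i - fst w $ i\<bar> \<le> sqrt (sqdist z w)" "\<bar>snd z $ i - snd w $ i\<bar> \<le> sqrt (sqdist z w)"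
      by (metis real_sqrt_abs real_sqrt_le_iff)+
  qed
  have m: "(\<lambda>z. fst z $ i) \<in> borel_measurable (pairs_algebra n)" "(\<lambda>z. snd z $ i) \<in> borel_measurable (pairs_algebra n)"
    using measurable_vec_index'[OF measurable_fst_pairs i] measurable_vec_index'[OF measurable_snd_pairs i] by simp_all
  show "lipschitz_pairs n (\<lambda>z. a - fst z $ i)" "lipschitz_pairs n (\<lambda>z. a - snd z $ i)"
    unfolding lipschitz_pairs_def using m le by (auto intro!: exI[of _ 1] simp: abs_minus_commute)
qed

text \<open>Let $k(z,w)$ be $1$ when $z$ and $w$ are close and $0$ otherwise. By
  transitivity $\int k(z,w)\,d\nu(w)$ is a constant $c$, and integrating over $z$ shows that it is
  the same constant for $\mu$. Where $k$ does not vanish, $f(z)\le f(w)+\varepsilon$; integrating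
  $f(z)\,k(z,w)$ over both variables gives
  $c\int f\,d\mu\le c\,(\int f\,d\nu+\varepsilon)$, and $c$ is positive and finite.\<close>
lemma lipschitz_integral_le:
  assumes n: "n \<ge> 3" and mu: "invariant_measure n \<mu>" and nu: "invariant_measure n \<nu>"
    and f: "lipschitz_pairs n f" "\<And>z. f z \<ge> 0"
  shows "(\<integral>\<^sup>+ z. ennreal (f z) \<partial>\<mu>) \<le> (\<integral>\<^sup>+ z. ennreal (f z) \<partial>\<nu>)"
proof (rule ennreal_le_epsilon)
  fix \<epsilon> :: real assume e: "\<epsilon> > 0"
  interpret mu: invariant_measure n \<mu> by fact
  interpret nu: invariant_measure n \<nu> by fact
  interpret P: pair_sigma_finite \<mu> \<nu> ..
  obtain C where C: "C \<ge> 0" "\<And>z w. z\<in>orthonormal_pairs n \<Longrightarrow> w\<in>orthonormal_pairs n \<Longrightarrow> \<bar>f z - f w\<bar> \<le> C * sqrt (sqdist z w)"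
    using f(1) by (auto simp: lipschitz_pairs_def)
  define d where "d = (\<epsilon> / (C + 1))\<^sup>2"
  have d: "d > 0" using e C(1) by (simp add: d_def)
  have near: "f z \<le> f w + \<epsilon>" if "z\<in>orthonormal_pairs n" "w\<in>orthonormal_pairs n" "sqdist z w < d" for z w
  proof -
    have "sqrt (sqdist z w) \<le> \<epsilon> / (C + 1)" using that(3) e C(1) by (intro real_le_lsqrt) (auto simp: d_def)
    then have "C * sqrt (sqdist z w) \<le> C * (\<epsilon> / (C + 1))" using C(1) by (rule mult_left_mono)
    also have "\<dots> \<le> \<epsilon>" using C(1) e by (simp add: field_simps)
    finally show ?thesis using C(2)[OF that(1,2)] by linarith
  qed
  let ?k = "\<lambda>z w. (if sqdist z w < d then 1 else 0) :: ennreal"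
  have fm [measurable]: "f \<in> borel_measurable (pairs_algebra n)" using f(1) by (simp add: lipschitz_pairs_def)
  have km: "(\<lambda>(z, w). ?k z w) \<in> borel_measurable (pairs_algebra n \<Otimes>\<^sub>M pairs_algebra n)"
  proof -
    note measurable_sqdist [measurable]
    have "(\<lambda>p. if (\<lambda>(z, w). sqdist z w) p < d then 1 else 0 :: ennreal) \<in> borel_measurable (pairs_algebra n \<Otimes>\<^sub>M pairs_algebra n)"
      by measurable
    then show ?thesis by (simp add: case_prod_beta)
  qed
  obtain z0 where z0: "z0 \<in> orthonormal_pairs n" using mu.not_empty by auto
  define c where "c = nu.kernel_mass d z0"
  have cnu: "(\<integral>\<^sup>+ w. ?k z w \<partial>\<nu>) = c" if "z \<in> orthonormal_pairs n" for z
    using nu.kernel_mass_const[OF n that z0] by (simp add: c_def nu.kernel_mass_def)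
  define c' where "c' = mu.kernel_mass d z0"
  have cmu: "(\<integral>\<^sup>+ z. ?k z w \<partial>\<mu>) = c'" if w: "w \<in> orthonormal_pairs n" for w
  proof -
    have "(\<integral>\<^sup>+ z. ?k z w \<partial>\<mu>) = (\<integral>\<^sup>+ z. ?k w z \<partial>\<mu>)" using w by (intro nn_integral_cong) (simp add: sqdist_sym[of _ n w])
    then show ?thesis using mu.kernel_mass_const[OF n w z0] by (simp add: c'_def mu.kernel_mass_def)
  qed
  have kmP: "(\<lambda>(z, w). ?k z w) \<in> borel_measurable (\<mu> \<Otimes>\<^sub>M \<nu>)"
    using km by (simp cong: measurable_cong_sets sets_pair_measure_cong)
  have fub: "(\<integral>\<^sup>+ z. (\<integral>\<^sup>+ w. h z w \<partial>\<nu>) \<partial>\<mu>) = (\<integral>\<^sup>+ w. (\<integral>\<^sup>+ z. h z w \<partial>\<mu>) \<partial>\<nu>)"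
    if "(\<lambda>(z, w). h z w) \<in> borel_measurable (\<mu> \<Otimes>\<^sub>M \<nu>)" for h :: "_ \<Rightarrow> _ \<Rightarrow> ennreal"
    using P.Fubini'[OF that] by simp
  \<comment> \<open>Integrate the kernel over both variables in either order.\<close>
  have cc: "c = c'"
  proof -
    have "c = (\<integral>\<^sup>+ z. c \<partial>\<mu>)" using mu.emeasure_space_1 by simp
    also have "\<dots> = (\<integral>\<^sup>+ z. (\<integral>\<^sup>+ w. ?k z w \<partial>\<nu>) \<partial>\<mu>)"
      by (intro nn_integral_cong) (simp only: cnu mu.space_mu)
    also have "\<dots> = (\<integral>\<^sup>+ w. (\<integral>\<^sup>+ z. ?k z w \<partial>\<mu>) \<partial>\<nu>)" by (rule fub[OF kmP])
    also have "\<dots> = (\<integral>\<^sup>+ w. c' \<partial>\<nu>)" by (intro nn_integral_cong) (simp only: cmu nu.space_mu)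
    also have "\<dots> = c'" using nu.emeasure_space_1 by simp
    finally show ?thesis .
  qed
  have c: "c \<noteq> 0" "c \<noteq> \<infinity>"
    using nu.kernel_mass_pos[OF n z0 d] nu.kernel_mass_le_1[of d z0] by (auto simp: c_def top_unique)
  have fmu: "(\<lambda>z. ennreal (f z)) \<in> borel_measurable \<mu>" and fnu: "(\<lambda>z. ennreal (f z)) \<in> borel_measurable \<nu>"
    using fm by (simp_all cong: measurable_cong_sets)
  have "(\<integral>\<^sup>+ z. ennreal (f z) \<partial>\<mu>) * c = (\<integral>\<^sup>+ z. ennreal (f z) * c \<partial>\<mu>)"
    using fmu by (rule nn_integral_multc[symmetric])
  also have "\<dots> = (\<integral>\<^sup>+ z. (\<integral>\<^sup>+ w. ennreal (f z) * ?k z w \<partial>\<nu>) \<partial>\<mu>)"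
  proof (rule nn_integral_cong)
    fix z assume "z \<in> space \<mu>"
    then have z: "z \<in> orthonormal_pairs n" by simp
    have "(\<lambda>w. ?k z w) \<in> borel_measurable \<nu>" using nu.measurable_kernel_section[OF z, of d] by (simp cong: measurable_cong_sets)
    then show "ennreal (f z) * c = (\<integral>\<^sup>+ w. ennreal (f z) * ?k z w \<partial>\<nu>)"
      by (simp add: nn_integral_cmult cnu[OF z])
  qed
  also have "\<dots> \<le> (\<integral>\<^sup>+ z. (\<integral>\<^sup>+ w. (ennreal (f w) + ennreal \<epsilon>) * ?k z w \<partial>\<nu>) \<partial>\<mu>)"
    using near f(2) e by (intro nn_integral_mono) (auto simp: ennreal_plus[symmetric] simp del: ennreal_plus intro!: ennreal_leI)
  also have "\<dots> = (\<integral>\<^sup>+ w. (\<integral>\<^sup>+ z. (ennreal (f w) + ennreal \<epsilon>) * ?k z w \<partial>\<mu>) \<partial>\<nu>)"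
  proof (rule fub)
    have "(\<lambda>p. (ennreal (f (snd p)) + ennreal \<epsilon>) * (\<lambda>(z, w). ?k z w) p) \<in> borel_measurable (\<mu> \<Otimes>\<^sub>M \<nu>)"
      by (intro borel_measurable_times_ennreal kmP borel_measurable_add measurable_compose[OF measurable_snd fnu]) auto
    then show "(\<lambda>(z, w). (ennreal (f w) + ennreal \<epsilon>) * ?k z w) \<in> borel_measurable (\<mu> \<Otimes>\<^sub>M \<nu>)"
      by (simp add: case_prod_beta)
  qed
  also have "\<dots> = (\<integral>\<^sup>+ w. (ennreal (f w) + ennreal \<epsilon>) * c \<partial>\<nu>)"
  proof (rule nn_integral_cong)
    fix w assume "w \<in> space \<nu>"
    then have w: "w \<in> orthonormal_pairs n" by simp
    have "(\<lambda>z. ?k w z) \<in> borel_measurable \<mu>" using mu.measurable_kernel_section[OF w, of d] by (simp cong: measurable_cong_sets)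
    then have "(\<lambda>z. ?k z w) \<in> borel_measurable \<mu>"
      by (rule measurable_cong[THEN iffD1, rotated]) (simp add: sqdist_sym[OF w])
    then show "(\<integral>\<^sup>+ z. (ennreal (f w) + ennreal \<epsilon>) * ?k z w \<partial>\<mu>) = (ennreal (f w) + ennreal \<epsilon>) * c"
      by (simp add: nn_integral_cmult cmu[OF w] cc)
  qed
  also have "\<dots> = ((\<integral>\<^sup>+ w. ennreal (f w) \<partial>\<nu>) + ennreal \<epsilon>) * c"
    using fnu nu.emeasure_space_1 by (subst nn_integral_multc) (auto simp: nn_integral_add)
  finally have "(\<integral>\<^sup>+ z. ennreal (f z) \<partial>\<mu>) * c \<le> ((\<integral>\<^sup>+ w. ennreal (f w) \<partial>\<nu>) + ennreal \<epsilon>) * c" .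
  then have "(\<integral>\<^sup>+ z. ennreal (f z) \<partial>\<mu>) * c / c \<le> ((\<integral>\<^sup>+ w. ennreal (f w) \<partial>\<nu>) + ennreal \<epsilon>) * c / c"
    by (rule divide_right_mono_ennreal)
  then show "(\<integral>\<^sup>+ z. ennreal (f z) \<partial>\<mu>) \<le> (\<integral>\<^sup>+ w. ennreal (f w) \<partial>\<nu>) + ennreal \<epsilon>"
    using c by (simp add: ennreal_mult_divide_eq)
qed

text \<open>The indicator of the set is the increasing limit of the Lipschitz functions
  $\min(1,j f^+)$.\<close>
lemma positivity_set_emeasure_le:
  assumes n: "n \<ge> 3" and mu: "invariant_measure n \<mu>" and nu: "invariant_measure n \<nu>"
    and f: "lipschitz_pairs n f"
  shows "emeasure \<mu> {z \<in> orthonormal_pairs n. f z > 0} \<le> emeasure \<nu> {z \<in> orthonormal_pairs n. f z > 0}"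
proof -
  let ?U = "{z \<in> orthonormal_pairs n. f z > 0}"
  have lim: "(\<lambda>j. \<integral>\<^sup>+ z. ennreal (min 1 (real j * max 0 (f z))) \<partial>\<rho>) \<longlonglongrightarrow> emeasure \<rho> ?U"
    if "invariant_measure n \<rho>" for \<rho>
  proof -
    interpret invariant_measure n \<rho> by fact
    have fm [measurable]: "f \<in> borel_measurable \<rho>" using f by (simp add: lipschitz_pairs_def cong: measurable_cong_sets)
    have "{z \<in> space \<rho>. f z > 0} \<in> sets \<rho>" by measurable
    then have U: "?U \<in> sets \<rho>" by simp
    have "(\<lambda>j. \<integral>\<^sup>+ z. ennreal (min 1 (real j * max 0 (f z))) \<partial>\<rho>) \<longlonglongrightarrow> (\<integral>\<^sup>+ z. indicator {z. f z > 0} z \<partial>\<rho>)"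
    proof (rule nn_integral_LIMSEQ)
      show "incseq (\<lambda>j z. ennreal (min 1 (real j * max 0 (f z))))"
      proof (intro incseq_SucI le_funI ennreal_leI)
        fix j z
        have "real j * max 0 (f z) \<le> real (Suc j) * max 0 (f z)" by (intro mult_right_mono) auto
        then show "min 1 (real j * max 0 (f z)) \<le> min 1 (real (Suc j) * max 0 (f z))" by linarith
      qed
      fix z show "(\<lambda>j. ennreal (min 1 (real j * max 0 (f z)))) \<longlonglongrightarrow> indicator {z. f z > 0} z"
      proof (cases "f z > 0")
        case True
        obtain j0 :: nat where j0: "real j0 * f z > 1" using reals_Archimedean3[OF True] by blast
        have "eventually (\<lambda>j. ennreal (min 1 (real j * max 0 (f z))) = 1) sequentially"
          unfolding eventually_sequentially
        proof (intro exI[of _ j0] allI impI)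
          fix j assume "j0 \<le> j"
          then have "real j0 * f z \<le> real j * f z" using True by (intro mult_right_mono) auto
          then have "real j * f z \<ge> 1" using j0 by linarith
          then show "ennreal (min 1 (real j * max 0 (f z))) = 1" using True by simp
        qed
        then show ?thesis using True by (simp add: tendsto_eventually)
      qed (auto simp: max_def)
    qed measurable
    also have "(\<integral>\<^sup>+ z. indicator {z. f z > 0} z \<partial>\<rho>) = (\<integral>\<^sup>+ z. indicator ?U z \<partial>\<rho>)"
      by (intro nn_integral_cong) (auto simp: indicator_def)
    also have "\<dots> = emeasure \<rho> ?U" using U by simp
    finally show ?thesis .
  qed
  have "lipschitz_pairs n (\<lambda>z. min 1 (real j * max 0 (f z)))" for j
    by (intro lipschitz_pairs_min lipschitz_pairs_const lipschitz_pairs_cmult lipschitz_pairs_max0 f)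
  then have "(\<integral>\<^sup>+ z. ennreal (min 1 (real j * max 0 (f z))) \<partial>\<mu>) \<le> (\<integral>\<^sup>+ z. ennreal (min 1 (real j * max 0 (f z))) \<partial>\<nu>)" for j
    by (rule lipschitz_integral_le[OF n mu nu]) auto
  then show ?thesis by (intro LIMSEQ_le[OF lim[OF mu] lim[OF nu]]) auto
qed

text \<open>The positivity sets of Lipschitz functions are closed under intersection
  (take the minimum) and generate the $\sigma$-algebra (coordinates are Lipschitz), and both
  measures agree on them.\<close>
lemma invariant_measure_unique:
  assumes n: "n \<ge> 3" and mu: "invariant_measure n \<mu>" and nu: "invariant_measure n \<nu>"
  shows "\<mu> = \<nu>"
proof -
  interpret mu: invariant_measure n \<mu> by fact
  interpret nu: invariant_measure n \<nu> by fact
  let ?T = "orthonormal_pairs n"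
  define E where "E = {{z \<in> ?T. f z > 0} | f. lipschitz_pairs n f}"
  have ET: "E \<subseteq> Pow ?T" by (auto simp: E_def)
  have memE: "{z \<in> ?T. f z > 0} \<in> E" if "lipschitz_pairs n f" for f using that by (auto simp: E_def)
  have TE: "?T \<in> E" using memE[OF lipschitz_pairs_const[of n 1]] by simp
  have sE: "sigma_sets ?T E = sets (pairs_algebra n)"
  proof
    have "E \<subseteq> sets (pairs_algebra n)"
    proof
      fix A assume "A \<in> E"
      then obtain f where f1: "A = {z \<in> ?T. f z > 0}" "lipschitz_pairs n f"
        unfolding E_def by blast
      then have f: "A = {z \<in> ?T. f z > 0}" "f \<in> borel_measurable (pairs_algebra n)"
        by (simp_all add: lipschitz_pairs_def)
      note f(2) [measurable]
      have "{z \<in> space (pairs_algebra n). f z > 0} \<in> sets (pairs_algebra n)" by measurable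
      then show "A \<in> sets (pairs_algebra n)" using f(1) by simp
    qed
    from sets.sigma_sets_subset[OF this] show "sigma_sets ?T E \<subseteq> sets (pairs_algebra n)" by simp
  next
    let ?S = "sigma ?T E"
    have sp: "space ?S = ?T" and st: "sets ?S = sigma_sets ?T E" using ET by (simp_all add: space_measure_of sets_measure_of)
    have half: "f \<in> borel_measurable ?S" if "\<And>a. lipschitz_pairs n (\<lambda>z. a - f z)" for f
    proof (rule borel_measurable_iff_less[THEN iffD2], intro allI)
      fix a
      have "{w \<in> space ?S. f w < a} = {z \<in> ?T. a - f z > 0}" by (auto simp: sp)
      then show "{w \<in> space ?S. f w < a} \<in> sets ?S" using memE[OF that[of a]] by (auto simp: st intro: sigma_sets.Basic)
    qed
    have "(\<lambda>z. z) \<in> measurable ?S (pairs_algebra n)"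
    proof (rule measurable_pairs_algebraI)
      show "fst \<in> measurable ?S (borel_vec n)" "snd \<in> measurable ?S (borel_vec n)"
        using half[OF lipschitz_pairs_coord(1)] half[OF lipschitz_pairs_coord(2)] orthonormal_pairs_subset[of n] sp
        by (auto intro!: measurable_borel_vecI)
    qed (simp add: sp)
    then show "sets (pairs_algebra n) \<subseteq> sigma_sets ?T E"
    proof (intro subsetI)
      fix A assume A: "A \<in> sets (pairs_algebra n)" and m: "(\<lambda>z. z) \<in> measurable ?S (pairs_algebra n)"
      have "A \<subseteq> ?T" using sets.sets_into_space[OF A] by simp
      then show "A \<in> sigma_sets ?T E" using measurable_sets[OF m A] by (simp add: sp st Int_absorb2)
    qed
  qed
  show ?thesis
  proof (rule measure_eqI_generator_eq[where E=E and \<Omega>="?T" and A="\<lambda>_. ?T"])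
    show "Int_stable E"
    proof (rule Int_stableI)
      fix a b assume "a \<in> E" "b \<in> E"
      then obtain f g where fg: "a = {z \<in> ?T. f z > 0}" "b = {z \<in> ?T. g z > 0}" "lipschitz_pairs n f" "lipschitz_pairs n g"
        unfolding E_def by blast
      have "a \<inter> b = {z \<in> ?T. min (f z) (g z) > 0}" unfolding fg by auto
      then show "a \<inter> b \<in> E" using memE[OF lipschitz_pairs_min[OF fg(3,4)]] by simp
    qed
    show "emeasure \<mu> X = emeasure \<nu> X" if "X \<in> E" for X
      using that positivity_set_emeasure_le[OF n mu nu] positivity_set_emeasure_le[OF n nu mu]
      by (auto simp: E_def intro: antisym)
  qed (use ET TE sE mu.emeasure_space_1 in auto)
qed

lemma stiefel_measure_eqI:
  assumes "n \<ge> 3" "is_invariant_measure n \<mu>"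
  shows "stiefel_measure n = \<mu>"
  unfolding stiefel_measure_def
  by (rule the_equality) (use assms invariant_measure_unique in \<open>auto simp: invariant_measure_def\<close>)

section \<open>Gram--Schmidt and the invariant measure\<close>

abbreviation gauss2 :: "nat \<Rightarrow> (real vec \<times> real vec) measure" where
  "gauss2 n \<equiv> gauss n \<Otimes>\<^sub>M gauss n"

interpretation gauss2: pair_prob_space "gauss n" "gauss n" for n ..

lemma sets_gauss2 [measurable_cong]: "sets (gauss2 n) = sets (borel_vec n \<Otimes>\<^sub>M borel_vec n)"
  by (intro sets_pair_measure_cong) simp_all

lemma space_gauss2: "space (gauss2 n) = carrier_vec n \<times> carrier_vec n"
  by (simp add: space_pair_measure)

lemma nn_integral_gauss2_rot:
  assumes g: "g \<in> orth_mats n" and f: "f \<in> borel_measurable (borel_vec n \<Otimes>\<^sub>M borel_vec n)"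
  shows "(\<integral>\<^sup>+ z. f (rot g z) \<partial>gauss2 n) = (\<integral>\<^sup>+ z. f z \<partial>gauss2 n)"
proof -
  note gc = orth_matsD(1)[OF g]
  have fm: "f \<in> borel_measurable (gauss2 n)" using f by (simp cong: measurable_cong_sets add: sets_gauss2)
  have r: "rot g \<in> measurable (borel_vec n \<Otimes>\<^sub>M borel_vec n) (borel_vec n \<Otimes>\<^sub>M borel_vec n)"
    unfolding case_prod_beta
    by (intro measurable_Pair measurable_mult_mat_vec[OF _ gc] measurable_fst measurable_snd)
  have frm: "(\<lambda>z. f (rot g z)) \<in> borel_measurable (gauss2 n)"
    using measurable_compose[OF r f] by (simp cong: measurable_cong_sets add: sets_gauss2)
  have sec: "(\<lambda>y. f (x, y)) \<in> borel_measurable (borel_vec n)" if "x \<in> carrier_vec n" for x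
    by (rule measurable_compose[OF measurable_Pair1' f]) (use that in simp)
  have "(\<lambda>x. \<integral>\<^sup>+ y. f (x, y) \<partial>gauss n) \<in> borel_measurable (gauss n)"
    by (rule gauss.borel_measurable_nn_integral_fst[OF fm])
  then have im: "(\<lambda>x. \<integral>\<^sup>+ y. f (x, y) \<partial>gauss n) \<in> borel_measurable (borel_vec n)" by (simp cong: measurable_cong_sets)
  have "(\<integral>\<^sup>+ z. f (rot g z) \<partial>gauss2 n) = (\<integral>\<^sup>+ x. \<integral>\<^sup>+ y. f (g *\<^sub>v x, g *\<^sub>v y) \<partial>gauss n \<partial>gauss n)"
    by (subst gauss.nn_integral_fst[OF frm, symmetric]) simp
  also have "\<dots> = (\<integral>\<^sup>+ x. \<integral>\<^sup>+ y. f (g *\<^sub>v x, y) \<partial>gauss n \<partial>gauss n)"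
    by (intro nn_integral_cong nn_integral_gauss_orth[OF g] sec) (simp add: orth_mats_apply(3)[OF g])
  also have "\<dots> = (\<integral>\<^sup>+ x. \<integral>\<^sup>+ y. f (x, y) \<partial>gauss n \<partial>gauss n)"
    by (rule nn_integral_gauss_orth[OF g im])
  also have "\<dots> = (\<integral>\<^sup>+ z. f z \<partial>gauss2 n)"
    by (rule gauss.nn_integral_fst[OF fm])
  finally show ?thesis .
qed

definition gram :: "real vec \<times> real vec \<Rightarrow> real" where
  "gram z = (fst z \<bullet> fst z) * (snd z \<bullet> snd z) - (fst z \<bullet> snd z)\<^sup>2"

text \<open>The component of $y$ orthogonal to $x$; it is $y$ itself when $x=0$, as division by zero gives
  $0$.\<close>
definition perp :: "real vec \<Rightarrow> real vec \<Rightarrow> real vec" where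
  "perp x y = y - ((x \<bullet> y) / (x \<bullet> x)) \<cdot>\<^sub>v x"

definition normalize_vec :: "real vec \<Rightarrow> real vec" where
  "normalize_vec v = (1 / sqrt (v \<bullet> v)) \<cdot>\<^sub>v v"

text \<open>Gram--Schmidt. On linearly dependent pairs the value is an arbitrary orthonormal pair, and
  all weights used below vanish there.\<close>
definition frame :: "nat \<Rightarrow> real vec \<times> real vec \<Rightarrow> real vec \<times> real vec" where
  "frame n z = (if gram z > 0 then (normalize_vec (fst z), normalize_vec (perp (fst z) (snd z)))
     else (unit_vec n 0, unit_vec n 1))"

lemma perp_carrier [simp]: "x \<in> carrier_vec n \<Longrightarrow> y \<in> carrier_vec n \<Longrightarrow> perp x y \<in> carrier_vec n"
  by (simp add: perp_def)

lemma perp_orthogonal: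
  assumes "x \<in> carrier_vec n" "y \<in> carrier_vec n"
  shows "x \<bullet> perp x y = 0"
proof (cases "x \<bullet> x = 0")
  case True
  then have "x = 0\<^sub>v n" using real_scalar_prod_eq_0_iff[OF assms(1)] by simp
  then show ?thesis using assms by simp
next
  case False
  then show ?thesis using assms by (simp add: perp_def scalar_prod_minus_distrib[of _ n])
qed

lemma perp_scalar_prod:
  assumes "x \<in> carrier_vec n" "y \<in> carrier_vec n" "v \<in> carrier_vec n"
  shows "v \<bullet> perp x y = v \<bullet> y - (x \<bullet> y) * (v \<bullet> x) / (x \<bullet> x)"
  using assms by (simp add: perp_def scalar_prod_minus_distrib[of _ n])

text \<open>Pythagoras; with division by zero as $0$ it also holds for $x=0$.\<close>
lemma perp_norm:
  assumes "x \<in> carrier_vec n" "y \<in> carrier_vec n"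
  shows "perp x y \<bullet> perp x y = y \<bullet> y - (x \<bullet> y)\<^sup>2 / (x \<bullet> x)"
proof -
  have "perp x y \<bullet> perp x y = perp x y \<bullet> y - (x \<bullet> y) * (perp x y \<bullet> x) / (x \<bullet> x)"
    using assms by (rule perp_scalar_prod) (use assms in simp)
  also have "perp x y \<bullet> x = 0"
    using perp_orthogonal[OF assms] comm_scalar_prod[OF assms(1) perp_carrier[OF assms]] by simp
  also have "perp x y \<bullet> y = y \<bullet> perp x y" using comm_scalar_prod[OF assms(2) perp_carrier[OF assms]] by simp
  also have "\<dots> = y \<bullet> y - (x \<bullet> y)\<^sup>2 / (x \<bullet> x)"
    using perp_scalar_prod[OF assms assms(2)] comm_scalar_prod[OF assms] by (simp add: power2_eq_square)
  finally show ?thesis by simp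
qed

lemma gram_eq:
  assumes "x \<in> carrier_vec n" "y \<in> carrier_vec n"
  shows "gram (x, y) = (x \<bullet> x) * (perp x y \<bullet> perp x y)"
proof (cases "x \<bullet> x = 0")
  case True
  then have "x = 0\<^sub>v n" using real_scalar_prod_eq_0_iff[OF assms(1)] by simp
  then show ?thesis using assms by (simp add: gram_def)
next
  case False
  then show ?thesis using assms by (simp add: perp_norm gram_def field_simps)
qed

lemma gram_nonneg: "z \<in> carrier_vec n \<times> carrier_vec n \<Longrightarrow> gram z \<ge> 0"
  using gram_eq[of "fst z" n "snd z"] real_scalar_prod_ge_0 by auto

lemma gram_posD:
  assumes "gram (x, y) > 0" "x \<in> carrier_vec n" "y \<in> carrier_vec n"
  shows "x \<bullet> x > 0" "perp x y \<bullet> perp x y > 0"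
  using assms gram_eq[OF assms(2,3)] real_scalar_prod_ge_0[of x] real_scalar_prod_ge_0[of "perp x y"]
  by (auto simp: zero_less_mult_iff)

lemma normalize_vec_scalar:
  assumes "v \<in> carrier_vec n" "w \<in> carrier_vec n"
  shows "normalize_vec v \<bullet> normalize_vec w = (v \<bullet> w) / (sqrt (v \<bullet> v) * sqrt (w \<bullet> w))"
  using assms by (simp add: normalize_vec_def)

lemma frame_in:
  assumes "n \<ge> 2" "z \<in> carrier_vec n \<times> carrier_vec n"
  shows "frame n z \<in> orthonormal_pairs n"
proof (cases "gram z > 0")
  case True
  obtain x y where z: "z = (x, y)" "x \<in> carrier_vec n" "y \<in> carrier_vec n" using assms by (cases z) auto
  note p = gram_posD[OF True[unfolded z(1)] z(2,3)]
  show ?thesis using True p z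
    by (simp add: frame_def orthonormal_pairs_iff normalize_vec_scalar[of _ n] perp_orthogonal)
       (simp add: normalize_vec_def)
next
  case False
  then show ?thesis using assms(1) by (simp add: frame_def orthonormal_pairs_iff)
qed

lemma measurable_gram: "gram \<in> borel_measurable (borel_vec n \<Otimes>\<^sub>M borel_vec n)"
  unfolding gram_def
  by (intro borel_measurable_diff borel_measurable_times borel_measurable_power measurable_scalar_prod[of _ _ n] measurable_fst measurable_snd)

lemma measurable_perp:
  assumes "f \<in> measurable M (borel_vec n)" "g \<in> measurable M (borel_vec n)"
  shows "(\<lambda>x. perp (f x) (g x)) \<in> measurable M (borel_vec n)"
  unfolding perp_def
  by (intro measurable_vec_minus measurable_vec_smult borel_measurable_divide measurable_scalar_prod[of _ _ n] assms)

lemma measurable_normalize_vec: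
  assumes "f \<in> measurable M (borel_vec n)"
  shows "(\<lambda>x. normalize_vec (f x)) \<in> measurable M (borel_vec n)"
  unfolding normalize_vec_def
  by (intro measurable_vec_smult borel_measurable_divide measurable_compose[OF _ borel_measurable_sqrt] measurable_scalar_prod[of _ _ n] assms borel_measurable_const)

lemma measurable_frame:
  assumes "n \<ge> 2"
  shows "frame n \<in> measurable (borel_vec n \<Otimes>\<^sub>M borel_vec n) (pairs_algebra n)"
proof (rule measurable_pairs_algebraI)
  let ?M = "borel_vec n \<Otimes>\<^sub>M borel_vec n"
  have P: "{z \<in> space ?M. gram z > 0} \<in> sets ?M" using measurable_gram[of n] by measurable
  show "(\<lambda>z. fst (frame n z)) \<in> measurable ?M (borel_vec n)"
    unfolding frame_def if_distrib[of fst] fst_conv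
    by (intro measurable_If P measurable_normalize_vec measurable_fst measurable_const) auto
  show "(\<lambda>z. snd (frame n z)) \<in> measurable ?M (borel_vec n)"
    unfolding frame_def if_distrib[of snd] snd_conv
    by (intro measurable_If P measurable_normalize_vec measurable_perp measurable_fst measurable_snd measurable_const) auto
qed (use frame_in[OF assms] in \<open>auto simp: space_pair_measure\<close>)

lemma gram_rot:
  assumes "g \<in> orth_mats n" "z \<in> carrier_vec n \<times> carrier_vec n"
  shows "gram (rot g z) = gram z"
  using assms by (cases z) (auto simp: gram_def orth_mats_scalar_prod)

lemma frame_rot:
  assumes g: "g \<in> orth_mats n" and z: "z \<in> carrier_vec n \<times> carrier_vec n" and p: "gram z > 0"
  shows "frame n (rot g z) = rot g (frame n z)"
proof -
  obtain x y where xy: "z = (x, y)" "x \<in> carrier_vec n" "y \<in> carrier_vec n" using z by (cases z) auto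
  note gc = orth_matsD(1)[OF g]
  have nv: "normalize_vec (g *\<^sub>v v) = g *\<^sub>v normalize_vec v" if "v \<in> carrier_vec n" for v
    using that gc by (simp add: normalize_vec_def orth_mats_scalar_prod[OF g] mult_mat_vec[OF gc])
  have pp: "perp (g *\<^sub>v x) (g *\<^sub>v y) = g *\<^sub>v perp x y"
    using xy gc by (simp add: perp_def orth_mats_scalar_prod[OF g] mult_mat_vec[OF gc] mult_minus_distrib_mat_vec[OF gc])
  show ?thesis using p gram_rot[OF g z] xy by (simp add: frame_def nv pp)
qed

lemma integral_gauss_norm:
  "integrable (gauss n) (\<lambda>x. x \<bullet> x)" "(\<integral>x. x \<bullet> x \<partial>gauss n) = real n"
proof -
  have e: "x \<bullet> x = (\<Sum>i<n. (unit_vec n i \<bullet> x)\<^sup>2)" if "x \<in> carrier_vec n" for x :: "real vec"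
    unfolding scalar_prod_sum[OF that, of x] using that by (intro sum.cong) (auto simp: power2_eq_square)
  have "integrable (gauss n) (\<lambda>x. \<Sum>i<n. (unit_vec n i \<bullet> x)\<^sup>2)"
    by (intro Bochner_Integration.integrable_sum gauss_linear_2) simp
  then show "integrable (gauss n) (\<lambda>x. x \<bullet> x)"
    by (rule Bochner_Integration.integrable_cong[THEN iffD1, rotated -1]) (simp_all add: e)
  have "(\<integral>x. x \<bullet> x \<partial>gauss n) = (\<integral>x. (\<Sum>i<n. (unit_vec n i \<bullet> x)\<^sup>2) \<partial>gauss n)"
    by (rule Bochner_Integration.integral_cong) (simp_all add: e)
  also have "\<dots> = (\<Sum>i<n. \<integral>x. (unit_vec n i \<bullet> x)\<^sup>2 \<partial>gauss n)"
    by (intro Bochner_Integration.integral_sum gauss_linear_2) simp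
  also have "\<dots> = real n" by (simp add: gauss_linear_2)
  finally show "(\<integral>x. x \<bullet> x \<partial>gauss n) = real n" .
qed

lemma nn_integral_gauss_perp:
  assumes x: "x \<in> carrier_vec n"
  shows "(\<integral>\<^sup>+ y. ennreal (gram (x, y)) \<partial>gauss n) = ennreal ((real n - 1) * (x \<bullet> x))"
proof -
  have "integrable (gauss n) (\<lambda>y. (x \<bullet> x) * (y \<bullet> y) - (x \<bullet> y)\<^sup>2)"
    using integral_gauss_norm gauss_linear_2[OF x] by (intro Bochner_Integration.integrable_diff integrable_mult_right) auto
  moreover have "(\<integral>y. (x \<bullet> x) * (y \<bullet> y) - (x \<bullet> y)\<^sup>2 \<partial>gauss n) = (real n - 1) * (x \<bullet> x)"
    using integral_gauss_norm[of n] gauss_linear_2[OF x] by (subst Bochner_Integration.integral_diff) (auto simp: algebra_simps)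
  moreover have "AE y in gauss n. 0 \<le> (x \<bullet> x) * (y \<bullet> y) - (x \<bullet> y)\<^sup>2"
    using gram_nonneg[of "(x, _)" n] x by (intro AE_I2) (auto simp: gram_def)
  ultimately show ?thesis unfolding gram_def by (simp add: nn_integral_eq_integral)
qed

lemma nn_integral_gram:
  "n \<ge> 1 \<Longrightarrow> (\<integral>\<^sup>+ z. ennreal (gram z) \<partial>gauss2 n) = ennreal (real n * (real n - 1))"
proof -
  assume n: "n \<ge> 1"
  have m: "(\<lambda>z. ennreal (gram z)) \<in> borel_measurable (gauss2 n)"
    using measurable_gram[of n] by (simp cong: measurable_cong_sets add: sets_gauss2)
  have "(\<integral>\<^sup>+ z. ennreal (gram z) \<partial>gauss2 n) = (\<integral>\<^sup>+ x. \<integral>\<^sup>+ y. ennreal (gram (x, y)) \<partial>gauss n \<partial>gauss n)"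
    by (rule gauss.nn_integral_fst[OF m, symmetric])
  also have "\<dots> = (\<integral>\<^sup>+ x. ennreal ((real n - 1) * (x \<bullet> x)) \<partial>gauss n)"
    by (intro nn_integral_cong nn_integral_gauss_perp) simp
  also have "\<dots> = ennreal (\<integral>x. (real n - 1) * (x \<bullet> x) \<partial>gauss n)"
    using integral_gauss_norm[of n] n by (intro nn_integral_eq_integral) (auto simp: real_scalar_prod_ge_0)
  also have "(\<integral>x. (real n - 1) * (x \<bullet> x) \<partial>gauss n) = real n * (real n - 1)" using integral_gauss_norm[of n] by simp
  finally show ?thesis .
qed

definition weighted_frame :: "nat \<Rightarrow> (real vec \<times> real vec \<Rightarrow> real) \<Rightarrow> (real vec \<times> real vec) measure" where
  "weighted_frame n \<phi> = distr (density (gauss2 n) (\<lambda>z. ennreal (\<phi> z) / (\<integral>\<^sup>+ z. ennreal (\<phi> z) \<partial>gauss2 n))) (pairs_algebra n) (frame n)"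

text \<open>Weights that may be inserted before applying Gram--Schmidt to a pair of independent Gaussian
  vectors.\<close>
locale frame_weight =
  fixes n :: nat and \<phi> :: "real vec \<times> real vec \<Rightarrow> real"
  assumes n: "n \<ge> 3"
    and meas: "\<phi> \<in> borel_measurable (borel_vec n \<Otimes>\<^sub>M borel_vec n)"
    and rot: "\<And>g z. g \<in> orth_mats n \<Longrightarrow> z \<in> carrier_vec n \<times> carrier_vec n \<Longrightarrow> \<phi> (rot g z) = \<phi> z"
    and gram0: "\<And>z. z \<in> carrier_vec n \<times> carrier_vec n \<Longrightarrow> gram z = 0 \<Longrightarrow> \<phi> z = 0"
    and pos: "(\<integral>\<^sup>+ z. ennreal (\<phi> z) \<partial>gauss2 n) \<noteq> 0" and fin: "(\<integral>\<^sup>+ z. ennreal (\<phi> z) \<partial>gauss2 n) \<noteq> \<infinity>"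
begin

abbreviation "W \<equiv> (\<integral>\<^sup>+ z. ennreal (\<phi> z) \<partial>gauss2 n)"

lemma n2: "n \<ge> 2" using n by simp

lemma nn_integral_weighted:
  assumes f: "f \<in> borel_measurable (pairs_algebra n)"
  shows "(\<integral>\<^sup>+ z. f z \<partial>weighted_frame n \<phi>) = (\<integral>\<^sup>+ z. ennreal (\<phi> z) / W * f (frame n z) \<partial>gauss2 n)"
proof -
  have fr: "frame n \<in> measurable (gauss2 n) (pairs_algebra n)"
    using measurable_frame[OF n2] by (simp cong: measurable_cong_sets add: sets_gauss2)
  have \<phi>m: "(\<lambda>z. ennreal (\<phi> z) / W) \<in> borel_measurable (gauss2 n)"
    using meas by (simp cong: measurable_cong_sets add: sets_gauss2)
  show ?thesis
    unfolding weighted_frame_def using f fr \<phi>m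
    by (subst nn_integral_distr) (auto simp: nn_integral_density intro!: nn_integral_density)
qed

text \<open>A rotation preserves the Gaussian measure and the weight and commutes with
  Gram--Schmidt, except on dependent pairs, where the weight vanishes.\<close>
lemma weighted_frame_invariant: "is_invariant_measure n (weighted_frame n \<phi>)"
  unfolding is_invariant_measure_def
proof (intro conjI ballI)
  let ?\<mu> = "weighted_frame n \<phi>"
  show s: "sets ?\<mu> = sets (pairs_algebra n)" by (simp add: weighted_frame_def)
  have T: "orthonormal_pairs n \<in> sets ?\<mu>" unfolding s using sets.top[of "pairs_algebra n"] by simp
  have \<phi>m: "(\<lambda>z. ennreal (\<phi> z)) \<in> borel_measurable (gauss2 n)"
    using meas by (simp cong: measurable_cong_sets add: sets_gauss2)
  have "emeasure ?\<mu> (orthonormal_pairs n) = (\<integral>\<^sup>+ z. indicator (orthonormal_pairs n) z \<partial>?\<mu>)" using T by simp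
  also have "\<dots> = (\<integral>\<^sup>+ z. ennreal (\<phi> z) / W * indicator (orthonormal_pairs n) (frame n z) \<partial>gauss2 n)"
    using T s by (intro nn_integral_weighted) auto
  also have "\<dots> = (\<integral>\<^sup>+ z. ennreal (\<phi> z) / W \<partial>gauss2 n)"
    using frame_in[OF n2] by (intro nn_integral_cong) (auto simp: space_gauss2)
  also have "\<dots> = 1" using pos fin \<phi>m by (simp add: nn_integral_divide ennreal_divide_self top.not_eq_extremum)
  finally show "emeasure ?\<mu> (orthonormal_pairs n) = 1" .
  fix g assume "g \<in> SO_mats n"
  then have g: "g \<in> orth_mats n" by (simp add: SO_mats_iff)
  have rm: "rot g \<in> measurable ?\<mu> ?\<mu>" using measurable_rot[OF g] s by (simp cong: measurable_cong_sets)
  show "distr ?\<mu> ?\<mu> (rot g) = ?\<mu>"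
  proof (rule measure_eqI)
    fix A assume "A \<in> sets (distr ?\<mu> ?\<mu> (rot g))"
    then have A: "A \<in> sets ?\<mu>" by simp
    then have iA: "indicator A \<in> borel_measurable (pairs_algebra n)" (is "?i \<in> _")
      using s by (metis borel_measurable_indicator)
    have iA2: "(\<lambda>z. ?i (rot g z) :: ennreal) \<in> borel_measurable (pairs_algebra n)"
      by (rule measurable_compose[OF measurable_rot[OF g] iA])
    have fm: "(\<lambda>z. ennreal (\<phi> z) / W * ?i (frame n z)) \<in> borel_measurable (borel_vec n \<Otimes>\<^sub>M borel_vec n)"
      using meas measurable_compose[OF measurable_frame[OF n2] iA] by measurable
    have "emeasure (distr ?\<mu> ?\<mu> (rot g)) A = (\<integral>\<^sup>+ z. ?i z \<partial>distr ?\<mu> ?\<mu> (rot g))" using A by simp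
    also have "\<dots> = (\<integral>\<^sup>+ z. ?i (rot g z) \<partial>?\<mu>)" using A by (intro nn_integral_distr rm) auto
    also have "\<dots> = (\<integral>\<^sup>+ z. ennreal (\<phi> z) / W * ?i (rot g (frame n z)) \<partial>gauss2 n)"
      by (rule nn_integral_weighted[OF iA2])
    also have "\<dots> = (\<integral>\<^sup>+ z. ennreal (\<phi> (rot g z)) / W * ?i (frame n (rot g z)) \<partial>gauss2 n)"
    proof (rule nn_integral_cong)
      fix z assume "z \<in> space (gauss2 n)"
      then have z: "z \<in> carrier_vec n \<times> carrier_vec n" by (simp add: space_gauss2)
      show "ennreal (\<phi> z) / W * ?i (rot g (frame n z)) = ennreal (\<phi> (rot g z)) / W * ?i (frame n (rot g z))"
      proof (cases "gram z > 0")
        case True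
        then show ?thesis using frame_rot[OF g z True] rot[OF g z] by simp
      next
        case False
        then have "gram z = 0" using gram_nonneg[OF z] by simp
        then show ?thesis using rot[OF g z] gram0[OF z] by simp
      qed
    qed
    also have "\<dots> = (\<integral>\<^sup>+ z. ennreal (\<phi> z) / W * ?i (frame n z) \<partial>gauss2 n)"
      by (rule nn_integral_gauss2_rot[OF g fm])
    also have "\<dots> = (\<integral>\<^sup>+ z. ?i z \<partial>?\<mu>)" by (rule nn_integral_weighted[OF iA, symmetric])
    also have "\<dots> = emeasure ?\<mu> A" using A by simp
    finally show "emeasure (distr ?\<mu> ?\<mu> (rot g)) A = emeasure ?\<mu> A" .
  qed simp
qed

text \<open>By uniqueness the weighted measure does not depend on the weight, so a weight
  adapted to the integrand may be used to compute an integral over orthonormal pairs.\<close>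
lemma nn_integral_frame:
  assumes f: "f \<in> borel_measurable (pairs_algebra n)"
  shows "(\<integral>\<^sup>+ z. ennreal (\<phi> z) * f (frame n z) \<partial>gauss2 n) = W * (\<integral>\<^sup>+ z. f z \<partial>stiefel_measure n)"
proof -
  have fr: "frame n \<in> measurable (gauss2 n) (pairs_algebra n)"
    using measurable_frame[OF n2] by (simp cong: measurable_cong_sets add: sets_gauss2)
  have \<phi>m: "(\<lambda>z. ennreal (\<phi> z)) \<in> borel_measurable (gauss2 n)"
    using meas by (simp cong: measurable_cong_sets add: sets_gauss2)
  have fm: "(\<lambda>z. f (frame n z)) \<in> borel_measurable (gauss2 n)" by (rule measurable_compose[OF fr f])
  have "W * (\<integral>\<^sup>+ z. f z \<partial>stiefel_measure n) = W * (\<integral>\<^sup>+ z. ennreal (\<phi> z) / W * f (frame n z) \<partial>gauss2 n)"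
    using stiefel_measure_eqI[OF n weighted_frame_invariant] nn_integral_weighted[OF f] by simp
  also have "\<dots> = (\<integral>\<^sup>+ z. W * (ennreal (\<phi> z) / W * f (frame n z)) \<partial>gauss2 n)"
    using \<phi>m fm by (intro nn_integral_cmult[symmetric]) auto
  also have "\<dots> = (\<integral>\<^sup>+ z. ennreal (\<phi> z) * f (frame n z) \<partial>gauss2 n)"
  proof (rule nn_integral_cong)
    fix z
    have "W * (ennreal (\<phi> z) / W) = ennreal (\<phi> z)"
      using pos fin ennreal_mult_divide_eq[of W "ennreal (\<phi> z)"] by (simp add: ennreal_times_divide mult.commute)
    then show "W * (ennreal (\<phi> z) / W * f (frame n z)) = ennreal (\<phi> z) * f (frame n z)"
      by (metis mult.assoc)
  qed
  finally show ?thesis by simp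
qed

end

lemma frame_weight_gram:
  assumes "n \<ge> 3"
  shows "frame_weight n gram"
proof
  show "(\<integral>\<^sup>+ z. ennreal (gram z) \<partial>gauss2 n) \<noteq> 0" "(\<integral>\<^sup>+ z. ennreal (gram z) \<partial>gauss2 n) \<noteq> \<infinity>"
    using assms nn_integral_gram[of n] by auto
qed (use assms measurable_gram gram_rot in auto)

lemma invariant_stiefel:
  assumes "n \<ge> 3"
  shows "invariant_measure n (stiefel_measure n)"
proof -
  interpret frame_weight n gram by (rule frame_weight_gram[OF assms])
  show ?thesis using stiefel_measure_eqI[OF n weighted_frame_invariant] weighted_frame_invariant
    by (simp add: invariant_measure_def)
qed

section \<open>Fourth moments of Gaussian linear forms\<close>

text \<open>Polarization of the fourth moment:
  $12\,s^2t^2=(s+t)^4+(s-t)^4-2s^4-2t^4$.\<close>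
lemma gauss_linear_22:
  assumes c: "c \<in> carrier_vec n" and d: "d \<in> carrier_vec n"
  shows "has_bochner_integral (gauss n) (\<lambda>x. (c \<bullet> x)\<^sup>2 * (d \<bullet> x)\<^sup>2) ((c \<bullet> c) * (d \<bullet> d) + 2 * (c \<bullet> d)\<^sup>2)"
proof -
  have H: "has_bochner_integral (gauss n) (\<lambda>x. (v \<bullet> x) ^ 4) (3 * (v \<bullet> v)\<^sup>2)" if "v \<in> carrier_vec n" for v
    using gauss_linear_4[OF that] by (simp add: has_bochner_integral_iff)
  have "has_bochner_integral (gauss n)
      (\<lambda>x. (1 / 12) * (((c + d) \<bullet> x) ^ 4 + ((c - d) \<bullet> x) ^ 4 - 2 * (c \<bullet> x) ^ 4 - 2 * (d \<bullet> x) ^ 4))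
      ((1 / 12) * (3 * ((c + d) \<bullet> (c + d))\<^sup>2 + 3 * ((c - d) \<bullet> (c - d))\<^sup>2 - 2 * (3 * (c \<bullet> c)\<^sup>2) - 2 * (3 * (d \<bullet> d)\<^sup>2)))"
    by (intro has_bochner_integral_mult_right has_bochner_integral_diff has_bochner_integral_add H) (use c d in auto)
  moreover have "(1 / 12) * (3 * ((c + d) \<bullet> (c + d))\<^sup>2 + 3 * ((c - d) \<bullet> (c - d))\<^sup>2 - 2 * (3 * (c \<bullet> c)\<^sup>2) - 2 * (3 * (d \<bullet> d)\<^sup>2))
     = (c \<bullet> c) * (d \<bullet> d) + 2 * (c \<bullet> d)\<^sup>2"
  proof -
    have e: "(c + d) \<bullet> (c + d) = c \<bullet> c + 2 * (c \<bullet> d) + d \<bullet> d" "(c - d) \<bullet> (c - d) = c \<bullet> c - 2 * (c \<bullet> d) + d \<bullet> d"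
      using c d comm_scalar_prod[OF d c]
      by (simp_all add: add_scalar_prod_distrib[of _ n] scalar_prod_add_distrib[of _ n] minus_scalar_prod_distrib[of _ n] scalar_prod_minus_distrib[of _ n])
    show ?thesis unfolding e by (simp add: power2_eq_square field_simps)
  qed
  ultimately have "has_bochner_integral (gauss n)
      (\<lambda>x. (1 / 12) * (((c + d) \<bullet> x) ^ 4 + ((c - d) \<bullet> x) ^ 4 - 2 * (c \<bullet> x) ^ 4 - 2 * (d \<bullet> x) ^ 4)) ((c \<bullet> c) * (d \<bullet> d) + 2 * (c \<bullet> d)\<^sup>2)"
    by (simp only:)
  then show ?thesis
  proof (rule has_bochner_integral_cong[THEN iffD1, rotated -1])
    fix x assume "x \<in> space (gauss n)"
    then have "(c + d) \<bullet> x = c \<bullet> x + d \<bullet> x" "(c - d) \<bullet> x = c \<bullet> x - d \<bullet> x"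
      using c d by (simp_all add: add_scalar_prod_distrib[of _ n] minus_scalar_prod_distrib[of _ n])
    moreover have "(1 / 12) * ((s + t) ^ 4 + (s - t) ^ 4 - 2 * s ^ 4 - 2 * t ^ 4) = s\<^sup>2 * t\<^sup>2" for s t :: real
      by (simp add: power4_eq_xxxx power2_eq_square algebra_simps)
    ultimately show "(1 / 12) * (((c + d) \<bullet> x) ^ 4 + ((c - d) \<bullet> x) ^ 4 - 2 * (c \<bullet> x) ^ 4 - 2 * (d \<bullet> x) ^ 4) = (c \<bullet> x)\<^sup>2 * (d \<bullet> x)\<^sup>2"
      by simp
  qed auto
qed

lemma polarization_identity:
  fixes aa bb cc dd ab cd ac ad bc bd :: real
  shows "(1 / 16) * (((aa + 2 * ab + bb) * (cc + 2 * cd + dd) + 2 * (ac + ad + bc + bd)\<^sup>2)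
     - ((aa + 2 * ab + bb) * (cc - 2 * cd + dd) + 2 * (ac - ad + bc - bd)\<^sup>2)
     - ((aa - 2 * ab + bb) * (cc + 2 * cd + dd) + 2 * (ac + ad - bc - bd)\<^sup>2)
     + ((aa - 2 * ab + bb) * (cc - 2 * cd + dd) + 2 * (ac - ad - bc + bd)\<^sup>2)) = ab * cd + ac * bd + ad * bc"
  by (simp add: power2_eq_square field_simps)

text \<open>Polarization again, now by $4st=(s+t)^2-(s-t)^2$ in both pairs of factors.\<close>
lemma gauss_linear_1111:
  assumes a: "a \<in> carrier_vec n" and b: "b \<in> carrier_vec n" and c: "c \<in> carrier_vec n" and d: "d \<in> carrier_vec n"
  shows "has_bochner_integral (gauss n) (\<lambda>x. (a \<bullet> x) * (b \<bullet> x) * ((c \<bullet> x) * (d \<bullet> x)))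
     ((a \<bullet> b) * (c \<bullet> d) + (a \<bullet> c) * (b \<bullet> d) + (a \<bullet> d) * (b \<bullet> c))"
proof -
  let ?G = "\<lambda>u v. (u \<bullet> u) * (v \<bullet> v) + 2 * (u \<bullet> v)\<^sup>2"
  let ?F = "\<lambda>u v x. (u \<bullet> x)\<^sup>2 * (v \<bullet> x)\<^sup>2"
  have "has_bochner_integral (gauss n)
      (\<lambda>x. (1 / 16) * (?F (a + b) (c + d) x - ?F (a + b) (c - d) x - ?F (a - b) (c + d) x + ?F (a - b) (c - d) x))
      ((1 / 16) * (?G (a + b) (c + d) - ?G (a + b) (c - d) - ?G (a - b) (c + d) + ?G (a - b) (c - d)))"
    by (intro has_bochner_integral_mult_right has_bochner_integral_diff has_bochner_integral_add gauss_linear_22) (use a b c d in auto)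
  moreover have "(1 / 16) * (?G (a + b) (c + d) - ?G (a + b) (c - d) - ?G (a - b) (c + d) + ?G (a - b) (c - d))
     = (a \<bullet> b) * (c \<bullet> d) + (a \<bullet> c) * (b \<bullet> d) + (a \<bullet> d) * (b \<bullet> c)"
  proof -
    have e: "(u + v) \<bullet> (u + v) = u \<bullet> u + 2 * (u \<bullet> v) + v \<bullet> v" "(u - v) \<bullet> (u - v) = u \<bullet> u - 2 * (u \<bullet> v) + v \<bullet> v"
      if "u \<in> carrier_vec n" "v \<in> carrier_vec n" for u v :: "real vec"
      using that comm_scalar_prod[OF that]
      by (simp_all add: add_scalar_prod_distrib[of _ n] scalar_prod_add_distrib[of _ n] minus_scalar_prod_distrib[of _ n] scalar_prod_minus_distrib[of _ n])
    have f: "(a + b) \<bullet> (c + d) = a \<bullet> c + a \<bullet> d + b \<bullet> c + b \<bullet> d" "(a + b) \<bullet> (c - d) = a \<bullet> c - a \<bullet> d + b \<bullet> c - b \<bullet> d"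
      "(a - b) \<bullet> (c + d) = a \<bullet> c + a \<bullet> d - b \<bullet> c - b \<bullet> d" "(a - b) \<bullet> (c - d) = a \<bullet> c - a \<bullet> d - b \<bullet> c + b \<bullet> d"
      using a b c d
      by (simp_all add: add_scalar_prod_distrib[of _ n] scalar_prod_add_distrib[of _ n] minus_scalar_prod_distrib[of _ n] scalar_prod_minus_distrib[of _ n])
    show ?thesis unfolding e[OF a b] e[OF c d] f by (rule polarization_identity)
  qed
  ultimately have "has_bochner_integral (gauss n)
      (\<lambda>x. (1 / 16) * (?F (a + b) (c + d) x - ?F (a + b) (c - d) x - ?F (a - b) (c + d) x + ?F (a - b) (c - d) x))
      ((a \<bullet> b) * (c \<bullet> d) + (a \<bullet> c) * (b \<bullet> d) + (a \<bullet> d) * (b \<bullet> c))" by (simp only:)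
  then show ?thesis
  proof (rule has_bochner_integral_cong[THEN iffD1, rotated -1])
    fix x assume "x \<in> space (gauss n)"
    then have e: "(a + b) \<bullet> x = a \<bullet> x + b \<bullet> x" "(a - b) \<bullet> x = a \<bullet> x - b \<bullet> x" "(c + d) \<bullet> x = c \<bullet> x + d \<bullet> x" "(c - d) \<bullet> x = c \<bullet> x - d \<bullet> x"
      using a b c d by (simp_all add: add_scalar_prod_distrib[of _ n] minus_scalar_prod_distrib[of _ n])
    show "(1 / 16) * (?F (a + b) (c + d) x - ?F (a + b) (c - d) x - ?F (a - b) (c + d) x + ?F (a - b) (c - d) x)
       = (a \<bullet> x) * (b \<bullet> x) * ((c \<bullet> x) * (d \<bullet> x))"
      unfolding e by (simp add: power2_eq_square algebra_simps)
  qed auto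
qed

lemma gauss_sum_squares_sq:
  assumes c: "\<And>j. j < m \<Longrightarrow> c j \<in> carrier_vec n"
  shows "integrable (gauss n) (\<lambda>x. (\<Sum>j<m. (c j \<bullet> x)\<^sup>2)\<^sup>2)"
    "(\<integral>x. (\<Sum>j<m. (c j \<bullet> x)\<^sup>2)\<^sup>2 \<partial>gauss n) \<le> 3 * (\<Sum>j<m. c j \<bullet> c j)\<^sup>2"
proof -
  let ?E = "\<lambda>j k. (c j \<bullet> c j) * (c k \<bullet> c k) + 2 * (c j \<bullet> c k)\<^sup>2"
  have "has_bochner_integral (gauss n) (\<lambda>x. \<Sum>j<m. \<Sum>k<m. (c j \<bullet> x)\<^sup>2 * (c k \<bullet> x)\<^sup>2) (\<Sum>j<m. \<Sum>k<m. ?E j k)"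
    by (intro has_bochner_integral_sum gauss_linear_22) (use c in auto)
  then have H: "has_bochner_integral (gauss n) (\<lambda>x. (\<Sum>j<m. (c j \<bullet> x)\<^sup>2)\<^sup>2) (\<Sum>j<m. \<Sum>k<m. ?E j k)"
    by (simp add: power2_eq_square sum_product)
  then show "integrable (gauss n) (\<lambda>x. (\<Sum>j<m. (c j \<bullet> x)\<^sup>2)\<^sup>2)" by (simp add: has_bochner_integral_iff)
  have "?E j k \<le> 3 * ((c j \<bullet> c j) * (c k \<bullet> c k))" if "j < m" "k < m" for j k
  proof -
    have "gram (c j, c k) \<ge> 0" using c that by (intro gram_nonneg) auto
    then show ?thesis by (simp add: gram_def)
  qed
  then have "(\<Sum>j<m. \<Sum>k<m. ?E j k) \<le> (\<Sum>j<m. \<Sum>k<m. 3 * ((c j \<bullet> c j) * (c k \<bullet> c k)))"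
    by (intro sum_mono) auto
  also have "\<dots> = 3 * (\<Sum>j<m. c j \<bullet> c j)\<^sup>2" unfolding power2_eq_square sum_product by (simp add: sum_distrib_left)
  finally show "(\<integral>x. (\<Sum>j<m. (c j \<bullet> x)\<^sup>2)\<^sup>2 \<partial>gauss n) \<le> 3 * (\<Sum>j<m. c j \<bullet> c j)\<^sup>2"
    using H by (simp add: has_bochner_integral_iff)
qed

lemma scalar_prod_self_unit:
  fixes x :: "real vec"
  assumes "x \<in> carrier_vec n"
  shows "x \<bullet> x = (\<Sum>i<n. (unit_vec n i \<bullet> x)\<^sup>2)"
proof -
  have "unit_vec n i \<bullet> x = x $ i" if "i < n" for i using assms that by simp
  then show ?thesis unfolding scalar_prod_sum[OF assms, of x] by (intro sum.cong) (simp_all add: power2_eq_square)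
qed

text \<open>The second bound is $E\,Y^2\ge(E\,Y)^2$ for $Y=|x|^2$.\<close>
lemma integral_gauss_norm_sq:
  "integrable (gauss n) (\<lambda>x. (x \<bullet> x)\<^sup>2)" "(\<integral>x. (x \<bullet> x)\<^sup>2 \<partial>gauss n) \<ge> (real n)\<^sup>2"
proof -
  have "integrable (gauss n) (\<lambda>x. (\<Sum>j<n. (unit_vec n j \<bullet> x)\<^sup>2)\<^sup>2)" by (rule gauss_sum_squares_sq) simp
  then show I: "integrable (gauss n) (\<lambda>x. (x \<bullet> x)\<^sup>2)"
    by (rule Bochner_Integration.integrable_cong[THEN iffD1, rotated -1]) (simp_all add: scalar_prod_self_unit[of _ n])
  have "0 \<le> (\<integral>x. (x \<bullet> x - real n)\<^sup>2 \<partial>gauss n)" by (intro Bochner_Integration.integral_nonneg) simp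
  also have "\<dots> = (\<integral>x. (x \<bullet> x)\<^sup>2 - 2 * real n * (x \<bullet> x) + (real n)\<^sup>2 \<partial>gauss n)"
    by (intro Bochner_Integration.integral_cong refl) (simp add: power2_eq_square algebra_simps)
  also have "\<dots> = (\<integral>x. (x \<bullet> x)\<^sup>2 \<partial>gauss n) - 2 * real n * real n + (real n)\<^sup>2"
    using I integral_gauss_norm[of n] gauss.prob_space[of n] by simp
  finally show "(\<integral>x. (x \<bullet> x)\<^sup>2 \<partial>gauss n) \<ge> (real n)\<^sup>2" by (simp add: power2_eq_square)
qed

section \<open>Bilinear forms on orthonormal pairs\<close>

text \<open>The vector $b^Tx$; matrices are plain functions here because they only provide
  coefficients.\<close>
definition left_form :: "nat \<Rightarrow> (nat \<Rightarrow> nat \<Rightarrow> real) \<Rightarrow> real vec \<Rightarrow> real vec" where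
  "left_form n b x = Matrix.vec n (\<lambda>j. \<Sum>i<n. b i j * x $ i)"

definition bilform :: "nat \<Rightarrow> (nat \<Rightarrow> nat \<Rightarrow> real) \<Rightarrow> real vec \<times> real vec \<Rightarrow> real" where
  "bilform n b z = left_form n b (fst z) \<bullet> snd z"

definition frob :: "nat \<Rightarrow> (nat \<Rightarrow> nat \<Rightarrow> real) \<Rightarrow> real" where
  "frob n b = (\<Sum>i<n. \<Sum>j<n. (b i j)\<^sup>2)"

lemma left_form_carrier [simp]: "left_form n b x \<in> carrier_vec n"
  by (simp add: left_form_def)

lemma left_form_smult: "x \<in> carrier_vec n \<Longrightarrow> left_form n b (a \<cdot>\<^sub>v x) = a \<cdot>\<^sub>v left_form n b x"
  by (intro eq_vecI) (auto simp: left_form_def sum_distrib_left mult_ac intro!: sum.cong)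

lemma left_form_zero: "left_form n b (0\<^sub>v n) = 0\<^sub>v n"
  by (intro eq_vecI) (auto simp: left_form_def)

lemma left_form_norm:
  assumes "x \<in> carrier_vec n"
  shows "left_form n b x \<bullet> left_form n b x = (\<Sum>j<n. (Matrix.vec n (\<lambda>i. b i j) \<bullet> x)\<^sup>2)"
  using assms by (simp add: scalar_prod_sum[of _ n] left_form_def power2_eq_square)

lemma measurable_left_form:
  assumes "f \<in> measurable M (borel_vec n)"
  shows "(\<lambda>x. left_form n b (f x)) \<in> measurable M (borel_vec n)"
proof (rule measurable_borel_vecI)
  fix j assume "j < n"
  then show "(\<lambda>x. left_form n b (f x) $ j) \<in> borel_measurable M"
    using measurable_vec_index'[OF assms] by (auto simp: left_form_def intro!: borel_measurable_sum borel_measurable_times)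
qed simp

lemma measurable_bilform: "bilform n b \<in> borel_measurable (pairs_algebra n)"
  unfolding bilform_def
  by (intro measurable_scalar_prod[of _ _ n] measurable_left_form measurable_fst_pairs measurable_snd_pairs)

lemma perp_swap:
  assumes "x \<in> carrier_vec n" "y \<in> carrier_vec n" "u \<in> carrier_vec n"
  shows "u \<bullet> perp x y = perp x u \<bullet> y"
proof -
  have "perp x u \<bullet> y = y \<bullet> perp x u" using assms by (intro comm_scalar_prod[of _ n]) auto
  also have "\<dots> = y \<bullet> u - (x \<bullet> u) * (y \<bullet> x) / (x \<bullet> x)" by (rule perp_scalar_prod) (use assms in auto)
  also have "\<dots> = u \<bullet> perp x y"
    using assms comm_scalar_prod[OF assms(1,2)] comm_scalar_prod[OF assms(1,3)] comm_scalar_prod[OF assms(2,3)]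
    by (simp add: perp_scalar_prod[of x n y u] mult.commute)
  finally show ?thesis ..
qed

lemma bilform_frame:
  assumes "gram (x, y) > 0" "x \<in> carrier_vec n" "y \<in> carrier_vec n"
  shows "bilform n b (frame n (x, y)) = (perp x (left_form n b x) \<bullet> y) / sqrt (gram (x, y))"
proof -
  have "left_form n b (normalize_vec x) = (1 / sqrt (x \<bullet> x)) \<cdot>\<^sub>v left_form n b x"
    using assms by (simp add: normalize_vec_def left_form_smult)
  then have "bilform n b (frame n (x, y)) = (left_form n b x \<bullet> perp x y) / (sqrt (x \<bullet> x) * sqrt (perp x y \<bullet> perp x y))"
    using assms by (simp add: frame_def bilform_def)
      (simp add: normalize_vec_def scalar_prod_smult_distrib[of _ n] smult_scalar_prod_distrib[of _ n])
  also have "sqrt (x \<bullet> x) * sqrt (perp x y \<bullet> perp x y) = sqrt (gram (x, y))"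
    using assms by (simp add: gram_eq[of _ n] real_sqrt_mult)
  also have "left_form n b x \<bullet> perp x y = perp x (left_form n b x) \<bullet> y" by (rule perp_swap) (use assms in auto)
  finally show ?thesis .
qed

lemma gram_bilform_sq:
  assumes "x \<in> carrier_vec n" "y \<in> carrier_vec n"
  shows "gram (x, y) * (bilform n b (frame n (x, y)))\<^sup>2 = (perp x (left_form n b x) \<bullet> y)\<^sup>2"
proof (cases "gram (x, y) > 0")
  case True
  then show ?thesis using assms by (simp add: bilform_frame power_divide)
next
  case False
  then have 0: "gram (x, y) = 0" using gram_nonneg[of "(x, y)" n] assms by simp
  then consider "x \<bullet> x = 0" | "perp x y \<bullet> perp x y = 0" using gram_eq[OF assms] by auto
  then have "left_form n b x \<bullet> perp x y = 0"
  proof cases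
    case 1
    then have "x = 0\<^sub>v n" using assms real_scalar_prod_eq_0_iff by blast
    then show ?thesis using assms by (simp add: left_form_zero)
  next
    case 2
    then have "perp x y = 0\<^sub>v n" using assms real_scalar_prod_eq_0_iff[of "perp x y" n] by simp
    then show ?thesis by simp
  qed
  then show ?thesis using 0 perp_swap[of x n y "left_form n b x"] assms by simp
qed

lemma gram_sq_bilform:
  assumes "x \<in> carrier_vec n" "y \<in> carrier_vec n"
  shows "(gram (x, y))\<^sup>2 * (bilform n b (frame n (x, y))) ^ 4 = (perp x (left_form n b x) \<bullet> y) ^ 4"
proof -
  have "(gram (x, y))\<^sup>2 * (bilform n b (frame n (x, y))) ^ 4 = (gram (x, y) * (bilform n b (frame n (x, y)))\<^sup>2)\<^sup>2"
    by (simp add: power_mult_distrib)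
  then show ?thesis using gram_bilform_sq[OF assms] by simp
qed

text \<open>The lower bound is $E\,Y^2\ge(E\,Y)^2$ for the Gram determinant $Y$.\<close>
lemma gram_sq_moment:
  assumes "n \<ge> 2"
  shows "(\<integral>\<^sup>+ z. ennreal ((gram z)\<^sup>2) \<partial>gauss2 n) \<noteq> \<infinity>"
    "ennreal ((real n * (real n - 1))\<^sup>2) \<le> (\<integral>\<^sup>+ z. ennreal ((gram z)\<^sup>2) \<partial>gauss2 n)"
proof -
  have gm: "gram \<in> borel_measurable (gauss2 n)"
    using measurable_gram[of n] by (simp cong: measurable_cong_sets add: sets_gauss2)
  have m: "(\<lambda>z. ennreal ((gram z)\<^sup>2)) \<in> borel_measurable (gauss2 n)" using gm by measurable
  let ?c = "\<integral>x. (x \<bullet> x)\<^sup>2 \<partial>gauss n"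
  have nn: "(\<integral>\<^sup>+ x. ennreal ((x \<bullet> x)\<^sup>2) \<partial>gauss n) = ennreal ?c"
    using integral_gauss_norm_sq[of n] by (intro nn_integral_eq_integral) auto
  have xm: "(\<lambda>x. x \<bullet> x) \<in> borel_measurable (gauss n)" using integral_gauss_norm(1)[of n] by auto
  have "(\<integral>\<^sup>+ z. ennreal ((gram z)\<^sup>2) \<partial>gauss2 n) = (\<integral>\<^sup>+ x. \<integral>\<^sup>+ y. ennreal ((gram (x, y))\<^sup>2) \<partial>gauss n \<partial>gauss n)"
    by (rule gauss.nn_integral_fst[OF m, symmetric])
  also have "\<dots> \<le> (\<integral>\<^sup>+ x. \<integral>\<^sup>+ y. ennreal ((x \<bullet> x)\<^sup>2) * ennreal ((y \<bullet> y)\<^sup>2) \<partial>gauss n \<partial>gauss n)"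
  proof (intro nn_integral_mono)
    fix x y assume "x \<in> space (gauss n)" "y \<in> space (gauss n)"
    then have "gram (x, y) \<ge> 0" by (intro gram_nonneg[of _ n]) auto
    moreover have "gram (x, y) \<le> (x \<bullet> x) * (y \<bullet> y)" by (simp add: gram_def)
    ultimately have "(gram (x, y))\<^sup>2 \<le> ((x \<bullet> x) * (y \<bullet> y))\<^sup>2" by (intro power_mono)
    then show "ennreal ((gram (x, y))\<^sup>2) \<le> ennreal ((x \<bullet> x)\<^sup>2) * ennreal ((y \<bullet> y)\<^sup>2)"
      by (simp add: power_mult_distrib flip: ennreal_mult)
  qed
  also have "\<dots> = ennreal ?c * ennreal ?c" using xm by (simp add: nn_integral_cmult nn_integral_multc nn)
  also have "\<dots> < \<infinity>" by (simp add: ennreal_mult_less_top)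
  finally show fin: "(\<integral>\<^sup>+ z. ennreal ((gram z)\<^sup>2) \<partial>gauss2 n) \<noteq> \<infinity>" by simp
  have I2: "integrable (gauss2 n) (\<lambda>z. (gram z)\<^sup>2)"
    using gm fin by (intro integrableI_nonneg) (auto simp: top.not_eq_extremum)
  have g0: "AE z in gauss2 n. 0 \<le> gram z" by (intro AE_I2 gram_nonneg[of _ n]) (simp add: space_gauss2)
  have fin1: "(\<integral>\<^sup>+ z. ennreal (gram z) \<partial>gauss2 n) = ennreal (real n * (real n - 1))" using assms by (intro nn_integral_gram) simp
  have I1: "integrable (gauss2 n) gram"
    using gm g0 fin1 by (intro integrableI_nonneg) auto
  let ?m = "real n * (real n - 1)"
  have e1: "(\<integral>z. gram z \<partial>gauss2 n) = ?m"
    using nn_integral_eq_integral[OF I1 g0] fin1 assms Bochner_Integration.integral_nonneg_AE[OF g0] by simp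
  have "0 \<le> (\<integral>z. (gram z - ?m)\<^sup>2 \<partial>gauss2 n)" by (intro Bochner_Integration.integral_nonneg) simp
  also have "\<dots> = (\<integral>z. (gram z)\<^sup>2 - 2 * ?m * gram z + ?m\<^sup>2 \<partial>gauss2 n)"
    by (intro Bochner_Integration.integral_cong refl) (simp add: power2_eq_square algebra_simps)
  also have "\<dots> = (\<integral>z. (gram z)\<^sup>2 \<partial>gauss2 n) - 2 * ?m * ?m + ?m\<^sup>2"
    using I1 I2 e1 gauss2.prob_space[of n] by simp
  also have "2 * ?m * ?m = 2 * ?m\<^sup>2" by (simp only: power2_eq_square mult.assoc)
  finally have "?m\<^sup>2 \<le> (\<integral>z. (gram z)\<^sup>2 \<partial>gauss2 n)" by linarith
  then show "ennreal (?m\<^sup>2) \<le> (\<integral>\<^sup>+ z. ennreal ((gram z)\<^sup>2) \<partial>gauss2 n)"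
    using I2 by (subst nn_integral_eq_integral) auto
qed

lemma perp_left_form_le:
  assumes "x \<in> carrier_vec n"
  shows "perp x (left_form n b x) \<bullet> perp x (left_form n b x) \<le> left_form n b x \<bullet> left_form n b x"
  using perp_norm[OF assms left_form_carrier, of b x] real_scalar_prod_ge_0[of x] by simp

lemma frob_nonneg: "frob n b \<ge> 0"
  by (auto simp: frob_def intro!: sum_nonneg)

lemma frob_columns: "(\<Sum>j<n. Matrix.vec n (\<lambda>i. b i j) \<bullet> Matrix.vec n (\<lambda>i. b i j)) = frob n b"
  unfolding frob_def by (subst sum.swap) (simp add: scalar_prod_sum[of _ n] power2_eq_square)

text \<open>With the squared Gram determinant as weight the denominators of Gram--Schmidt
  cancel. For fixed $x$ the integrand is the fourth power of a linear form in $y$ whose coefficient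
  vector is the part of $b^Tx$ orthogonal to $x$, so the inner integral is at most $3|b^Tx|^4$. The
  outer integral contributes another factor $3$.\<close>
lemma bilform_fourth_moment_nn:
  assumes n: "n \<ge> 3"
  shows "ennreal ((real n * (real n - 1))\<^sup>2) * (\<integral>\<^sup>+ z. ennreal ((bilform n b z) ^ 4) \<partial>stiefel_measure n) \<le> ennreal (9 * (frob n b)\<^sup>2)"
proof -
  have n2: "n \<ge> 2" using n by simp
  note gs = gram_sq_moment[OF n2]
  have "real n * (real n - 1) > 0" using n by simp
  then have "0 < (real n * (real n - 1))\<^sup>2" by (rule zero_less_power)
  then have "0 < ennreal ((real n * (real n - 1))\<^sup>2)" by (simp only: ennreal_less_zero_iff)
  then have ne0: "(\<integral>\<^sup>+ z. ennreal ((gram z)\<^sup>2) \<partial>gauss2 n) \<noteq> 0" using gs(2) by (metis leD)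
  interpret frame_weight n "\<lambda>z. (gram z)\<^sup>2"
  proof
    show "(\<lambda>z. (gram z)\<^sup>2) \<in> borel_measurable (borel_vec n \<Otimes>\<^sub>M borel_vec n)" using measurable_gram by measurable
  qed (use n gs(1) ne0 gram_rot in auto)
  have bm: "(\<lambda>z. ennreal ((bilform n b z) ^ 4)) \<in> borel_measurable (pairs_algebra n)" using measurable_bilform by measurable
  have "ennreal ((real n * (real n - 1))\<^sup>2) * (\<integral>\<^sup>+ z. ennreal ((bilform n b z) ^ 4) \<partial>stiefel_measure n)
     \<le> (\<integral>\<^sup>+ z. ennreal ((gram z)\<^sup>2) \<partial>gauss2 n) * (\<integral>\<^sup>+ z. ennreal ((bilform n b z) ^ 4) \<partial>stiefel_measure n)"
    using gs(2) by (rule mult_right_mono) simp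
  also have "\<dots> = (\<integral>\<^sup>+ z. ennreal ((gram z)\<^sup>2) * ennreal ((bilform n b (frame n z)) ^ 4) \<partial>gauss2 n)"
    by (rule nn_integral_frame[OF bm, symmetric])
  also have "\<dots> = (\<integral>\<^sup>+ x. \<integral>\<^sup>+ y. ennreal ((gram (x, y))\<^sup>2) * ennreal ((bilform n b (frame n (x, y))) ^ 4) \<partial>gauss n \<partial>gauss n)"
  proof (rule gauss.nn_integral_fst[symmetric])
    have "(\<lambda>z. ennreal ((gram z)\<^sup>2) * ennreal ((bilform n b (frame n z)) ^ 4)) \<in> borel_measurable (borel_vec n \<Otimes>\<^sub>M borel_vec n)"
      using meas measurable_compose[OF measurable_frame[OF n2] bm] by measurable
    then show "(\<lambda>z. ennreal ((gram z)\<^sup>2) * ennreal ((bilform n b (frame n z)) ^ 4)) \<in> borel_measurable (gauss2 n)"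
      by (simp cong: measurable_cong_sets add: sets_gauss2)
  qed
  also have "\<dots> = (\<integral>\<^sup>+ x. \<integral>\<^sup>+ y. ennreal ((perp x (left_form n b x) \<bullet> y) ^ 4) \<partial>gauss n \<partial>gauss n)"
    by (intro nn_integral_cong) (simp add: gram_sq_bilform flip: ennreal_mult)
  also have "\<dots> = (\<integral>\<^sup>+ x. ennreal (3 * (perp x (left_form n b x) \<bullet> perp x (left_form n b x))\<^sup>2) \<partial>gauss n)"
  proof (rule nn_integral_cong)
    fix x assume "x \<in> space (gauss n)"
    then have "perp x (left_form n b x) \<in> carrier_vec n" by simp
    from nn_integral_gauss_linear[OF this, of 2]
    show "(\<integral>\<^sup>+ y. ennreal ((perp x (left_form n b x) \<bullet> y) ^ 4) \<partial>gauss n) = ennreal (3 * (perp x (left_form n b x) \<bullet> perp x (left_form n b x))\<^sup>2)"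
      by (simp add: fact_numeral mult.commute)
  qed
  also have "\<dots> \<le> (\<integral>\<^sup>+ x. ennreal (3 * (\<Sum>j<n. (Matrix.vec n (\<lambda>i. b i j) \<bullet> x)\<^sup>2)\<^sup>2) \<partial>gauss n)"
  proof (intro nn_integral_mono ennreal_leI mult_left_mono power_mono)
    fix x assume "x \<in> space (gauss n)"
    then show "perp x (left_form n b x) \<bullet> perp x (left_form n b x) \<le> (\<Sum>j<n. (Matrix.vec n (\<lambda>i. b i j) \<bullet> x)\<^sup>2)"
      using perp_left_form_le[of x n b] by (simp add: left_form_norm)
  qed (auto simp: real_scalar_prod_ge_0)
  also have "\<dots> = ennreal (\<integral>x. 3 * (\<Sum>j<n. (Matrix.vec n (\<lambda>i. b i j) \<bullet> x)\<^sup>2)\<^sup>2 \<partial>gauss n)"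
    using gauss_sum_squares_sq(1)[of n "\<lambda>j. Matrix.vec n (\<lambda>i. b i j)" n] by (intro nn_integral_eq_integral) auto
  also have "\<dots> \<le> ennreal (9 * (frob n b)\<^sup>2)"
    using gauss_sum_squares_sq(2)[of n "\<lambda>j. Matrix.vec n (\<lambda>i. b i j)" n] frob_columns[of n b]
    by (intro ennreal_leI) simp
  finally show ?thesis .
qed

text \<open>As for the fourth moment, with the Gram determinant itself as weight.\<close>
lemma bilform_second_moment_nn:
  assumes n: "n \<ge> 3"
  shows "ennreal (real n * (real n - 1)) * (\<integral>\<^sup>+ z. ennreal ((bilform n b z)\<^sup>2) \<partial>stiefel_measure n)
    = (\<integral>\<^sup>+ x. ennreal (perp x (left_form n b x) \<bullet> perp x (left_form n b x)) \<partial>gauss n)"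
proof -
  have n2: "n \<ge> 2" using n by simp
  interpret frame_weight n gram by (rule frame_weight_gram[OF n])
  have bm: "(\<lambda>z. ennreal ((bilform n b z)\<^sup>2)) \<in> borel_measurable (pairs_algebra n)" using measurable_bilform by measurable
  have "ennreal (real n * (real n - 1)) * (\<integral>\<^sup>+ z. ennreal ((bilform n b z)\<^sup>2) \<partial>stiefel_measure n)
     = (\<integral>\<^sup>+ z. ennreal (gram z) \<partial>gauss2 n) * (\<integral>\<^sup>+ z. ennreal ((bilform n b z)\<^sup>2) \<partial>stiefel_measure n)"
    using n by (simp add: nn_integral_gram)
  also have "\<dots> = (\<integral>\<^sup>+ z. ennreal (gram z) * ennreal ((bilform n b (frame n z))\<^sup>2) \<partial>gauss2 n)"
    by (rule nn_integral_frame[OF bm, symmetric])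
  also have "\<dots> = (\<integral>\<^sup>+ x. \<integral>\<^sup>+ y. ennreal (gram (x, y)) * ennreal ((bilform n b (frame n (x, y)))\<^sup>2) \<partial>gauss n \<partial>gauss n)"
  proof (rule gauss.nn_integral_fst[symmetric])
    have "(\<lambda>z. ennreal (gram z) * ennreal ((bilform n b (frame n z))\<^sup>2)) \<in> borel_measurable (borel_vec n \<Otimes>\<^sub>M borel_vec n)"
      using meas measurable_compose[OF measurable_frame[OF n2] bm] by measurable
    then show "(\<lambda>z. ennreal (gram z) * ennreal ((bilform n b (frame n z))\<^sup>2)) \<in> borel_measurable (gauss2 n)"
      by (simp cong: measurable_cong_sets add: sets_gauss2)
  qed
  also have "\<dots> = (\<integral>\<^sup>+ x. \<integral>\<^sup>+ y. ennreal ((perp x (left_form n b x) \<bullet> y)\<^sup>2) \<partial>gauss n \<partial>gauss n)"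
    using gram_nonneg[of _ n] by (intro nn_integral_cong) (simp add: gram_bilform_sq flip: ennreal_mult)
  also have "\<dots> = (\<integral>\<^sup>+ x. ennreal (perp x (left_form n b x) \<bullet> perp x (left_form n b x)) \<partial>gauss n)"
  proof (rule nn_integral_cong)
    fix x assume "x \<in> space (gauss n)"
    then have "perp x (left_form n b x) \<in> carrier_vec n" by simp
    from nn_integral_gauss_linear[OF this, of 1]
    show "(\<integral>\<^sup>+ y. ennreal ((perp x (left_form n b x) \<bullet> y)\<^sup>2) \<partial>gauss n) = ennreal (perp x (left_form n b x) \<bullet> perp x (left_form n b x))"
      by simp
  qed
  finally show ?thesis .
qed

text \<open>By the formula for fourth moments the mean is
  $(\mathrm{tr}\,b)^2+|b|^2+\mathrm{tr}(b^2)$, and $\mathrm{tr}(b^2)\le|b|^2$.\<close>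
lemma quadratic_form_moment:
  assumes tr: "(\<Sum>i<n. b i i) = 0"
  shows "integrable (gauss n) (\<lambda>x. (x \<bullet> left_form n b x)\<^sup>2)" "(\<integral>x. (x \<bullet> left_form n b x)\<^sup>2 \<partial>gauss n) \<le> 2 * frob n b"
proof -
  let ?u = "\<lambda>i. unit_vec n i :: real vec"
  let ?d = "\<lambda>i j. if i = j then 1 else 0 :: real"
  let ?M = "\<lambda>i j k l. ?d i j * ?d k l + ?d i k * ?d j l + ?d i l * ?d j k"
  have uu: "?u i \<bullet> ?u j = ?d i j" if "i < n" "j < n" for i j
    using that by (simp add: scalar_prod_left_unit[of _ n])
  have H: "has_bochner_integral (gauss n) (\<lambda>x. (?u i \<bullet> x) * (?u j \<bullet> x) * ((?u k \<bullet> x) * (?u l \<bullet> x))) (?M i j k l)"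
    if "i < n" "j < n" "k < n" "l < n" for i j k l
    using gauss_linear_1111[of "?u i" n "?u j" "?u k" "?u l"] that by (simp only: uu unit_vec_carrier)
  have "has_bochner_integral (gauss n)
     (\<lambda>x. \<Sum>i<n. \<Sum>j<n. \<Sum>k<n. \<Sum>l<n. b i j * b k l * ((?u i \<bullet> x) * (?u j \<bullet> x) * ((?u k \<bullet> x) * (?u l \<bullet> x))))
     (\<Sum>i<n. \<Sum>j<n. \<Sum>k<n. \<Sum>l<n. b i j * b k l * ?M i j k l)"
    by (intro has_bochner_integral_sum has_bochner_integral_mult_right H) auto
  then have H2: "has_bochner_integral (gauss n) (\<lambda>x. (x \<bullet> left_form n b x)\<^sup>2) (\<Sum>i<n. \<Sum>j<n. \<Sum>k<n. \<Sum>l<n. b i j * b k l * ?M i j k l)"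
  proof (rule has_bochner_integral_cong[THEN iffD1, rotated -1])
    fix x assume "x \<in> space (gauss n)"
    then have x: "x \<in> carrier_vec n" by simp
    have "x \<bullet> left_form n b x = (\<Sum>j<n. \<Sum>i<n. b i j * (x $ i * x $ j))"
      by (simp add: scalar_prod_sum[of _ n] left_form_def sum_distrib_left mult_ac)
    also have "\<dots> = (\<Sum>i<n. \<Sum>j<n. b i j * (x $ i * x $ j))" by (rule sum.swap)
    finally have "(x \<bullet> left_form n b x)\<^sup>2 = (\<Sum>i<n. \<Sum>k<n. (\<Sum>j<n. b i j * (x $ i * x $ j)) * (\<Sum>l<n. b k l * (x $ k * x $ l)))"
      by (simp only: power2_eq_square sum_product)
    also have "\<dots> = (\<Sum>i<n. \<Sum>k<n. \<Sum>j<n. \<Sum>l<n. (b i j * (x $ i * x $ j)) * (b k l * (x $ k * x $ l)))"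
      by (simp only: sum_product)
    also have "\<dots> = (\<Sum>i<n. \<Sum>j<n. \<Sum>k<n. \<Sum>l<n. (b i j * (x $ i * x $ j)) * (b k l * (x $ k * x $ l)))"
      by (intro sum.cong refl sum.swap)
    also have "\<dots> = (\<Sum>i<n. \<Sum>j<n. \<Sum>k<n. \<Sum>l<n. b i j * b k l * ((?u i \<bullet> x) * (?u j \<bullet> x) * ((?u k \<bullet> x) * (?u l \<bullet> x))))"
      by (intro sum.cong refl) (use x in \<open>simp add: mult_ac\<close>)
    finally show "(\<Sum>i<n. \<Sum>j<n. \<Sum>k<n. \<Sum>l<n. b i j * b k l * ((?u i \<bullet> x) * (?u j \<bullet> x) * ((?u k \<bullet> x) * (?u l \<bullet> x)))) = (x \<bullet> left_form n b x)\<^sup>2" ..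
  qed (rule refl)+
  have le: "(\<Sum>i<n. \<Sum>j<n. \<Sum>k<n. \<Sum>l<n. b i j * b k l * ?M i j k l) \<le> 2 * frob n b"
  proof -
    have T: "(\<Sum>i<n. \<Sum>j<n. \<Sum>k<n. \<Sum>l<n. b i j * b k l * ?M i j k l)
      = (\<Sum>i<n. \<Sum>j<n. \<Sum>k<n. \<Sum>l<n. b i j * b k l * (?d i j * ?d k l)) +
        (\<Sum>i<n. \<Sum>j<n. \<Sum>k<n. \<Sum>l<n. b i j * b k l * (?d i k * ?d j l)) +
        (\<Sum>i<n. \<Sum>j<n. \<Sum>k<n. \<Sum>l<n. b i j * b k l * (?d i l * ?d j k))"
      by (simp only: sum.distrib[symmetric] distrib_left)
    have "(\<Sum>i<n. \<Sum>j<n. \<Sum>k<n. \<Sum>l<n. b i j * b k l * (?d i j * ?d k l)) = (\<Sum>i<n. \<Sum>j<n. ?d i j * b i j * (\<Sum>k<n. \<Sum>l<n. ?d k l * b k l))"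
      by (simp add: sum_distrib_left mult_ac)
    also have "(\<Sum>k<n. \<Sum>l<n. ?d k l * b k l) = (\<Sum>k<n. b k k)"
      by (intro sum.cong refl) (simp add: if_distrib[of "\<lambda>t. t * _"] cong: if_cong)
    also have "(\<Sum>i<n. \<Sum>j<n. ?d i j * b i j * (\<Sum>k<n. b k k)) = 0" unfolding tr by simp
    finally have T1: "(\<Sum>i<n. \<Sum>j<n. \<Sum>k<n. \<Sum>l<n. b i j * b k l * (?d i j * ?d k l)) = 0" .
    have T2: "(\<Sum>i<n. \<Sum>j<n. \<Sum>k<n. \<Sum>l<n. b i j * b k l * (?d i k * ?d j l)) = (\<Sum>i<n. \<Sum>j<n. b i j * b i j)"
    proof (intro sum.cong refl)
      fix i j assume "i \<in> {..<n}" "j \<in> {..<n}"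
      have pt: "b i j * b k l * (?d i k * ?d j l) = (if i = k then (if j = l then b i j * b k l else 0) else 0)" for k l by simp
      have "(\<Sum>k<n. \<Sum>l<n. b i j * b k l * (?d i k * ?d j l)) = (\<Sum>k<n. if i = k then (\<Sum>l<n. if j = l then b i j * b k l else 0) else 0)"
        unfolding pt by (intro sum.cong refl) simp
      also have "\<dots> = b i j * b i j" using \<open>i \<in> _\<close> \<open>j \<in> _\<close> by simp
      finally show "(\<Sum>k<n. \<Sum>l<n. b i j * b k l * (?d i k * ?d j l)) = b i j * b i j" .
    qed
    have T3: "(\<Sum>i<n. \<Sum>j<n. \<Sum>k<n. \<Sum>l<n. b i j * b k l * (?d i l * ?d j k)) = (\<Sum>i<n. \<Sum>j<n. b i j * b j i)"
    proof (intro sum.cong refl)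
      fix i j assume "i \<in> {..<n}" "j \<in> {..<n}"
      have pt: "b i j * b k l * (?d i l * ?d j k) = (if j = k then (if i = l then b i j * b k l else 0) else 0)" for k l by simp
      have "(\<Sum>k<n. \<Sum>l<n. b i j * b k l * (?d i l * ?d j k)) = (\<Sum>k<n. if j = k then (\<Sum>l<n. if i = l then b i j * b k l else 0) else 0)"
        unfolding pt by (intro sum.cong refl) simp
      also have "\<dots> = b i j * b j i" using \<open>i \<in> _\<close> \<open>j \<in> _\<close> by simp
      finally show "(\<Sum>k<n. \<Sum>l<n. b i j * b k l * (?d i l * ?d j k)) = b i j * b j i" .
    qed
    have "(\<Sum>i<n. \<Sum>j<n. b i j * b j i) \<le> (\<Sum>i<n. \<Sum>j<n. (b i j * b i j + b j i * b j i) / 2)"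
    proof (intro sum_mono)
      fix i j
      show "b i j * b j i \<le> (b i j * b i j + b j i * b j i) / 2"
        using sum_squares_bound[of "b i j" "b j i"] by (simp add: power2_eq_square)
    qed
    also have "\<dots> = ((\<Sum>i<n. \<Sum>j<n. b i j * b i j) + (\<Sum>i<n. \<Sum>j<n. b j i * b j i)) / 2"
      by (simp add: sum.distrib sum_divide_distrib add_divide_distrib)
    also have "(\<Sum>i<n. \<Sum>j<n. b j i * b j i) = (\<Sum>i<n. \<Sum>j<n. b i j * b i j)" by (rule sum.swap)
    finally have C: "(\<Sum>i<n. \<Sum>j<n. b i j * b j i) \<le> (\<Sum>i<n. \<Sum>j<n. b i j * b i j)" by simp
    have "frob n b = (\<Sum>i<n. \<Sum>j<n. b i j * b i j)" by (simp only: frob_def power2_eq_square)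
    then show ?thesis unfolding T T1 T2 T3 using C by linarith
  qed
  obtain S where S: "has_bochner_integral (gauss n) (\<lambda>x. (x \<bullet> left_form n b x)\<^sup>2) S" "S \<le> 2 * frob n b"
    by (rule that[OF H2 le])
  then show "integrable (gauss n) (\<lambda>x. (x \<bullet> left_form n b x)\<^sup>2)" "(\<integral>x. (x \<bullet> left_form n b x)\<^sup>2 \<partial>gauss n) \<le> 2 * frob n b"
    by (auto simp: has_bochner_integral_iff)
qed

text \<open>The Gaussian mean of $|b^Tx|^2$ is the squared Frobenius norm. It splits into the
  part orthogonal to $x$, whose mean is the second moment on orthonormal pairs up to the factor
  $n(n-1)$, and the radial part $(x^Tbx)^2/|x|^2$. Because $b$ is traceless, the radial part is small,
  namely at most $2|b|^2/n$ on average.\<close>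
lemma bilform_second_moment_lower_nn:
  assumes n: "n \<ge> 3" and tr: "(\<Sum>i<n. b i i) = 0"
  shows "ennreal (frob n b) \<le> ennreal (real n * (real n - 1)) * (\<integral>\<^sup>+ z. ennreal ((bilform n b z)\<^sup>2) \<partial>stiefel_measure n)
    + ennreal (2 * frob n b / real n)"
proof -
  have n2: "n \<ge> 2" using n by simp
  let ?A = "\<lambda>z. (fst z \<bullet> left_form n b (fst z))\<^sup>2"
  let ?E = "\<integral>\<^sup>+ z. ennreal (?A z) \<partial>stiefel_measure n"
  have Am: "(\<lambda>z. ennreal (?A z)) \<in> borel_measurable (pairs_algebra n)"
    by (intro measurable_compose[OF _ measurable_ennreal] borel_measurable_power measurable_scalar_prod[of _ _ n] measurable_left_form measurable_fst_pairs)
  have qm: "(\<lambda>x. x \<bullet> left_form n b x) \<in> borel_measurable (borel_vec n)"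
    by (intro measurable_scalar_prod[of _ _ n] measurable_left_form measurable_ident_sets) auto
  have xm: "(\<lambda>x. x \<bullet> x) \<in> borel_measurable (borel_vec n)"
    by (intro measurable_scalar_prod[of _ _ n] measurable_ident_sets) auto
  have Afr: "?A (frame n (x, y)) = (x \<bullet> left_form n b x)\<^sup>2 / (x \<bullet> x)\<^sup>2"
    if "x \<in> carrier_vec n" "y \<in> carrier_vec n" "gram (x, y) > 0" for x y
  proof -
    have "left_form n b (normalize_vec x) = (1 / sqrt (x \<bullet> x)) \<cdot>\<^sub>v left_form n b x"
      using that by (simp add: normalize_vec_def left_form_smult)
    then have "normalize_vec x \<bullet> left_form n b (normalize_vec x) = (x \<bullet> left_form n b x) / (x \<bullet> x)"
      using that real_scalar_prod_ge_0[of x]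
      by (simp add: normalize_vec_def scalar_prod_smult_distrib[of _ n] smult_scalar_prod_distrib[of _ n] left_form_smult)
    then show ?thesis using that by (simp add: frame_def power_divide)
  qed
  \<comment> \<open>Every weight of the form $h(x)$ times the Gram determinant computes the same mean of
    $(x^Tbx)^2$ over orthonormal pairs; the choices $h=1$ and $h=|x|^2$ are compared.\<close>
  have gen: "(\<integral>\<^sup>+ z. ennreal (h (fst z) * gram z) \<partial>gauss2 n) * ?E
      = (\<integral>\<^sup>+ x. ennreal ((real n - 1) * h x * ((x \<bullet> left_form n b x)\<^sup>2 / (x \<bullet> x))) \<partial>gauss n)"
    if h: "h \<in> borel_measurable (borel_vec n)" "\<And>x. x \<in> carrier_vec n \<Longrightarrow> h x \<ge> 0"
      "\<And>g x. g \<in> orth_mats n \<Longrightarrow> x \<in> carrier_vec n \<Longrightarrow> h (g *\<^sub>v x) = h x"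
      and W: "(\<integral>\<^sup>+ z. ennreal (h (fst z) * gram z) \<partial>gauss2 n) \<noteq> 0" "(\<integral>\<^sup>+ z. ennreal (h (fst z) * gram z) \<partial>gauss2 n) \<noteq> \<infinity>" for h
  proof -
    interpret frame_weight n "\<lambda>z. h (fst z) * gram z"
    proof
      show "(\<lambda>z. h (fst z) * gram z) \<in> borel_measurable (borel_vec n \<Otimes>\<^sub>M borel_vec n)"
        by (intro borel_measurable_times measurable_gram measurable_compose[OF measurable_fst h(1)])
    qed (use n W h(3) gram_rot in auto)
    have "(\<integral>\<^sup>+ z. ennreal (h (fst z) * gram z) \<partial>gauss2 n) * ?E
        = (\<integral>\<^sup>+ z. ennreal (h (fst z) * gram z) * ennreal (?A (frame n z)) \<partial>gauss2 n)"
      by (rule nn_integral_frame[OF Am, symmetric])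
    also have "\<dots> = (\<integral>\<^sup>+ x. \<integral>\<^sup>+ y. ennreal (h (fst (x, y)) * gram (x, y)) * ennreal (?A (frame n (x, y))) \<partial>gauss n \<partial>gauss n)"
    proof (rule gauss.nn_integral_fst[symmetric])
      have "(\<lambda>z. ennreal (h (fst z) * gram z) * ennreal (?A (frame n z))) \<in> borel_measurable (borel_vec n \<Otimes>\<^sub>M borel_vec n)"
        using meas measurable_compose[OF measurable_frame[OF n2] Am] by measurable
      then show "(\<lambda>z. ennreal (h (fst z) * gram z) * ennreal (?A (frame n z))) \<in> borel_measurable (gauss2 n)"
        by (simp cong: measurable_cong_sets add: sets_gauss2)
    qed
    also have "\<dots> = (\<integral>\<^sup>+ x. \<integral>\<^sup>+ y. ennreal (h x * ((x \<bullet> left_form n b x)\<^sup>2 / (x \<bullet> x)\<^sup>2)) * ennreal (gram (x, y)) \<partial>gauss n \<partial>gauss n)"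
    proof (intro nn_integral_cong)
      fix x y assume "x \<in> space (gauss n)" "y \<in> space (gauss n)"
      then have xy: "x \<in> carrier_vec n" "y \<in> carrier_vec n" by auto
      show "ennreal (h (fst (x, y)) * gram (x, y)) * ennreal (?A (frame n (x, y)))
          = ennreal (h x * ((x \<bullet> left_form n b x)\<^sup>2 / (x \<bullet> x)\<^sup>2)) * ennreal (gram (x, y))"
      proof (cases "gram (x, y) > 0")
        case True
        then show ?thesis using Afr[OF xy True] h(2)[OF xy(1)] by (simp add: mult_ac flip: ennreal_mult)
      next
        case False
        then have "gram (x, y) = 0" using gram_nonneg[of "(x, y)" n] xy by simp
        then show ?thesis by simp
      qed
    qed
    also have "\<dots> = (\<integral>\<^sup>+ x. ennreal ((real n - 1) * h x * ((x \<bullet> left_form n b x)\<^sup>2 / (x \<bullet> x))) \<partial>gauss n)"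
    proof (rule nn_integral_cong)
      fix x assume "x \<in> space (gauss n)"
      then have x: "x \<in> carrier_vec n" by simp
      have "(\<lambda>y. gram (x, y)) \<in> borel_measurable (borel_vec n)"
        by (rule measurable_compose[OF measurable_Pair1' measurable_gram]) (use x in simp)
      then have gm: "(\<lambda>y. ennreal (gram (x, y))) \<in> borel_measurable (gauss n)" by (simp cong: measurable_cong_sets)
      have "(\<integral>\<^sup>+ y. ennreal (h x * ((x \<bullet> left_form n b x)\<^sup>2 / (x \<bullet> x)\<^sup>2)) * ennreal (gram (x, y)) \<partial>gauss n)
         = ennreal (h x * ((x \<bullet> left_form n b x)\<^sup>2 / (x \<bullet> x)\<^sup>2)) * ennreal ((real n - 1) * (x \<bullet> x))"
        using gm by (simp add: nn_integral_cmult nn_integral_gauss_perp[OF x])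
      also have "\<dots> = ennreal (h x * ((x \<bullet> left_form n b x)\<^sup>2 / (x \<bullet> x)\<^sup>2) * ((real n - 1) * (x \<bullet> x)))"
        using n h(2)[OF x] real_scalar_prod_ge_0[of x] by (simp flip: ennreal_mult)
      also have "h x * ((x \<bullet> left_form n b x)\<^sup>2 / (x \<bullet> x)\<^sup>2) * ((real n - 1) * (x \<bullet> x)) = (real n - 1) * h x * ((x \<bullet> left_form n b x)\<^sup>2 / (x \<bullet> x))"
        by (cases "x \<bullet> x = 0") (simp_all add: power2_eq_square)
      finally show "(\<integral>\<^sup>+ y. ennreal (h x * ((x \<bullet> left_form n b x)\<^sup>2 / (x \<bullet> x)\<^sup>2)) * ennreal (gram (x, y)) \<partial>gauss n)
        = ennreal ((real n - 1) * h x * ((x \<bullet> left_form n b x)\<^sup>2 / (x \<bullet> x)))" .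
    qed
    finally show ?thesis .
  qed
  let ?N = "\<integral>x. (x \<bullet> x)\<^sup>2 \<partial>gauss n"
  have W2: "(\<integral>\<^sup>+ z. ennreal ((fst z \<bullet> fst z) * gram z) \<partial>gauss2 n) = ennreal ((real n - 1) * ?N)"
  proof -
    have m: "(\<lambda>z. ennreal ((fst z \<bullet> fst z) * gram z)) \<in> borel_measurable (gauss2 n)"
    proof -
      have "(\<lambda>z. (fst z \<bullet> fst z) * gram z) \<in> borel_measurable (borel_vec n \<Otimes>\<^sub>M borel_vec n)"
        by (intro borel_measurable_times measurable_gram measurable_scalar_prod[of _ _ n] measurable_fst)
      then show ?thesis by (simp cong: measurable_cong_sets add: sets_gauss2)
    qed
    have "(\<integral>\<^sup>+ z. ennreal ((fst z \<bullet> fst z) * gram z) \<partial>gauss2 n) = (\<integral>\<^sup>+ x. \<integral>\<^sup>+ y. ennreal ((x \<bullet> x) * gram (x, y)) \<partial>gauss n \<partial>gauss n)"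
      using gauss.nn_integral_fst[OF m] by simp
    also have "\<dots> = (\<integral>\<^sup>+ x. ennreal ((real n - 1) * (x \<bullet> x)\<^sup>2) \<partial>gauss n)"
    proof (rule nn_integral_cong)
      fix x assume "x \<in> space (gauss n)"
      then have x: "x \<in> carrier_vec n" by simp
      have "(\<lambda>y. gram (x, y)) \<in> borel_measurable (borel_vec n)"
        by (rule measurable_compose[OF measurable_Pair1' measurable_gram]) (use x in simp)
      then have gm: "(\<lambda>y. ennreal (gram (x, y))) \<in> borel_measurable (gauss n)" by (simp cong: measurable_cong_sets)
      have "(\<integral>\<^sup>+ y. ennreal ((x \<bullet> x) * gram (x, y)) \<partial>gauss n) = (\<integral>\<^sup>+ y. ennreal (x \<bullet> x) * ennreal (gram (x, y)) \<partial>gauss n)"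
        using x gram_nonneg[of "(x, _)" n] by (intro nn_integral_cong) (simp add: ennreal_mult real_scalar_prod_ge_0)
      also have "\<dots> = ennreal (x \<bullet> x) * ennreal ((real n - 1) * (x \<bullet> x))"
        using gm by (simp add: nn_integral_cmult nn_integral_gauss_perp[OF x])
      also have "\<dots> = ennreal ((real n - 1) * (x \<bullet> x)\<^sup>2)"
        using n real_scalar_prod_ge_0[of x] by (simp add: power2_eq_square mult_ac flip: ennreal_mult)
      finally show "(\<integral>\<^sup>+ y. ennreal ((x \<bullet> x) * gram (x, y)) \<partial>gauss n) = ennreal ((real n - 1) * (x \<bullet> x)\<^sup>2)" .
    qed
    also have "\<dots> = ennreal (\<integral>x. (real n - 1) * (x \<bullet> x)\<^sup>2 \<partial>gauss n)"
      using integral_gauss_norm_sq(1)[of n] n by (intro nn_integral_eq_integral) auto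
    finally show ?thesis by simp
  qed
  have N: "?N \<ge> (real n)\<^sup>2" by (rule integral_gauss_norm_sq)
  have Np: "?N > 0" using N n by (smt (verit, best) of_nat_0_less_iff zero_less_power not_numeral_le_zero not_gr0)
  note Q = quadratic_form_moment[where n=n and b=b, OF tr]
  have "ennreal ((real n - 1) * ?N) * ?E = (\<integral>\<^sup>+ x. ennreal ((real n - 1) * (x \<bullet> x) * ((x \<bullet> left_form n b x)\<^sup>2 / (x \<bullet> x))) \<partial>gauss n)"
    using gen[of "\<lambda>x. x \<bullet> x"] xm Np n by (simp add: W2 real_scalar_prod_ge_0 orth_mats_scalar_prod)
  also have "\<dots> \<le> (\<integral>\<^sup>+ x. ennreal ((real n - 1) * (x \<bullet> left_form n b x)\<^sup>2) \<partial>gauss n)"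
    using n by (intro nn_integral_mono ennreal_leI) (auto simp: mult_left_mono)
  also have "\<dots> = ennreal (\<integral>x. (real n - 1) * (x \<bullet> left_form n b x)\<^sup>2 \<partial>gauss n)"
    using Q(1) n by (intro nn_integral_eq_integral) auto
  also have "\<dots> \<le> ennreal ((real n - 1) * (2 * frob n b))"
    using Q(2) n by (intro ennreal_leI) (simp add: mult_left_mono)
  finally have E1: "ennreal ((real n - 1) * ?N) * ?E \<le> ennreal ((real n - 1) * (2 * frob n b))" .
  have Efin: "?E \<noteq> \<infinity>"
  proof
    assume "?E = \<infinity>"
    then have "ennreal ((real n - 1) * ?N) * ?E = \<infinity>" using Np n by (simp add: ennreal_mult_eq_top_iff)
    then show False using E1 by (simp add: top_unique)
  qed
  then obtain e where e: "?E = ennreal e" "e \<ge> 0" by (cases ?E) auto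
  have "(real n - 1) * ?N * e \<le> (real n - 1) * (2 * frob n b)"
    using E1 e Np n frob_nonneg[of n b] by (simp flip: ennreal_mult)
  then have "?N * e \<le> 2 * frob n b" using n by (simp add: mult.assoc)
  moreover have "(real n)\<^sup>2 * e \<le> ?N * e" using N e by (intro mult_right_mono)
  ultimately have e2: "real n * (real n * e) \<le> 2 * frob n b" by (simp add: power2_eq_square mult.assoc)
  \<comment> \<open>The mean of the radial part.\<close>
  let ?R = "\<integral>\<^sup>+ x. ennreal ((x \<bullet> left_form n b x)\<^sup>2 / (x \<bullet> x)) \<partial>gauss n"
  have Rm: "(\<lambda>x. ennreal ((x \<bullet> left_form n b x)\<^sup>2 / (x \<bullet> x))) \<in> borel_measurable (gauss n)"
  proof -
    have "(\<lambda>x. (x \<bullet> left_form n b x)\<^sup>2 / (x \<bullet> x)) \<in> borel_measurable (borel_vec n)"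
      by (intro borel_measurable_divide borel_measurable_power qm xm)
    then show ?thesis by (simp cong: measurable_cong_sets)
  qed
  have "ennreal (real n * (real n - 1)) * ?E = (\<integral>\<^sup>+ x. ennreal ((real n - 1) * ((x \<bullet> left_form n b x)\<^sup>2 / (x \<bullet> x))) \<partial>gauss n)"
    using gen[of "\<lambda>x. 1"] n by (simp add: nn_integral_gram)
  also have "\<dots> = (\<integral>\<^sup>+ x. ennreal (real n - 1) * ennreal ((x \<bullet> left_form n b x)\<^sup>2 / (x \<bullet> x)) \<partial>gauss n)"
    using n by (intro nn_integral_cong ennreal_mult) (auto simp: real_scalar_prod_ge_0)
  also have "\<dots> = ennreal (real n - 1) * ?R" by (rule nn_integral_cmult[OF Rm])
  finally have "ennreal (real n - 1) * ?R = ennreal (real n - 1) * ennreal (real n * e)"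
    using n e by (simp add: mult_ac flip: ennreal_mult)
  then have "?R = ennreal (real n * e)" using n by (simp add: ennreal_mult_cancel_left)
  then have R: "?R \<le> ennreal (2 * frob n b / real n)"
    using e2 n by (auto intro!: ennreal_leI simp: field_simps)
  have "ennreal (frob n b) = (\<integral>\<^sup>+ x. ennreal (left_form n b x \<bullet> left_form n b x) \<partial>gauss n)"
  proof -
    have "has_bochner_integral (gauss n) (\<lambda>x. \<Sum>j<n. (Matrix.vec n (\<lambda>i. b i j) \<bullet> x)\<^sup>2) (\<Sum>j<n. Matrix.vec n (\<lambda>i. b i j) \<bullet> Matrix.vec n (\<lambda>i. b i j))"
      by (intro has_bochner_integral_sum) (simp add: has_bochner_integral_iff gauss_linear_2)
    then have "(\<integral>\<^sup>+ x. ennreal (\<Sum>j<n. (Matrix.vec n (\<lambda>i. b i j) \<bullet> x)\<^sup>2) \<partial>gauss n) = ennreal (frob n b)"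
      by (subst nn_integral_eq_integral) (auto simp: has_bochner_integral_iff frob_columns sum_nonneg)
    moreover have "(\<integral>\<^sup>+ x. ennreal (left_form n b x \<bullet> left_form n b x) \<partial>gauss n) = (\<integral>\<^sup>+ x. ennreal (\<Sum>j<n. (Matrix.vec n (\<lambda>i. b i j) \<bullet> x)\<^sup>2) \<partial>gauss n)"
      by (intro nn_integral_cong) (simp add: left_form_norm)
    ultimately show ?thesis by simp
  qed
  also have "\<dots> = (\<integral>\<^sup>+ x. ennreal (perp x (left_form n b x) \<bullet> perp x (left_form n b x)) + ennreal ((x \<bullet> left_form n b x)\<^sup>2 / (x \<bullet> x)) \<partial>gauss n)"
  proof (rule nn_integral_cong)
    fix x assume "x \<in> space (gauss n)"
    then have x: "x \<in> carrier_vec n" by simp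
    have "left_form n b x \<bullet> left_form n b x = perp x (left_form n b x) \<bullet> perp x (left_form n b x) + (x \<bullet> left_form n b x)\<^sup>2 / (x \<bullet> x)"
      using perp_norm[OF x left_form_carrier] by simp
    then show "ennreal (left_form n b x \<bullet> left_form n b x) = ennreal (perp x (left_form n b x) \<bullet> perp x (left_form n b x)) + ennreal ((x \<bullet> left_form n b x)\<^sup>2 / (x \<bullet> x))"
      by (simp add: real_scalar_prod_ge_0)
  qed
  also have "\<dots> = (\<integral>\<^sup>+ x. ennreal (perp x (left_form n b x) \<bullet> perp x (left_form n b x)) \<partial>gauss n) + ?R"
  proof (rule nn_integral_add)
    have "(\<lambda>x. perp x (left_form n b x) \<bullet> perp x (left_form n b x)) \<in> borel_measurable (borel_vec n)"
      by (intro measurable_scalar_prod[of _ _ n] measurable_perp measurable_left_form measurable_ident_sets) auto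
    then show "(\<lambda>x. ennreal (perp x (left_form n b x) \<bullet> perp x (left_form n b x))) \<in> borel_measurable (gauss n)"
      by (simp cong: measurable_cong_sets)
  qed (rule Rm)
  also have "\<dots> \<le> ennreal (real n * (real n - 1)) * (\<integral>\<^sup>+ z. ennreal ((bilform n b z)\<^sup>2) \<partial>stiefel_measure n) + ennreal (2 * frob n b / real n)"
    unfolding bilform_second_moment_nn[OF n] using R by (rule add_left_mono)
  finally show ?thesis .
qed

section \<open>Function spaces on orthonormal pairs\<close>

locale stiefel =
  fixes n :: nat
  assumes n3: "n \<ge> 3"
begin

abbreviation T :: "(real vec \<times> real vec) set" where "T \<equiv> orthonormal_pairs n"
abbreviation \<sigma> :: "(real vec \<times> real vec) measure" where "\<sigma> \<equiv> stiefel_measure n"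
abbreviation nice :: "(real vec \<times> real vec \<Rightarrow> real) \<Rightarrow> bool" where "nice \<equiv> lipschitz_pairs n"

sublocale S: invariant_measure n \<sigma>
  by (rule invariant_stiefel[OF n3])

lemma niceE:
  assumes "nice f"
  obtains C where "C \<ge> 0" "\<And>z w. z \<in> T \<Longrightarrow> w \<in> T \<Longrightarrow> \<bar>f z - f w\<bar> \<le> C * sqrt (sqdist z w)"
  using assms by (auto simp: lipschitz_pairs_def)

lemma T_ne: "T \<noteq> {}"
  using S.not_empty by simp

lemma sqdist_le:
  assumes "z \<in> T" "w \<in> T"
  shows "sqdist z w \<le> 8"
proof -
  have le: "(x - y) \<bullet> (x - y) \<le> 4" if "x \<in> carrier_vec n" "y \<in> carrier_vec n" "x \<bullet> x = 1" "y \<bullet> y = 1" for x y :: "real vec"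
  proof -
    have "0 \<le> (x + y) \<bullet> (x + y)" by (rule real_scalar_prod_ge_0)
    then show ?thesis
      using that comm_scalar_prod[OF that(1,2)]
      by (simp add: add_scalar_prod_distrib[of _ n] scalar_prod_add_distrib[of _ n] minus_scalar_prod_distrib[of _ n] scalar_prod_minus_distrib[of _ n])
  qed
  show ?thesis using assms le[of "fst z" "fst w"] le[of "snd z" "snd w"]
    by (cases z; cases w) (auto simp: sqdist_def orthonormal_pairs_iff)
qed

lemma nice_bounded:
  assumes "nice f"
  obtains B where "B \<ge> 0" "\<And>z. z \<in> T \<Longrightarrow> \<bar>f z\<bar> \<le> B"
proof -
  obtain C where C: "C \<ge> 0" "\<And>z w. z \<in> T \<Longrightarrow> w \<in> T \<Longrightarrow> \<bar>f z - f w\<bar> \<le> C * sqrt (sqdist z w)"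
    using niceE[OF assms] by blast
  obtain z0 where z0: "z0 \<in> T" using T_ne by blast
  have "\<bar>f z\<bar> \<le> \<bar>f z0\<bar> + C * sqrt 8" if "z \<in> T" for z
  proof -
    have "C * sqrt (sqdist z z0) \<le> C * sqrt 8" using sqdist_le[OF that z0] C(1) by (intro mult_left_mono) auto
    then show ?thesis using C(2)[OF that z0] by linarith
  qed
  then show ?thesis using C(1) by (intro that[of "\<bar>f z0\<bar> + C * sqrt 8"]) auto
qed

lemma nice_const [simp]: "nice (\<lambda>_. c)" by (rule lipschitz_pairs_const)

lemma nice_add:
  assumes "nice f" "nice g"
  shows "nice (\<lambda>z. f z + g z)"
proof -
  obtain C where C: "C \<ge> 0" "\<And>z w. z \<in> T \<Longrightarrow> w \<in> T \<Longrightarrow> \<bar>f z - f w\<bar> \<le> C * sqrt (sqdist z w)"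
    using niceE[OF assms(1)] by blast
  obtain D where D: "D \<ge> 0" "\<And>z w. z \<in> T \<Longrightarrow> w \<in> T \<Longrightarrow> \<bar>g z - g w\<bar> \<le> D * sqrt (sqdist z w)"
    using niceE[OF assms(2)] by blast
  have "\<bar>(f z + g z) - (f w + g w)\<bar> \<le> (C + D) * sqrt (sqdist z w)" if "z \<in> T" "w \<in> T" for z w
    using C(2)[OF that] D(2)[OF that] by (simp add: distrib_right)
  then show ?thesis using assms C(1) D(1) by (auto simp: lipschitz_pairs_def intro!: exI[of _ "C + D"])
qed

lemma nice_mult:
  assumes "nice f" "nice g"
  shows "nice (\<lambda>z. f z * g z)"
proof -
  obtain C where C: "C \<ge> 0" "\<And>z w. z \<in> T \<Longrightarrow> w \<in> T \<Longrightarrow> \<bar>f z - f w\<bar> \<le> C * sqrt (sqdist z w)"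
    using niceE[OF assms(1)] by blast
  obtain D where D: "D \<ge> 0" "\<And>z w. z \<in> T \<Longrightarrow> w \<in> T \<Longrightarrow> \<bar>g z - g w\<bar> \<le> D * sqrt (sqdist z w)"
    using niceE[OF assms(2)] by blast
  obtain A where A: "A \<ge> 0" "\<And>z. z \<in> T \<Longrightarrow> \<bar>f z\<bar> \<le> A" using nice_bounded[OF assms(1)] by blast
  obtain B where B: "B \<ge> 0" "\<And>z. z \<in> T \<Longrightarrow> \<bar>g z\<bar> \<le> B" using nice_bounded[OF assms(2)] by blast
  have "\<bar>f z * g z - f w * g w\<bar> \<le> (B * C + A * D) * sqrt (sqdist z w)" if zw: "z \<in> T" "w \<in> T" for z w
  proof -
    have "f z * g z - f w * g w = g z * (f z - f w) + f w * (g z - g w)" by (simp add: algebra_simps)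
    then have "\<bar>f z * g z - f w * g w\<bar> \<le> \<bar>g z\<bar> * \<bar>f z - f w\<bar> + \<bar>f w\<bar> * \<bar>g z - g w\<bar>"
      by (metis abs_mult abs_triangle_ineq)
    also have "\<dots> \<le> B * (C * sqrt (sqdist z w)) + A * (D * sqrt (sqdist z w))"
      using zw A B C D by (intro add_mono mult_mono) auto
    finally show ?thesis by (simp add: algebra_simps)
  qed
  then show ?thesis using assms A(1) B(1) C(1) D(1) by (auto simp: lipschitz_pairs_def intro!: exI[of _ "B * C + A * D"])
qed

lemma nice_cmult: "nice f \<Longrightarrow> nice (\<lambda>z. c * f z)" by (rule nice_mult) simp_all

lemma nice_diff: "nice f \<Longrightarrow> nice g \<Longrightarrow> nice (\<lambda>z. f z - g z)"
  using nice_add[of f "\<lambda>z. (-1) * g z"] nice_cmult[of g "-1"] by simp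

lemma nice_sum: "(\<And>i. i \<in> I \<Longrightarrow> nice (f i)) \<Longrightarrow> nice (\<lambda>z. \<Sum>i\<in>I. f i z)"
  by (induction I rule: infinite_finite_induct) (auto intro: nice_add)

lemma nice_prod: "(\<And>i. i \<in> I \<Longrightarrow> nice (f i)) \<Longrightarrow> nice (\<lambda>z. \<Prod>i\<in>I. f i z)"
  by (induction I rule: infinite_finite_induct) (auto intro: nice_mult)

lemma nice_power: "nice f \<Longrightarrow> nice (\<lambda>z. f z ^ k)"
  by (induction k) (auto intro: nice_mult)

lemma nice_coord: "i < n \<Longrightarrow> nice (\<lambda>z. fst z $ i)" "i < n \<Longrightarrow> nice (\<lambda>z. snd z $ i)"
  using lipschitz_pairs_cmult[OF lipschitz_pairs_coord(1), of i n "-1" 0] lipschitz_pairs_cmult[OF lipschitz_pairs_coord(2), of i n "-1" 0]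
  by simp_all

lemma nice_measurable: "nice f \<Longrightarrow> f \<in> borel_measurable \<sigma>"
  by (simp add: lipschitz_pairs_def cong: measurable_cong_sets)

lemma nice_integrable:
  assumes "nice f" shows "integrable \<sigma> f"
proof -
  obtain B where "B \<ge> 0" "\<And>z. z \<in> T \<Longrightarrow> \<bar>f z\<bar> \<le> B" using nice_bounded[OF assms] by blast
  then show ?thesis by (intro S.integrable_const_bound[of f B] AE_I2 nice_measurable[OF assms]) auto
qed

text \<open>A continuous function that does not vanish at $z$ is bounded away from $0$ on a small
  ball around $z$, which has positive measure.\<close>
lemma nice_eq_0:
  assumes f: "nice f" and 0: "(\<integral>z. (f z)\<^sup>2 \<partial>\<sigma>) = 0" and z: "z \<in> T"
  shows "f z = 0"
proof (rule ccontr)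
  assume ne: "f z \<noteq> 0"
  obtain C where C: "C \<ge> 0" "\<And>z w. z \<in> T \<Longrightarrow> w \<in> T \<Longrightarrow> \<bar>f z - f w\<bar> \<le> C * sqrt (sqdist z w)"
    using niceE[OF f] by blast
  define e where "e = (\<bar>f z\<bar> / (2 * (C + 1)))\<^sup>2"
  have e: "e > 0" using ne C(1) by (simp add: e_def)
  define a where "a = (f z / 2)\<^sup>2"
  have a: "a > 0" using ne by (simp add: a_def)
  have near: "a \<le> (f w)\<^sup>2" if "w \<in> T" "sqdist z w < e" for w
  proof -
    have "sqrt (sqdist z w) \<le> \<bar>f z\<bar> / (2 * (C + 1))" using that(2) C(1) by (intro real_le_lsqrt) (auto simp: e_def)
    then have "C * sqrt (sqdist z w) \<le> C * (\<bar>f z\<bar> / (2 * (C + 1)))" using C(1) by (rule mult_left_mono)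
    also have "\<dots> \<le> \<bar>f z\<bar> / 2" using C(1) by (simp add: field_simps)
    finally have "\<bar>f z - f w\<bar> \<le> \<bar>f z\<bar> / 2" using C(2)[OF z that(1)] by linarith
    then have "\<bar>f z / 2\<bar> \<le> \<bar>f w\<bar>" by (auto simp: abs_if split: if_splits)
    then show ?thesis unfolding a_def by (simp only: abs_le_square_iff)
  qed
  have "ennreal a * S.kernel_mass e z = (\<integral>\<^sup>+ w. ennreal a * (if sqdist z w < e then 1 else 0) \<partial>\<sigma>)"
    unfolding S.kernel_mass_def using S.measurable_kernel_section[OF z, of e]
    by (subst nn_integral_cmult) (auto cong: measurable_cong_sets)
  also have "\<dots> \<le> (\<integral>\<^sup>+ w. ennreal ((f w)\<^sup>2) \<partial>\<sigma>)"
    using near by (intro nn_integral_mono) (auto intro!: ennreal_leI)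
  also have "\<dots> = ennreal (\<integral>z. (f z)\<^sup>2 \<partial>\<sigma>)"
    by (rule nn_integral_eq_integral[OF nice_integrable[OF nice_power[OF f]]]) auto
  also have "\<dots> = 0" using 0 by simp
  finally have "ennreal a * S.kernel_mass e z = 0" by simp
  then show False using a S.kernel_mass_pos[OF n3 z e] by simp
qed

lemma integral_rot:
  assumes g: "g \<in> SO_mats n" and f: "nice f"
  shows "(\<integral>z. f (rot g z) \<partial>\<sigma>) = (\<integral>z. f z \<partial>\<sigma>)"
proof -
  have m: "rot g \<in> measurable \<sigma> \<sigma>"
    using measurable_rot[of g n] g by (simp add: SO_mats_iff cong: measurable_cong_sets)
  have "(\<integral>z. f z \<partial>\<sigma>) = (\<integral>z. f z \<partial>distr \<sigma> \<sigma> (rot g))"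
    using S.inv g by (simp add: is_invariant_measure_def)
  also have "\<dots> = (\<integral>z. f (rot g z) \<partial>\<sigma>)"
    by (rule integral_distr[OF m nice_measurable[OF f]])
  finally show ?thesis by simp
qed

definition ip :: "(real vec \<times> real vec \<Rightarrow> real) \<Rightarrow> (real vec \<times> real vec \<Rightarrow> real) \<Rightarrow> real" where
  "ip f g = (\<integral>z. f z * g z \<partial>\<sigma>)"

lemma ip_cong: "(\<And>z. z \<in> T \<Longrightarrow> f z = f' z) \<Longrightarrow> (\<And>z. z \<in> T \<Longrightarrow> g z = g' z) \<Longrightarrow> ip f g = ip f' g'"
  unfolding ip_def by (intro Bochner_Integration.integral_cong) auto

lemma ip_sym: "ip f g = ip g f" by (simp add: ip_def mult.commute)

lemma ip_cmult_left: "ip (\<lambda>z. c * f z) g = c * ip f g"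
  by (simp add: ip_def mult.assoc)

lemma ip_sum_left:
  assumes "\<And>i. i \<in> I \<Longrightarrow> nice (f i)" "nice g"
  shows "ip (\<lambda>z. \<Sum>i\<in>I. c i * f i z) g = (\<Sum>i\<in>I. c i * ip (f i) g)"
proof -
  have "ip (\<lambda>z. \<Sum>i\<in>I. c i * f i z) g = (\<integral>z. (\<Sum>i\<in>I. c i * (f i z * g z)) \<partial>\<sigma>)"
    unfolding ip_def by (intro Bochner_Integration.integral_cong refl) (simp add: sum_distrib_right mult.assoc)
  also have "\<dots> = (\<Sum>i\<in>I. c i * ip (f i) g)"
    unfolding ip_def using assms by (subst Bochner_Integration.integral_sum) (auto intro!: nice_integrable nice_mult)
  finally show ?thesis .
qed

lemma ip_diff_left: "nice f \<Longrightarrow> nice g \<Longrightarrow> nice h \<Longrightarrow> ip (\<lambda>z. f z - g z) h = ip f h - ip g h"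
  unfolding ip_def by (simp add: left_diff_distrib nice_integrable nice_mult)

definition orthonormal :: "nat \<Rightarrow> (nat \<Rightarrow> real vec \<times> real vec \<Rightarrow> real) \<Rightarrow> bool" where
  "orthonormal d \<psi> \<longleftrightarrow> (\<forall>i<d. nice (\<psi> i)) \<and> (\<forall>i<d. \<forall>j<d. ip (\<psi> i) (\<psi> j) = (if i = j then 1 else 0))"

text \<open>The functions that agree with a linear combination on $T$; values elsewhere do not matter.\<close>
definition fspan :: "'j set \<Rightarrow> ('j \<Rightarrow> real vec \<times> real vec \<Rightarrow> real) \<Rightarrow> (real vec \<times> real vec \<Rightarrow> real) set" where
  "fspan J m = {f. \<exists>c. \<forall>z\<in>T. f z = (\<Sum>j\<in>J. c j * m j z)}"

lemma fspanI:
  assumes "\<And>z. z \<in> T \<Longrightarrow> f z = (\<Sum>j\<in>J. c j * m j z)"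
  shows "f \<in> fspan J m"
  unfolding fspan_def mem_Collect_eq by (rule exI[of _ c]) (intro ballI assms)

lemma fspanE:
  assumes "f \<in> fspan J m"
  obtains c where "\<And>z. z \<in> T \<Longrightarrow> f z = (\<Sum>j\<in>J. c j * m j z)"
proof -
  from assms obtain c where "\<forall>z\<in>T. f z = (\<Sum>j\<in>J. c j * m j z)" unfolding fspan_def mem_Collect_eq by (elim exE)
  then show thesis by (intro that[of c]) (elim bspec)
qed

lemma fspan_base:
  assumes "finite J" "j \<in> J" shows "m j \<in> fspan J m"
  by (rule fspanI[where c = "\<lambda>k. if k = j then 1 else 0"]) (use assms in \<open>simp add: if_distrib[of "\<lambda>t. t * _"] cong: if_cong\<close>)

definition lin_indep :: "'j set \<Rightarrow> ('j \<Rightarrow> real vec \<times> real vec \<Rightarrow> real) \<Rightarrow> bool" where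
  "lin_indep J m \<longleftrightarrow> (\<forall>c. (\<forall>z\<in>T. (\<Sum>j\<in>J. c j * m j z) = 0) \<longrightarrow> (\<forall>j\<in>J. c j = 0))"

lemma lin_indepD:
  assumes "lin_indep J m" "\<And>z. z \<in> T \<Longrightarrow> (\<Sum>j\<in>J. c j * m j z) = 0" "j \<in> J"
  shows "c j = 0"
proof -
  have "\<forall>z\<in>T. (\<Sum>j\<in>J. c j * m j z) = 0" using assms(2) by (intro ballI)
  then show ?thesis using assms(1,3) unfolding lin_indep_def by (elim allE[of _ c]) (drule (1) mp, erule (1) bspec)
qed

lemma fspan_sum:
  assumes "\<And>i. i \<in> I \<Longrightarrow> f i \<in> fspan J m"
  shows "(\<lambda>z. \<Sum>i\<in>I. a i * f i z) \<in> fspan J m"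
proof -
  have "\<forall>i\<in>I. \<exists>c. \<forall>z\<in>T. f i z = (\<Sum>j\<in>J. c j * m j z)" using assms by (simp add: fspan_def)
  then obtain c where c: "\<And>i z. i \<in> I \<Longrightarrow> z \<in> T \<Longrightarrow> f i z = (\<Sum>j\<in>J. c i j * m j z)" by metis
  show ?thesis
  proof (rule fspanI)
    fix z assume that: "z \<in> T"
  have "(\<Sum>i\<in>I. a i * f i z) = (\<Sum>j\<in>J. \<Sum>i\<in>I. a i * c i j * m j z)"
  proof -
    have "(\<Sum>i\<in>I. a i * f i z) = (\<Sum>i\<in>I. \<Sum>j\<in>J. a i * c i j * m j z)"
      using c that by (intro sum.cong) (auto simp: sum_distrib_left mult.assoc)
    also have "\<dots> = (\<Sum>j\<in>J. \<Sum>i\<in>I. a i * c i j * m j z)" by (rule sum.swap)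
    finally show ?thesis .
  qed
  then show "(\<Sum>i\<in>I. a i * f i z) = (\<Sum>j\<in>J. (\<Sum>i\<in>I. a i * c i j) * m j z)" by (simp add: sum_distrib_right)
  qed
qed

lemma fspan_cong: "f \<in> fspan J m \<Longrightarrow> (\<And>z. z \<in> T \<Longrightarrow> f z = g z) \<Longrightarrow> g \<in> fspan J m"
  by (auto simp: fspan_def)

lemma fspan_add: "f \<in> fspan J m \<Longrightarrow> g \<in> fspan J m \<Longrightarrow> (\<lambda>z. f z + g z) \<in> fspan J m"
  using fspan_sum[of "{True, False}" "\<lambda>b. if b then f else g" J m "\<lambda>_. 1"] by simp

lemma fspan_cmult: "f \<in> fspan J m \<Longrightarrow> (\<lambda>z. a * f z) \<in> fspan J m"
  using fspan_sum[of "{True}" "\<lambda>b. f" J m "\<lambda>_. a"] by simp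

lemma fspan_trans:
  assumes "f \<in> fspan J m" "\<And>j. j \<in> J \<Longrightarrow> m j \<in> fspan K q"
  shows "f \<in> fspan K q"
proof -
  obtain c where c: "\<And>z. z \<in> T \<Longrightarrow> f z = (\<Sum>j\<in>J. c j * m j z)" using fspanE[OF assms(1)] by blast
  show ?thesis by (rule fspan_cong[OF fspan_sum[of J m K q c]]) (use assms(2) c in auto)
qed

lemma orthonormal_coeff:
  assumes on: "orthonormal d \<psi>" and f: "\<And>z. z \<in> T \<Longrightarrow> f z = (\<Sum>i<d. c i * \<psi> i z)" and k: "k < d"
  shows "ip f (\<psi> k) = c k"
proof -
  have "ip f (\<psi> k) = ip (\<lambda>z. \<Sum>i<d. c i * \<psi> i z) (\<psi> k)" using f by (intro ip_cong) auto
  also have "\<dots> = (\<Sum>i<d. c i * ip (\<psi> i) (\<psi> k))" using on k by (intro ip_sum_left) (auto simp: orthonormal_def)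
  also have "\<dots> = (\<Sum>i<d. if i = k then c i else 0)" using on k by (intro sum.cong) (auto simp: orthonormal_def)
  finally show ?thesis using k by simp
qed

lemma orthonormal_norm:
  assumes on: "orthonormal d \<psi>" and f: "\<And>z. z \<in> T \<Longrightarrow> f z = (\<Sum>i<d. c i * \<psi> i z)"
  shows "(\<integral>z. (f z)\<^sup>2 \<partial>\<sigma>) = (\<Sum>i<d. (c i)\<^sup>2)"
proof -
  have ff: "nice (\<lambda>z. \<Sum>i<d. c i * \<psi> i z)" using on by (intro nice_sum nice_cmult) (auto simp: orthonormal_def)
  have "(\<integral>z. (f z)\<^sup>2 \<partial>\<sigma>) = ip (\<lambda>z. \<Sum>i<d. c i * \<psi> i z) f"
    unfolding ip_def using f by (intro Bochner_Integration.integral_cong) (auto simp: power2_eq_square)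
  also have "\<dots> = ip (\<lambda>z. \<Sum>i<d. c i * \<psi> i z) (\<lambda>z. \<Sum>i<d. c i * \<psi> i z)" using f by (intro ip_cong) auto
  also have "\<dots> = (\<Sum>i<d. c i * ip (\<psi> i) (\<lambda>z. \<Sum>i<d. c i * \<psi> i z))"
    using on by (intro ip_sum_left ff) (auto simp: orthonormal_def)
  also have "\<dots> = (\<Sum>i<d. c i * c i)"
    using orthonormal_coeff[OF on refl] by (intro sum.cong refl) (simp add: ip_sym[of "\<psi> _"])
  finally show ?thesis by (simp add: power2_eq_square)
qed

text \<open>Gram--Schmidt. Only finitely many functions are involved, so spans can be given by
  explicit coefficients; the dimension is exactly the number of functions if they are
  independent.\<close>
lemma orthonormal_basis_exists:
  assumes "finite J" "\<And>j. j \<in> J \<Longrightarrow> nice (m j)"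
  shows "\<exists>d \<psi>. d \<le> card J \<and> orthonormal d \<psi> \<and> (\<forall>i<d. \<psi> i \<in> fspan J m) \<and> (\<forall>j\<in>J. m j \<in> fspan {..<d} \<psi>) \<and>
    (lin_indep J m \<longrightarrow> d = card J)"
  using assms
proof (induction J rule: finite_induct)
  case empty
  then show ?case by (auto simp: orthonormal_def intro!: exI[of _ 0])
next
  case (insert j J)
  have IHx: "\<exists>d \<psi>. d \<le> card J \<and> orthonormal d \<psi> \<and> (\<forall>i<d. \<psi> i \<in> fspan J m) \<and> (\<forall>j\<in>J. m j \<in> fspan {..<d} \<psi>) \<and>
    (lin_indep J m \<longrightarrow> d = card J)"
    by (rule insert.IH) (use insert.prems in simp)
  obtain d \<psi> where H: "d \<le> card J" "orthonormal d \<psi>" "\<forall>i<d. \<psi> i \<in> fspan J m" "\<forall>j\<in>J. m j \<in> fspan {..<d} \<psi>"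
    "lin_indep J m \<longrightarrow> d = card J"
    using IHx by (elim exE conjE) (rule that)
  note IH = H(1,2) H(3)[rule_format] H(4)[rule_format] H(5)
  have nj: "nice (m j)" using insert.prems by simp
  have n\<psi>: "nice (\<psi> i)" if "i < d" for i using IH(2) that by (simp add: orthonormal_def)
  define p where "p = (\<lambda>z. \<Sum>i<d. ip (m j) (\<psi> i) * \<psi> i z)"
  define r where "r = (\<lambda>z. m j z - p z)"
  have np: "nice p" unfolding p_def by (intro nice_sum nice_cmult n\<psi>) auto
  have nr: "nice r" unfolding r_def by (intro nice_diff nj np)
  have rorth: "ip r (\<psi> k) = 0" if "k < d" for k
    unfolding r_def using orthonormal_coeff[OF IH(2), of p "\<lambda>i. ip (m j) (\<psi> i)" k] that
    by (subst ip_diff_left) (auto simp: p_def nj np[unfolded p_def] n\<psi>)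
  have mono: "f \<in> fspan (insert j J) m" if "f \<in> fspan J m" for f
    by (rule fspan_trans[OF that]) (use insert.hyps in \<open>auto intro: fspan_base\<close>)
  have pJ: "p \<in> fspan J m" unfolding p_def by (intro fspan_sum IH(3)) auto
  have ind': "lin_indep J m" if ind: "lin_indep (insert j J) m"
    unfolding lin_indep_def
  proof (intro allI impI ballI)
    fix c k assume 0: "\<forall>z\<in>T. (\<Sum>j\<in>J. c j * m j z) = 0" and k: "k \<in> J"
    have e: "(\<Sum>k\<in>insert j J. (if k = j then 0 else c k) * m k z) = (\<Sum>k\<in>J. c k * m k z)" for z
    proof -
      have "(\<Sum>k\<in>insert j J. (if k = j then 0 else c k) * m k z) = (\<Sum>k\<in>J. (if k = j then 0 else c k) * m k z)"
        using insert.hyps by (subst sum.insert) simp_all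
      also have "\<dots> = (\<Sum>k\<in>J. c k * m k z)" using insert.hyps(2) by (intro sum.cong) auto
      finally show ?thesis .
    qed
    have "(if k = j then 0 else c k) = 0"
      by (rule lin_indepD[OF ind]) (use 0 e k in simp_all)
    then show "c k = 0" using k insert.hyps(2) by (cases "k = j") auto
  qed
  show ?case
  proof (cases "(\<integral>z. (r z)\<^sup>2 \<partial>\<sigma>) = 0")
    case True
    then have r0: "r z = 0" if "z \<in> T" for z using nice_eq_0[OF nr _ that] by simp
    have mj: "m j \<in> fspan {..<d} \<psi>"
    proof (rule fspanI)
      fix z assume "z \<in> T"
      then show "m j z = (\<Sum>i<d. ip (m j) (\<psi> i) * \<psi> i z)" using r0[of z] by (simp add: r_def p_def)
    qed
    have notind: "\<not> lin_indep (insert j J) m"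
    proof
      assume ind: "lin_indep (insert j J) m"
      obtain c where c: "\<And>z. z \<in> T \<Longrightarrow> p z = (\<Sum>j\<in>J. c j * m j z)" using fspanE[OF pJ] by blast
      let ?c = "\<lambda>k. if k = j then 1 else - c k"
      have "(\<Sum>k\<in>insert j J. ?c k * m k z) = 0" if "z \<in> T" for z
      proof -
        have "(\<Sum>k\<in>insert j J. ?c k * m k z) = m j z + (\<Sum>k\<in>J. ?c k * m k z)"
          using insert.hyps by (subst sum.insert) simp_all
        also have "(\<Sum>k\<in>J. ?c k * m k z) = (\<Sum>k\<in>J. - (c k * m k z))"
          using insert.hyps(2) by (intro sum.cong) auto
        finally show ?thesis using c[OF that] r0[OF that] by (simp add: r_def sum_negf)
      qed
      from lin_indepD[OF ind this, of j] show False by simp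
    qed
    show ?thesis
    proof (rule exI[of _ d], rule exI[of _ \<psi>], intro conjI allI impI ballI)
      show "d \<le> card (insert j J)" using IH(1) insert.hyps by simp
      show "orthonormal d \<psi>" by (rule IH(2))
      show "\<psi> i \<in> fspan (insert j J) m" if "i < d" for i by (rule mono[OF IH(3)[OF that]])
      show "m k \<in> fspan {..<d} \<psi>" if "k \<in> insert j J" for k using that mj IH(4) by (cases "k = j") simp_all
      show "d = card (insert j J)" if "lin_indep (insert j J) m" using that notind by (rule notE[rotated])
    qed
  next
    case False
    have nn: "(\<integral>z. (r z)\<^sup>2 \<partial>\<sigma>) > 0"
      by (rule le_neq_trans[OF Bochner_Integration.integral_nonneg False[symmetric]]) simp
    define N where "N = sqrt (\<integral>z. (r z)\<^sup>2 \<partial>\<sigma>)"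
    have N: "N > 0" "N * N = ip r r" using nn by (simp_all add: N_def ip_def power2_eq_square)
    define \<psi>' where "\<psi>' = \<psi>(d := (\<lambda>z. (1 / N) * r z))"
    have on: "orthonormal (Suc d) \<psi>'"
    proof -
      have "ip (\<lambda>z. (1 / N) * r z) (\<lambda>z. (1 / N) * r z) = (1 / N) * ((1 / N) * ip r r)"
        by (subst ip_cmult_left, subst ip_sym, subst ip_cmult_left) simp
      also have "\<dots> = 1" using N(1) by (simp flip: N(2))
      finally have 1: "ip (\<lambda>z. (1 / N) * r z) (\<lambda>z. (1 / N) * r z) = 1" .
      have 2: "ip (\<lambda>z. (1 / N) * r z) (\<psi> k) = 0" "ip (\<psi> k) (\<lambda>z. (1 / N) * r z) = 0" if "k < d" for k
        using rorth[OF that] ip_cmult_left[of "1 / N" r "\<psi> k"] ip_sym[of "\<psi> k"] by simp_all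
      show ?thesis
        unfolding orthonormal_def \<psi>'_def using IH(2) 1 2 nice_cmult[OF nr, of "1 / N"]
        by (auto simp: orthonormal_def less_Suc_eq)
    qed
    have \<psi>old: "\<psi>' i = \<psi> i" if "i < d" for i using that by (simp add: \<psi>'_def)
    have sub: "f \<in> fspan {..<Suc d} \<psi>'" if "f \<in> fspan {..<d} \<psi>" for f
    proof (rule fspan_trans[OF that])
      fix i assume "i \<in> {..<d}"
      then show "\<psi> i \<in> fspan {..<Suc d} \<psi>'" using fspan_base[of "{..<Suc d}" i \<psi>'] \<psi>old by simp
    qed
    have mj: "m j \<in> fspan {..<Suc d} \<psi>'"
    proof (rule fspan_cong[OF fspan_add])
      show "p \<in> fspan {..<Suc d} \<psi>'" by (rule sub, rule fspanI) (simp add: p_def)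
      show "(\<lambda>z. N * \<psi>' d z) \<in> fspan {..<Suc d} \<psi>'" by (intro fspan_cmult fspan_base) auto
      show "p z + N * \<psi>' d z = m j z" for z using N(1) by (simp add: \<psi>'_def r_def)
    qed
    have rin: "r \<in> fspan (insert j J) m"
    proof (rule fspan_cong[OF fspan_add])
      show "m j \<in> fspan (insert j J) m" using insert.hyps by (intro fspan_base) auto
      show "(\<lambda>z. (-1) * p z) \<in> fspan (insert j J) m" by (intro fspan_cmult mono pJ)
    qed (simp add: r_def)
    have in': "\<psi>' i \<in> fspan (insert j J) m" if "i < Suc d" for i
      using that IH(3) mono fspan_cmult[OF rin, of "1 / N"] by (auto simp: \<psi>'_def less_Suc_eq)
    show ?thesis
    proof (rule exI[of _ "Suc d"], rule exI[of _ \<psi>'], intro conjI allI impI ballI)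
      show "Suc d \<le> card (insert j J)" using IH(1) insert.hyps by simp
      show "orthonormal (Suc d) \<psi>'" by (rule on)
      show "\<psi>' i \<in> fspan (insert j J) m" if "i < Suc d" for i by (rule in'[OF that])
      show "m k \<in> fspan {..<Suc d} \<psi>'" if "k \<in> insert j J" for k
        using that mj sub[OF IH(4)] by (cases "k = j") simp_all
      show "Suc d = card (insert j J)" if "lin_indep (insert j J) m" using IH(5) ind'[OF that] insert.hyps by simp
    qed
  qed
qed

text \<open>The kernel $K(w)=\sum_i\psi_i(w)^2$ is the supremum of $f(w)^2$ over the unit ball of
  the span, which is invariant under rotations; hence $K$ is constant on $T$ by transitivity, and
  its integral is $d$.\<close>
lemma reproducing_kernel_const:
  assumes on: "orthonormal d \<psi>"
    and inv: "\<And>g i. g \<in> SO_mats n \<Longrightarrow> i < d \<Longrightarrow> (\<lambda>z. \<psi> i (rot g z)) \<in> fspan {..<d} \<psi>"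
    and z: "z \<in> T"
  shows "(\<Sum>i<d. (\<psi> i z)\<^sup>2) = real d"
proof -
  let ?K = "\<lambda>z. \<Sum>i<d. (\<psi> i z)\<^sup>2"
  have n\<psi>: "nice (\<psi> i)" if "i < d" for i using on that by (simp add: orthonormal_def)
  have le: "?K w \<le> ?K v" if vw: "v \<in> T" "w \<in> T" for v w
  proof -
    obtain g where g: "g \<in> SO_mats n" "rot g v = w" using SO_transitive[OF n3 vw] by blast
    let ?f = "\<lambda>z. \<Sum>i<d. \<psi> i w * \<psi> i z"
    have nf: "nice ?f" by (intro nice_sum nice_cmult n\<psi>) auto
    have "(\<lambda>z. ?f (rot g z)) \<in> fspan {..<d} \<psi>" by (intro fspan_sum inv g) auto
    then obtain a where a: "\<And>z. z \<in> T \<Longrightarrow> ?f (rot g z) = (\<Sum>i<d. a i * \<psi> i z)" using fspanE by blast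
    have "(\<Sum>i<d. (a i)\<^sup>2) = (\<integral>z. (?f (rot g z))\<^sup>2 \<partial>\<sigma>)"
      by (rule orthonormal_norm[OF on a, symmetric])
    also have "\<dots> = (\<integral>z. (?f z)\<^sup>2 \<partial>\<sigma>)" by (rule integral_rot[OF g(1) nice_power[OF nf]])
    also have "\<dots> = ?K w" by (rule orthonormal_norm[OF on]) simp
    finally have an: "(\<Sum>i<d. (a i)\<^sup>2) = ?K w" .
    have "?K w = ?f w" by (simp add: power2_eq_square)
    also have "\<dots> = (\<Sum>i<d. a i * \<psi> i v)" using a[OF vw(1)] g(2) by simp
    finally have "(?K w)\<^sup>2 = (\<Sum>i<d. a i * \<psi> i v)\<^sup>2" by simp
    also have "\<dots> \<le> (\<Sum>i<d. (a i)\<^sup>2) * ?K v" by (rule Cauchy_Schwarz_ineq_sum)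
    finally have "?K w * ?K w \<le> ?K w * ?K v" unfolding an power2_eq_square[of "?K w"] .
    moreover have "?K w \<ge> 0" "?K v \<ge> 0" by (auto intro: sum_nonneg)
    ultimately show ?thesis by (cases "?K w = 0") (auto simp: mult_le_cancel_left)
  qed
  have const: "?K w = ?K z" if "w \<in> T" for w using le[OF z that] le[OF that z] by simp
  have "real d = (\<Sum>i<d. ip (\<psi> i) (\<psi> i))" using on by (simp add: orthonormal_def)
  also have "\<dots> = (\<integral>w. ?K w \<partial>\<sigma>)"
    unfolding ip_def by (subst Bochner_Integration.integral_sum) (auto simp: power2_eq_square intro!: nice_integrable nice_mult n\<psi>)
  also have "\<dots> = (\<integral>w. ?K z \<partial>\<sigma>)" by (intro Bochner_Integration.integral_cong refl const) simp
  also have "\<dots> = ?K z" using S.prob_space by simp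
  finally show ?thesis by simp
qed

text \<open>Cauchy--Schwarz applied to an expansion in an orthonormal basis, the kernel being
  equal to the dimension.\<close>
lemma sup_bound_by_dim:
  assumes J: "finite J" "\<And>j. j \<in> J \<Longrightarrow> nice (m j)"
    and inv: "\<And>g j. g \<in> SO_mats n \<Longrightarrow> j \<in> J \<Longrightarrow> (\<lambda>z. m j (rot g z)) \<in> fspan J m"
    and f: "f \<in> fspan J m" and z: "z \<in> T"
  shows "(f z)\<^sup>2 \<le> real (card J) * (\<integral>z. (f z)\<^sup>2 \<partial>\<sigma>)"
proof -
  obtain d \<psi> where d: "d \<le> card J" "orthonormal d \<psi>" "\<And>i. i < d \<Longrightarrow> \<psi> i \<in> fspan J m" "\<And>j. j \<in> J \<Longrightarrow> m j \<in> fspan {..<d} \<psi>"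
    using orthonormal_basis_exists[of J m, OF J] by blast
  have inv': "(\<lambda>z. \<psi> i (rot g z)) \<in> fspan {..<d} \<psi>" if g: "g \<in> SO_mats n" and i: "i < d" for g i
  proof -
    obtain c where c: "\<And>z. z \<in> T \<Longrightarrow> \<psi> i z = (\<Sum>j\<in>J. c j * m j z)" using fspanE[OF d(3)[OF i]] by blast
    have "(\<lambda>z. \<Sum>j\<in>J. c j * m j (rot g z)) \<in> fspan J m" by (intro fspan_sum inv g)
    then have "(\<lambda>z. \<psi> i (rot g z)) \<in> fspan J m"
      by (rule fspan_cong) (use c rot_orthonormal_pairs g in \<open>auto simp: SO_mats_iff simp del: split_paired_All\<close>)
    then show ?thesis by (rule fspan_trans) (rule d(4))
  qed
  have "f \<in> fspan {..<d} \<psi>" using f by (rule fspan_trans) (rule d(4))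
  then obtain a where a: "\<And>z. z \<in> T \<Longrightarrow> f z = (\<Sum>i<d. a i * \<psi> i z)" using fspanE by blast
  have "(f z)\<^sup>2 = (\<Sum>i<d. a i * \<psi> i z)\<^sup>2" using a[OF z] by simp
  also have "\<dots> \<le> (\<Sum>i<d. (a i)\<^sup>2) * (\<Sum>i<d. (\<psi> i z)\<^sup>2)" by (rule Cauchy_Schwarz_ineq_sum)
  also have "\<dots> = (\<integral>z. (f z)\<^sup>2 \<partial>\<sigma>) * real d"
    using orthonormal_norm[OF d(2) a] reproducing_kernel_const[OF d(2) inv' z] by simp
  also have "\<dots> \<le> (\<integral>z. (f z)\<^sup>2 \<partial>\<sigma>) * real (card J)"
    using d(1) by (intro mult_left_mono Bochner_Integration.integral_nonneg) auto
  finally show ?thesis by (simp add: mult.commute)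
qed

end

section \<open>Monomials of given bidegree\<close>

text \<open>Exponents of monomials are lists, so that finiteness and cardinality are those of compositions
  of a number.\<close>
definition exponents :: "nat \<Rightarrow> nat \<Rightarrow> nat list set" where
  "exponents n d = {\<alpha>. length \<alpha> = n \<and> sum_list \<alpha> = d}"

definition monomial_fun :: "nat \<Rightarrow> nat list \<times> nat list \<Rightarrow> real vec \<times> real vec \<Rightarrow> real" where
  "monomial_fun n j z = (\<Prod>i<n. fst z $ i ^ (fst j ! i)) * (\<Prod>i<n. snd z $ i ^ (snd j ! i))"

lemma card_exponents: "n \<ge> 1 \<Longrightarrow> card (exponents n d) = (d + n - 1) choose d"
  unfolding exponents_def by (rule card_length_sum_list)

lemma finite_exponents [simp]: "finite (exponents n d)"
proof (rule finite_subset)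
  show "exponents n d \<subseteq> {\<alpha>. set \<alpha> \<subseteq> {..d} \<and> length \<alpha> = n}"
    using member_le_sum_list by (fastforce simp: exponents_def)
qed (rule finite_lists_length_eq, simp)

definition exp_add :: "nat list \<Rightarrow> nat list \<Rightarrow> nat list" where
  "exp_add \<alpha> \<beta> = map2 (+) \<alpha> \<beta>"

lemma exp_add_nth: "length \<alpha> = n \<Longrightarrow> length \<beta> = n \<Longrightarrow> i < n \<Longrightarrow> exp_add \<alpha> \<beta> ! i = \<alpha> ! i + \<beta> ! i"
  by (simp add: exp_add_def)

lemma exp_add_exponents: "\<alpha> \<in> exponents n a \<Longrightarrow> \<beta> \<in> exponents n b \<Longrightarrow> exp_add \<alpha> \<beta> \<in> exponents n (a + b)"
  by (auto simp: exponents_def sum_list_sum_nth exp_add_def sum.distrib)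

definition unit_exp :: "nat \<Rightarrow> nat \<Rightarrow> nat list" where
  "unit_exp n i = (replicate n 0)[i := 1]"

lemma unit_exp_nth: "k < n \<Longrightarrow> unit_exp n i ! k = (if k = i then 1 else 0)"
  by (simp add: unit_exp_def nth_list_update)

lemma unit_exp_exponents:
  assumes "i < n" shows "unit_exp n i \<in> exponents n 1"
proof -
  have l: "length (unit_exp n i) = n" by (simp add: unit_exp_def)
  have "sum_list (unit_exp n i) = (\<Sum>k<n. unit_exp n i ! k)" by (simp add: sum_list_sum_nth l atLeast0LessThan)
  also have "\<dots> = (\<Sum>k<n. if k = i then 1 else 0)" by (intro sum.cong) (auto simp: unit_exp_nth)
  finally show ?thesis using assms l by (simp add: exponents_def)
qed

lemma exp0_exponents: "replicate n 0 \<in> exponents n 0"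
  by (auto simp: exponents_def sum_list_replicate)

context stiefel
begin

definition bihom :: "nat \<Rightarrow> nat \<Rightarrow> (real vec \<times> real vec \<Rightarrow> real) set" where
  "bihom a b = fspan (exponents n a \<times> exponents n b) (monomial_fun n)"

lemma nice_monomial: "nice (monomial_fun n j)"
  unfolding monomial_fun_def by (intro nice_mult nice_prod nice_power nice_coord) auto

lemma bihom_monomial: "\<alpha> \<in> exponents n a \<Longrightarrow> \<beta> \<in> exponents n b \<Longrightarrow> monomial_fun n (\<alpha>, \<beta>) \<in> bihom a b"
  unfolding bihom_def by (rule fspan_base) auto

lemma monomial_fun_mult:
  assumes "\<alpha> \<in> exponents n a" "\<beta> \<in> exponents n b" "\<alpha>' \<in> exponents n a'" "\<beta>' \<in> exponents n b'"
  shows "monomial_fun n (\<alpha>, \<beta>) z * monomial_fun n (\<alpha>', \<beta>') z = monomial_fun n (exp_add \<alpha> \<alpha>', exp_add \<beta> \<beta>') z"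
  using assms by (simp add: monomial_fun_def exponents_def exp_add_nth[of _ n] power_add prod.distrib mult_ac)

lemma bihom_mult:
  assumes "f \<in> bihom a b" "g \<in> bihom a' b'"
  shows "(\<lambda>z. f z * g z) \<in> bihom (a + a') (b + b')"
proof -
  let ?J = "exponents n a \<times> exponents n b" and ?K = "exponents n a' \<times> exponents n b'"
  obtain c where c: "\<And>z. z \<in> T \<Longrightarrow> f z = (\<Sum>j\<in>?J. c j * monomial_fun n j z)"
    using fspanE[OF assms(1)[unfolded bihom_def]] by blast
  obtain d where d: "\<And>z. z \<in> T \<Longrightarrow> g z = (\<Sum>j\<in>?K. d j * monomial_fun n j z)"
    using fspanE[OF assms(2)[unfolded bihom_def]] by blast
  have mm: "(\<lambda>z. monomial_fun n j z * monomial_fun n k z) \<in> bihom (a + a') (b + b')" if "j \<in> ?J" "k \<in> ?K" for j k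
  proof -
    obtain \<alpha> \<beta> \<alpha>' \<beta>' where jk: "j = (\<alpha>, \<beta>)" "k = (\<alpha>', \<beta>')" by (cases j, cases k)
    have m: "\<alpha> \<in> exponents n a" "\<beta> \<in> exponents n b" "\<alpha>' \<in> exponents n a'" "\<beta>' \<in> exponents n b'" using that jk by auto
    show ?thesis unfolding jk monomial_fun_mult[OF m] by (intro bihom_monomial exp_add_exponents m)
  qed
  have "(\<lambda>z. \<Sum>j\<in>?J. c j * (\<Sum>k\<in>?K. d k * (monomial_fun n j z * monomial_fun n k z))) \<in> bihom (a + a') (b + b')"
    unfolding bihom_def by (intro fspan_sum mm[unfolded bihom_def])
  then show ?thesis
    unfolding bihom_def
  proof (rule fspan_cong)
    fix z assume z: "z \<in> T"
    show "(\<Sum>j\<in>?J. c j * (\<Sum>k\<in>?K. d k * (monomial_fun n j z * monomial_fun n k z))) = f z * g z"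
      unfolding c[OF z] d[OF z] sum_product by (intro sum.cong refl) (simp add: sum_distrib_left mult_ac)
  qed
qed

lemma bihom_one: "(\<lambda>z. 1) \<in> bihom 0 0"
proof -
  have "monomial_fun n (replicate n 0, replicate n 0) = (\<lambda>z. 1)" by (auto simp: monomial_fun_def fun_eq_iff)
  then show ?thesis using bihom_monomial[OF exp0_exponents exp0_exponents] by simp
qed

lemma bihom_power: "f \<in> bihom a b \<Longrightarrow> (\<lambda>z. f z ^ k) \<in> bihom (k * a) (k * b)"
  by (induction k) (auto intro: bihom_one bihom_mult)

lemma bihom_prod:
  assumes "finite I" "\<And>i. i \<in> I \<Longrightarrow> f i \<in> bihom (a i) (b i)"
  shows "(\<lambda>z. \<Prod>i\<in>I. f i z) \<in> bihom (\<Sum>i\<in>I. a i) (\<Sum>i\<in>I. b i)"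
  using assms by (induction I rule: finite_induct) (auto intro: bihom_one bihom_mult)

lemma bihom_coord:
  assumes "i < n"
  shows "(\<lambda>z. fst z $ i) \<in> bihom 1 0" "(\<lambda>z. snd z $ i) \<in> bihom 0 1"
proof -
  have "(\<Prod>k<n. v $ k ^ (unit_exp n i ! k)) = v $ i" for v :: "real vec"
    using assms by (simp add: unit_exp_nth if_distrib[of "power _"] cong: if_cong)
  then have "monomial_fun n (unit_exp n i, replicate n 0) = (\<lambda>z. fst z $ i)" "monomial_fun n (replicate n 0, unit_exp n i) = (\<lambda>z. snd z $ i)"
    by (auto simp: monomial_fun_def fun_eq_iff)
  then show "(\<lambda>z. fst z $ i) \<in> bihom 1 0" "(\<lambda>z. snd z $ i) \<in> bihom 0 1"
    using bihom_monomial[OF unit_exp_exponents[OF assms] exp0_exponents] bihom_monomial[OF exp0_exponents unit_exp_exponents[OF assms]]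
    by simp_all
qed

lemma bihom_sum: "(\<And>i. i \<in> I \<Longrightarrow> f i \<in> bihom a b) \<Longrightarrow> (\<lambda>z. \<Sum>i\<in>I. c i * f i z) \<in> bihom a b"
  unfolding bihom_def by (rule fspan_sum)

text \<open>Rotated coordinates are linear forms in the old ones.\<close>
lemma bihom_rot_monomial:
  assumes g: "g \<in> SO_mats n" and j: "j \<in> exponents n a \<times> exponents n b"
  shows "(\<lambda>z. monomial_fun n j (rot g z)) \<in> bihom a b"
proof -
  have gc: "g \<in> carrier_mat n n" using g by (simp add: SO_mats_def)
  have e: "(\<Sum>i<n. \<alpha> ! i) = d" if "\<alpha> \<in> exponents n d" for \<alpha> d
    using that by (auto simp: exponents_def sum_list_sum_nth atLeast0LessThan)
  have l1: "(\<lambda>z. fst (rot g z) $ i) \<in> bihom 1 0" if i: "i < n" for i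
  proof -
    have "(\<lambda>z. \<Sum>k<n. g $$ (i, k) * fst z $ k) \<in> bihom 1 0" by (intro bihom_sum bihom_coord) simp
    then show ?thesis unfolding bihom_def
      by (rule fspan_cong) (use i gc in \<open>auto simp: orthonormal_pairs_iff scalar_prod_sum[of _ n]\<close>)
  qed
  have l2: "(\<lambda>z. snd (rot g z) $ i) \<in> bihom 0 1" if i: "i < n" for i
  proof -
    have "(\<lambda>z. \<Sum>k<n. g $$ (i, k) * snd z $ k) \<in> bihom 0 1" by (intro bihom_sum bihom_coord) simp
    then show ?thesis unfolding bihom_def
      by (rule fspan_cong) (use i gc in \<open>auto simp: orthonormal_pairs_iff scalar_prod_sum[of _ n]\<close>)
  qed
  have "(\<lambda>z. (\<Prod>i<n. fst (rot g z) $ i ^ (fst j ! i)) * (\<Prod>i<n. snd (rot g z) $ i ^ (snd j ! i)))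
    \<in> bihom ((\<Sum>i<n. fst j ! i * 1) + (\<Sum>i<n. snd j ! i * 0)) ((\<Sum>i<n. fst j ! i * 0) + (\<Sum>i<n. snd j ! i * 1))"
    by (intro bihom_mult bihom_prod bihom_power l1 l2) auto
  then show ?thesis using j e by (auto simp: monomial_fun_def)
qed

lemma bihom_sup_bound:
  assumes f: "f \<in> bihom a b" and z: "z \<in> T"
  shows "(f z)\<^sup>2 \<le> real (((a + n - 1) choose a) * ((b + n - 1) choose b)) * (\<integral>z. (f z)\<^sup>2 \<partial>\<sigma>)"
proof -
  have "card (exponents n a \<times> exponents n b) = ((a + n - 1) choose a) * ((b + n - 1) choose b)"
    using n3 by (simp add: card_exponents)
  then show ?thesis
    using sup_bound_by_dim[of "exponents n a \<times> exponents n b" "monomial_fun n", OF _ nice_monomial bihom_rot_monomial[unfolded bihom_def] f[unfolded bihom_def] z]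
    by (metis finite_SigmaI finite_exponents)
qed

lemma bihom_rot:
  assumes f: "f \<in> bihom a b" and g: "g \<in> SO_mats n"
  shows "(\<lambda>z. f (rot g z)) \<in> bihom a b"
proof -
  obtain c where c: "\<And>z. z \<in> T \<Longrightarrow> f z = (\<Sum>j\<in>exponents n a \<times> exponents n b. c j * monomial_fun n j z)"
    using fspanE[OF f[unfolded bihom_def]] by blast
  have "(\<lambda>z. \<Sum>j\<in>exponents n a \<times> exponents n b. c j * monomial_fun n j (rot g z)) \<in> bihom a b"
    by (intro bihom_sum bihom_rot_monomial g)
  then show ?thesis unfolding bihom_def
  proof (rule fspan_cong)
    fix z assume "z \<in> T"
    then have "rot g z \<in> T" using g rot_orthonormal_pairs by (simp add: SO_mats_iff)
    then show "(\<Sum>j\<in>exponents n a \<times> exponents n b. c j * monomial_fun n j (rot g z)) = f (rot g z)" by (rule c[symmetric])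
  qed
qed

text \<open>On $T$ the biform $|x|^2|y|^2$ is the constant $1$.\<close>
lemma bihom_norm_one: "(\<lambda>z. 1) \<in> bihom 2 2"
proof -
  have 1: "(\<lambda>z. \<Sum>i<n. 1 * (fst z $ i * fst z $ i)) \<in> bihom (1 + 1) (0 + 0)"
    by (intro bihom_sum bihom_mult bihom_coord) auto
  have 2: "(\<lambda>z. \<Sum>i<n. 1 * (snd z $ i * snd z $ i)) \<in> bihom (0 + 0) (1 + 1)"
    by (intro bihom_sum bihom_mult bihom_coord) auto
  have "(\<lambda>z. (\<Sum>i<n. 1 * (fst z $ i * fst z $ i)) * (\<Sum>i<n. 1 * (snd z $ i * snd z $ i))) \<in> bihom 2 2"
    using bihom_mult[OF 1 2] by (simp add: numeral_2_eq_2)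
  then show ?thesis unfolding bihom_def
    by (rule fspan_cong) (auto simp: orthonormal_pairs_iff scalar_prod_sum[of _ n])
qed

end

section \<open>Evaluation of polynomials\<close>

definition mono_eval :: "real vec \<times> real vec \<Rightarrow> (var \<Rightarrow>\<^sub>0 nat) \<Rightarrow> real" where
  "mono_eval z m = (\<Prod>v\<in>Poly_Mapping.keys m. var_value z v ^ Poly_Mapping.lookup m v)"

lemma mono_eval_superset:
  assumes "finite V" "Poly_Mapping.keys m \<subseteq> V"
  shows "mono_eval z m = (\<Prod>v\<in>V. var_value z v ^ Poly_Mapping.lookup m v)"
  unfolding mono_eval_def by (rule prod.mono_neutral_left) (use assms in \<open>auto simp: in_keys_iff\<close>)

lemma mono_eval_add: "mono_eval z (m + m') = mono_eval z m * mono_eval z m'"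
proof -
  let ?V = "Poly_Mapping.keys m \<union> Poly_Mapping.keys m'"
  have "mono_eval z (m + m') = (\<Prod>v\<in>?V. var_value z v ^ Poly_Mapping.lookup (m + m') v)"
    by (rule mono_eval_superset) (simp_all add: Poly_Mapping.keys_add)
  also have "\<dots> = (\<Prod>v\<in>?V. var_value z v ^ Poly_Mapping.lookup m v) * (\<Prod>v\<in>?V. var_value z v ^ Poly_Mapping.lookup m' v)"
    by (simp add: lookup_add power_add prod.distrib)
  finally show ?thesis by (simp add: mono_eval_superset[of ?V])
qed

lemma poly_eval_superset:
  assumes "finite S" "Poly_Mapping.keys p \<subseteq> S"
  shows "poly_eval p z = (\<Sum>m\<in>S. Poly_Mapping.lookup p m * mono_eval z m)"
  unfolding poly_eval_def mono_eval_def[symmetric]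
  by (rule sum.mono_neutral_left) (use assms in \<open>auto simp: in_keys_iff\<close>)

lemma poly_eval_add: "poly_eval (p + q) z = poly_eval p z + poly_eval q z"
proof -
  let ?S = "Poly_Mapping.keys p \<union> Poly_Mapping.keys q"
  have "poly_eval (p + q) z = (\<Sum>m\<in>?S. Poly_Mapping.lookup (p + q) m * mono_eval z m)"
    by (rule poly_eval_superset) (simp_all add: Poly_Mapping.keys_add)
  also have "\<dots> = (\<Sum>m\<in>?S. Poly_Mapping.lookup p m * mono_eval z m) + (\<Sum>m\<in>?S. Poly_Mapping.lookup q m * mono_eval z m)"
    by (simp add: lookup_add distrib_right sum.distrib)
  finally show ?thesis by (simp add: poly_eval_superset[of ?S])
qed

lemma poly_eval_zero [simp]: "poly_eval 0 z = 0" by (simp add: poly_eval_def)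

lemma poly_eval_sum: "poly_eval (\<Sum>i\<in>I. f i) z = (\<Sum>i\<in>I. poly_eval (f i) z)"
  by (induction I rule: infinite_finite_induct) (auto simp: poly_eval_add)

lemma poly_eval_single [simp]: "poly_eval (Poly_Mapping.single m c) z = c * mono_eval z m"
  by (simp add: poly_eval_superset[of "{m}"])

lemma poly_mapping_sum_single:
  fixes p :: "'a \<Rightarrow>\<^sub>0 'b::comm_monoid_add"
  shows "p = (\<Sum>m\<in>Poly_Mapping.keys p. Poly_Mapping.single m (Poly_Mapping.lookup p m))"
  by (rule poly_mapping_eqI) (auto simp: lookup_sum lookup_single when_def in_keys_iff)

lemma poly_eval_mult: "poly_eval (p * q) z = poly_eval p z * poly_eval q z"
proof -
  have "p * q = (\<Sum>m\<in>Poly_Mapping.keys p. \<Sum>m'\<in>Poly_Mapping.keys q.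
     Poly_Mapping.single (m + m') (Poly_Mapping.lookup p m * Poly_Mapping.lookup q m'))"
    by (subst poly_mapping_sum_single[of p], subst poly_mapping_sum_single[of q]) (simp add: sum_product mult_single)
  then have "poly_eval (p * q) z = (\<Sum>m\<in>Poly_Mapping.keys p. \<Sum>m'\<in>Poly_Mapping.keys q.
     (Poly_Mapping.lookup p m * Poly_Mapping.lookup q m') * (mono_eval z m * mono_eval z m'))"
    by (simp add: poly_eval_sum mono_eval_add)
  also have "\<dots> = poly_eval p z * poly_eval q z"
    unfolding poly_eval_def mono_eval_def[symmetric] sum_product by (intro sum.cong refl) (simp add: mult_ac)
  finally show ?thesis .
qed

lemma mono_eval_0 [simp]: "mono_eval z 0 = 1" by (simp add: mono_eval_def)

lemma poly_eval_const [simp]: "poly_eval (const_poly c) z = c" by (simp add: const_poly_def)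

lemma poly_eval_var [simp]: "poly_eval (var_poly v) z = var_value z v"
  by (simp add: var_poly_def mono_eval_def)

lemma poly_eval_uminus: "poly_eval (- p) z = - poly_eval p z"
  using poly_eval_add[of p "- p" z] by simp

lemma poly_eval_diff: "poly_eval (p - q) z = poly_eval p z - poly_eval q z"
  using poly_eval_add[of p "- q" z] by (simp add: poly_eval_uminus)

lemma poly_eval_one: "poly_eval 1 z = 1"
  using poly_eval_const[of 1 z] by (simp add: const_poly_def)

lemma poly_eval_power: "poly_eval (p ^ k) z = poly_eval p z ^ k"
  by (induction k) (auto simp: poly_eval_mult poly_eval_one)

section \<open>Biforms and the ideal\<close>

definition vars :: "nat \<Rightarrow> var set" where
  "vars n = Xvar ` {..<n} \<union> Yvar ` {..<n}"

lemma polys_iff: "p \<in> polys n \<longleftrightarrow> (\<forall>m\<in>Poly_Mapping.keys p. Poly_Mapping.keys m \<subseteq> vars n)"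
  by (simp add: polys_def vars_def)

lemma keys_diff_subset: "Poly_Mapping.keys (p - q) \<subseteq> Poly_Mapping.keys p \<union> Poly_Mapping.keys (q :: 'a \<Rightarrow>\<^sub>0 'b :: ab_group_add)"
  by (auto simp: in_keys_iff lookup_minus)

lemma polys_add: "p \<in> polys n \<Longrightarrow> q \<in> polys n \<Longrightarrow> p + q \<in> polys n"
  using Poly_Mapping.keys_add[of p q] by (auto simp: polys_iff)

lemma polys_0 [simp]: "0 \<in> polys n" by (simp add: polys_iff)

lemma polys_mult:
  assumes "p \<in> polys n" "q \<in> polys n" shows "p * q \<in> polys n"
  unfolding polys_iff
proof
  fix m assume "m \<in> Poly_Mapping.keys (p * q)"
  then obtain a b where "m = a + b" "a \<in> Poly_Mapping.keys p" "b \<in> Poly_Mapping.keys q"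
    using Poly_Mapping.keys_mult[of p q] by auto
  then show "Poly_Mapping.keys m \<subseteq> vars n" using assms Poly_Mapping.keys_add[of a b] unfolding polys_iff by blast
qed

lemma polys_const [simp]: "const_poly c \<in> polys n"
  by (auto simp: polys_iff const_poly_def split: if_splits)

lemma polys_var: "v \<in> vars n \<Longrightarrow> var_poly v \<in> polys n"
  by (auto simp: polys_iff var_poly_def)

abbreviation xdeg :: "nat \<Rightarrow> (var \<Rightarrow>\<^sub>0 nat) \<Rightarrow> nat" where
  "xdeg n m \<equiv> (\<Sum>i<n. Poly_Mapping.lookup m (Xvar i))"
abbreviation ydeg :: "nat \<Rightarrow> (var \<Rightarrow>\<^sub>0 nat) \<Rightarrow> nat" where
  "ydeg n m \<equiv> (\<Sum>i<n. Poly_Mapping.lookup m (Yvar i))"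

lemma biforms_iff: "p \<in> biforms n a b \<longleftrightarrow> (\<forall>m\<in>Poly_Mapping.keys p. Poly_Mapping.keys m \<subseteq> vars n \<and> xdeg n m = a \<and> ydeg n m = b)"
  by (auto simp: biforms_def polys_iff)

lemma biforms_add: "p \<in> biforms n a b \<Longrightarrow> q \<in> biforms n a b \<Longrightarrow> p + q \<in> biforms n a b"
  using Poly_Mapping.keys_add[of p q] unfolding biforms_iff by blast

lemma biforms_diff: "p \<in> biforms n a b \<Longrightarrow> q \<in> biforms n a b \<Longrightarrow> p - q \<in> biforms n a b"
  using keys_diff_subset[of p q] unfolding biforms_iff by blast

lemma biforms_0 [simp]: "0 \<in> biforms n a b" by (simp add: biforms_iff)

lemma biforms_mult:
  assumes "p \<in> biforms n a b" "q \<in> biforms n a' b'" shows "p * q \<in> biforms n (a + a') (b + b')"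
  unfolding biforms_iff
proof
  fix m assume "m \<in> Poly_Mapping.keys (p * q)"
  then obtain k l where m: "m = k + l" "k \<in> Poly_Mapping.keys p" "l \<in> Poly_Mapping.keys q"
    using Poly_Mapping.keys_mult[of p q] by auto
  then have "Poly_Mapping.keys m \<subseteq> vars n" using assms Poly_Mapping.keys_add[of k l] unfolding biforms_iff by blast
  moreover have "xdeg n m = a + a'" "ydeg n m = b + b'"
    using assms m by (auto simp: biforms_iff lookup_add sum.distrib)
  ultimately show "Poly_Mapping.keys m \<subseteq> vars n \<and> xdeg n m = a + a' \<and> ydeg n m = b + b'" by simp
qed

lemma biforms_const: "const_poly c \<in> biforms n 0 0"
  by (auto simp: biforms_iff const_poly_def split: if_splits)

lemma biforms_cmult: "p \<in> biforms n a b \<Longrightarrow> const_poly c * p \<in> biforms n a b"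
  using biforms_mult[OF biforms_const] by simp

lemma biforms_sum: "(\<And>i. i \<in> I \<Longrightarrow> f i \<in> biforms n a b) \<Longrightarrow> (\<Sum>i\<in>I. f i) \<in> biforms n a b"
  by (induction I rule: infinite_finite_induct) (auto intro: biforms_add)

lemma biforms_var: "i < n \<Longrightarrow> var_poly (Xvar i) \<in> biforms n 1 0" "i < n \<Longrightarrow> var_poly (Yvar i) \<in> biforms n 0 1"
  by (auto simp: biforms_iff var_poly_def vars_def lookup_single when_def)

abbreviation theta :: "nat \<Rightarrow> rpoly" where
  "theta n \<equiv> \<Sum>i<n. var_poly (Xvar i) * var_poly (Yvar i)"

lemma ortho_idealI: "g \<in> polys n \<Longrightarrow> g * theta n \<in> ortho_ideal n"
  by (auto simp: ortho_ideal_def)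

lemma ortho_ideal_0 [simp]: "0 \<in> ortho_ideal n"
  using ortho_idealI[of 0 n] by simp

lemma ortho_ideal_add: "p \<in> ortho_ideal n \<Longrightarrow> q \<in> ortho_ideal n \<Longrightarrow> p + q \<in> ortho_ideal n"
  by (auto simp: ortho_ideal_def distrib_right[symmetric] intro: polys_add)

lemma ortho_ideal_mult: "r \<in> polys n \<Longrightarrow> p \<in> ortho_ideal n \<Longrightarrow> r * p \<in> ortho_ideal n"
  by (auto simp: ortho_ideal_def mult.assoc[symmetric] intro: polys_mult)

lemma const_poly_mult: "const_poly a * const_poly b = const_poly (a * b)"
  by (simp add: const_poly_def mult_single)

lemma const_poly_add: "const_poly a + const_poly b = const_poly (a + b)"
  by (simp add: const_poly_def single_add)

lemma const_poly_1: "const_poly 1 = 1" by (simp add: const_poly_def)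

lemma const_poly_minus1: "const_poly (-1) * p = - p"
proof -
  have "const_poly (-1) = - 1" by (simp add: const_poly_def single_uminus)
  then show ?thesis by simp
qed

lemma poly_eval_ortho_ideal:
  assumes "p \<in> ortho_ideal n" "z \<in> ortho_variety n"
  shows "poly_eval p z = 0"
proof -
  obtain g where g: "p = g * theta n" using assms by (auto simp: ortho_ideal_def)
  obtain x y where z: "z = (x, y)" "x \<in> carrier_vec n" "y \<in> carrier_vec n" "y \<bullet> x = 0"
    using assms(2) by (auto simp: ortho_variety_def)
  have "poly_eval (theta n) z = (\<Sum>i<n. y $ i * x $ i)"
    using z by (simp add: poly_eval_sum poly_eval_mult mult.commute)
  also have "\<dots> = 0" using z by (simp add: scalar_prod_sum[of _ n])
  finally show ?thesis by (simp add: g poly_eval_mult)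
qed

section \<open>Monomials as polynomials\<close>

definition mexp :: "nat \<Rightarrow> nat list \<times> nat list \<Rightarrow> (var \<Rightarrow>\<^sub>0 nat)" where
  "mexp n j = (\<Sum>i<n. Poly_Mapping.single (Xvar i) (fst j ! i)) + (\<Sum>i<n. Poly_Mapping.single (Yvar i) (snd j ! i))"

definition mpoly :: "nat \<Rightarrow> nat list \<times> nat list \<Rightarrow> rpoly" where
  "mpoly n j = Poly_Mapping.single (mexp n j) 1"

lemma lookup_mexp:
  "Poly_Mapping.lookup (mexp n j) (Xvar i) = (if i < n then fst j ! i else 0)"
  "Poly_Mapping.lookup (mexp n j) (Yvar i) = (if i < n then snd j ! i else 0)"
  by (auto simp: mexp_def lookup_add lookup_sum lookup_single when_def)

lemma keys_mexp: "Poly_Mapping.keys (mexp n j) \<subseteq> vars n"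
proof
  fix v assume "v \<in> Poly_Mapping.keys (mexp n j)"
  then show "v \<in> vars n" by (cases v) (auto simp: in_keys_iff lookup_mexp vars_def split: if_splits)
qed

lemma prod_vars: "(\<Prod>v\<in>vars n. f v) = (\<Prod>i<n. f (Xvar i)) * (\<Prod>i<n. f (Yvar i))"
proof -
  have "(\<Prod>v\<in>vars n. f v) = (\<Prod>v\<in>Xvar ` {..<n}. f v) * (\<Prod>v\<in>Yvar ` {..<n}. f v)"
    unfolding vars_def by (rule prod.union_disjoint) auto
  then show ?thesis by (simp add: prod.reindex inj_on_def)
qed

lemma poly_eval_mpoly: "poly_eval (mpoly n j) z = monomial_fun n j z"
proof -
  have "poly_eval (mpoly n j) z = (\<Prod>v\<in>vars n. var_value z v ^ Poly_Mapping.lookup (mexp n j) v)"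
    unfolding mpoly_def using mono_eval_superset[OF _ keys_mexp] by (simp add: vars_def)
  then show ?thesis by (cases z) (simp add: prod_vars lookup_mexp monomial_fun_def)
qed

lemma sum_exponents: "\<alpha> \<in> exponents n a \<Longrightarrow> (\<Sum>i<n. \<alpha> ! i) = a"
  by (auto simp: exponents_def sum_list_sum_nth atLeast0LessThan)

lemma mpoly_biform: "j \<in> exponents n a \<times> exponents n b \<Longrightarrow> mpoly n j \<in> biforms n a b"
  using keys_mexp[of n j] by (auto simp: biforms_iff mpoly_def lookup_mexp sum_exponents)

lemma mexp_inj:
  assumes "j \<in> exponents n a \<times> exponents n b" "k \<in> exponents n a \<times> exponents n b" "mexp n j = mexp n k"
  shows "j = k"
proof -
  have "fst j ! i = fst k ! i" "snd j ! i = snd k ! i" if "i < n" for i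
    using lookup_mexp[of n j i] lookup_mexp[of n k i] assms(3) that by simp_all
  then have "fst j = fst k" "snd j = snd k" using assms(1,2) by (auto simp: exponents_def intro!: nth_equalityI)
  then show ?thesis by (simp add: prod_eq_iff)
qed

lemma const_mult_mpoly: "const_poly c * mpoly n j = Poly_Mapping.single (mexp n j) c"
  by (simp add: const_poly_def mpoly_def mult_single)

text \<open>This identifies the finitely supported exponent maps occurring in a biform with
  pairs of exponent lists.\<close>
lemma biform_decomposition:
  assumes p: "p \<in> biforms n a b"
  shows "p = (\<Sum>j\<in>exponents n a \<times> exponents n b. const_poly (Poly_Mapping.lookup p (mexp n j)) * mpoly n j)"
proof (rule poly_mapping_eqI)
  fix m
  let ?J = "exponents n a \<times> exponents n b"
  have R: "Poly_Mapping.lookup (\<Sum>j\<in>?J. const_poly (Poly_Mapping.lookup p (mexp n j)) * mpoly n j) m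
     = (\<Sum>j\<in>?J. if mexp n j = m then Poly_Mapping.lookup p m else 0)"
    unfolding lookup_sum const_mult_mpoly lookup_single by (intro sum.cong refl) simp
  show "Poly_Mapping.lookup p m = Poly_Mapping.lookup (\<Sum>j\<in>?J. const_poly (Poly_Mapping.lookup p (mexp n j)) * mpoly n j) m"
  proof (cases "m \<in> Poly_Mapping.keys p")
    case False
    then show ?thesis unfolding R by (simp add: in_keys_iff)
  next
    case True
    define j where "j = (map (\<lambda>i. Poly_Mapping.lookup m (Xvar i)) [0..<n], map (\<lambda>i. Poly_Mapping.lookup m (Yvar i)) [0..<n])"
    have mk: "Poly_Mapping.keys m \<subseteq> vars n" "xdeg n m = a" "ydeg n m = b" using p True by (auto simp: biforms_iff)
    have jJ: "j \<in> ?J" using mk by (auto simp: j_def exponents_def sum_list_sum_nth atLeast0LessThan)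
    have mj: "mexp n j = m"
    proof (rule poly_mapping_eqI)
      fix v
      have "v \<notin> vars n \<Longrightarrow> Poly_Mapping.lookup m v = 0" using mk(1) by (auto simp: in_keys_iff)
      then show "Poly_Mapping.lookup (mexp n j) v = Poly_Mapping.lookup m v"
        by (cases v) (auto simp: lookup_mexp j_def vars_def image_iff)
    qed
    have "(\<Sum>k\<in>?J. if mexp n k = m then Poly_Mapping.lookup p m else 0) = (\<Sum>k\<in>?J. if k = j then Poly_Mapping.lookup p m else 0)"
    proof (intro sum.cong refl)
      fix k assume "k \<in> ?J"
      then have "mexp n k = m \<longleftrightarrow> k = j" using mexp_inj[OF \<open>k \<in> ?J\<close> jJ] mj by metis
      then show "(if mexp n k = m then Poly_Mapping.lookup p m else 0) = (if k = j then Poly_Mapping.lookup p m else 0)" by simp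
    qed
    then show ?thesis unfolding R using jJ by simp
  qed
qed

lemma mpoly_mult:
  assumes "\<alpha> \<in> exponents n a" "\<beta> \<in> exponents n b" "\<alpha>' \<in> exponents n a'" "\<beta>' \<in> exponents n b'"
  shows "mpoly n (\<alpha>, \<beta>) * mpoly n (\<alpha>', \<beta>') = mpoly n (exp_add \<alpha> \<alpha>', exp_add \<beta> \<beta>')"
proof -
  have "mexp n (\<alpha>, \<beta>) + mexp n (\<alpha>', \<beta>') = mexp n (exp_add \<alpha> \<alpha>', exp_add \<beta> \<beta>')"
  proof (rule poly_mapping_eqI)
    fix v
    show "Poly_Mapping.lookup (mexp n (\<alpha>, \<beta>) + mexp n (\<alpha>', \<beta>')) v = Poly_Mapping.lookup (mexp n (exp_add \<alpha> \<alpha>', exp_add \<beta> \<beta>')) v"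
      using assms by (cases v) (auto simp: lookup_add lookup_mexp exp_add_nth exponents_def)
  qed
  then show ?thesis by (simp add: mpoly_def mult_single)
qed

lemma mpoly_unit:
  assumes "i < n" "k < n"
  shows "mpoly n (unit_exp n i, unit_exp n k) = var_poly (Xvar i) * var_poly (Yvar k)"
proof -
  have "mexp n (unit_exp n i, unit_exp n k) = Poly_Mapping.single (Xvar i) 1 + Poly_Mapping.single (Yvar k) 1"
  proof (rule poly_mapping_eqI)
    fix v show "Poly_Mapping.lookup (mexp n (unit_exp n i, unit_exp n k)) v = Poly_Mapping.lookup (Poly_Mapping.single (Xvar i) 1 + Poly_Mapping.single (Yvar k) 1) v"
      using assms by (cases v) (auto simp: lookup_mexp lookup_add lookup_single when_def unit_exp_nth)
  qed
  then show ?thesis by (simp add: mpoly_def var_poly_def mult_single)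
qed

lemma exponents_1D:
  assumes "\<beta> \<in> exponents n 1"
  obtains i where "i < n" "\<beta> = unit_exp n i"
proof -
  have l: "length \<beta> = n" and s: "(\<Sum>k<n. \<beta> ! k) = 1" using assms sum_exponents[OF assms] by (auto simp: exponents_def)
  then obtain i where i: "i < n" "\<beta> ! i \<noteq> 0" by (metis lessThan_iff sum.neutral zero_neq_one)
  have "\<beta> ! i + (\<Sum>k\<in>{..<n} - {i}. \<beta> ! k) = 1" using s sum.remove[of "{..<n}" i "(!) \<beta>"] i by simp
  then have "\<beta> ! i = 1" "(\<Sum>k\<in>{..<n} - {i}. \<beta> ! k) = 0" using i(2) by linarith+
  moreover from this(2) have "\<forall>k\<in>{..<n} - {i}. \<beta> ! k = 0" by (subst (asm) sum_eq_0_iff) simp_all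
  ultimately have "\<beta> ! k = (if k = i then 1 else 0)" if "k < n" for k using that by simp
  then have "\<beta> = unit_exp n i" using l by (intro nth_equalityI) (auto simp: unit_exp_nth, simp add: unit_exp_def)
  then show thesis using i that by blast
qed

lemma exponents_2_split:
  assumes "\<alpha> \<in> exponents n 2" "0 < n" "\<alpha> ! 0 \<noteq> 0"
  obtains i where "i < n" "\<alpha> = exp_add (unit_exp n 0) (unit_exp n i)"
proof -
  define \<beta> where "\<beta> = \<alpha>[0 := \<alpha> ! 0 - 1]"
  have l: "length \<alpha> = n" using assms by (simp add: exponents_def)
  have \<alpha>k: "\<alpha> ! k = (if k = 0 then 1 else 0) + \<beta> ! k" if "k < n" for k
    using assms(3) that l by (auto simp: \<beta>_def nth_list_update)
  have "2 = (\<Sum>k<n. (if k = 0 then 1 else 0) + \<beta> ! k)" using sum_exponents[OF assms(1)] \<alpha>k by simp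
  also have "\<dots> = 1 + (\<Sum>k<n. \<beta> ! k)" using assms(2) by (simp add: sum.distrib)
  finally have "(\<Sum>k<n. \<beta> ! k) = 1" by simp
  then have "\<beta> \<in> exponents n 1" using l by (auto simp: exponents_def sum_list_sum_nth atLeast0LessThan \<beta>_def)
  then obtain i where i: "i < n" "\<beta> = unit_exp n i" by (rule exponents_1D)
  have "\<alpha> = exp_add (unit_exp n 0) (unit_exp n i)"
    using l \<alpha>k i by (intro nth_equalityI) (auto simp: exp_add_def unit_exp_nth, auto simp: unit_exp_def)
  then show thesis using i that by blast
qed

section \<open>Normal forms modulo the ideal\<close>

text \<open>The exponents of the monomials of bidegree $(2,2)$ that are not divisible by $x_0y_0$, which plays
  the part of a leading term of $\sum_i x_iy_i$.\<close>
definition normal_exps :: "nat \<Rightarrow> (nat list \<times> nat list) set" where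
  "normal_exps n = {j \<in> exponents n 2 \<times> exponents n 2. fst j ! 0 = 0 \<or> snd j ! 0 = 0}"

lemma finite_normal_exps [simp]: "finite (normal_exps n)"
  by (rule finite_subset[of _ "exponents n 2 \<times> exponents n 2"]) (auto simp: normal_exps_def)

definition reducible :: "nat \<Rightarrow> rpoly \<Rightarrow> bool" where
  "reducible n p \<longleftrightarrow> (\<exists>c. p - (\<Sum>j\<in>normal_exps n. const_poly (c j) * mpoly n j) \<in> ortho_ideal n)"

lemma reducible_0: "reducible n 0"
  unfolding reducible_def by (rule exI[of _ "\<lambda>_. 0"]) (simp add: const_poly_def)

lemma reducible_add:
  assumes "reducible n p" "reducible n q" shows "reducible n (p + q)"
proof -
  obtain c d where "p - (\<Sum>j\<in>normal_exps n. const_poly (c j) * mpoly n j) \<in> ortho_ideal n"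
    "q - (\<Sum>j\<in>normal_exps n. const_poly (d j) * mpoly n j) \<in> ortho_ideal n" using assms by (auto simp: reducible_def)
  from ortho_ideal_add[OF this] show ?thesis unfolding reducible_def
    by (intro exI[of _ "\<lambda>j. c j + d j"]) (simp add: const_poly_add[symmetric] distrib_right sum.distrib algebra_simps)
qed

lemma reducible_cmult:
  assumes "reducible n p" shows "reducible n (const_poly a * p)"
proof -
  obtain c where "p - (\<Sum>j\<in>normal_exps n. const_poly (c j) * mpoly n j) \<in> ortho_ideal n" using assms by (auto simp: reducible_def)
  from ortho_ideal_mult[OF polys_const this, of a] show ?thesis unfolding reducible_def
    by (intro exI[of _ "\<lambda>j. a * c j"]) (simp add: right_diff_distrib sum_distrib_left const_poly_mult[symmetric] mult.assoc)
qed

lemma reducible_sum: "(\<And>i. i \<in> I \<Longrightarrow> reducible n (f i)) \<Longrightarrow> reducible n (\<Sum>i\<in>I. f i)"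
  by (induction I rule: infinite_finite_induct) (auto intro: reducible_add reducible_0)

lemma reducible_cong:
  assumes "p - q \<in> ortho_ideal n" "reducible n q" shows "reducible n p"
proof -
  obtain c where "q - (\<Sum>j\<in>normal_exps n. const_poly (c j) * mpoly n j) \<in> ortho_ideal n" using assms by (auto simp: reducible_def)
  from ortho_ideal_add[OF assms(1) this] show ?thesis unfolding reducible_def by (intro exI[of _ c]) (simp add: algebra_simps)
qed

lemma reducible_normal: "j \<in> normal_exps n \<Longrightarrow> reducible n (mpoly n j)"
  unfolding reducible_def
  by (rule exI[of _ "\<lambda>k. if k = j then 1 else 0"])
     (simp add: if_distrib[of const_poly] if_distrib[of "\<lambda>t. t * _"] const_poly_1 const_poly_def[of 0] cong: if_cong)

abbreviation e2 :: "nat \<Rightarrow> nat \<Rightarrow> nat \<Rightarrow> nat list" where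
  "e2 n i k \<equiv> exp_add (unit_exp n i) (unit_exp n k)"

lemma mpoly_e2:
  assumes "i < n" "i' < n" "k < n" "k' < n"
  shows "mpoly n (e2 n i i', e2 n k k') = var_poly (Xvar i) * var_poly (Yvar k) * (var_poly (Xvar i') * var_poly (Yvar k'))"
  using mpoly_mult[of "unit_exp n i" n 1 "unit_exp n k" 1 "unit_exp n i'" 1 "unit_exp n k'" 1] assms
  by (simp add: unit_exp_exponents[unfolded One_nat_def] mpoly_unit)

text \<open>Multiplying $\sum_l x_ly_l$ by $x_iy_k$ expresses $x_0x_i\,y_0y_k$ through the
  monomials $x_lx_i\,y_ly_k$ with $l\ge 1$.\<close>
lemma reducible_step:
  assumes n: "0 < n" and ik: "i < n" "k < n"
    and red: "\<And>l. l \<in> {1..<n} \<Longrightarrow> reducible n (mpoly n (e2 n l i, e2 n l k))"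
  shows "reducible n (mpoly n (e2 n 0 i, e2 n 0 k))"
proof (rule reducible_cong)
  let ?q = "var_poly (Xvar i) * var_poly (Yvar k)"
  let ?r = "\<Sum>l\<in>{1..<n}. const_poly (-1) * mpoly n (e2 n l i, e2 n l k)"
  show "reducible n ?r" by (intro reducible_sum reducible_cmult red)
  have "{..<n} = insert 0 {1..<n}" using n by auto
  then have "theta n = var_poly (Xvar 0) * var_poly (Yvar 0) + (\<Sum>l\<in>{1..<n}. var_poly (Xvar l) * var_poly (Yvar l))"
    by simp
  then have "?q * theta n = var_poly (Xvar 0) * var_poly (Yvar 0) * ?q + (\<Sum>l\<in>{1..<n}. var_poly (Xvar l) * var_poly (Yvar l) * ?q)"
    by (simp add: distrib_left sum_distrib_left mult.commute)
  also have "\<dots> = mpoly n (e2 n 0 i, e2 n 0 k) - ?r"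
    using n ik by (simp add: mpoly_e2 const_poly_minus1 sum_negf)
  finally have "mpoly n (e2 n 0 i, e2 n 0 k) - ?r = ?q * theta n" ..
  also have "\<dots> \<in> ortho_ideal n" using ik by (intro ortho_idealI polys_mult polys_var) (auto simp: vars_def)
  finally show "mpoly n (e2 n 0 i, e2 n 0 k) - ?r \<in> ortho_ideal n" .
qed

lemma e2_nth: "a < n \<Longrightarrow> e2 n i k ! a = (if a = i then 1 else 0) + (if a = k then 1 else 0)"
  by (subst exp_add_nth[of _ n]) (auto simp: unit_exp_nth, auto simp: unit_exp_def)

lemma e2_exponents: "i < n \<Longrightarrow> k < n \<Longrightarrow> e2 n i k \<in> exponents n 2"
  using exp_add_exponents[OF unit_exp_exponents unit_exp_exponents] by (simp add: numeral_2_eq_2)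

lemma exp_add_comm: "exp_add \<alpha> \<beta> = exp_add \<beta> \<alpha>"
  unfolding exp_add_def by (rule nth_equalityI) (auto simp: add.commute)

text \<open>One reduction step suffices unless the monomial is $x_0^2y_0^2$, which needs two.\<close>
lemma reducible_mpoly:
  assumes n: "0 < n" and j: "j \<in> exponents n 2 \<times> exponents n 2"
  shows "reducible n (mpoly n j)"
proof (cases "j \<in> normal_exps n")
  case False
  obtain \<alpha> \<beta> where ab: "j = (\<alpha>, \<beta>)" by (cases j)
  have m: "\<alpha> \<in> exponents n 2" "\<beta> \<in> exponents n 2" "\<alpha> ! 0 \<noteq> 0" "\<beta> ! 0 \<noteq> 0" using j False by (auto simp: ab normal_exps_def)
  obtain i where i: "i < n" "\<alpha> = e2 n 0 i" using exponents_2_split[OF m(1) n m(3)] by blast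
  obtain k where k: "k < n" "\<beta> = e2 n 0 k" using exponents_2_split[OF m(2) n m(4)] by blast
  have gen: "reducible n (mpoly n (e2 n 0 i, e2 n 0 k))" if "i < n" "k < n" "i \<noteq> 0 \<or> k \<noteq> 0" for i k
    by (rule reducible_step[OF n that(1,2)], rule reducible_normal)
       (use n that in \<open>auto simp: normal_exps_def e2_nth e2_exponents\<close>)
  show ?thesis
  proof (cases "i = 0 \<and> k = 0")
    case False
    then show ?thesis using gen[OF i(1) k(1)] by (auto simp: ab i k)
  next
    case True
    have "reducible n (mpoly n (e2 n 0 0, e2 n 0 0))"
    proof (rule reducible_step[OF n n n])
      fix l assume "l \<in> {1..<n}"
      then show "reducible n (mpoly n (e2 n l 0, e2 n l 0))"
        using gen[of l l] by (simp add: exp_add_comm[of "unit_exp n l"])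
    qed
    then show ?thesis using True by (simp add: ab i k)
  qed
qed (rule reducible_normal)

lemma reducible_biform:
  assumes "0 < n" "p \<in> biforms n 2 2"
  shows "reducible n p"
  by (subst biform_decomposition[OF assms(2)]) (intro reducible_sum reducible_cmult reducible_mpoly assms(1))

text \<open>The excluded pairs of exponents are those of $x_0x_i\,y_0y_k$.\<close>
lemma card_normal_exps:
  assumes n: "n \<ge> 1"
  shows "card (normal_exps n) + n\<^sup>2 = ((n + 1) choose 2)\<^sup>2"
proof -
  let ?A = "{\<alpha> \<in> exponents n 2. \<alpha> ! 0 \<noteq> 0}"
  have "?A = e2 n 0 ` {..<n}"
  proof
    show "?A \<subseteq> e2 n 0 ` {..<n}" using n by (auto elim!: exponents_2_split)
    show "e2 n 0 ` {..<n} \<subseteq> ?A" using n by (auto simp: e2_exponents e2_nth)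
  qed
  moreover have "inj_on (e2 n 0) {..<n}"
  proof (rule inj_onI)
    fix i k assume ik: "i \<in> {..<n}" "k \<in> {..<n}" "e2 n 0 i = e2 n 0 k"
    have "(if i = 0 then 1 else 0) + 1 = (if i = 0 then 1 else 0) + (if i = k then 1 else (0 :: nat))"
      using e2_nth[of i n 0 i] e2_nth[of i n 0 k] ik by simp
    then show "i = k" by (auto split: if_splits)
  qed
  ultimately have cA: "card ?A = n" by (simp add: card_image)
  have "exponents n 2 \<times> exponents n 2 = normal_exps n \<union> ?A \<times> ?A" "normal_exps n \<inter> ?A \<times> ?A = {}"
    by (auto simp: normal_exps_def)
  then have "card (exponents n 2 \<times> exponents n 2) = card (normal_exps n) + card (?A \<times> ?A)"
    using card_Un_disjoint[of "normal_exps n" "?A \<times> ?A"] by (simp add: finite_subset[OF _ finite_exponents[of n 2]])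
  moreover have "card (exponents n 2) = (n + 1) choose 2" using n by (simp add: card_exponents)
  moreover have "card (?A \<times> ?A) = n * n" by (simp only: card_cartesian_product cA)
  ultimately show ?thesis by (simp add: card_cartesian_product power2_eq_square)
qed

section \<open>Independence of the normal monomials\<close>

text \<open>The coefficients of a polynomial with infinitely many roots vanish; exponents may
  coincide, so the conclusion concerns the sum over each value of the exponent.\<close>
lemma sum_powers_zero:
  fixes a :: "'j \<Rightarrow> real"
  assumes J: "finite J" and 0: "\<And>t. t > 0 \<Longrightarrow> (\<Sum>j\<in>J. a j * t ^ (e j)) = 0"
  shows "(\<Sum>j\<in>{j \<in> J. e j = k}. a j) = 0"
proof -
  define p where "p = (\<Sum>j\<in>J. monom (a j) (e j))"
  have ev: "poly p t = (\<Sum>j\<in>J. a j * t ^ (e j))" for t by (simp add: p_def poly_sum poly_monom)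
  have "p = 0"
  proof (rule ccontr)
    assume "p \<noteq> 0"
    then have "finite {t. poly p t = 0}" by (rule poly_roots_finite)
    moreover have "{0<..} \<subseteq> {t. poly p t = 0}" using 0 by (auto simp: ev)
    ultimately have "finite {0 :: real<..}" using finite_subset by blast
    then show False using infinite_Ioi by blast
  qed
  then have "0 = coeff p k" by simp
  also have "\<dots> = (\<Sum>j\<in>J. if e j = k then a j else 0)" by (simp add: p_def coeff_sum)
  also have "\<dots> = (\<Sum>j\<in>{j \<in> J. e j = k}. a j)" using J by (simp add: sum.inter_filter)
  finally show ?thesis by simp
qed

text \<open>Uniqueness of ternary digits.\<close>
lemma base3_unique:
  fixes d d' :: "nat \<Rightarrow> nat"
  assumes "\<And>i. i < N \<Longrightarrow> d i < 3" "\<And>i. i < N \<Longrightarrow> d' i < 3" "(\<Sum>i<N. d i * 3 ^ i) = (\<Sum>i<N. d' i * 3 ^ i)" "i < N"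
  shows "d i = d' i"
  using assms
proof (induction N arbitrary: d d' i)
  case (Suc N)
  have e: "(\<Sum>i<Suc N. f i * 3 ^ i) = f 0 + 3 * (\<Sum>i<N. f (Suc i) * 3 ^ i)" for f :: "nat \<Rightarrow> nat"
    by (subst sum.lessThan_Suc_shift) (simp add: sum_distrib_left mult_ac)
  have eq: "d 0 + 3 * (\<Sum>i<N. d (Suc i) * 3 ^ i) = d' 0 + 3 * (\<Sum>i<N. d' (Suc i) * 3 ^ i)"
    using Suc.prems(3) unfolding e .
  then have "(d 0 + 3 * (\<Sum>i<N. d (Suc i) * 3 ^ i)) mod 3 = (d' 0 + 3 * (\<Sum>i<N. d' (Suc i) * 3 ^ i)) mod 3" by simp
  then have 0: "d 0 = d' 0" using Suc.prems(1)[of 0] Suc.prems(2)[of 0] by simp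
  then have "(\<Sum>i<N. d (Suc i) * 3 ^ i) = (\<Sum>i<N. d' (Suc i) * 3 ^ i)" using eq by simp
  then have "d (Suc k) = d' (Suc k)" if "k < N" for k
    by (intro Suc.IH[of "\<lambda>i. d (Suc i)" "\<lambda>i. d' (Suc i)"]) (use Suc.prems that in auto)
  then show ?case using 0 Suc.prems(4) by (cases i) auto
qed simp

lemma exponents_le: "\<alpha> \<in> exponents n a \<Longrightarrow> i < n \<Longrightarrow> \<alpha> ! i \<le> a"
  using sum_exponents[of \<alpha> n a] member_le_sum[of i "{..<n}" "(!) \<alpha>"] by simp

text \<open>The power of $\tau$ in a monomial at the test points used for independence. The exponents
  with index $0$ are left out because the coordinates with index $0$ are chosen separately.\<close>
definition weight :: "nat \<Rightarrow> nat list \<times> nat list \<Rightarrow> nat" where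
  "weight n j = (\<Sum>i\<in>{1..<n}. fst j ! i * 3 ^ i) + (\<Sum>i\<in>{1..<n}. snd j ! i * 3 ^ (n + i))"

text \<open>Exponents are at most $2$, so those with index at least $1$ are the ternary digits of the
  weight.\<close>
lemma weight_inj:
  assumes j: "j \<in> exponents n 2 \<times> exponents n 2" and k: "k \<in> exponents n 2 \<times> exponents n 2" and n: "0 < n"
    and w: "weight n j = weight n k" and z: "fst j ! 0 = fst k ! 0" "snd j ! 0 = snd k ! 0"
  shows "j = k"
proof -
  define D where "D j i = (if i < n then fst j ! i else snd j ! (i - n))" for j :: "nat list \<times> nat list" and i
  have S: "(\<Sum>i<2 * n. D j i * 3 ^ i) = weight n j + fst j ! 0 + snd j ! 0 * 3 ^ n" for j
  proof -
    have "(\<Sum>i<2 * n. D j i * 3 ^ i) = (\<Sum>i<n. D j i * 3 ^ i) + (\<Sum>i<n. D j (n + i) * 3 ^ (n + i))"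
      using sum.nat_group[of "\<lambda>i. D j i * 3 ^ i" n 2] by (simp add: numeral_2_eq_2 atLeast0LessThan[symmetric] sum.shift_bounds_nat_ivl[of _ 0 n n, simplified] add.commute)
    also have "(\<Sum>i<n. D j i * 3 ^ i) = (\<Sum>i<n. fst j ! i * 3 ^ i)" by (intro sum.cong) (auto simp: D_def)
    also have "(\<Sum>i<n. D j (n + i) * 3 ^ (n + i)) = (\<Sum>i<n. snd j ! i * 3 ^ (n + i))" by (intro sum.cong) (auto simp: D_def)
    also have "{..<n} = insert 0 {1..<n}" using n by auto
    finally show ?thesis by (simp add: weight_def)
  qed
  have De: "D j i = D k i" if "i < 2 * n" for i
  proof (rule base3_unique[OF _ _ _ that])
    fix i assume i: "i < 2 * n"
    then have "i - n < n" using n by linarith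
    then have "l \<in> exponents n 2 \<times> exponents n 2 \<Longrightarrow> D l i < 3" for l
      using exponents_le[of "fst l" n 2 i] exponents_le[of "snd l" n 2 "i - n"] by (auto simp: D_def)
    then show "D j i < 3" "D k i < 3" using j k by blast+
  qed (simp add: S w z)
  then have "fst j ! i = fst k ! i" "snd j ! i = snd k ! i" if "i < n" for i
    using that De[of i] De[of "n + i"] by (simp_all add: D_def)
  then have "fst j = fst k" "snd j = snd k" using j k by (auto simp: exponents_def intro!: nth_equalityI)
  then show ?thesis by (simp add: prod_eq_iff)
qed

lemma monomial_fun_scale:
  assumes j: "j \<in> exponents n a \<times> exponents n b" and "x \<in> carrier_vec n" "y \<in> carrier_vec n"
  shows "monomial_fun n j (s \<cdot>\<^sub>v x, t \<cdot>\<^sub>v y) = s ^ a * t ^ b * monomial_fun n j (x, y)"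
proof -
  have e: "(\<Prod>i<n. (s \<cdot>\<^sub>v x) $ i ^ (\<alpha> ! i)) = s ^ d * (\<Prod>i<n. x $ i ^ (\<alpha> ! i))"
    if "x \<in> carrier_vec n" "\<alpha> \<in> exponents n d" for s and x :: "real vec" and \<alpha> d
  proof -
    have "(\<Prod>i<n. (s \<cdot>\<^sub>v x) $ i ^ (\<alpha> ! i)) = (\<Prod>i<n. s ^ (\<alpha> ! i) * x $ i ^ (\<alpha> ! i))"
      using that(1) by (intro prod.cong) (auto simp: power_mult_distrib)
    also have "\<dots> = s ^ (\<Sum>i<n. \<alpha> ! i) * (\<Prod>i<n. x $ i ^ (\<alpha> ! i))" by (simp add: prod.distrib power_sum)
    finally show ?thesis using sum_exponents[OF that(2)] by simp
  qed
  have "fst j \<in> exponents n a" "snd j \<in> exponents n b" using j by auto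
  then show ?thesis unfolding monomial_fun_def fst_conv snd_conv e[OF assms(2)] e[OF assms(3)] by (simp add: e[OF assms(2)] e[OF assms(3)] del: index_smult_vec)
qed

context stiefel
begin

lemma vanishing_extends:
  assumes J: "J \<subseteq> exponents n 2 \<times> exponents n 2"
    and 0: "\<And>z. z \<in> T \<Longrightarrow> (\<Sum>j\<in>J. c j * monomial_fun n j z) = 0"
    and x: "x \<in> carrier_vec n" "x \<bullet> x > 0" and y: "y \<in> carrier_vec n" "y \<bullet> y > 0" and xy: "x \<bullet> y = 0"
  shows "(\<Sum>j\<in>J. c j * monomial_fun n j (x, y)) = 0"
proof -
  let ?s = "1 / sqrt (x \<bullet> x)" and ?t = "1 / sqrt (y \<bullet> y)"
  have "(?s \<cdot>\<^sub>v x, ?t \<cdot>\<^sub>v y) \<in> T" using x y xy by (simp add: orthonormal_pairs_iff)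
  then have "0 = (\<Sum>j\<in>J. c j * monomial_fun n j (?s \<cdot>\<^sub>v x, ?t \<cdot>\<^sub>v y))" using 0 by simp
  also have "\<dots> = (\<Sum>j\<in>J. ?s\<^sup>2 * ?t\<^sup>2 * (c j * monomial_fun n j (x, y)))"
    using J x y by (intro sum.cong refl) (subst monomial_fun_scale[of _ n 2 2], auto)
  also have "\<dots> = ?s\<^sup>2 * ?t\<^sup>2 * (\<Sum>j\<in>J. c j * monomial_fun n j (x, y))" by (simp only: sum_distrib_left)
  finally show ?thesis using x(2) y(2) by simp
qed

text \<open>Test points are $x=(t,\tau^{3},\tau^{9},\dots)$ and $y$ with $y_i=\tau^{3^{n+i}}$ for
  $i\ge 1$, where $y_0=-s/t$ makes them orthogonal. In a normal monomial $x_0$ and $y_0$ do not both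
  occur, so the power of $t$ reveals the exponents of $x_0$ and $y_0$; then the power of
  $\tau$ reveals all remaining exponents. Comparing coefficients first in $t$ and then in $\tau$
  isolates every single coefficient.\<close>
lemma lin_indep_normal: "lin_indep (normal_exps n) (monomial_fun n)"
  unfolding lin_indep_def
proof (intro allI impI ballI)
  fix c j0 assume "\<forall>z\<in>T. (\<Sum>j\<in>normal_exps n. c j * monomial_fun n j z) = 0" and j0: "j0 \<in> normal_exps n"
  then have van: "(\<Sum>j\<in>normal_exps n. c j * monomial_fun n j z) = 0" if "z \<in> T" for z using that by blast
  have n0: "0 < n" using n3 by simp
  have sub: "normal_exps n \<subseteq> exponents n 2 \<times> exponents n 2" by (auto simp: normal_exps_def)
  \<comment> \<open>The shift by $2$ keeps the exponent of $t$ nonnegative.\<close>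
  define E where "E j = 2 + fst j ! 0 - snd j ! 0" for j :: "nat list \<times> nat list"
  have le2: "fst j ! 0 \<le> 2" "snd j ! 0 \<le> 2" if "j \<in> normal_exps n" for j
    using that sub exponents_le[OF _ n0] by auto
  have Edet: "fst j ! 0 = fst j0 ! 0 \<and> snd j ! 0 = snd j0 ! 0" if "j \<in> normal_exps n" "E j = E j0" for j
  proof -
    have "fst j ! 0 = 0 \<or> snd j ! 0 = 0" "fst j0 ! 0 = 0 \<or> snd j0 ! 0 = 0" using that j0 by (auto simp: normal_exps_def)
    then show ?thesis using that(2) le2[OF that(1)] le2[OF j0] unfolding E_def by linarith
  qed
  define G where "G = {j \<in> normal_exps n. E j = E j0}"
  have tau: "(\<Sum>j\<in>G. c j * \<tau> ^ weight n j) = 0" if \<tau>: "\<tau> > 0" for \<tau> :: real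
  proof -
    define s where "s = (\<Sum>i\<in>{1..<n}. \<tau> ^ (3 ^ i) * \<tau> ^ (3 ^ (n + i)))"
    have s: "s > 0" unfolding s_def using \<tau> n3 by (intro sum_pos) auto
    have "(\<Sum>j\<in>normal_exps n. (c j * (- s) ^ (snd j ! 0) * \<tau> ^ weight n j) * t ^ E j) = 0" if t: "t > 0" for t
    proof -
      define x where "x = Matrix.vec n (\<lambda>i. if i = 0 then t else \<tau> ^ (3 ^ i))"
      define y where "y = Matrix.vec n (\<lambda>i. if i = 0 then - s / t else \<tau> ^ (3 ^ (n + i)))"
      have c: "x \<in> carrier_vec n" "y \<in> carrier_vec n" by (simp_all add: x_def y_def)
      have ins: "{..<n} = insert 0 {1..<n}" using n0 by auto
      have "x \<bullet> y = t * (- s / t) + (\<Sum>i\<in>{1..<n}. \<tau> ^ (3 ^ i) * \<tau> ^ (3 ^ (n + i)))"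
        unfolding scalar_prod_sum[OF c(2)] ins by (simp add: x_def y_def n0)
      also have "\<dots> = 0" using t by (simp add: s_def)
      finally have xy: "x \<bullet> y = 0" .
      have ne: "v \<bullet> v > 0" if "v \<in> carrier_vec n" "v $ 0 \<noteq> 0" for v :: "real vec"
      proof -
        have "v \<noteq> 0\<^sub>v n" using that n0 by auto
        then show ?thesis using real_scalar_prod_ge_0[of v] real_scalar_prod_eq_0_iff[OF that(1)] by linarith
      qed
      have pos: "x \<bullet> x > 0" "y \<bullet> y > 0"
        using t s n0 by (auto intro!: ne c simp: x_def y_def)
      have "0 = (\<Sum>j\<in>normal_exps n. c j * monomial_fun n j (x, y))"
        using vanishing_extends[OF sub van c(1) pos(1) c(2) pos(2) xy] by simp
      also have "\<dots> = (\<Sum>j\<in>normal_exps n. (1 / t\<^sup>2) * ((c j * (- s) ^ (snd j ! 0) * \<tau> ^ weight n j) * t ^ E j))"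
      proof (intro sum.cong refl)
        fix j assume j: "j \<in> normal_exps n"
        have "monomial_fun n j (x, y) = t ^ (fst j ! 0) * (- s / t) ^ (snd j ! 0) *
          ((\<Prod>i\<in>{1..<n}. (\<tau> ^ (3 ^ i)) ^ (fst j ! i)) * (\<Prod>i\<in>{1..<n}. (\<tau> ^ (3 ^ (n + i))) ^ (snd j ! i)))"
          unfolding monomial_fun_def ins by (simp add: x_def y_def n0)
        also have "(\<Prod>i\<in>{1..<n}. (\<tau> ^ (3 ^ i)) ^ (fst j ! i)) * (\<Prod>i\<in>{1..<n}. (\<tau> ^ (3 ^ (n + i))) ^ (snd j ! i)) = \<tau> ^ weight n j"
          by (simp add: weight_def power_add power_sum power_mult[symmetric] mult.commute)
        also have "t ^ (fst j ! 0) * (- s / t) ^ (snd j ! 0) = (1 / t\<^sup>2) * ((- s) ^ (snd j ! 0) * t ^ E j)"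
        proof -
          have "t ^ E j * t ^ (snd j ! 0) = t\<^sup>2 * t ^ (fst j ! 0)"
            using le2[OF j] by (simp add: E_def power_add[symmetric])
          moreover have "(- s / t) ^ (snd j ! 0) * t ^ (snd j ! 0) = (- s) ^ (snd j ! 0)"
            using t by (simp flip: power_mult_distrib)
          ultimately have "t\<^sup>2 * (t ^ (fst j ! 0) * (- s / t) ^ (snd j ! 0)) = (- s) ^ (snd j ! 0) * t ^ E j"
            by (metis mult.assoc mult.commute)
          then show ?thesis using t by (simp add: field_simps)
        qed
        finally show "c j * monomial_fun n j (x, y) = (1 / t\<^sup>2) * ((c j * (- s) ^ (snd j ! 0) * \<tau> ^ weight n j) * t ^ E j)"
          by simp
      qed
      also have "\<dots> = (1 / t\<^sup>2) * (\<Sum>j\<in>normal_exps n. (c j * (- s) ^ (snd j ! 0) * \<tau> ^ weight n j) * t ^ E j)"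
        by (simp only: sum_distrib_left)
      finally show ?thesis using t by simp
    qed
    from sum_powers_zero[of "normal_exps n" "\<lambda>j. c j * (- s) ^ (snd j ! 0) * \<tau> ^ weight n j" E "E j0", OF _ this]
    have "0 = (\<Sum>j\<in>G. c j * (- s) ^ (snd j ! 0) * \<tau> ^ weight n j)" by (simp add: G_def)
    also have "\<dots> = (\<Sum>j\<in>G. (- s) ^ (snd j0 ! 0) * (c j * \<tau> ^ weight n j))"
      using Edet by (intro sum.cong) (auto simp: G_def)
    also have "\<dots> = (- s) ^ (snd j0 ! 0) * (\<Sum>j\<in>G. c j * \<tau> ^ weight n j)" by (simp only: sum_distrib_left)
    finally show ?thesis using s by simp
  qed
  have "finite G" by (simp add: G_def)
  from sum_powers_zero[OF this tau, of "weight n j0"] have "(\<Sum>j\<in>{j \<in> G. weight n j = weight n j0}. c j) = 0" by simp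
  moreover have "{j \<in> G. weight n j = weight n j0} = {j0}"
  proof
    show "{j \<in> G. weight n j = weight n j0} \<subseteq> {j0}"
    proof
      fix j assume "j \<in> {j \<in> G. weight n j = weight n j0}"
      then have j: "j \<in> normal_exps n" "E j = E j0" "weight n j = weight n j0" by (simp_all add: G_def)
      have "j = j0" by (rule weight_inj[OF _ _ n0 j(3)]) (use j j0 sub Edet[OF j(1,2)] in auto)
      then show "j \<in> {j0}" by simp
    qed
  qed (use j0 in \<open>simp add: G_def\<close>)
  ultimately show "c j0 = 0" by simp
qed

lemma T_variety: "T \<subseteq> ortho_variety n"
  by (auto simp: orthonormal_pairs_def)

text \<open>Reduce to normal monomials; by independence all coefficients of the remainder
  vanish.\<close>
lemma vanishing_imp_ideal:
  assumes p: "p \<in> biforms n 2 2" and 0: "\<And>z. z \<in> T \<Longrightarrow> poly_eval p z = 0"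
  shows "p \<in> ortho_ideal n"
proof -
  have n0: "0 < n" using n3 by simp
  obtain c where c: "p - (\<Sum>j\<in>normal_exps n. const_poly (c j) * mpoly n j) \<in> ortho_ideal n"
    using reducible_biform[OF n0 p] by (auto simp: reducible_def)
  have "(\<Sum>j\<in>normal_exps n. c j * monomial_fun n j z) = 0" if "z \<in> T" for z
    using poly_eval_ortho_ideal[OF c, of z] that T_variety 0[OF that]
    by (auto simp: poly_eval_diff poly_eval_sum poly_eval_mult poly_eval_mpoly)
  then have "c j = 0" if "j \<in> normal_exps n" for j using lin_indepD[OF lin_indep_normal _ that] by blast
  then have "(\<Sum>j\<in>normal_exps n. const_poly (c j) * mpoly n j) = 0" by (simp add: const_poly_def)
  then show ?thesis using c by simp
qed

lemma bihom_eq_normal: "f \<in> bihom 2 2 \<longleftrightarrow> f \<in> fspan (normal_exps n) (monomial_fun n)"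
proof
  assume "f \<in> bihom 2 2"
  then show "f \<in> fspan (normal_exps n) (monomial_fun n)"
    unfolding bihom_def
  proof (rule fspan_trans)
    fix j assume j: "j \<in> exponents n 2 \<times> exponents n 2"
    obtain c where c: "mpoly n j - (\<Sum>k\<in>normal_exps n. const_poly (c k) * mpoly n k) \<in> ortho_ideal n"
      using reducible_mpoly[OF _ j] n3 by (auto simp: reducible_def)
    show "monomial_fun n j \<in> fspan (normal_exps n) (monomial_fun n)"
      by (rule fspanI[where c = c])
         (use poly_eval_ortho_ideal[OF c] T_variety in \<open>auto simp: poly_eval_diff poly_eval_sum poly_eval_mult poly_eval_mpoly\<close>)
  qed
next
  assume "f \<in> fspan (normal_exps n) (monomial_fun n)"
  then show "f \<in> bihom 2 2" unfolding bihom_def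
    by (rule fspan_trans) (auto intro: fspan_base simp: normal_exps_def)
qed

end

section \<open>The quotient as a space of functions\<close>

context stiefel
begin

abbreviation B22 :: "rpoly set" where "B22 \<equiv> biforms n 2 2"
abbreviation cls :: "rpoly \<Rightarrow> rpoly set" where "cls \<equiv> biform_class n"

lemma cls_iff: "p \<in> B22 \<Longrightarrow> q \<in> cls p \<longleftrightarrow> q \<in> B22 \<and> p - q \<in> ortho_ideal n"
  by (auto simp: biform_class_def biform_rel_def)

lemma ideal_iff_eval:
  assumes "p \<in> B22" "q \<in> B22"
  shows "p - q \<in> ortho_ideal n \<longleftrightarrow> (\<forall>z\<in>T. poly_eval p z = poly_eval q z)"
proof
  assume "p - q \<in> ortho_ideal n"
  then show "\<forall>z\<in>T. poly_eval p z = poly_eval q z"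
    using poly_eval_ortho_ideal T_variety by (fastforce simp: poly_eval_diff)
next
  assume "\<forall>z\<in>T. poly_eval p z = poly_eval q z"
  then show "p - q \<in> ortho_ideal n"
    using assms by (intro vanishing_imp_ideal biforms_diff) (auto simp: poly_eval_diff)
qed

text \<open>This is what makes the quotient a space of functions on $T$.\<close>
lemma cls_eq_iff:
  assumes "p \<in> B22" "q \<in> B22"
  shows "cls p = cls q \<longleftrightarrow> (\<forall>z\<in>T. poly_eval p z = poly_eval q z)"
proof
  assume "cls p = cls q"
  moreover have "q \<in> cls q" using assms(2) by (simp add: cls_iff)
  ultimately have "p - q \<in> ortho_ideal n" using cls_iff[OF assms(1)] by blast
  then show "\<forall>z\<in>T. poly_eval p z = poly_eval q z" using ideal_iff_eval[OF assms] by blast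
next
  assume "\<forall>z\<in>T. poly_eval p z = poly_eval q z"
  then show "cls p = cls q" using assms by (auto simp: cls_iff ideal_iff_eval)
qed

lemma quotient_iff: "f \<in> biform_quotient n \<longleftrightarrow> (\<exists>p\<in>B22. f = cls p)"
  by (auto simp: biform_quotient_def quotient_def biform_class_def)

lemma Q_eval_cls:
  assumes p: "p \<in> B22" and z: "z \<in> ortho_variety n"
  shows "Q_eval (cls p) z = poly_eval p z"
proof -
  have "(\<lambda>q. poly_eval q z) ` cls p = {poly_eval p z}"
  proof (intro equalityI subsetI)
    fix r assume "r \<in> (\<lambda>q. poly_eval q z) ` cls p"
    then obtain q where "q \<in> cls p" "r = poly_eval q z" by blast
    then show "r \<in> {poly_eval p z}" using poly_eval_ortho_ideal[of "p - q" n z] z cls_iff[OF p] by (simp add: poly_eval_diff)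
  next
    fix r assume "r \<in> {poly_eval p z}"
    moreover have "p \<in> cls p" using p by (simp add: cls_iff)
    ultimately show "r \<in> (\<lambda>q. poly_eval q z) ` cls p" by blast
  qed
  then show ?thesis by (simp add: Q_eval_def)
qed

lemma Q_eval_T: "p \<in> B22 \<Longrightarrow> z \<in> T \<Longrightarrow> Q_eval (cls p) z = poly_eval p z"
  using Q_eval_cls T_variety by blast

lemma Q_add_cls:
  assumes "p \<in> B22" "q \<in> B22"
  shows "Q_add n (cls p) (cls q) = cls (p + q)"
proof -
  have "cls (p' + q') = cls (p + q)" if "p' \<in> cls p" "q' \<in> cls q" for p' q'
    using that assms by (subst cls_eq_iff) (auto simp: cls_iff ideal_iff_eval poly_eval_add intro: biforms_add)
  moreover have "p \<in> cls p" "q \<in> cls q" using assms by (simp_all add: cls_iff)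
  ultimately show ?thesis unfolding Q_add_def by blast
qed

lemma Q_smult_cls:
  assumes "p \<in> B22"
  shows "Q_smult n c (cls p) = cls (const_poly c * p)"
proof -
  have "cls (const_poly c * p') = cls (const_poly c * p)" if "p' \<in> cls p" for p'
    using that assms by (subst cls_eq_iff) (auto simp: cls_iff ideal_iff_eval poly_eval_mult intro: biforms_cmult)
  moreover have "p \<in> cls p" using assms by (simp add: cls_iff)
  ultimately show ?thesis unfolding Q_smult_def by blast
qed

lemma Q_integral_cls: "p \<in> B22 \<Longrightarrow> Q_integral n (cls p) = (\<integral>z. poly_eval p z \<partial>\<sigma>)"
  unfolding Q_integral_def by (intro Bochner_Integration.integral_cong) (auto simp: Q_eval_T)

lemma M_inner_cls: "p \<in> B22 \<Longrightarrow> q \<in> B22 \<Longrightarrow> M_inner n (cls p) (cls q) = ip (poly_eval p) (poly_eval q)"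
  unfolding M_inner_def ip_def by (intro Bochner_Integration.integral_cong) (auto simp: Q_eval_T)

lemma poly_eval_biform_sum:
  assumes "p \<in> biforms n a b"
  shows "poly_eval p z = (\<Sum>j\<in>exponents n a \<times> exponents n b. Poly_Mapping.lookup p (mexp n j) * monomial_fun n j z)"
  by (subst biform_decomposition[OF assms]) (simp add: poly_eval_sum poly_eval_mult poly_eval_mpoly)

lemma nice_poly_eval:
  assumes "p \<in> biforms n a b" shows "nice (poly_eval p)"
proof -
  have "poly_eval p = (\<lambda>z. \<Sum>j\<in>exponents n a \<times> exponents n b. Poly_Mapping.lookup p (mexp n j) * monomial_fun n j z)"
    by (rule ext) (rule poly_eval_biform_sum[OF assms])
  then show ?thesis by (simp only:) (intro nice_sum nice_cmult nice_monomial)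
qed

lemma poly_eval_fun:
  "poly_eval (p + q) = (\<lambda>z. poly_eval p z + poly_eval q z)"
  "poly_eval (const_poly c * p) = (\<lambda>z. c * poly_eval p z)"
  "poly_eval 0 = (\<lambda>z. 0)"
  by (rule ext, simp add: poly_eval_add poly_eval_mult)+

lemma poly_eval_bihom: "p \<in> biforms n a b \<Longrightarrow> poly_eval p \<in> bihom a b"
  unfolding bihom_def by (rule fspanI) (erule poly_eval_biform_sum)

lemma bihom_representative:
  assumes "f \<in> bihom a b"
  obtains p where "p \<in> biforms n a b" "\<And>z. z \<in> T \<Longrightarrow> poly_eval p z = f z"
proof -
  obtain c where c: "\<And>z. z \<in> T \<Longrightarrow> f z = (\<Sum>j\<in>exponents n a \<times> exponents n b. c j * monomial_fun n j z)"
    using fspanE[OF assms[unfolded bihom_def]] by blast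
  show thesis
    by (rule that[of "\<Sum>j\<in>exponents n a \<times> exponents n b. const_poly (c j) * mpoly n j"])
       (use c in \<open>auto intro!: biforms_sum biforms_cmult mpoly_biform simp: poly_eval_sum poly_eval_mult poly_eval_mpoly\<close>)
qed

lemma M_set_iff: "f \<in> M_set n \<longleftrightarrow> (\<exists>p\<in>B22. f = cls p \<and> (\<integral>z. poly_eval p z \<partial>\<sigma>) = 0)"
  by (auto simp: M_set_def quotient_iff Q_integral_cls)

text \<open>Both numbers equal $\sum_{i,k}\langle\psi_i,\chi_k\rangle^2$.\<close>
lemma orthonormal_card_eq:
  assumes 1: "orthonormal d \<psi>" and 2: "orthonormal e \<chi>"
    and 12: "\<And>i. i < d \<Longrightarrow> \<psi> i \<in> fspan {..<e} \<chi>" and 21: "\<And>i. i < e \<Longrightarrow> \<chi> i \<in> fspan {..<d} \<psi>"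
  shows "d = e"
proof -
  have P: "(\<Sum>k<e. (ip (\<psi> i) (\<chi> k))\<^sup>2) = 1"
    if "orthonormal d \<psi>" "orthonormal e \<chi>" "\<psi> i \<in> fspan {..<e} \<chi>" "i < d" for d e i and \<psi> \<chi> :: "nat \<Rightarrow> _"
  proof -
    note h = that
    obtain c where c: "\<And>z. z \<in> T \<Longrightarrow> \<psi> i z = (\<Sum>k<e. c k * \<chi> k z)" using fspanE[OF h(3)] by blast
    have "(\<Sum>k<e. (ip (\<psi> i) (\<chi> k))\<^sup>2) = (\<Sum>k<e. (c k)\<^sup>2)"
      by (intro sum.cong refl) (simp add: orthonormal_coeff[OF that(2) c])
    also have "\<dots> = (\<integral>z. (\<psi> i z)\<^sup>2 \<partial>\<sigma>)" by (rule orthonormal_norm[OF that(2) c, symmetric])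
    also have "\<dots> = 1" using that(1,4) by (simp add: orthonormal_def ip_def power2_eq_square)
    finally show ?thesis .
  qed
  have "real d = (\<Sum>i<d. \<Sum>k<e. (ip (\<psi> i) (\<chi> k))\<^sup>2)" using P[OF 1 2 12] by simp
  also have "\<dots> = (\<Sum>k<e. \<Sum>i<d. (ip (\<chi> k) (\<psi> i))\<^sup>2)" by (subst sum.swap) (simp add: ip_sym)
  also have "\<dots> = real e" using P[OF 2 1 21] by simp
  finally show ?thesis by simp
qed

definition dimM :: nat where "dimM = card (normal_exps n) - 1"

text \<open>Subtracting their means from the normal monomials and orthonormalizing gives functions
  that together with the constant $1$ form an orthonormal basis of all biforms; comparing with a
  basis obtained from the independent normal monomials determines their number.\<close>
lemma mean_zero_basis:
  obtains \<psi> where "orthonormal dimM \<psi>" "\<And>i. i < dimM \<Longrightarrow> \<psi> i \<in> bihom 2 2" "\<And>i. i < dimM \<Longrightarrow> (\<integral>z. \<psi> i z \<partial>\<sigma>) = 0"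
    "\<And>f. f \<in> bihom 2 2 \<Longrightarrow> (\<integral>z. f z \<partial>\<sigma>) = 0 \<Longrightarrow> f \<in> fspan {..<dimM} \<psi>" "card (normal_exps n) = Suc dimM"
proof -
  let ?J = "normal_exps n" and ?m = "monomial_fun n"
  define \<mu> where "\<mu> j = (\<integral>z. ?m j z \<partial>\<sigma>)" for j
  define m' where "m' j = (\<lambda>z. ?m j z - \<mu> j)" for j
  have nm': "nice (m' j)" for j unfolding m'_def by (intro nice_diff nice_monomial) simp
  have im': "(\<integral>z. m' j z \<partial>\<sigma>) = 0" for j
    unfolding m'_def \<mu>_def using nice_integrable[OF nice_monomial] S.prob_space by simp
  obtain d \<psi> where d: "orthonormal d \<psi>" "\<And>i. i < d \<Longrightarrow> \<psi> i \<in> fspan ?J m'" "\<And>j. j \<in> ?J \<Longrightarrow> m' j \<in> fspan {..<d} \<psi>"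
    using orthonormal_basis_exists[of ?J m', OF finite_normal_exps nm'] by blast
  have i\<psi>: "(\<integral>z. \<psi> i z \<partial>\<sigma>) = 0" if "i < d" for i
  proof -
    note h = that
    obtain c where c: "\<And>z. z \<in> T \<Longrightarrow> \<psi> i z = (\<Sum>j\<in>?J. c j * m' j z)" using fspanE[OF d(2)[OF h]] by blast
    have "(\<integral>z. \<psi> i z \<partial>\<sigma>) = (\<integral>z. (\<Sum>j\<in>?J. c j * m' j z) \<partial>\<sigma>)" using c by (intro Bochner_Integration.integral_cong) auto
    also have "\<dots> = (\<Sum>j\<in>?J. c j * (\<integral>z. m' j z \<partial>\<sigma>))"
      by (subst Bochner_Integration.integral_sum) (auto intro!: nice_integrable nice_cmult nm')
    finally show ?thesis by (simp add: im')
  qed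
  have m'b: "m' j \<in> bihom 2 2" if "j \<in> ?J" for j
  proof -
    have "?m j \<in> bihom 2 2" unfolding bihom_eq_normal using that by (intro fspan_base) auto
    then have "(\<lambda>z. ?m j z + (- \<mu> j) * 1) \<in> bihom 2 2"
      unfolding bihom_def by (rule fspan_add) (rule fspan_cmult[OF bihom_norm_one[unfolded bihom_def]])
    then show ?thesis by (simp add: m'_def)
  qed
  have \<psi>b: "\<psi> i \<in> bihom 2 2" if "i < d" for i
    using fspan_trans[OF d(2)[OF that] m'b[unfolded bihom_def]] by (simp add: bihom_def)
  define \<psi>' where "\<psi>' = \<psi>(d := (\<lambda>z. 1))"
  have on': "orthonormal (Suc d) \<psi>'"
  proof -
    have "ip (\<lambda>z. 1) (\<lambda>z. 1) = 1" using S.prob_space by (simp add: ip_def)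
    moreover have "ip (\<psi> i) (\<lambda>z. 1) = 0" "ip (\<lambda>z. 1) (\<psi> i) = 0" if "i < d" for i using i\<psi>[OF that] by (simp_all add: ip_def)
    ultimately show ?thesis using d(1) unfolding orthonormal_def \<psi>'_def by (auto simp: less_Suc_eq)
  qed
  have old: "\<psi>' i = \<psi> i" if "i < d" for i using that by (simp add: \<psi>'_def)
  have sub: "f \<in> fspan {..<Suc d} \<psi>'" if "f \<in> fspan {..<d} \<psi>" for f
    by (rule fspan_trans[OF that]) (use old fspan_base[of "{..<Suc d}" _ \<psi>'] in \<open>metis finite_lessThan lessThan_iff less_SucI\<close>)
  have one: "(\<lambda>z. 1) \<in> fspan {..<Suc d} \<psi>'" using fspan_base[of "{..<Suc d}" d \<psi>'] by (simp add: \<psi>'_def)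
  have mj: "?m j \<in> fspan {..<Suc d} \<psi>'" if "j \<in> ?J" for j
    by (rule fspan_cong[OF fspan_add[OF sub[OF d(3)[OF that]] fspan_cmult[OF one, of "\<mu> j"]]]) (simp add: m'_def)
  have Fsub: "f \<in> fspan {..<Suc d} \<psi>'" if "f \<in> bihom 2 2" for f
    using fspan_trans[OF that[unfolded bihom_eq_normal] mj] by simp
  obtain \<chi> where \<chi>: "orthonormal (card ?J) \<chi>" "\<And>i. i < card ?J \<Longrightarrow> \<chi> i \<in> fspan ?J ?m" "\<And>j. j \<in> ?J \<Longrightarrow> ?m j \<in> fspan {..<card ?J} \<chi>"
    using orthonormal_basis_exists[of ?J ?m, OF finite_normal_exps nice_monomial] lin_indep_normal by blast
  have "card ?J = Suc d"
  proof (rule orthonormal_card_eq[OF \<chi>(1) on'])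
    show "\<chi> i \<in> fspan {..<Suc d} \<psi>'" if "i < card ?J" for i
      using Fsub \<chi>(2)[OF that] bihom_eq_normal by blast
    show "\<psi>' i \<in> fspan {..<card ?J} \<chi>" if "i < Suc d" for i
    proof (rule fspan_trans[OF _ \<chi>(3)])
      show "\<psi>' i \<in> fspan ?J ?m"
      proof (cases "i = d")
        case True
        then show ?thesis using bihom_norm_one unfolding bihom_eq_normal by (simp add: \<psi>'_def)
      next
        case False
        then show ?thesis using \<psi>b[of i] that unfolding bihom_eq_normal by (simp add: \<psi>'_def)
      qed
    qed
  qed
  then have dd: "dimM = d" and cE: "card ?J = Suc dimM" by (simp_all add: dimM_def)
  show thesis
  proof (rule that[of \<psi>])
    fix f assume f: "f \<in> bihom 2 2" "(\<integral>z. f z \<partial>\<sigma>) = 0"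
    obtain c where c: "\<And>z. z \<in> T \<Longrightarrow> f z = (\<Sum>i<Suc d. c i * \<psi>' i z)" using fspanE[OF Fsub[OF f(1)]] by blast
    have "c d = ip f (\<psi>' d)" using orthonormal_coeff[OF on' c, of d] by simp
    also have "\<dots> = 0" using f(2) by (simp add: ip_def \<psi>'_def)
    finally have "c d = 0" .
    then show "f \<in> fspan {..<dimM} \<psi>" unfolding dd by (intro fspanI[where c = c]) (simp add: c old)
  qed (use d(1) \<psi>b i\<psi> cE dd in auto)
qed

lemma dimM_formula: "int dimM = (int ((n + 1) choose 2))\<^sup>2 - (int n)\<^sup>2 - 1"
proof -
  obtain \<psi> :: "nat \<Rightarrow> real vec \<times> real vec \<Rightarrow> real" where "card (normal_exps n) = Suc dimM" using mean_zero_basis by blast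
  moreover have "card (normal_exps n) + n\<^sup>2 = ((n + 1) choose 2)\<^sup>2" using n3 by (intro card_normal_exps) simp
  ultimately have "Suc dimM + n\<^sup>2 = ((n + 1) choose 2)\<^sup>2" by simp
  then have "int (Suc dimM + n\<^sup>2) = int (((n + 1) choose 2)\<^sup>2)" by (rule arg_cong)
  then show ?thesis by simp
qed

section \<open>The module structure\<close>

lemma M_add_closed: "f \<in> M_set n \<Longrightarrow> g \<in> M_set n \<Longrightarrow> Q_add n f g \<in> M_set n"
  unfolding M_set_iff
  by (elim bexE conjE) (auto intro!: bexI[OF _ biforms_add] simp: Q_add_cls poly_eval_fun nice_integrable nice_poly_eval)

lemma M_smult_closed: "f \<in> M_set n \<Longrightarrow> Q_smult n c f \<in> M_set n"
  unfolding M_set_iff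
  by (elim bexE conjE) (auto intro!: bexI[OF _ biforms_cmult] simp: Q_smult_cls poly_eval_fun)

lemma M_zero: "cls 0 \<in> M_set n"
  unfolding M_set_iff by (rule bexI[of _ 0]) (auto simp: poly_eval_fun)

lemma M_setE:
  assumes "f \<in> M_set n"
  obtains p where "p \<in> B22" "f = cls p" "(\<integral>z. poly_eval p z \<partial>\<sigma>) = 0"
  using assms by (auto simp: M_set_iff)

lemma abelian_group_M: "abelian_group (M_space n)"
proof (rule abelian_groupI)
  show "\<exists>y\<in>carrier (M_space n). y \<oplus>\<^bsub>M_space n\<^esub> x = \<zero>\<^bsub>M_space n\<^esub>" if x: "x \<in> carrier (M_space n)" for x
  proof -
    have xM: "x \<in> M_set n" using x by (simp add: M_space_def)
    obtain p where p: "p \<in> B22" "x = cls p" "(\<integral>z. poly_eval p z \<partial>\<sigma>) = 0" using M_setE[OF xM] by blast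
    have "Q_smult n (-1) x \<in> M_set n" using x by (intro M_smult_closed) (simp add: M_space_def)
    moreover have "Q_add n (Q_smult n (-1) x) x = cls 0"
      using p(1) biforms_cmult[OF p(1), of "-1"] by (simp add: p(2) Q_smult_cls Q_add_cls const_poly_minus1)
    ultimately show ?thesis by (auto simp: M_space_def)
  qed
qed (auto simp: M_space_def M_add_closed M_zero Q_add_cls biforms_add add_ac elim!: M_setE)

lemma vectorspace_M: "vectorspace class_ring (M_space n)"
proof -
  have "module class_ring (M_space n)"
    by (rule moduleI[OF _ abelian_group_M])
       (auto simp: M_space_def M_add_closed M_smult_closed Q_add_cls Q_smult_cls biforms_add biforms_cmult const_poly_add[symmetric]
          const_poly_mult[symmetric] const_poly_1 distrib_left distrib_right mult.assoc class_cring.is_cring elim!: M_setE)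
  then show ?thesis by (intro vectorspace.intro class_field)
qed

definition rep_sum :: "(nat \<Rightarrow> rpoly) \<Rightarrow> nat \<Rightarrow> real vec \<Rightarrow> rpoly" where
  "rep_sum P d u = (\<Sum>i<d. const_poly (u $ i) * P i)"

lemma poly_eval_rep_sum: "poly_eval (rep_sum P d u) z = (\<Sum>i<d. u $ i * poly_eval (P i) z)"
  by (simp add: rep_sum_def poly_eval_sum poly_eval_mult)

text \<open>The coordinates with respect to an orthonormal basis of mean zero biforms define a
  linear isometry onto $\mathcal M$; this transports the dimension.\<close>
lemma isometry_and_dim: "dim_M n = dimM \<and> (\<exists>\<phi>. is_linear_isometry n \<phi>)"
proof -
  obtain \<psi> where \<psi>: "orthonormal dimM \<psi>" "\<And>i. i < dimM \<Longrightarrow> \<psi> i \<in> bihom 2 2" "\<And>i. i < dimM \<Longrightarrow> (\<integral>z. \<psi> i z \<partial>\<sigma>) = 0"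
    "\<And>f. f \<in> bihom 2 2 \<Longrightarrow> (\<integral>z. f z \<partial>\<sigma>) = 0 \<Longrightarrow> f \<in> fspan {..<dimM} \<psi>"
    "card (normal_exps n) = Suc dimM"
    by (rule mean_zero_basis) (rule that)
  let ?d = dimM
  define P where "P i = (SOME p. p \<in> B22 \<and> (\<forall>z\<in>T. poly_eval p z = \<psi> i z))" for i
  have P: "P i \<in> B22" "z \<in> T \<Longrightarrow> poly_eval (P i) z = \<psi> i z" if i: "i < ?d" for i z
  proof -
    obtain p where "p \<in> B22" "\<And>z. z \<in> T \<Longrightarrow> poly_eval p z = \<psi> i z" by (rule bihom_representative[OF \<psi>(2)[OF i]]) (rule that)
    then have "p \<in> B22 \<and> (\<forall>z\<in>T. poly_eval p z = \<psi> i z)" by (intro conjI ballI)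
    then have "P i \<in> B22 \<and> (\<forall>z\<in>T. poly_eval (P i) z = \<psi> i z)" unfolding P_def by (rule someI)
    then show "P i \<in> B22" "z \<in> T \<Longrightarrow> poly_eval (P i) z = \<psi> i z" by blast+
  qed
  define R where "R u = rep_sum P ?d u" for u
  have RB: "R u \<in> B22" for u unfolding R_def rep_sum_def by (intro biforms_sum biforms_cmult P) auto
  have Re: "poly_eval (R u) z = (\<Sum>i<?d. u $ i * \<psi> i z)" if "z \<in> T" for u z
    using that P by (simp add: R_def poly_eval_rep_sum)
  have R0: "(\<integral>z. poly_eval (R u) z \<partial>\<sigma>) = 0" for u
  proof -
    have "(\<integral>z. poly_eval (R u) z \<partial>\<sigma>) = (\<integral>z. (\<Sum>i<?d. u $ i * \<psi> i z) \<partial>\<sigma>)" using Re by (intro Bochner_Integration.integral_cong) auto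
    also have "\<dots> = (\<Sum>i<?d. u $ i * (\<integral>z. \<psi> i z \<partial>\<sigma>))"
      using \<psi>(1) by (subst Bochner_Integration.integral_sum) (auto intro!: nice_integrable nice_cmult simp: orthonormal_def)
    finally show ?thesis using \<psi>(3) by simp
  qed
  define \<phi> where "\<phi> u = cls (R u)" for u
  have \<phi>M: "\<phi> u \<in> M_set n" for u unfolding M_set_iff \<phi>_def using RB R0 by blast
  have hom: "\<phi> \<in> module_hom class_ring (module_vec TYPE(real) ?d) (M_space n)"
    unfolding module_hom_def
  proof (intro CollectI conjI ballI allI impI)
    show "\<phi> \<in> carrier (module_vec TYPE(real) ?d) \<rightarrow> carrier (M_space n)" using \<phi>M by (simp add: M_space_def)
    fix u v :: "real vec" assume "u \<in> carrier (module_vec TYPE(real) ?d) \<and> v \<in> carrier (module_vec TYPE(real) ?d)"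
    then have uv: "u \<in> carrier_vec ?d" "v \<in> carrier_vec ?d" by (simp_all add: module_vec_simps)
    have "cls (R (u + v)) = cls (R u + R v)"
      using uv by (subst cls_eq_iff) (auto simp: RB biforms_add poly_eval_add Re distrib_right sum.distrib)
    then show "\<phi> (u \<oplus>\<^bsub>module_vec TYPE(real) ?d\<^esub> v) = \<phi> u \<oplus>\<^bsub>M_space n\<^esub> \<phi> v"
      by (simp add: \<phi>_def M_space_def Q_add_cls RB module_vec_simps)
  next
    fix r :: real and u :: "real vec" assume "r \<in> carrier class_ring \<and> u \<in> carrier (module_vec TYPE(real) ?d)"
    then have uv: "u \<in> carrier_vec ?d" by (simp_all add: module_vec_simps)
    have "cls (R (r \<cdot>\<^sub>v u)) = cls (const_poly r * R u)"
      using uv by (subst cls_eq_iff) (auto simp: RB biforms_cmult poly_eval_mult Re sum_distrib_left mult.assoc)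
    then show "\<phi> (r \<odot>\<^bsub>module_vec TYPE(real) ?d\<^esub> u) = r \<odot>\<^bsub>M_space n\<^esub> \<phi> u"
      by (simp add: \<phi>_def M_space_def Q_smult_cls RB module_vec_simps)
  qed
  have lin: "linear_map class_ring (module_vec TYPE(real) ?d) (M_space n) \<phi>"
    by (intro linear_map.intro mod_hom.intro vectorspace_M vec_vs mod_hom_axioms.intro hom)
       (use vectorspace_M vec_vs[of ?d] in \<open>auto simp: vectorspace_def\<close>)
  have iso: "M_inner n (\<phi> u) (\<phi> v) = u \<bullet> v" if "u \<in> carrier_vec ?d" "v \<in> carrier_vec ?d" for u v
  proof -
    have n\<psi>: "nice (\<psi> i)" if "i < ?d" for i using \<psi>(1) that by (simp add: orthonormal_def)
    have "M_inner n (\<phi> u) (\<phi> v) = ip (\<lambda>z. \<Sum>i<?d. u $ i * \<psi> i z) (\<lambda>z. \<Sum>i<?d. v $ i * \<psi> i z)"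
      unfolding \<phi>_def M_inner_cls[OF RB RB] using Re by (intro ip_cong) auto
    also have "\<dots> = (\<Sum>i<?d. u $ i * ip (\<psi> i) (\<lambda>z. \<Sum>i<?d. v $ i * \<psi> i z))"
      by (intro ip_sum_left nice_sum nice_cmult n\<psi>) auto
    also have "\<dots> = (\<Sum>i<?d. u $ i * v $ i)"
      using orthonormal_coeff[OF \<psi>(1) refl] by (intro sum.cong refl) (simp add: ip_sym[of "\<psi> _"])
    finally show ?thesis using that by (simp add: scalar_prod_sum[of _ ?d])
  qed
  have inj: "inj_on \<phi> (carrier_vec ?d)"
  proof (rule inj_onI)
    fix u v :: "real vec" assume uv: "u \<in> carrier_vec ?d" "v \<in> carrier_vec ?d" and e: "\<phi> u = \<phi> v"
    have "(\<Sum>i<?d. u $ i * \<psi> i z) = (\<Sum>i<?d. v $ i * \<psi> i z)" if "z \<in> T" for z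
    proof -
      have "poly_eval (R u) z = poly_eval (R v) z" using e cls_eq_iff[OF RB RB, of u v] that by (simp add: \<phi>_def)
      then show ?thesis unfolding Re[OF that] .
    qed
    then have "u $ k = v $ k" if "k < ?d" for k
      using orthonormal_coeff[OF \<psi>(1), of "\<lambda>z. \<Sum>i<?d. u $ i * \<psi> i z" "\<lambda>i. u $ i" k]
        orthonormal_coeff[OF \<psi>(1), of "\<lambda>z. \<Sum>i<?d. u $ i * \<psi> i z" "\<lambda>i. v $ i" k] that by simp
    then show "u = v" using uv by (intro eq_vecI) auto
  qed
  have surj: "\<phi> ` carrier_vec ?d = M_set n"
  proof (intro equalityI subsetI)
    fix f assume "f \<in> M_set n"
    then obtain p where p: "p \<in> B22" "f = cls p" "(\<integral>z. poly_eval p z \<partial>\<sigma>) = 0" by (rule M_setE)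
    obtain c where c: "\<And>z. z \<in> T \<Longrightarrow> poly_eval p z = (\<Sum>i<?d. c i * \<psi> i z)"
      using fspanE[OF \<psi>(4)[OF poly_eval_bihom[OF p(1)] p(3)]] by blast
    have "f = \<phi> (Matrix.vec ?d c)"
      unfolding p(2) \<phi>_def using p(1) RB c by (subst cls_eq_iff) (auto simp: Re)
    then show "f \<in> \<phi> ` carrier_vec ?d" by simp
  qed (use \<phi>M in auto)
  interpret vs: vec_space "TYPE(real)" ?d .
  have "vectorspace.dim class_ring (module_vec TYPE(real) ?d) = vectorspace.dim class_ring (M_space n)"
    by (rule linear_map.dim_eq[OF lin]) (use vs.fin_dim inj surj in \<open>simp_all add: module_vec_simps M_space_def\<close>)
  then have dim: "dim_M n = ?d" using vs.dim_is_n by (simp add: dim_M_def)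
  have "is_linear_isometry n \<phi>" unfolding is_linear_isometry_def dim using lin iso by blast
  then show ?thesis using dim by blast
qed

end

section \<open>Volumes of balls, caps and nets\<close>

abbreviation vnorm :: "real vec \<Rightarrow> real" where "vnorm v \<equiv> sqrt (v \<bullet> v)"

lemma scalar_prod_Cauchy:
  assumes "u \<in> carrier_vec n" "v \<in> carrier_vec n"
  shows "\<bar>u \<bullet> v\<bar> \<le> vnorm u * vnorm v"
proof -
  have "(u \<bullet> v)\<^sup>2 \<le> (u \<bullet> u) * (v \<bullet> v)" using gram_nonneg[of "(u, v)" n] assms by (simp add: gram_def)
  then have "sqrt ((u \<bullet> v)\<^sup>2) \<le> sqrt ((u \<bullet> u) * (v \<bullet> v))" by (rule real_sqrt_le_mono)
  then show ?thesis by (simp add: real_sqrt_mult)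
qed

lemma vnorm_triangle:
  assumes "u \<in> carrier_vec n" "v \<in> carrier_vec n"
  shows "vnorm (u + v) \<le> vnorm u + vnorm v"
proof (rule real_le_lsqrt)
  have "(u + v) \<bullet> (u + v) = u \<bullet> u + 2 * (u \<bullet> v) + v \<bullet> v"
    using assms comm_scalar_prod[OF assms]
    by (simp add: add_scalar_prod_distrib[of _ n] scalar_prod_add_distrib[of _ n])
  also have "\<dots> \<le> (vnorm u)\<^sup>2 + 2 * (vnorm u * vnorm v) + (vnorm v)\<^sup>2"
    using scalar_prod_Cauchy[OF assms] real_scalar_prod_ge_0[of u] real_scalar_prod_ge_0[of v] by simp
  finally show "(u + v) \<bullet> (u + v) \<le> (vnorm u + vnorm v)\<^sup>2" by (simp add: power2_sum)
qed (use real_scalar_prod_ge_0 in auto)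

lemma vball_iff: "r \<ge> 0 \<Longrightarrow> v \<in> vball n c r \<longleftrightarrow> v \<in> carrier_vec n \<and> vnorm (v - c) \<le> r"
  by (auto simp: vball_def sqrt_le_D intro: real_le_lsqrt real_scalar_prod_ge_0)

lemma vball_0_iff: "v \<in> vball n (0\<^sub>v n) r \<longleftrightarrow> v \<in> carrier_vec n \<and> v \<bullet> v \<le> r\<^sup>2"
  by (auto simp: vball_def)

text \<open>The cap lies in the ball around $ta$ of radius $\sqrt{r^2-t^2}$, and
  $1-s\le e^{-s}$.\<close>
lemma cap_subset_ball:
  assumes a: "a \<in> carrier_vec n" "a \<bullet> a = 1" and t: "t \<ge> 0" and r: "r > 0"
  shows "{u \<in> vball n (0\<^sub>v n) r. u \<bullet> a \<ge> t} \<subseteq> vball n (t \<cdot>\<^sub>v a) (r * exp (- t\<^sup>2 / (2 * r\<^sup>2)))"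
proof
  fix u assume "u \<in> {u \<in> vball n (0\<^sub>v n) r. u \<bullet> a \<ge> t}"
  then have u: "u \<in> carrier_vec n" "u \<bullet> u \<le> r\<^sup>2" "u \<bullet> a \<ge> t" by (auto simp: vball_0_iff)
  have "(u - t \<cdot>\<^sub>v a) \<bullet> (u - t \<cdot>\<^sub>v a) = u \<bullet> u - 2 * t * (u \<bullet> a) + t\<^sup>2"
    using u a comm_scalar_prod[OF u(1) a(1)]
    by (simp add: minus_scalar_prod_distrib[of _ n] scalar_prod_minus_distrib[of _ n] power2_eq_square algebra_simps)
  also have "\<dots> \<le> r\<^sup>2 - 2 * t * t + t\<^sup>2" using u t by (intro add_mono diff_mono mult_left_mono) auto
  also have "\<dots> = r\<^sup>2 * (1 + (- t\<^sup>2 / r\<^sup>2))" using r by (simp add: field_simps power2_eq_square)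
  also have "\<dots> \<le> r\<^sup>2 * exp (- t\<^sup>2 / r\<^sup>2)" by (intro mult_left_mono exp_ge_add_one_self) simp
  also have "\<dots> = (r * exp (- t\<^sup>2 / (2 * r\<^sup>2)))\<^sup>2"
    by (simp add: power_mult_distrib exp_double[symmetric] power2_eq_square[of "exp _"] flip: exp_add)
  finally show "u \<in> vball n (t \<cdot>\<^sub>v a) (r * exp (- t\<^sup>2 / (2 * r\<^sup>2)))" using u by (simp add: vball_def)
qed

text \<open>In dimension $n$ the volume of the enclosing balls decays like a Gaussian in $t$.\<close>
lemma two_caps_measure:
  assumes a: "a \<in> carrier_vec n" "a \<bullet> a = N" "N > 0" and t: "t \<ge> 0" and r: "r > 0"
  shows "emeasure (lborel_vec n) {u \<in> vball n (0\<^sub>v n) r. \<bar>u \<bullet> a\<bar> \<ge> t}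
    \<le> ennreal (2 * (unit_ball_vol n * r ^ n) * exp (- (real n / (2 * r\<^sup>2 * N)) * t\<^sup>2))"
proof -
  define b where "b = (1 / sqrt N) \<cdot>\<^sub>v a"
  have b: "b \<in> carrier_vec n" "b \<bullet> b = 1" using a by (simp_all add: b_def)
  have b': "- b \<in> carrier_vec n" "(- b) \<bullet> (- b) = 1" using b by simp_all
  let ?t = "t / sqrt N" and ?s = "r * exp (- (t / sqrt N)\<^sup>2 / (2 * r\<^sup>2))"
  have s: "?s > 0" using r by simp
  have "{u \<in> vball n (0\<^sub>v n) r. \<bar>u \<bullet> a\<bar> \<ge> t} \<subseteq> vball n (?t \<cdot>\<^sub>v b) ?s \<union> vball n (?t \<cdot>\<^sub>v (- b)) ?s"
  proof
    fix u assume "u \<in> {u \<in> vball n (0\<^sub>v n) r. \<bar>u \<bullet> a\<bar> \<ge> t}"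
    then have u: "u \<in> vball n (0\<^sub>v n) r" "u \<in> carrier_vec n" "\<bar>u \<bullet> a\<bar> \<ge> t" by (auto simp: vball_0_iff)
    have ub: "u \<bullet> b = (u \<bullet> a) / sqrt N" "u \<bullet> (- b) = - (u \<bullet> a) / sqrt N" using u a by (simp_all add: b_def)
    have "u \<bullet> b \<ge> ?t \<or> u \<bullet> (- b) \<ge> ?t"
    proof -
      have "t \<le> u \<bullet> a \<or> t \<le> - (u \<bullet> a)" using u(3) by linarith
      then show ?thesis unfolding ub using a(3) divide_right_mono[of t "u \<bullet> a" "sqrt N"] divide_right_mono[of t "- (u \<bullet> a)" "sqrt N"] by auto
    qed
    then show "u \<in> vball n (?t \<cdot>\<^sub>v b) ?s \<union> vball n (?t \<cdot>\<^sub>v (- b)) ?s"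
      using cap_subset_ball[OF b, of ?t r] cap_subset_ball[OF b', of ?t r] u t a(3) r by auto
  qed
  then have "emeasure (lborel_vec n) {u \<in> vball n (0\<^sub>v n) r. \<bar>u \<bullet> a\<bar> \<ge> t}
    \<le> emeasure (lborel_vec n) (vball n (?t \<cdot>\<^sub>v b) ?s \<union> vball n (?t \<cdot>\<^sub>v (- b)) ?s)"
    using b b' by (intro emeasure_mono) auto
  also have "\<dots> \<le> emeasure (lborel_vec n) (vball n (?t \<cdot>\<^sub>v b) ?s) + emeasure (lborel_vec n) (vball n (?t \<cdot>\<^sub>v (- b)) ?s)"
    using b b' by (intro emeasure_subadditive) auto
  also have "\<dots> = ennreal (2 * (unit_ball_vol n * ?s ^ n))"
    using b b' s by (simp add: emeasure_vball flip: ennreal_plus)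
  also have "?s ^ n = r ^ n * exp (- (real n / (2 * r\<^sup>2 * N)) * t\<^sup>2)"
  proof -
    have "exp (- (t / sqrt N)\<^sup>2 / (2 * r\<^sup>2)) ^ n = exp (real n * (- (t / sqrt N)\<^sup>2 / (2 * r\<^sup>2)))" by (rule exp_of_nat_mult[symmetric])
    also have "real n * (- (t / sqrt N)\<^sup>2 / (2 * r\<^sup>2)) = - (real n / (2 * r\<^sup>2 * N)) * t\<^sup>2"
      using a(3) by (simp add: power_divide field_simps)
    finally show ?thesis by (simp add: power_mult_distrib)
  qed
  finally show ?thesis by (simp add: mult_ac)
qed

text \<open>An odd moment of the Gaussian after rescaling by $\sqrt c$.\<close>
lemma nn_integral_power_exp:
  assumes c: "c > 0" and k: "k \<ge> 1"
  shows "(\<integral>\<^sup>+ t. ennreal (2 * real k * t ^ (2 * k - 1)) * indicator {0..} t * ennreal (exp (- c * t\<^sup>2)) \<partial>lborel) = ennreal (fact k / c ^ k)"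
proof -
  obtain m where m: "k = Suc m" using k by (cases k) auto
  let ?f = "\<lambda>x :: real. ennreal (indicat_real {0..} x *\<^sub>R (exp (- x\<^sup>2) * x ^ (2 * m + 1)))"
  have odd: "x ^ (2 * m + 1) \<ge> 0" if "x \<ge> 0" for x :: real using that by simp
  have I1: "(\<integral>\<^sup>+ x. ?f x \<partial>lborel) = ennreal (fact m / 2)"
    using gaussian_moment_odd_pos[of m] odd
    by (subst nn_integral_eq_integral) (auto simp: has_bochner_integral_iff indicator_def)
  have I2: "(\<integral>\<^sup>+ x. ?f x \<partial>lborel) = ennreal \<bar>sqrt c\<bar> * (\<integral>\<^sup>+ t. ?f (0 + sqrt c * t) \<partial>lborel)"
    using c by (intro nn_integral_real_affine) auto
  have "(\<integral>\<^sup>+ t. ennreal (2 * real k * t ^ (2 * k - 1)) * indicator {0..} t * ennreal (exp (- c * t\<^sup>2)) \<partial>lborel)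
     = (\<integral>\<^sup>+ t. ennreal (2 * real k / sqrt c ^ (2 * m + 1)) * ?f (0 + sqrt c * t) \<partial>lborel)"
  proof (rule nn_integral_cong)
    fix t :: real
    show "ennreal (2 * real k * t ^ (2 * k - 1)) * indicator {0..} t * ennreal (exp (- c * t\<^sup>2)) = ennreal (2 * real k / sqrt c ^ (2 * m + 1)) * ?f (0 + sqrt c * t)"
    proof (cases "t \<ge> 0")
      case True
      have "2 * real k * t ^ (2 * k - 1) * exp (- c * t\<^sup>2) = (2 * real k / sqrt c ^ (2 * m + 1)) * (exp (- (sqrt c * t)\<^sup>2) * (sqrt c * t) ^ (2 * m + 1))"
        using c by (simp add: m power_mult_distrib)
      then show ?thesis using True c by (simp add: ennreal_mult[symmetric])
    next
      case False
      then have "\<not> sqrt c * t \<ge> 0" using c by (simp add: zero_le_mult_iff)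
      then show ?thesis using False by simp
    qed
  qed
  also have "\<dots> = ennreal (2 * real k / sqrt c ^ (2 * m + 1)) * (\<integral>\<^sup>+ t. ?f (0 + sqrt c * t) \<partial>lborel)"
    by (rule nn_integral_cmult) measurable
  finally have I: "(\<integral>\<^sup>+ t. ennreal (2 * real k * t ^ (2 * k - 1)) * indicator {0..} t * ennreal (exp (- c * t\<^sup>2)) \<partial>lborel)
     = ennreal (2 * real k / sqrt c ^ (2 * m + 1)) * (\<integral>\<^sup>+ t. ?f (0 + sqrt c * t) \<partial>lborel)"
    .
  have "(\<integral>\<^sup>+ t. ?f (0 + sqrt c * t) \<partial>lborel) = ennreal (fact m / 2 / sqrt c)"
  proof -
    have "ennreal (sqrt c) * (\<integral>\<^sup>+ t. ?f (0 + sqrt c * t) \<partial>lborel) = ennreal (fact m / 2)"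
      using I1 I2 c by simp
    also have "\<dots> = ennreal (sqrt c) * ennreal (fact m / 2 / sqrt c)" using c by (simp flip: ennreal_mult)
    finally show ?thesis using c by (simp add: ennreal_mult_cancel_left)
  qed
  then have "ennreal (2 * real k / sqrt c ^ (2 * m + 1)) * (\<integral>\<^sup>+ t. ?f (0 + sqrt c * t) \<partial>lborel) = ennreal (2 * real k / sqrt c ^ (2 * m + 1) * (fact m / 2 / sqrt c))"
    using c by (simp flip: ennreal_mult)
  also have "2 * real k / sqrt c ^ (2 * m + 1) * (fact m / 2 / sqrt c) = fact k / (sqrt c ^ (2 * m + 1) * sqrt c)"
    using c by (simp add: m field_simps)
  also have "sqrt c ^ (2 * m + 1) * sqrt c = (sqrt c)\<^sup>2 ^ k" by (simp add: m power_mult power2_eq_square)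
  also have "\<dots> = c ^ k" using c by simp
  finally show ?thesis using I by simp
qed

text \<open>Integrating the Gaussian tail bound for caps over $t$ (layer cake formula) gives the
  moments of a Gaussian variable, up to the factor $2$ for the two caps.\<close>
lemma ball_linear_moment:
  assumes a: "a \<in> carrier_vec n" "a \<bullet> a \<le> N" and N: "N > 0" and r: "r > 0" and k: "k \<ge> 1" and n: "n \<ge> 1"
  shows "(\<integral>\<^sup>+ u. indicator (vball n (0\<^sub>v n) r) u * ennreal ((u \<bullet> a) ^ (2 * k)) \<partial>lborel_vec n)
    \<le> ennreal (2 * (unit_ball_vol n * r ^ n) * (fact k * (2 * r\<^sup>2 * N / real n) ^ k))"
proof (cases "a \<bullet> a = 0")
  case True
  then have "a = 0\<^sub>v n" using real_scalar_prod_eq_0_iff[OF a(1)] by simp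
  then have "(\<integral>\<^sup>+ u. indicator (vball n (0\<^sub>v n) r) u * ennreal ((u \<bullet> a) ^ (2 * k)) \<partial>lborel_vec n) = (\<integral>\<^sup>+ u. 0 \<partial>lborel_vec n)"
    using k by (intro nn_integral_cong) (auto simp: power_0_left)
  then show ?thesis by simp
next
  case False
  define A where "A = a \<bullet> a"
  have A: "A > 0" "A \<le> N" using False a real_scalar_prod_ge_0[of a] by (auto simp: A_def)
  interpret sigma_finite_measure "lborel_vec n" by (rule sigma_finite_lborel_vec)
  interpret P: pair_sigma_finite "lborel_vec n" "lborel :: real measure" ..
  let ?B = "vball n (0\<^sub>v n) r" and ?h = "\<lambda>t :: real. ennreal (2 * real k * t ^ (2 * k - 1)) * indicator {0..} t"
  let ?c = "real n / (2 * r\<^sup>2 * A)" and ?V = "2 * (unit_ball_vol n * r ^ n)"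
  have V: "?V \<ge> 0" using r by simp
  have am: "(\<lambda>u. u \<bullet> a) \<in> borel_measurable (lborel_vec n)"
    by (intro measurable_scalar_prod[of _ _ n] measurable_const measurable_ident_sets) (use a in auto)
  have lc: "ennreal (s ^ (2 * k)) = (\<integral>\<^sup>+ t. ?h t * (if t \<le> \<bar>s\<bar> then 1 else 0) \<partial>lborel)" for s :: real
  proof -
    have "(\<integral>\<^sup>+ t. ennreal (2 * real k * t ^ (2 * k - 1)) * indicator {0..\<bar>s\<bar>} t \<partial>lborel) = ennreal (\<bar>s\<bar> ^ (2 * k) - 0 ^ (2 * k))"
      using k by (intro nn_integral_FTC_Icc) (auto intro!: derivative_eq_intros)
    also have "\<bar>s\<bar> ^ (2 * k) - 0 ^ (2 * k) = s ^ (2 * k)" using k by (simp add: power_even_abs power_0_left)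
    finally have "ennreal (s ^ (2 * k)) = (\<integral>\<^sup>+ t. ennreal (2 * real k * t ^ (2 * k - 1)) * indicator {0..\<bar>s\<bar>} t \<partial>lborel)" ..
    also have "\<dots> = (\<integral>\<^sup>+ t. ?h t * (if t \<le> \<bar>s\<bar> then 1 else 0) \<partial>lborel)"
      by (intro nn_integral_cong) (auto simp: indicator_def)
    finally show ?thesis .
  qed
  have jm: "(\<lambda>p. indicator ?B (fst p) * (?h (snd p) * (if snd p \<le> \<bar>fst p \<bullet> a\<bar> then 1 else 0)) :: ennreal) \<in> borel_measurable (lborel_vec n \<Otimes>\<^sub>M lborel)"
  proof -
    have 1: "(\<lambda>p. fst p \<bullet> a) \<in> borel_measurable (lborel_vec n \<Otimes>\<^sub>M (lborel :: real measure))"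
      by (rule measurable_compose[OF measurable_fst am])
    have 2: "(\<lambda>p. indicator ?B (fst p) :: ennreal) \<in> borel_measurable (lborel_vec n \<Otimes>\<^sub>M (lborel :: real measure))"
      by (rule measurable_compose[OF measurable_fst]) auto
    note [measurable] = 1 2
    show ?thesis by measurable
  qed
  have "(\<integral>\<^sup>+ u. indicator ?B u * ennreal ((u \<bullet> a) ^ (2 * k)) \<partial>lborel_vec n)
      = (\<integral>\<^sup>+ u. (\<integral>\<^sup>+ t. indicator ?B u * (?h t * (if t \<le> \<bar>u \<bullet> a\<bar> then 1 else 0)) \<partial>lborel) \<partial>lborel_vec n)"
    unfolding lc by (intro nn_integral_cong nn_integral_cmult[symmetric]) measurable
  also have "\<dots> = (\<integral>\<^sup>+ t. (\<integral>\<^sup>+ u. indicator ?B u * (?h t * (if t \<le> \<bar>u \<bullet> a\<bar> then 1 else 0)) \<partial>lborel_vec n) \<partial>lborel)"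
    using P.Fubini'[of "\<lambda>u t. indicator ?B u * (?h t * (if t \<le> \<bar>u \<bullet> a\<bar> then 1 else 0))"] jm by (simp add: case_prod_beta)
  also have "\<dots> \<le> (\<integral>\<^sup>+ t. ennreal ?V * (?h t * ennreal (exp (- ?c * t\<^sup>2))) \<partial>lborel)"
  proof (rule nn_integral_mono)
    fix t :: real
    show "(\<integral>\<^sup>+ u. indicator ?B u * (?h t * (if t \<le> \<bar>u \<bullet> a\<bar> then 1 else 0)) \<partial>lborel_vec n) \<le> ennreal ?V * (?h t * ennreal (exp (- ?c * t\<^sup>2)))"
    proof (cases "t \<ge> 0")
      case True
      let ?S = "{u \<in> ?B. \<bar>u \<bullet> a\<bar> \<ge> t}"
      have S: "?S \<in> sets (lborel_vec n)"
      proof -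
        have "{u \<in> space (lborel_vec n). \<bar>u \<bullet> a\<bar> \<ge> t} \<in> sets (lborel_vec n)" using am by measurable
        moreover have "?S = ?B \<inter> {u \<in> space (lborel_vec n). \<bar>u \<bullet> a\<bar> \<ge> t}" by (auto simp: vball_def)
        ultimately show ?thesis by auto
      qed
      have "(\<integral>\<^sup>+ u. indicator ?B u * (?h t * (if t \<le> \<bar>u \<bullet> a\<bar> then 1 else 0)) \<partial>lborel_vec n) = (\<integral>\<^sup>+ u. ?h t * indicator ?S u \<partial>lborel_vec n)"
        by (intro nn_integral_cong) (auto simp: indicator_def)
      also have "\<dots> = ?h t * emeasure (lborel_vec n) ?S" using S by (rule nn_integral_cmult_indicator)
      also have "\<dots> \<le> ?h t * ennreal (?V * exp (- ?c * t\<^sup>2))"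
        by (intro mult_left_mono two_caps_measure[OF a(1) A_def[symmetric] A(1) True r]) simp
      also have "\<dots> = ennreal ?V * (?h t * ennreal (exp (- ?c * t\<^sup>2)))"
        unfolding ennreal_mult[OF V order_less_imp_le[OF exp_gt_zero]] by (simp only: mult_ac)
      finally show ?thesis .
    qed simp
  qed
  also have "\<dots> = ennreal ?V * (\<integral>\<^sup>+ t. ?h t * ennreal (exp (- ?c * t\<^sup>2)) \<partial>lborel)"
    by (rule nn_integral_cmult) measurable
  also have "(\<integral>\<^sup>+ t. ?h t * ennreal (exp (- ?c * t\<^sup>2)) \<partial>lborel) = ennreal (fact k / ?c ^ k)"
    using n r A by (intro nn_integral_power_exp k) auto
  also have "ennreal ?V * ennreal (fact k / ?c ^ k) = ennreal (?V * (fact k * (2 * r\<^sup>2 * A / real n) ^ k))"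
    using V n r A by (subst ennreal_mult[symmetric]) (auto simp: power_divide)
  also have "\<dots> \<le> ennreal (?V * (fact k * (2 * r\<^sup>2 * N / real n) ^ k))"
    using A V n by (intro ennreal_leI mult_left_mono power_mono divide_right_mono) auto
  finally show ?thesis .
qed

text \<open>The balls of radius $d/2$ around the points are disjoint and contained in the ball
  of radius $1+d/2$.\<close>
lemma separated_card_bound:
  assumes S: "finite S" "S \<subseteq> vball n (0\<^sub>v n) 1" and d: "d > 0"
    and sep: "\<And>x y. x \<in> S \<Longrightarrow> y \<in> S \<Longrightarrow> x \<noteq> y \<Longrightarrow> vnorm (x - y) > d"
  shows "real (card S) \<le> (1 + 2 / d) ^ n"
proof -
  let ?L = "lborel_vec n" and ?w = "unit_ball_vol (real n)"
  have Sc: "x \<in> carrier_vec n" "vnorm x \<le> 1" if "x \<in> S" for x using S that by (auto simp: vball_0_iff)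
  have disj: "disjoint_family_on (\<lambda>x. vball n x (d / 2)) S"
    unfolding disjoint_family_on_def
  proof (intro ballI impI)
    fix x y assume xy: "x \<in> S" "y \<in> S" "x \<noteq> y"
    show "vball n x (d / 2) \<inter> vball n y (d / 2) = {}"
    proof (rule ccontr)
      assume "vball n x (d / 2) \<inter> vball n y (d / 2) \<noteq> {}"
      then obtain v where "v \<in> vball n x (d / 2)" "v \<in> vball n y (d / 2)" by blast
      then have v: "v \<in> carrier_vec n" "vnorm (v - x) \<le> d / 2" "vnorm (v - y) \<le> d / 2" using d by (auto simp: vball_iff)
      note c = carrier_vecD[OF v(1)] carrier_vecD[OF Sc(1)[OF xy(1)]] carrier_vecD[OF Sc(1)[OF xy(2)]]
      have "x - y = (v - y) + (- 1) \<cdot>\<^sub>v (v - x)" by (intro eq_vecI) (simp_all add: c)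
      moreover have "vnorm ((- 1) \<cdot>\<^sub>v (v - x)) = vnorm (v - x)" using v Sc xy by simp
      ultimately have "vnorm (x - y) \<le> vnorm (v - y) + vnorm (v - x)"
        using vnorm_triangle[of "v - y" n "(- 1) \<cdot>\<^sub>v (v - x)"] v Sc xy by simp
      then show False using v sep[OF xy] by linarith
    qed
  qed
  have sub: "(\<Union>x\<in>S. vball n x (d / 2)) \<subseteq> vball n (0\<^sub>v n) (1 + d / 2)"
  proof
    fix v assume "v \<in> (\<Union>x\<in>S. vball n x (d / 2))"
    then obtain x where x: "x \<in> S" "v \<in> vball n x (d / 2)" by blast
    then have v: "v \<in> carrier_vec n" "vnorm (v - x) \<le> d / 2" using d by (auto simp: vball_iff)
    have "v = (v - x) + x" using v Sc[OF x(1)] by (intro eq_vecI) auto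
    then have "vnorm v \<le> vnorm (v - x) + vnorm x" using vnorm_triangle[of "v - x" n x] v Sc[OF x(1)] by simp
    then have "vnorm v \<le> 1 + d / 2" using v Sc[OF x(1)] by linarith
    then show "v \<in> vball n (0\<^sub>v n) (1 + d / 2)" using v d by (simp add: vball_0_iff sqrt_le_D)
  qed
  have "(\<Sum>x\<in>S. emeasure ?L (vball n x (d / 2))) = emeasure ?L (\<Union>x\<in>S. vball n x (d / 2))"
    using S disj Sc by (intro sum_emeasure) auto
  also have "\<dots> \<le> emeasure ?L (vball n (0\<^sub>v n) (1 + d / 2))" using sub by (rule emeasure_mono) auto
  also have "\<dots> = ennreal (?w * (1 + d / 2) ^ n)" using d by (intro emeasure_vball) auto
  also have "(\<Sum>x\<in>S. emeasure ?L (vball n x (d / 2))) = ennreal (real (card S) * (?w * (d / 2) ^ n))"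
    using d Sc by (simp add: emeasure_vball ennreal_mult ennreal_of_nat_eq_real_of_nat)
  finally have "real (card S) * (?w * (d / 2) ^ n) \<le> ?w * (1 + d / 2) ^ n" using d by (simp add: ennreal_le_iff)
  then have "real (card S) * (d / 2) ^ n \<le> (1 + d / 2) ^ n" by (simp add: mult.left_commute)
  then have "real (card S) \<le> (1 + d / 2) ^ n / (d / 2) ^ n" using d by (simp add: pos_le_divide_eq)
  also have "\<dots> = ((1 + d / 2) / (d / 2)) ^ n" by (simp only: power_divide)
  also have "(1 + d / 2) / (d / 2) = 1 + 2 / d" using d by (simp add: field_simps)
  finally show ?thesis .
qed

text \<open>A separated set of maximal cardinality is a net.\<close>
lemma net_exists:
  assumes d: "d > 0"
  obtains X where "finite X" "X \<subseteq> vball n (0\<^sub>v n) 1" "real (card X) \<le> (1 + 2 / d) ^ n"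
    "\<And>u. u \<in> vball n (0\<^sub>v n) 1 \<Longrightarrow> \<exists>x\<in>X. vnorm (u - x) \<le> d"
proof -
  define P where "P S \<longleftrightarrow> finite S \<and> S \<subseteq> vball n (0\<^sub>v n) 1 \<and> (\<forall>x\<in>S. \<forall>y\<in>S. x \<noteq> y \<longrightarrow> vnorm (x - y) > d)" for S
  have cb: "real (card S) \<le> (1 + 2 / d) ^ n" if "P S" for S
    by (rule separated_card_bound) (use that d in \<open>auto simp: P_def\<close>)
  then have bound: "card S \<le> nat \<lfloor>(1 + 2 / d) ^ n\<rfloor>" if "P S" for S
    using that by (intro le_nat_floor) blast
  have "P {}" by (simp add: P_def)
  moreover have "\<forall>S. P S \<longrightarrow> card S < Suc (nat \<lfloor>(1 + 2 / d) ^ n\<rfloor>)" using bound by (simp only: less_Suc_eq_le) blast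
  ultimately have "\<exists>X. P X \<and> (\<forall>S. P S \<longrightarrow> card S \<le> card X)" by (rule Lattices_Big.ex_has_greatest_nat)
  then obtain X where PX: "P X" and mx: "\<And>S. P S \<Longrightarrow> card S \<le> card X" by blast
  have X: "finite X" "X \<subseteq> vball n (0\<^sub>v n) 1" "\<And>x y. x \<in> X \<Longrightarrow> y \<in> X \<Longrightarrow> x \<noteq> y \<Longrightarrow> vnorm (x - y) > d"
    using PX by (auto simp: P_def)
  show thesis
  proof (rule that[of X])
    show "real (card X) \<le> (1 + 2 / d) ^ n" by (rule cb[OF PX])
    fix u assume u: "u \<in> vball n (0\<^sub>v n) 1"
    show "\<exists>x\<in>X. vnorm (u - x) \<le> d"
    proof (rule ccontr)
      assume "\<not> (\<exists>x\<in>X. vnorm (u - x) \<le> d)"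
      then have far: "vnorm (u - x) > d" if "x \<in> X" for x using that by force
      have sym: "vnorm (x - u) = vnorm (u - x)" if "x \<in> X" for x
      proof -
        have c: "x \<in> carrier_vec n" "u \<in> carrier_vec n" using X that u by (auto simp: vball_0_iff)
        have "x - u = - (u - x)" using c by (intro eq_vecI) auto
        then show ?thesis using c by simp
      qed
      have "u \<notin> X"
      proof
        assume "u \<in> X"
        then have "vnorm (u - u) > d" by (rule far)
        moreover have "vnorm (u - u) = 0" using u by (auto simp: vball_0_iff)
        ultimately show False using d by simp
      qed
      moreover have "P (insert u X)" using X u far sym by (auto simp: P_def)
      ultimately show False using mx[of "insert u X"] X(1) by simp
    qed
  qed (use X in auto)
qed

section \<open>Greedy approximation by averages\<close>

fun sumsets :: "nat \<Rightarrow> real vec set \<Rightarrow> nat \<Rightarrow> real vec set" where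
  "sumsets n X 0 = {0\<^sub>v n}"
| "sumsets n X (Suc m) = (\<lambda>(s, x). s + x) ` (sumsets n X m \<times> X)"

lemma sumsets_finite: "finite X \<Longrightarrow> finite (sumsets n X m)"
  by (induction m) auto

lemma sumsets_card: "finite X \<Longrightarrow> card (sumsets n X m) \<le> card X ^ m"
proof (induction m)
  case (Suc m)
  have "card (sumsets n X (Suc m)) \<le> card (sumsets n X m \<times> X)"
    unfolding sumsets.simps by (rule card_image_le) (use Suc.prems sumsets_finite in simp)
  also have "\<dots> \<le> card X ^ m * card X" using Suc by (simp add: card_cartesian_product)
  finally show ?case by (simp add: mult.commute)
qed simp

lemma sumsets_carrier: "X \<subseteq> carrier_vec n \<Longrightarrow> sumsets n X m \<subseteq> carrier_vec n"
  by (induction m) (auto intro!: add_carrier_vec)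

text \<open>If $s$ is a sum of $m$ points of $X$ with error $e=s-mf$, choose the next point $x$ with
  $\langle x-f,e-f\rangle\le 0$. Then
  $|e+x-f|^2=|e|^2+2\langle x-f,e-f\rangle+|x|^2-|f|^2\le|e|^2+R^2$. The choice is possible
  because $X$ dominates $f$ in the direction $e-f$.\<close>
lemma greedy_average:
  assumes X: "X \<subseteq> carrier_vec n" and R: "\<And>x. x \<in> X \<Longrightarrow> x \<bullet> x \<le> R\<^sup>2" and f: "f \<in> carrier_vec n"
    and sup: "\<And>w. w \<in> carrier_vec n \<Longrightarrow> \<exists>x\<in>X. x \<bullet> w \<le> f \<bullet> w"
  shows "\<exists>s\<in>sumsets n X m. (s - real m \<cdot>\<^sub>v f) \<bullet> (s - real m \<cdot>\<^sub>v f) \<le> real m * R\<^sup>2"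
proof (induction m)
  case 0
  have "0\<^sub>v n - 0 \<cdot>\<^sub>v f = 0\<^sub>v n" using f by (intro eq_vecI) auto
  then show ?case by simp
next
  case (Suc m)
  then obtain s where s: "s \<in> sumsets n X m" "(s - real m \<cdot>\<^sub>v f) \<bullet> (s - real m \<cdot>\<^sub>v f) \<le> real m * R\<^sup>2" by blast
  have sc: "s \<in> carrier_vec n" using s sumsets_carrier[OF X] by blast
  define e where "e = s - real m \<cdot>\<^sub>v f"
  have e: "e \<in> carrier_vec n" using sc f by (simp add: e_def)
  obtain x where x: "x \<in> X" "x \<bullet> (e - f) \<le> f \<bullet> (e - f)" using sup[of "e - f"] e f by auto
  have xc: "x \<in> carrier_vec n" using x X by blast
  have "s + x - real (Suc m) \<cdot>\<^sub>v f = e + (x - f)"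
    using sc xc f by (intro eq_vecI) (auto simp: e_def algebra_simps)
  then have "(s + x - real (Suc m) \<cdot>\<^sub>v f) \<bullet> (s + x - real (Suc m) \<cdot>\<^sub>v f) = (e + (x - f)) \<bullet> (e + (x - f))" by simp
  also have "\<dots> = e \<bullet> e + 2 * (x \<bullet> (e - f) - f \<bullet> (e - f)) + (x \<bullet> x - f \<bullet> f)"
    using e xc f comm_scalar_prod[OF e xc] comm_scalar_prod[OF e f] comm_scalar_prod[OF f xc]
    by (simp add: add_scalar_prod_distrib[of _ n] scalar_prod_add_distrib[of _ n] minus_scalar_prod_distrib[of _ n] scalar_prod_minus_distrib[of _ n])
  also have "\<dots> \<le> real m * R\<^sup>2 + 2 * 0 + R\<^sup>2"
    using s(2) x(2) R[OF x(1)] real_scalar_prod_ge_0[of f] by (intro add_mono) (auto simp: e_def)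
  finally have "(s + x - real (Suc m) \<cdot>\<^sub>v f) \<bullet> (s + x - real (Suc m) \<cdot>\<^sub>v f) \<le> real (Suc m) * R\<^sup>2"
    by (simp add: algebra_simps)
  moreover have "s + x \<in> sumsets n X (Suc m)" using s(1) x(1) by force
  ultimately show ?case by blast
qed

text \<open>The set is covered by balls of radius $R/\sqrt m$ around the means of $m$ points
  of $X$.\<close>
lemma greedy_volume_bound:
  assumes X: "X \<subseteq> carrier_vec n" "finite X" and R: "R > 0" "\<And>x. x \<in> X \<Longrightarrow> x \<bullet> x \<le> R\<^sup>2" and m: "m \<ge> 1"
    and A: "A \<subseteq> carrier_vec n"
    and sup: "\<And>f w. f \<in> A \<Longrightarrow> w \<in> carrier_vec n \<Longrightarrow> \<exists>x\<in>X. x \<bullet> w \<le> f \<bullet> w"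
  shows "emeasure (completion (lborel_vec n)) A \<le> ennreal (real (card X) ^ m * (unit_ball_vol n * (R / sqrt m) ^ n))"
proof -
  let ?C = "(\<lambda>s. (1 / real m) \<cdot>\<^sub>v s) ` sumsets n X m" and ?s = "R / sqrt m"
  have s0: "?s > 0" using R m by simp
  have fin: "finite ?C" using sumsets_finite[OF X(2)] by simp
  have Cc: "c \<in> carrier_vec n" if "c \<in> ?C" for c using that sumsets_carrier[OF X(1), of m, THEN subsetD] by auto
  have cover: "A \<subseteq> (\<Union>c\<in>?C. vball n c ?s)"
  proof
    fix f assume f: "f \<in> A"
    have fc: "f \<in> carrier_vec n" using f A by blast
    obtain s where s: "s \<in> sumsets n X m" "(s - real m \<cdot>\<^sub>v f) \<bullet> (s - real m \<cdot>\<^sub>v f) \<le> real m * R\<^sup>2"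
      using greedy_average[OF X(1) R(2) fc sup[OF f]] by blast
    have sc: "s \<in> carrier_vec n" using s sumsets_carrier[OF X(1)] by blast
    have "f - (1 / real m) \<cdot>\<^sub>v s = (- 1 / real m) \<cdot>\<^sub>v (s - real m \<cdot>\<^sub>v f)"
      using sc fc m by (intro eq_vecI) (auto simp: field_simps)
    then have "(f - (1 / real m) \<cdot>\<^sub>v s) \<bullet> (f - (1 / real m) \<cdot>\<^sub>v s) = (1 / real m)\<^sup>2 * ((s - real m \<cdot>\<^sub>v f) \<bullet> (s - real m \<cdot>\<^sub>v f))"
      using sc fc by (simp add: power2_eq_square)
    also have "\<dots> \<le> (1 / real m)\<^sup>2 * (real m * R\<^sup>2)" using s(2) by (intro mult_left_mono) auto
    also have "\<dots> = ?s\<^sup>2" using m by (simp add: power_divide power2_eq_square)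
    finally have "f \<in> vball n ((1 / real m) \<cdot>\<^sub>v s) ?s" using fc by (simp add: vball_def)
    then show "f \<in> (\<Union>c\<in>?C. vball n c ?s)" using s(1) by blast
  qed
  have U: "(\<Union>c\<in>?C. vball n c ?s) \<in> sets (lborel_vec n)" using fin Cc by (intro sets.finite_UN) auto
  have "emeasure (completion (lborel_vec n)) A \<le> emeasure (completion (lborel_vec n)) (\<Union>c\<in>?C. vball n c ?s)"
    using cover U by (intro emeasure_mono) auto
  also have "\<dots> = emeasure (lborel_vec n) (\<Union>c\<in>?C. vball n c ?s)" using U by simp
  also have "\<dots> \<le> (\<Sum>c\<in>?C. emeasure (lborel_vec n) (vball n c ?s))" using fin Cc by (intro emeasure_subadditive_finite) auto
  also have "\<dots> = ennreal (real (card ?C) * (unit_ball_vol n * ?s ^ n))"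
    using s0 Cc by (simp add: emeasure_vball ennreal_mult ennreal_of_nat_eq_real_of_nat)
  also have "\<dots> \<le> ennreal (real (card X) ^ m * (unit_ball_vol n * ?s ^ n))"
  proof (intro ennreal_leI mult_right_mono)
    have "card ?C \<le> card (sumsets n X m)" using sumsets_finite[OF X(2)] by (rule card_image_le)
    also have "\<dots> \<le> card X ^ m" using X(2) by (rule sumsets_card)
    finally show "real (card ?C) \<le> real (card X) ^ m" by (simp flip: of_nat_power)
  qed (use s0 in simp)
  finally show ?thesis .
qed

section \<open>Coordinates given by a linear isometry\<close>

context stiefel
begin

lemma mean_zero_sup_bound:
  assumes f: "f \<in> bihom 2 2" "(\<integral>z. f z \<partial>\<sigma>) = 0" and z: "z \<in> T"
  shows "(f z)\<^sup>2 \<le> real dimM * (\<integral>z. (f z)\<^sup>2 \<partial>\<sigma>)"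
proof -
  obtain \<psi> where \<psi>: "orthonormal dimM \<psi>" "\<And>i. i < dimM \<Longrightarrow> \<psi> i \<in> bihom 2 2" "\<And>i. i < dimM \<Longrightarrow> (\<integral>z. \<psi> i z \<partial>\<sigma>) = 0"
    "\<And>f. f \<in> bihom 2 2 \<Longrightarrow> (\<integral>z. f z \<partial>\<sigma>) = 0 \<Longrightarrow> f \<in> fspan {..<dimM} \<psi>"
    "card (normal_exps n) = Suc dimM"
    by (rule mean_zero_basis) (rule that)
  have inv: "(\<lambda>z. \<psi> i (rot g z)) \<in> fspan {..<dimM} \<psi>" if g: "g \<in> SO_mats n" and i: "i < dimM" for g i
  proof (rule \<psi>(4)[OF bihom_rot[OF \<psi>(2)[OF i] g]])
    have "nice (\<psi> i)" using \<psi>(1) i by (simp add: orthonormal_def)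
    then show "(\<integral>z. \<psi> i (rot g z) \<partial>\<sigma>) = 0" using integral_rot[OF g] \<psi>(3)[OF i] by simp
  qed
  obtain a where a: "\<And>z. z \<in> T \<Longrightarrow> f z = (\<Sum>i<dimM. a i * \<psi> i z)" using fspanE[OF \<psi>(4)[OF f]] by blast
  have "(f z)\<^sup>2 = (\<Sum>i<dimM. a i * \<psi> i z)\<^sup>2" using a[OF z] by simp
  also have "\<dots> \<le> (\<Sum>i<dimM. (a i)\<^sup>2) * (\<Sum>i<dimM. (\<psi> i z)\<^sup>2)" by (rule Cauchy_Schwarz_ineq_sum)
  also have "\<dots> = (\<integral>z. (f z)\<^sup>2 \<partial>\<sigma>) * real dimM"
    using orthonormal_norm[OF \<psi>(1) a] reproducing_kernel_const[OF \<psi>(1) inv z] by simp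
  finally show ?thesis by (simp add: mult.commute)
qed

text \<open>Nonzero pairs can be normalized by homogeneity, and a biform vanishes when one of the two
  vectors is $0$.\<close>
lemma nonneg_on_variety:
  assumes p: "p \<in> B22" and 0: "\<And>z. z \<in> T \<Longrightarrow> poly_eval p z \<ge> 0" and z: "z \<in> ortho_variety n"
  shows "poly_eval p z \<ge> 0"
proof -
  obtain x y where xy: "z = (x, y)" "x \<in> carrier_vec n" "y \<in> carrier_vec n" "y \<bullet> x = 0"
    using z by (auto simp: ortho_variety_def)
  have scale: "poly_eval p (s \<cdot>\<^sub>v v, t \<cdot>\<^sub>v w) = s\<^sup>2 * t\<^sup>2 * poly_eval p (v, w)"
    if "v \<in> carrier_vec n" "w \<in> carrier_vec n" for s t v w
    unfolding poly_eval_biform_sum[OF p] sum_distrib_left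
    by (intro sum.cong refl) (subst monomial_fun_scale[of _ n 2 2], use that in auto)
  show ?thesis
  proof (cases "x \<bullet> x = 0 \<or> y \<bullet> y = 0")
    case True
    then have "x = 0 \<cdot>\<^sub>v x \<or> y = 0 \<cdot>\<^sub>v y" using real_scalar_prod_eq_0_iff[of _ n] xy by auto
    then show ?thesis
    proof
      assume "x = 0 \<cdot>\<^sub>v x"
      then have "poly_eval p z = poly_eval p (0 \<cdot>\<^sub>v x, 1 \<cdot>\<^sub>v y)" using xy(1) by simp
      then show ?thesis using scale[OF xy(2,3), of 0 1] by simp
    next
      assume "y = 0 \<cdot>\<^sub>v y"
      then have "poly_eval p z = poly_eval p (1 \<cdot>\<^sub>v x, 0 \<cdot>\<^sub>v y)" using xy(1) by simp
      then show ?thesis using scale[OF xy(2,3), of 1 0] by simp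
    qed
  next
    case False
    define s t where "s = sqrt (x \<bullet> x)" and "t = sqrt (y \<bullet> y)"
    have st: "s > 0" "t > 0" "s * s = x \<bullet> x" "t * t = y \<bullet> y"
      using False real_scalar_prod_ge_0[of x] real_scalar_prod_ge_0[of y] by (auto simp: s_def t_def)
    define v w where "v = (1 / s) \<cdot>\<^sub>v x" and "w = (1 / t) \<cdot>\<^sub>v y"
    have vw: "v \<in> carrier_vec n" "w \<in> carrier_vec n" using xy by (auto simp: v_def w_def)
    have "(v, w) \<in> T" using xy st vw by (simp add: orthonormal_pairs_def ortho_variety_def v_def w_def flip: st(3,4))
    moreover have "z = (s \<cdot>\<^sub>v v, t \<cdot>\<^sub>v w)" using xy st by (simp add: v_def w_def smult_smult_assoc)
    ultimately show ?thesis using scale[OF vw, of s t] 0 by simp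
  qed
qed

definition norm_poly :: rpoly where
  "norm_poly = (\<Sum>i<n. (var_poly (Xvar i))\<^sup>2) * (\<Sum>i<n. (var_poly (Yvar i))\<^sup>2)"

lemma norm_poly_biform: "norm_poly \<in> B22"
proof -
  have X: "(\<Sum>i<n. (var_poly (Xvar i))\<^sup>2) \<in> biforms n 2 0"
    unfolding power2_eq_square
    by (intro biforms_sum) (use biforms_mult[OF biforms_var(1) biforms_var(1)] in \<open>simp add: numeral_2_eq_2\<close>)
  have Y: "(\<Sum>i<n. (var_poly (Yvar i))\<^sup>2) \<in> biforms n 0 2"
    unfolding power2_eq_square
    by (intro biforms_sum) (use biforms_mult[OF biforms_var(2) biforms_var(2)] in \<open>simp add: numeral_2_eq_2\<close>)
  show ?thesis using biforms_mult[OF X Y] by (simp only: norm_poly_def add_0_left add_0_right)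
qed

lemma poly_eval_norm_poly:
  assumes "z \<in> T" shows "poly_eval norm_poly z = 1"
  using assms by (cases z) (auto simp: norm_poly_def poly_eval_mult poly_eval_sum poly_eval_power orthonormal_pairs_iff
    scalar_prod_sum[of _ n] power2_eq_square)

lemma norm_biform_cls: "norm_biform n = cls norm_poly"
  by (simp add: norm_biform_def norm_poly_def)

lemma H_plane_shift:
  assumes "p \<in> B22" "(\<integral>z. poly_eval p z \<partial>\<sigma>) = 0"
  shows "cls (p + norm_poly) \<in> H_plane n"
proof -
  have "Q_integral n (cls (p + norm_poly)) = (\<integral>z. poly_eval p z + poly_eval norm_poly z \<partial>\<sigma>)"
    using assms norm_poly_biform by (simp add: Q_integral_cls biforms_add poly_eval_fun)
  also have "\<dots> = 0 + (\<integral>z. poly_eval norm_poly z \<partial>\<sigma>)"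
    using assms norm_poly_biform by (subst Bochner_Integration.integral_add) (auto intro!: nice_integrable nice_poly_eval)
  also have "(\<integral>z. poly_eval norm_poly z \<partial>\<sigma>) = (\<integral>z. 1 \<partial>\<sigma>)"
    using poly_eval_norm_poly by (intro Bochner_Integration.integral_cong) auto
  finally show ?thesis using assms norm_poly_biform S.prob_space
    by (auto simp: H_plane_def quotient_iff intro: biforms_add)
qed

lemma Pos_tildeI:
  assumes p: "p \<in> B22" "(\<integral>z. poly_eval p z \<partial>\<sigma>) = 0" and ge: "\<And>z. z \<in> T \<Longrightarrow> poly_eval p z \<ge> - 1"
  shows "cls p \<in> Pos_tilde n"
proof -
  have pN: "p + norm_poly \<in> B22" using p norm_poly_biform by (intro biforms_add)
  have "Q_eval (cls (p + norm_poly)) z \<ge> 0" if z: "z \<in> ortho_variety n" for z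
  proof -
    have "poly_eval (p + norm_poly) w \<ge> 0" if "w \<in> T" for w
      using ge[OF that] poly_eval_norm_poly[OF that] by (simp add: poly_eval_add)
    from nonneg_on_variety[OF pN this z] show ?thesis using Q_eval_cls[OF pN z] by simp
  qed
  then have "cls (p + norm_poly) \<in> Pos_Q n" using pN by (auto simp: Pos_Q_def quotient_iff)
  then show ?thesis using p H_plane_shift[OF p] norm_poly_biform
    by (auto simp: Pos_tilde_def norm_biform_cls Q_add_cls quotient_iff)
qed

lemma Sos_tildeE:
  assumes p: "p \<in> B22" and S: "cls p \<in> Sos_tilde n"
  obtains k q where "\<And>i. i < (k :: nat) \<Longrightarrow> q i \<in> biforms n 1 1"
    "\<And>z. z \<in> T \<Longrightarrow> poly_eval p z + 1 = (\<Sum>i<k. (poly_eval (q i) z)\<^sup>2)"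
proof -
  have pN: "p + norm_poly \<in> B22" using p norm_poly_biform by (intro biforms_add)
  have "cls (p + norm_poly) \<in> Sos_Q n" using S p norm_poly_biform by (simp add: Sos_tilde_def norm_biform_cls Q_add_cls)
  then obtain r k q where r: "r \<in> cls (p + norm_poly)" and q: "\<forall>i<(k::nat). q i \<in> biforms n 1 1"
    and id: "r - (\<Sum>i<k. (q i)\<^sup>2) \<in> ortho_ideal n"
    unfolding Sos_Q_def by blast
  show thesis
  proof (rule that[of k q])
    fix z assume z: "z \<in> T"
    then have zv: "z \<in> ortho_variety n" using T_variety by blast
    have "poly_eval (p + norm_poly) z = poly_eval r z"
      using poly_eval_ortho_ideal[of "p + norm_poly - r" n z] r zv cls_iff[OF pN] by (simp add: poly_eval_diff)
    moreover have "poly_eval r z = (\<Sum>i<k. (poly_eval (q i) z)\<^sup>2)"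
      using poly_eval_ortho_ideal[OF id zv] by (simp add: poly_eval_diff poly_eval_sum poly_eval_power)
    ultimately show "poly_eval p z + 1 = (\<Sum>i<k. (poly_eval (q i) z)\<^sup>2)"
      using poly_eval_norm_poly[OF z] by (simp add: poly_eval_add)
  qed (use q in blast)
qed

end

text \<open>The volume is defined through an unspecified linear isometry, so the estimates are made
  for an arbitrary one.\<close>
locale isometric_coordinates = stiefel +
  fixes \<phi> :: "real vec \<Rightarrow> rpoly set"
  assumes isometry: "is_linear_isometry n \<phi>"
begin

abbreviation D :: nat where "D \<equiv> dim_M n"

lemma D_eq: "D = dimM" using isometry_and_dim by blast

lemma \<phi>_representative:
  assumes "u \<in> carrier_vec D"
  obtains p where "p \<in> B22" "\<phi> u = cls p" "(\<integral>z. poly_eval p z \<partial>\<sigma>) = 0"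
proof (rule M_setE)
  have "\<phi> \<in> module_hom class_ring (module_vec TYPE(real) D) (M_space n)"
    using isometry by (simp add: is_linear_isometry_def linear_map_def mod_hom_def mod_hom_axioms_def)
  then show "\<phi> u \<in> M_set n"
    using assms by (auto simp: module_hom_def module_vec_simps M_space_def)
qed (rule that)

definition \<Phi> :: "nat \<Rightarrow> real vec \<times> real vec \<Rightarrow> real" where
  "\<Phi> i = poly_eval (SOME p. p \<in> B22 \<and> \<phi> (unit_vec D i) = cls p \<and> (\<integral>z. poly_eval p z \<partial>\<sigma>) = 0)"

lemma \<Phi>_representative:
  assumes "i < D"
  obtains p where "p \<in> B22" "\<phi> (unit_vec D i) = cls p" "(\<integral>z. poly_eval p z \<partial>\<sigma>) = 0" "\<Phi> i = poly_eval p"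
proof -
  obtain p where "p \<in> B22" "\<phi> (unit_vec D i) = cls p" "(\<integral>z. poly_eval p z \<partial>\<sigma>) = 0"
    by (rule \<phi>_representative[of "unit_vec D i"]) (simp, rule that)
  then have "\<exists>p. p \<in> B22 \<and> \<phi> (unit_vec D i) = cls p \<and> (\<integral>z. poly_eval p z \<partial>\<sigma>) = 0" by blast
  from someI_ex[OF this] show thesis by (intro that) (auto simp: \<Phi>_def)
qed

lemma nice_\<Phi>: "i < D \<Longrightarrow> nice (\<Phi> i)"
  by (erule \<Phi>_representative) (simp add: nice_poly_eval)

lemma \<Phi>_bihom: "i < D \<Longrightarrow> \<Phi> i \<in> bihom 2 2"
  by (erule \<Phi>_representative) (simp add: poly_eval_bihom)

lemma \<Phi>_mean: "i < D \<Longrightarrow> (\<integral>z. \<Phi> i z \<partial>\<sigma>) = 0"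
  by (erule \<Phi>_representative) simp

lemma ip_\<Phi>:
  assumes p: "p \<in> B22" "\<phi> u = cls p" and u: "u \<in> carrier_vec D" and i: "i < D"
  shows "ip (poly_eval p) (\<Phi> i) = u $ i"
proof -
  obtain q where q: "q \<in> B22" "\<phi> (unit_vec D i) = cls q" "\<Phi> i = poly_eval q"
    using \<Phi>_representative[OF i] by metis
  have "ip (poly_eval p) (\<Phi> i) = M_inner n (\<phi> u) (\<phi> (unit_vec D i))"
    using p q by (simp add: M_inner_cls)
  also have "\<dots> = u \<bullet> unit_vec D i" using isometry u by (simp add: is_linear_isometry_def)
  also have "\<dots> = u $ i" using u i by simp
  finally show ?thesis .
qed

lemma orthonormal_\<Phi>: "orthonormal D \<Phi>"
  unfolding orthonormal_def
proof (intro conjI allI impI)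
  fix i j assume i: "i < D" and j: "j < D"
  obtain q where q: "q \<in> B22" "\<phi> (unit_vec D i) = cls q" "\<Phi> i = poly_eval q"
    using \<Phi>_representative[OF i] by metis
  show "ip (\<Phi> i) (\<Phi> j) = (if i = j then 1 else 0)"
    using ip_\<Phi>[OF q(1,2) _ j] i j by (simp add: q(3))
qed (rule nice_\<Phi>)

text \<open>The coordinates of the evaluation functional at $z$.\<close>
definition pt :: "real vec \<times> real vec \<Rightarrow> real vec" where "pt z = Matrix.vec D (\<lambda>i. \<Phi> i z)"

lemma pt_carrier [simp]: "pt z \<in> carrier_vec D" by (simp add: pt_def)

lemma scalar_pt: "u \<bullet> pt z = (\<Sum>i<D. u $ i * \<Phi> i z)"
  by (simp add: scalar_prod_sum[of _ D] pt_def)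

lemma nice_pt: "nice (\<lambda>z. u \<bullet> pt z)"
  unfolding scalar_pt by (intro nice_sum nice_cmult nice_\<Phi>) auto

lemma pt_bihom: "(\<lambda>z. u \<bullet> pt z) \<in> bihom 2 2"
  unfolding scalar_pt by (intro bihom_sum \<Phi>_bihom) auto

lemma pt_mean: "(\<integral>z. u \<bullet> pt z \<partial>\<sigma>) = 0"
  unfolding scalar_pt
  by (subst Bochner_Integration.integral_sum) (auto intro!: nice_integrable nice_cmult nice_\<Phi> simp: \<Phi>_mean)

lemma pt_norm:
  assumes "u \<in> carrier_vec D" shows "(\<integral>z. (u \<bullet> pt z)\<^sup>2 \<partial>\<sigma>) = u \<bullet> u"
  using orthonormal_norm[OF orthonormal_\<Phi>, of "\<lambda>z. u \<bullet> pt z" "\<lambda>i. u $ i"] assms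
  by (simp add: scalar_pt scalar_prod_sum[of _ D] power2_eq_square)

text \<open>The difference of the two sides has norm $0$ in $L^2(\sigma)$: the inner products of
  both sides with the basis functions agree because $\phi$ preserves inner products.\<close>
lemma \<phi>_pt:
  assumes p: "p \<in> B22" "\<phi> u = cls p" and u: "u \<in> carrier_vec D" and z: "z \<in> T"
  shows "poly_eval p z = u \<bullet> pt z"
proof -
  let ?p = "poly_eval p" and ?f = "\<lambda>z. u \<bullet> pt z"
  have n: "nice ?p" by (rule nice_poly_eval[OF p(1)])
  have "ip ?f ?p = (\<Sum>i<D. u $ i * ip (\<Phi> i) ?p)"
    unfolding scalar_pt by (intro ip_sum_left nice_\<Phi> n) auto
  also have "\<dots> = u \<bullet> u" using ip_\<Phi>[OF p u] u by (simp add: ip_sym[of "\<Phi> _"] scalar_prod_sum[of _ D])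
  finally have fp: "ip ?f ?p = u \<bullet> u" .
  have "M_inner n (\<phi> u) (\<phi> u) = u \<bullet> u" using isometry u by (simp add: is_linear_isometry_def)
  then have pp: "ip ?p ?p = u \<bullet> u" unfolding p(2) M_inner_cls[OF p(1) p(1)] .
  have ff: "ip ?f ?f = u \<bullet> u" using pt_norm[OF u] by (simp add: ip_def power2_eq_square)
  have "(\<integral>z. (?p z - ?f z)\<^sup>2 \<partial>\<sigma>) = ip (\<lambda>z. ?p z - ?f z) (\<lambda>z. ?p z - ?f z)"
    by (simp add: ip_def power2_eq_square)
  also have "\<dots> = ip (\<lambda>z. ?p z - ?f z) ?p - ip (\<lambda>z. ?p z - ?f z) ?f"
    unfolding ip_diff_left[OF n nice_pt nice_diff[OF n nice_pt]] by (simp only: ip_sym[of "\<lambda>z. ?p z - ?f z"])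
  also have "\<dots> = ip ?p ?p - ip ?f ?p - (ip ?p ?f - ip ?f ?f)"
    unfolding ip_diff_left[OF n nice_pt n] ip_diff_left[OF n nice_pt nice_pt] ..
  also have "\<dots> = 0" using fp pp ff ip_sym[of ?p ?f] by simp
  finally have "?p z - ?f z = 0" by (intro nice_eq_0[OF nice_diff[OF n nice_pt] _ z])
  then show ?thesis by simp
qed

text \<open>Apply the supremum bound to the mean zero biform $f=\sum_i\Phi_i(z)\Phi_i$, whose value at
  $z$ and whose squared norm are both equal to the left-hand side.\<close>
lemma pt_bound:
  assumes z: "z \<in> T"
  shows "pt z \<bullet> pt z \<le> real D"
proof -
  let ?s = "pt z \<bullet> pt z"
  have "?s\<^sup>2 \<le> real D * ?s"
    using mean_zero_sup_bound[OF pt_bihom pt_mean z, of "pt z"] unfolding pt_norm[OF pt_carrier] D_eq .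
  then have "?s * ?s \<le> ?s * real D" by (simp add: power2_eq_square mult.commute)
  moreover have "?s \<ge> 0" by (rule real_scalar_prod_ge_0)
  ultimately show ?thesis by (cases "?s = 0") (auto simp: mult_le_cancel_left)
qed

lemma Pos_preimageI:
  assumes u: "u \<in> carrier_vec D" and ge: "\<And>z. z \<in> T \<Longrightarrow> \<bar>u \<bullet> pt z\<bar> \<le> 1"
  shows "\<phi> u \<in> Pos_tilde n"
proof -
  obtain p where p: "p \<in> B22" "\<phi> u = cls p" "(\<integral>z. poly_eval p z \<partial>\<sigma>) = 0"
    by (rule \<phi>_representative[OF u]) (rule that)
  have "poly_eval p z \<ge> -1" if "z \<in> T" for z using \<phi>_pt[OF p(1,2) u that] ge[OF that] by simp
  then show ?thesis unfolding p(2) by (intro Pos_tildeI p)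
qed

lemma Sos_preimageE:
  assumes u: "u \<in> carrier_vec D" and S: "\<phi> u \<in> Sos_tilde n"
  obtains k q where "\<And>i. i < (k :: nat) \<Longrightarrow> q i \<in> biforms n 1 1"
    "\<And>z. z \<in> T \<Longrightarrow> u \<bullet> pt z + 1 = (\<Sum>i<k. (poly_eval (q i) z)\<^sup>2)"
proof -
  obtain p where p: "p \<in> B22" "\<phi> u = cls p" "(\<integral>z. poly_eval p z \<partial>\<sigma>) = 0"
    by (rule \<phi>_representative[OF u]) (rule that)
  obtain k q where "\<And>i. i < (k :: nat) \<Longrightarrow> q i \<in> biforms n 1 1"
    "\<And>z. z \<in> T \<Longrightarrow> poly_eval p z + 1 = (\<Sum>i<k. (poly_eval (q i) z)\<^sup>2)"
    by (rule Sos_tildeE[OF p(1) S[unfolded p(2)]]) (rule that)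
  then show thesis using \<phi>_pt[OF p(1,2) u] by (intro that[of k q]) auto
qed

end

section \<open>A lower bound for the volume of the nonnegative biforms\<close>

text \<open>Induction with Bernoulli's inequality $(1+1/(m+1))^{m+1}\ge 2$.\<close>
lemma fact_le_half_power: "fact m * 2 ^ m \<le> (real m + 1) ^ m"
proof (induction m)
  case (Suc m)
  have "2 * (real m + 1) ^ Suc m \<le> (real m + 2) ^ Suc m"
  proof -
    have "1 + real (Suc m) * (1 / (real m + 1)) \<le> (1 + 1 / (real m + 1)) ^ Suc m"
      by (rule Bernoulli_inequality) (simp add: order_trans[of _ 0])
    also have "1 + 1 / (real m + 1) = (real m + 2) / (real m + 1)" by (simp add: field_simps)
    finally have "1 + real (Suc m) * (1 / (real m + 1)) \<le> ((real m + 2) / (real m + 1)) ^ Suc m" .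
    moreover have "1 + real (Suc m) * (1 / (real m + 1)) = 2" by (simp add: field_simps)
    ultimately have "2 \<le> ((real m + 2) / (real m + 1)) ^ Suc m" by (simp only:)
    then have "2 \<le> (real m + 2) ^ Suc m / (real m + 1) ^ Suc m" by (simp only: power_divide)
    then show ?thesis by (simp add: pos_le_divide_eq del: power_Suc)
  qed
  moreover have "2 * (real m + 1) * (fact m * 2 ^ m) \<le> 2 * (real m + 1) * (real m + 1) ^ m"
    using Suc.IH by (intro mult_left_mono) auto
  ultimately have "2 * (real m + 1) * (fact m * 2 ^ m) \<le> (real m + 2) ^ Suc m"
    unfolding power_Suc mult.assoc by (rule order_trans[rotated])
  moreover have "fact (Suc m) * 2 ^ Suc m = 2 * (real m + 1) * (fact m * 2 ^ m)" by (simp add: algebra_simps)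
  moreover have "real (Suc m) + 1 = real m + 2" by simp
  ultimately show ?case by (simp only:)
qed simp

text \<open>The binomial coefficient is at most $2^{3n-1}$, so the product is at most
  $n!\,2^n/(n+1)^n$.\<close>
lemma sup_constant_le_1:
  assumes n: "n \<ge> 1"
  shows "real (((n * 2 + n - 1) choose (n * 2)) * ((n * 2 + n - 1) choose (n * 2)))
    * (4 * (fact n * (2 * (1 / (8 * sqrt (real n + 1)))\<^sup>2) ^ n)) \<le> 1"
proof -
  obtain m where m: "n = Suc m" using n by (cases n) auto
  have "(n * 2 + n - 1) choose (n * 2) \<le> 2 ^ (n * 2 + n - 1)"
    by (rule binomial_le_pow2)
  then have b: "real ((n * 2 + n - 1) choose (n * 2)) \<le> 2 ^ (n * 2 + n - 1)" by (metis of_nat_le_iff of_nat_numeral of_nat_power)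
  have "real (((n * 2 + n - 1) choose (n * 2)) * ((n * 2 + n - 1) choose (n * 2))) \<le> 2 ^ (n * 2 + n - 1) * 2 ^ (n * 2 + n - 1)"
    unfolding of_nat_mult by (intro mult_mono b) auto
  also have "\<dots> = 2 ^ (6 * m + 4)" by (simp only: power_add[symmetric]) (simp add: m power_add)
  also have "\<dots> = 64 ^ m * (16 :: real)" by (simp add: power_add power_mult)
  also have "\<dots> = 64 ^ n / 4" by (simp add: m)
  finally have b2: "real (((n * 2 + n - 1) choose (n * 2)) * ((n * 2 + n - 1) choose (n * 2))) \<le> 64 ^ n / 4" .
  have e: "2 * (1 / (8 * sqrt (real n + 1)))\<^sup>2 = 1 / (32 * (real n + 1))" by (simp add: power_divide power_mult_distrib divide_simps)
  have "real (((n * 2 + n - 1) choose (n * 2)) * ((n * 2 + n - 1) choose (n * 2)))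
    * (4 * (fact n * (2 * (1 / (8 * sqrt (real n + 1)))\<^sup>2) ^ n)) \<le> 64 ^ n / 4 * (4 * (fact n * (1 / (32 * (real n + 1))) ^ n))"
    unfolding e by (intro mult_right_mono b2) auto
  also have "\<dots> = fact n * (64 * (1 / (32 * (real n + 1)))) ^ n" by (simp only: power_mult_distrib) simp
  also have "64 * (1 / (32 * (real n + 1))) = 2 / (real n + 1)" by (simp add: field_simps)
  also have "fact n * (2 / (real n + 1)) ^ n = fact n * 2 ^ n / (real n + 1) ^ n" by (simp add: power_divide)
  also have "\<dots> \<le> 1" using fact_le_half_power[of n] by (subst pos_divide_le_eq) auto
  finally show ?thesis .
qed

context isometric_coordinates
begin

abbreviation L :: "real vec measure" where "L \<equiv> lborel_vec D"

definition moment :: "nat \<Rightarrow> real vec \<Rightarrow> ennreal" where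
  "moment k u = (\<integral>\<^sup>+ z. ennreal ((u \<bullet> pt z) ^ (2 * k)) \<partial>\<sigma>)"

lemma pair_measurable: "(\<lambda>(u, z). ennreal ((u \<bullet> pt z) ^ (2 * k))) \<in> borel_measurable (L \<Otimes>\<^sub>M \<sigma>)"
proof -
  have 1: "(\<lambda>w. fst w $ i) \<in> borel_measurable (L \<Otimes>\<^sub>M \<sigma>)" if "i < D" for i
    by (rule measurable_vec_index'[OF _ that]) (simp cong: measurable_cong_sets)
  have 2: "(\<lambda>w. \<Phi> i (snd w)) \<in> borel_measurable (L \<Otimes>\<^sub>M \<sigma>)" if "i < D" for i
    using measurable_compose[OF measurable_snd nice_measurable[OF nice_\<Phi>[OF that]]] .
  have "(\<lambda>w. \<Sum>i<D. fst w $ i * \<Phi> i (snd w)) \<in> borel_measurable (L \<Otimes>\<^sub>M \<sigma>)"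
    by (intro borel_measurable_sum borel_measurable_times 1 2) auto
  then show ?thesis by (simp add: scalar_pt case_prod_beta)
qed

lemma moment_measurable: "moment k \<in> borel_measurable L"
  unfolding moment_def by (rule S.borel_measurable_nn_integral[OF pair_measurable])

text \<open>Exchange the order of integration; for fixed $z$ the integrand is a power of the linear
  functional given by the evaluation vector at $z$.\<close>
lemma average_moment:
  assumes r: "r > 0" and k: "k \<ge> 1" and D: "D \<ge> 1"
  shows "(\<integral>\<^sup>+ u. indicator (vball D (0\<^sub>v D) r) u * moment k u \<partial>L)
    \<le> ennreal (2 * (unit_ball_vol D * r ^ D) * (fact k * (2 * r\<^sup>2) ^ k))"
proof -
  interpret L: sigma_finite_measure L by (rule sigma_finite_lborel_vec)
  interpret P: pair_sigma_finite L \<sigma> ..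
  let ?B = "vball D (0\<^sub>v D) r" and ?C = "2 * (unit_ball_vol D * r ^ D) * (fact k * (2 * r\<^sup>2) ^ k)"
  have jm: "(\<lambda>(u, z). indicator ?B u * ennreal ((u \<bullet> pt z) ^ (2 * k))) \<in> borel_measurable (L \<Otimes>\<^sub>M \<sigma>)"
  proof -
    have "(\<lambda>w. indicator ?B (fst w) :: ennreal) \<in> borel_measurable (L \<Otimes>\<^sub>M \<sigma>)"
      by (rule measurable_compose[OF measurable_fst]) auto
    then show ?thesis using pair_measurable[of k] by (simp add: case_prod_beta)
  qed
  have "(\<integral>\<^sup>+ u. indicator ?B u * moment k u \<partial>L) = (\<integral>\<^sup>+ u. \<integral>\<^sup>+ z. indicator ?B u * ennreal ((u \<bullet> pt z) ^ (2 * k)) \<partial>\<sigma> \<partial>L)"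
    unfolding moment_def
    by (intro nn_integral_cong nn_integral_cmult[symmetric] measurable_compose[OF _ measurable_ennreal] nice_measurable nice_power nice_pt)
  also have "\<dots> = (\<integral>\<^sup>+ z. \<integral>\<^sup>+ u. indicator ?B u * ennreal ((u \<bullet> pt z) ^ (2 * k)) \<partial>L \<partial>\<sigma>)"
    by (rule P.Fubini'[OF jm, symmetric])
  also have "\<dots> \<le> (\<integral>\<^sup>+ z. ennreal ?C \<partial>\<sigma>)"
  proof (rule nn_integral_mono)
    fix z assume "z \<in> space \<sigma>"
    then have "z \<in> T" by simp
    then show "(\<integral>\<^sup>+ u. indicator ?B u * ennreal ((u \<bullet> pt z) ^ (2 * k)) \<partial>L) \<le> ennreal ?C"
      using ball_linear_moment[OF pt_carrier pt_bound _ r k D] D by simp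
  qed
  also have "\<dots> = ennreal ?C" using S.emeasure_space_1 by simp
  finally show ?thesis .
qed

text \<open>The supremum bound is applied to $f^n$, a function of bidegree $(2n,2n)$.\<close>
lemma small_moment_imp_bounded:
  assumes u: "u \<in> carrier_vec D" and mom: "moment n u < ennreal \<Lambda>"
    and \<Lambda>: "real (((n * 2 + n - 1) choose (n * 2)) * ((n * 2 + n - 1) choose (n * 2))) * \<Lambda> \<le> 1" and z: "z \<in> T"
  shows "\<bar>u \<bullet> pt z\<bar> \<le> 1"
proof -
  let ?f = "\<lambda>z. (u \<bullet> pt z) ^ n" and ?N = "real (((n * 2 + n - 1) choose (n * 2)) * ((n * 2 + n - 1) choose (n * 2)))"
  have "moment n u = ennreal (\<integral>z. (u \<bullet> pt z) ^ (2 * n) \<partial>\<sigma>)"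
    unfolding moment_def by (intro nn_integral_eq_integral nice_integrable nice_power nice_pt) auto
  then have "(\<integral>z. (u \<bullet> pt z) ^ (2 * n) \<partial>\<sigma>) < \<Lambda>"
    using mom by (simp add: ennreal_less_iff Bochner_Integration.integral_nonneg)
  then have le: "(\<integral>z. (?f z)\<^sup>2 \<partial>\<sigma>) \<le> \<Lambda>" by (simp add: mult.commute flip: power_mult)
  have "(?f z)\<^sup>2 \<le> ?N * (\<integral>z. (?f z)\<^sup>2 \<partial>\<sigma>)" by (rule bihom_sup_bound[OF bihom_power[OF pt_bihom] z])
  also have "\<dots> \<le> ?N * \<Lambda>" by (intro mult_left_mono le) auto
  also have "\<dots> \<le> 1" by (rule \<Lambda>)
  finally have "\<bar>?f z\<bar> \<le> 1" by (simp add: abs_square_le_1)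
  then have "\<bar>u \<bullet> pt z\<bar> ^ n \<le> 1" by (simp add: power_abs)
  moreover have "1 < \<bar>u \<bullet> pt z\<bar> ^ n" if "1 < \<bar>u \<bullet> pt z\<bar>" using that n3 by (intro one_less_power) auto
  ultimately show ?thesis by force
qed

text \<open>By Markov's inequality the moment of order $2n$ is below twice the bound for its average
  on at least half of the ball, and these points yield nonnegative biforms.\<close>
lemma Pos_volume_lower_bound:
  assumes D: "D \<ge> 1" and meas: "\<phi> -` Pos_tilde n \<inter> carrier_vec D \<in> sets (lebesgue_vec D)"
  shows "ennreal (unit_ball_vol D * (1 / (8 * sqrt (real n + 1))) ^ D / 2)
    \<le> emeasure (lebesgue_vec D) (\<phi> -` Pos_tilde n \<inter> carrier_vec D)"
proof -
  define r where "r = 1 / (8 * sqrt (real n + 1))"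
  define \<Lambda> where "\<Lambda> = 4 * (fact n * (2 * r\<^sup>2) ^ n)"
  define V where "V = unit_ball_vol D * r ^ D"
  let ?B = "vball D (0\<^sub>v D) r"
  have r: "r > 0" by (simp add: r_def)
  have \<Lambda>: "\<Lambda> > 0" using r by (simp add: \<Lambda>_def)
  have V: "V \<ge> 0" using r by (simp add: V_def)
  have B: "?B \<in> sets L" by auto
  have mm [measurable]: "moment n \<in> borel_measurable L" by (rule moment_measurable)
  let ?G = "{u \<in> space L. u \<in> ?B \<and> moment n u < ennreal \<Lambda>}" and ?H = "{u \<in> space L. u \<in> ?B \<and> ennreal \<Lambda> \<le> moment n u}"
  have G: "?G \<in> sets L" using B by measurable
  have H: "?H \<in> sets L" using B by measurable
  have "ennreal \<Lambda> * emeasure L ?H = (\<integral>\<^sup>+ u. ennreal \<Lambda> * indicator ?H u \<partial>L)" using H by (rule nn_integral_cmult_indicator[symmetric])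
  also have "\<dots> \<le> (\<integral>\<^sup>+ u. indicator ?B u * moment n u \<partial>L)"
    by (intro nn_integral_mono) (auto simp: indicator_def)
  also have "\<dots> \<le> ennreal (2 * V * (fact n * (2 * r\<^sup>2) ^ n))"
    unfolding V_def using n3 by (intro average_moment r D) simp
  also have "2 * V * (fact n * (2 * r\<^sup>2) ^ n) = \<Lambda> * (V / 2)" by (simp add: \<Lambda>_def)
  also have "ennreal (\<Lambda> * (V / 2)) = ennreal \<Lambda> * ennreal (V / 2)" using \<Lambda> V by (intro ennreal_mult) auto
  finally have Hm: "emeasure L ?H \<le> ennreal (V / 2)" using \<Lambda> by (simp add: ennreal_mult_le_mult_iff)
  have "ennreal V = emeasure L ?B" unfolding V_def using r by (simp add: emeasure_vball)
  also have "\<dots> \<le> emeasure L (?G \<union> ?H)" using G H by (intro emeasure_mono) (auto simp: vball_def)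
  also have "\<dots> \<le> emeasure L ?G + emeasure L ?H" using G H by (rule emeasure_subadditive)
  also have "\<dots> \<le> emeasure L ?G + ennreal (V / 2)" using Hm by (rule add_left_mono)
  finally have "ennreal (V / 2) + ennreal (V / 2) \<le> emeasure L ?G + ennreal (V / 2)" using V by (simp flip: ennreal_plus)
  then have "ennreal (V / 2) \<le> emeasure L ?G" by (simp add: ennreal_add_left_cancel_le add.commute[of "emeasure L ?G"])
  also have "\<dots> = emeasure (lebesgue_vec D) ?G" using G by (simp add: lebesgue_vec_eq)
  also have "\<dots> \<le> emeasure (lebesgue_vec D) (\<phi> -` Pos_tilde n \<inter> carrier_vec D)"
  proof (rule emeasure_mono[OF subsetI meas])
    fix u assume u: "u \<in> ?G"
    have "\<bar>u \<bullet> pt z\<bar> \<le> 1" if "z \<in> T" for z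
      using u sup_constant_le_1[of n] n3 that by (intro small_moment_imp_bounded[of u \<Lambda>]) (auto simp: \<Lambda>_def r_def)
    then show "u \<in> \<phi> -` Pos_tilde n \<inter> carrier_vec D" using u Pos_preimageI by auto
  qed
  finally show ?thesis by (simp add: V_def r_def)
qed

end

section \<open>An upper bound for the volume of the sums of squares\<close>

lemma sum_pairs_nat:
  fixes f :: "nat \<Rightarrow> nat \<Rightarrow> 'a :: comm_monoid_add"
  assumes "n > 0"
  shows "(\<Sum>i<n. \<Sum>j<n. f i j) = (\<Sum>k<n * n. f (k div n) (k mod n))"
proof -
  have lt: "i * n + j < n * n" if "i < n" "j < n" for i j
  proof -
    have "i * n + j < Suc i * n" using that by simp
    also have "\<dots> \<le> n * n" using that by (intro mult_right_mono) auto
    finally show ?thesis .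
  qed
  have "(\<Sum>i<n. \<Sum>j<n. f i j) = (\<Sum>(i, j)\<in>{..<n} \<times> {..<n}. f i j)" by (rule sum.cartesian_product)
  also have "\<dots> = (\<Sum>k<n * n. f (k div n) (k mod n))"
    by (rule sum.reindex_bij_witness[of _ "\<lambda>k. (k div n, k mod n)" "\<lambda>(i, j). i * n + j"])
       (use assms lt in \<open>auto simp: less_mult_imp_div_less\<close>)
  finally show ?thesis .
qed

text \<open>Let $M$ be the supremum of $|Q|$ on the unit ball and $m_0$ its maximum on the net. If
  $|v-x|\le d$, then $Q(v)-Q(x)$ is the polar form at $(v-x,v+x)$, which is at most $2dM$ by the
  parallelogram law. Thus $M\le m_0+2dM$.\<close>
lemma quadratic_form_net:
  fixes N :: nat and A :: "nat \<Rightarrow> nat \<Rightarrow> real"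
  defines "Q v \<equiv> \<Sum>i<N. \<Sum>j<N. A i j * (v $ i * v $ j)"
  assumes X: "finite X" "X \<subseteq> vball N (0\<^sub>v N) 1" and d: "0 < d" "d < 1 / 2"
    and net: "\<And>u. u \<in> vball N (0\<^sub>v N) 1 \<Longrightarrow> \<exists>x\<in>X. vnorm (u - x) \<le> d"
  shows "\<exists>x\<in>X. \<forall>v\<in>carrier_vec N. \<bar>Q v\<bar> \<le> \<bar>Q x\<bar> / (1 - 2 * d) * (v \<bullet> v)"
proof -
  let ?B = "vball N (0\<^sub>v N) 1"
  define M where "M = (SUP v\<in>?B. \<bar>Q v\<bar>)"
  define m0 where "m0 = Max ((\<lambda>x. \<bar>Q x\<bar>) ` X)"
  have 0: "0\<^sub>v N \<in> ?B" by (simp add: vball_0_iff)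
  then have Xne: "X \<noteq> {}" using net by blast
  have scale: "Q (c \<cdot>\<^sub>v v) = c\<^sup>2 * Q v" if "v \<in> carrier_vec N" for c v
    using that by (auto simp: Q_def sum_distrib_left power2_eq_square mult_ac intro!: sum.cong)
  have "\<bar>Q v\<bar> \<le> (\<Sum>i<N. \<Sum>j<N. \<bar>A i j\<bar>)" if v: "v \<in> ?B" for v
  proof -
    have vc: "v \<in> carrier_vec N" "v \<bullet> v \<le> 1" using v by (auto simp: vball_0_iff)
    have c: "\<bar>v $ i\<bar> \<le> 1" if "i < N" for i
    proof -
      have "(v $ i)\<^sup>2 \<le> (\<Sum>i<N. (v $ i)\<^sup>2)" using that by (intro member_le_sum) auto
      also have "\<dots> = v \<bullet> v" using vc by (simp add: scalar_prod_sum[of _ N] power2_eq_square)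
      finally have "(v $ i)\<^sup>2 \<le> 1" using vc(2) by linarith
      then show ?thesis unfolding abs_square_le_1 .
    qed
    have "\<bar>Q v\<bar> \<le> (\<Sum>i<N. \<Sum>j<N. \<bar>A i j * (v $ i * v $ j)\<bar>)"
      unfolding Q_def by (intro order_trans[OF sum_abs] sum_mono sum_abs)
    also have "\<dots> \<le> (\<Sum>i<N. \<Sum>j<N. \<bar>A i j\<bar>)"
    proof (intro sum_mono)
      fix i j assume "i \<in> {..<N}" "j \<in> {..<N}"
      then have "\<bar>v $ i\<bar> * \<bar>v $ j\<bar> \<le> 1 * 1" by (intro mult_mono c) auto
      then have "\<bar>A i j\<bar> * (\<bar>v $ i\<bar> * \<bar>v $ j\<bar>) \<le> \<bar>A i j\<bar> * 1" by (intro mult_left_mono) auto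
      then show "\<bar>A i j * (v $ i * v $ j)\<bar> \<le> \<bar>A i j\<bar>" by (simp add: abs_mult)
    qed
    finally show ?thesis .
  qed
  then have "bdd_above ((\<lambda>v. \<bar>Q v\<bar>) ` ?B)" by (intro bdd_aboveI2)
  then have up: "\<bar>Q v\<bar> \<le> M" if "v \<in> ?B" for v unfolding M_def using that by (rule cSUP_upper2) auto
  have hom: "\<bar>Q v\<bar> \<le> M * (v \<bullet> v)" if bd: "\<And>w. w \<in> ?B \<Longrightarrow> \<bar>Q w\<bar> \<le> M" and v: "v \<in> carrier_vec N" for v M
  proof (cases "v \<bullet> v = 0")
    case True
    then have "v = 0\<^sub>v N" using real_scalar_prod_eq_0_iff[OF v] by simp
    then have "Q v = 0" by (simp add: Q_def)
    then show ?thesis using True by simp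
  next
    case False
    then have p: "v \<bullet> v > 0" using real_scalar_prod_ge_0[of v] by simp
    let ?w = "(1 / sqrt (v \<bullet> v)) \<cdot>\<^sub>v v"
    have "?w \<in> ?B" using v p by (simp add: vball_0_iff)
    then have "\<bar>(1 / sqrt (v \<bullet> v))\<^sup>2 * Q v\<bar> \<le> M" using bd scale[OF v] by metis
    then have "\<bar>Q v\<bar> / (v \<bullet> v) \<le> M" using p by (simp add: power_divide abs_mult)
    then show ?thesis using p by (simp add: pos_divide_le_eq)
  qed
  have M0: "M \<ge> 0" using up[OF 0] by simp
  have step: "\<bar>Q v\<bar> \<le> m0 + 2 * d * M" if v: "v \<in> ?B" for v
  proof -
    obtain x where x: "x \<in> X" "vnorm (v - x) \<le> d" using net[OF v] by blast
    have c: "v \<in> carrier_vec N" "x \<in> carrier_vec N" "v \<bullet> v \<le> 1" "x \<bullet> x \<le> 1" using v x X by (auto simp: vball_0_iff)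
    have dd: "(v - x) \<bullet> (v - x) \<le> d\<^sup>2" using x(2) d(1) by (metis sqrt_le_D)
    \<comment> \<open>Rescaled so that both vectors lie in the unit ball.\<close>
    define a b where "a = (1 / d) \<cdot>\<^sub>v (v - x)" and "b = (1 / 2) \<cdot>\<^sub>v (v + x)"
    have ab: "a \<in> carrier_vec N" "b \<in> carrier_vec N" using c by (simp_all add: a_def b_def)
    have an: "a \<bullet> a \<le> 1" using dd c d(1) by (simp add: a_def pos_divide_le_eq power2_eq_square)
    have "vnorm (v + x) \<le> vnorm v + vnorm x" by (rule vnorm_triangle[OF c(1,2)])
    also have "\<dots> \<le> 1 + 1" using c by (intro add_mono) auto
    finally have "(v + x) \<bullet> (v + x) \<le> 2\<^sup>2" using sqrt_le_D[of "(v + x) \<bullet> (v + x)" 2] by simp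
    then have bn: "b \<bullet> b \<le> 1" using c by (simp add: b_def)
    have par: "(a + b) \<bullet> (a + b) + (a - b) \<bullet> (a - b) = 2 * (a \<bullet> a) + 2 * (b \<bullet> b)"
      using ab comm_scalar_prod[OF ab]
      by (simp add: add_scalar_prod_distrib[of _ N] scalar_prod_add_distrib[of _ N] minus_scalar_prod_distrib[of _ N] scalar_prod_minus_distrib[of _ N])
    have ident: "Q v - Q x = d / 2 * (Q (a + b) - Q (a - b))"
    proof -
      have e: "v $ i * v $ j - x $ i * x $ j = d / 2 * ((a + b) $ i * (a + b) $ j - (a - b) $ i * (a - b) $ j)"
        if "i < N" "j < N" for i j using that c d(1) by (simp add: a_def b_def field_simps)
      have "Q v - Q x = (\<Sum>i<N. \<Sum>j<N. A i j * (v $ i * v $ j - x $ i * x $ j))"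
        by (simp add: Q_def sum_subtractf right_diff_distrib)
      also have "\<dots> = (\<Sum>i<N. \<Sum>j<N. A i j * (d / 2 * ((a + b) $ i * (a + b) $ j - (a - b) $ i * (a - b) $ j)))"
        by (intro sum.cong refl) (simp only: e lessThan_iff)
      also have "\<dots> = d / 2 * (Q (a + b) - Q (a - b))"
        unfolding Q_def sum_subtractf[symmetric] sum_distrib_left by (intro sum.cong refl) (simp add: algebra_simps)
      finally show ?thesis .
    qed
    have "\<bar>Q (a + b)\<bar> \<le> M * ((a + b) \<bullet> (a + b))" "\<bar>Q (a - b)\<bar> \<le> M * ((a - b) \<bullet> (a - b))"
      by (rule hom[OF up], assumption, use ab in simp)+
    then have "\<bar>Q (a + b) - Q (a - b)\<bar> \<le> M * ((a + b) \<bullet> (a + b)) + M * ((a - b) \<bullet> (a - b))"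
      by linarith
    also have "\<dots> = M * (2 * (a \<bullet> a) + 2 * (b \<bullet> b))" unfolding distrib_left[symmetric] par ..
    also have "\<dots> \<le> M * 4" using an bn M0 by (intro mult_left_mono) auto
    finally have "d / 2 * \<bar>Q (a + b) - Q (a - b)\<bar> \<le> d / 2 * (M * 4)" using d(1) by (intro mult_left_mono) auto
    then have "\<bar>Q v - Q x\<bar> \<le> 2 * d * M" using d(1) by (simp add: ident abs_mult)
    moreover have "\<bar>Q x\<bar> \<le> m0" unfolding m0_def using X(1) x(1) by (intro Max_ge) auto
    ultimately show ?thesis by linarith
  qed
  have "M \<le> m0 + 2 * d * M" unfolding M_def[of] using 0 step by (intro cSUP_least) (auto simp flip: M_def)
  then have "M * (1 - 2 * d) \<le> m0" by (simp add: algebra_simps)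
  then have M: "M \<le> m0 / (1 - 2 * d)" using d by (simp add: pos_le_divide_eq)
  have "m0 \<in> (\<lambda>x. \<bar>Q x\<bar>) ` X" unfolding m0_def using X(1) Xne by (intro Max_in) auto
  then obtain x where x: "x \<in> X" "m0 = \<bar>Q x\<bar>" by blast
  have "\<bar>Q v\<bar> \<le> \<bar>Q x\<bar> / (1 - 2 * d) * (v \<bullet> v)" if "v \<in> carrier_vec N" for v
  proof (rule hom[OF _ that])
    fix w assume "w \<in> ?B"
    then show "\<bar>Q w\<bar> \<le> \<bar>Q x\<bar> / (1 - 2 * d)" using up[of w] M unfolding x(2)[symmetric] by linarith
  qed
  then show ?thesis using x(1) by blast
qed

context stiefel
begin

lemma bilform_T:
  assumes "z \<in> T"
  shows "bilform n b z = (\<Sum>i<n. \<Sum>j<n. b i j * (fst z $ i * snd z $ j))"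
proof -
  have "snd z \<in> carrier_vec n" using assms by (cases z) (simp add: orthonormal_pairs_iff)
  then have "bilform n b z = (\<Sum>j<n. \<Sum>i<n. b i j * (fst z $ i * snd z $ j))"
    by (simp add: bilform_def scalar_prod_sum[of _ n] left_form_def sum_distrib_left mult_ac)
  also have "\<dots> = (\<Sum>i<n. \<Sum>j<n. b i j * (fst z $ i * snd z $ j))" by (rule sum.swap)
  finally show ?thesis .
qed

text \<open>On $T$ the form $\sum_i x_iy_i$ vanishes, so a multiple of it can be subtracted to
  remove the trace.\<close>
lemma biform11_traceless:
  assumes q: "q \<in> biforms n 1 1"
  obtains b where "(\<Sum>i<n. b i i) = 0" "\<And>z. z \<in> T \<Longrightarrow> poly_eval q z = bilform n b z"
proof -
  define c where "c i j = Poly_Mapping.lookup q (mexp n (unit_exp n i, unit_exp n j))" for i j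
  define t where "t = (\<Sum>i<n. c i i) / real n"
  define b where "b i j = c i j - (if i = j then t else 0)" for i j
  have E: "exponents n 1 = unit_exp n ` {..<n}"
  proof (intro equalityI subsetI)
    fix \<alpha> assume "\<alpha> \<in> exponents n 1"
    then show "\<alpha> \<in> unit_exp n ` {..<n}" by (metis exponents_1D image_eqI lessThan_iff)
  qed (use unit_exp_exponents in auto)
  have inj: "inj_on (unit_exp n) {..<n}"
  proof (rule inj_onI)
    fix i j assume ij: "i \<in> {..<n}" "j \<in> {..<n}" "unit_exp n i = unit_exp n j"
    then have "unit_exp n j ! i = 1" using unit_exp_nth[of i n i] by simp
    then show "i = j" using unit_exp_nth[of i n j] ij(1) by (simp split: if_splits)
  qed
  have unitp: "(\<Prod>k<n. v $ k ^ (unit_exp n i ! k)) = v $ i" if "i < n" for v :: "real vec" and i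
    using that by (simp add: unit_exp_nth if_distrib[of "power _"] cong: if_cong)
  have qe: "poly_eval q z = (\<Sum>i<n. \<Sum>j<n. c i j * (fst z $ i * snd z $ j))" for z
  proof -
    have "poly_eval q z = (\<Sum>(\<alpha>, \<beta>)\<in>exponents n 1 \<times> exponents n 1. Poly_Mapping.lookup q (mexp n (\<alpha>, \<beta>)) * monomial_fun n (\<alpha>, \<beta>) z)"
      by (subst poly_eval_biform_sum[OF q]) (simp add: case_prod_beta)
    also have "\<dots> = (\<Sum>\<alpha>\<in>exponents n 1. \<Sum>\<beta>\<in>exponents n 1. Poly_Mapping.lookup q (mexp n (\<alpha>, \<beta>)) * monomial_fun n (\<alpha>, \<beta>) z)"
      by (rule sum.cartesian_product[symmetric])
    also have "\<dots> = (\<Sum>i<n. \<Sum>j<n. c i j * monomial_fun n (unit_exp n i, unit_exp n j) z)"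
      unfolding E by (simp add: sum.reindex[OF inj] c_def)
    also have "\<dots> = (\<Sum>i<n. \<Sum>j<n. c i j * (fst z $ i * snd z $ j))"
      by (intro sum.cong refl) (simp add: monomial_fun_def unitp)
    finally show ?thesis .
  qed
  show thesis
  proof (rule that[of b])
    have "(\<Sum>i<n. b i i) = (\<Sum>i<n. c i i) - real n * t" by (simp add: b_def sum_subtractf)
    then show "(\<Sum>i<n. b i i) = 0" using n3 by (simp add: t_def)
    fix z assume z: "z \<in> T"
    have o: "(\<Sum>i<n. fst z $ i * snd z $ i) = 0"
    proof (cases z)
      case (Pair x y)
      then have "x \<in> carrier_vec n" "y \<in> carrier_vec n" "x \<bullet> y = 0" using z by (auto simp: orthonormal_pairs_iff)
      then show ?thesis using Pair by (simp add: scalar_prod_sum[of _ n])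
    qed
    have "bilform n b z = (\<Sum>i<n. \<Sum>j<n. c i j * (fst z $ i * snd z $ j) - (if i = j then t * (fst z $ i * snd z $ i) else 0))"
      unfolding bilform_T[OF z] by (intro sum.cong refl) (auto simp: b_def left_diff_distrib)
    also have "\<dots> = poly_eval q z - t * (\<Sum>i<n. fst z $ i * snd z $ i)"
      by (simp add: qe sum_subtractf sum_distrib_left)
    finally show "poly_eval q z = bilform n b z" using o by simp
  qed
qed

lemma nice_bilform:
  obtains f where "nice f" "\<And>z. z \<in> T \<Longrightarrow> bilform n b z = f z"
proof (rule that)
  show "nice (\<lambda>z. \<Sum>i<n. \<Sum>j<n. b i j * (fst z $ i * snd z $ j))"
    by (intro nice_sum nice_cmult nice_mult nice_coord) auto
qed (rule bilform_T)

definition pair_coord :: "nat \<Rightarrow> real vec \<times> real vec \<Rightarrow> real" where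
  "pair_coord k z = fst z $ (k div n) * snd z $ (k mod n)"

lemma nice_pair_coord: "k < n * n \<Longrightarrow> nice (pair_coord k)"
  unfolding pair_coord_def[abs_def] using n3 by (intro nice_mult nice_coord) (auto simp: less_mult_imp_div_less)

definition form_of_vec :: "real vec \<Rightarrow> nat \<Rightarrow> nat \<Rightarrow> real" where
  "form_of_vec v i j = v $ (i * n + j)"

definition vec_of_form :: "(nat \<Rightarrow> nat \<Rightarrow> real) \<Rightarrow> real vec" where
  "vec_of_form b = Matrix.vec (n * n) (\<lambda>k. b (k div n) (k mod n))"

lemma vec_of_form_carrier [simp]: "vec_of_form b \<in> carrier_vec (n * n)"
  by (simp add: vec_of_form_def)

lemma vec_of_form_of_vec: "v \<in> carrier_vec (n * n) \<Longrightarrow> vec_of_form (form_of_vec v) = v"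
  by (intro eq_vecI) (auto simp: vec_of_form_def form_of_vec_def)

lemma frob_vec: "frob n b = vec_of_form b \<bullet> vec_of_form b"
  unfolding frob_def using n3 by (subst sum_pairs_nat) (auto simp: scalar_prod_sum[of _ "n * n"] vec_of_form_def power2_eq_square)

lemma bilform_vec: "z \<in> T \<Longrightarrow> bilform n b z = (\<Sum>k<n * n. vec_of_form b $ k * pair_coord k z)"
  unfolding bilform_T using n3 by (subst sum_pairs_nat) (auto simp: vec_of_form_def pair_coord_def)

lemma bilform_second_moment_lower:
  assumes tr: "(\<Sum>i<n. b i i) = 0"
  shows "(1 - 2 / real n) * frob n b \<le> real n * (real n - 1) * (\<integral>z. (bilform n b z)\<^sup>2 \<partial>\<sigma>)"
proof -
  obtain f where f: "nice f" "\<And>z. z \<in> T \<Longrightarrow> bilform n b z = f z" by (rule nice_bilform) (rule that)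
  have "(\<integral>\<^sup>+ z. ennreal ((bilform n b z)\<^sup>2) \<partial>\<sigma>) = (\<integral>\<^sup>+ z. ennreal ((f z)\<^sup>2) \<partial>\<sigma>)" using f(2) by (intro nn_integral_cong) simp
  also have "\<dots> = ennreal (\<integral>z. (f z)\<^sup>2 \<partial>\<sigma>)" by (intro nn_integral_eq_integral nice_integrable nice_power f) auto
  also have "(\<integral>z. (f z)\<^sup>2 \<partial>\<sigma>) = (\<integral>z. (bilform n b z)\<^sup>2 \<partial>\<sigma>)" using f(2) by (intro Bochner_Integration.integral_cong) auto
  finally have "ennreal (frob n b) \<le> ennreal (real n * (real n - 1) * (\<integral>z. (bilform n b z)\<^sup>2 \<partial>\<sigma>) + 2 * frob n b / real n)"
    using bilform_second_moment_lower_nn[where n = n and b = b, OF n3 tr] n3 frob_nonneg[of n b]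
    by (simp add: ennreal_mult Bochner_Integration.integral_nonneg)
  moreover have "0 \<le> real n * (real n - 1) * (\<integral>z. (bilform n b z)\<^sup>2 \<partial>\<sigma>) + 2 * frob n b / real n"
    using n3 frob_nonneg[of n b] by (auto intro!: add_nonneg_nonneg Bochner_Integration.integral_nonneg mult_nonneg_nonneg)
  ultimately have "frob n b \<le> real n * (real n - 1) * (\<integral>z. (bilform n b z)\<^sup>2 \<partial>\<sigma>) + 2 * frob n b / real n"
    by (simp add: ennreal_le_iff)
  then show ?thesis by (simp add: algebra_simps)
qed

lemma bilform_fourth_moment:
  "(\<integral>z. (bilform n b z) ^ 4 \<partial>\<sigma>) \<le> (3 * frob n b / (real n * (real n - 1)))\<^sup>2"
proof -
  obtain f where f: "nice f" "\<And>z. z \<in> T \<Longrightarrow> bilform n b z = f z" by (rule nice_bilform) (rule that)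
  let ?I = "\<integral>z. (bilform n b z) ^ 4 \<partial>\<sigma>" and ?c = "real n * (real n - 1)"
  have c: "?c > 0" using n3 by simp
  have I0: "?I \<ge> 0" by (intro Bochner_Integration.integral_nonneg) simp
  have "(\<integral>\<^sup>+ z. ennreal ((bilform n b z) ^ 4) \<partial>\<sigma>) = (\<integral>\<^sup>+ z. ennreal ((f z) ^ 4) \<partial>\<sigma>)" using f(2) by (intro nn_integral_cong) simp
  also have "\<dots> = ennreal (\<integral>z. (f z) ^ 4 \<partial>\<sigma>)" by (intro nn_integral_eq_integral nice_integrable nice_power f) auto
  also have "(\<integral>z. (f z) ^ 4 \<partial>\<sigma>) = ?I" using f(2) by (intro Bochner_Integration.integral_cong) auto
  finally have "ennreal (?c\<^sup>2 * ?I) \<le> ennreal (9 * (frob n b)\<^sup>2)"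
    using bilform_fourth_moment_nn[OF n3, of b] I0 by (simp add: ennreal_mult)
  then have "?c\<^sup>2 * ?I \<le> 9 * (frob n b)\<^sup>2" by (simp add: ennreal_le_iff)
  moreover have "?c\<^sup>2 > 0" using c by (rule zero_less_power)
  ultimately have "?I \<le> 9 * (frob n b)\<^sup>2 / ?c\<^sup>2" by (simp only: pos_le_divide_eq mult.commute)
  then show ?thesis by (simp add: power_divide power_mult_distrib)
qed

lemma bessel:
  assumes on: "orthonormal d \<psi>" and f: "nice f"
  shows "(\<Sum>i<d. (ip f (\<psi> i))\<^sup>2) \<le> (\<integral>z. (f z)\<^sup>2 \<partial>\<sigma>)"
proof -
  let ?g = "\<lambda>z. \<Sum>i<d. ip f (\<psi> i) * \<psi> i z"
  have n\<psi>: "nice (\<psi> i)" if "i < d" for i using on that by (simp add: orthonormal_def)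
  have g: "nice ?g" by (intro nice_sum nice_cmult n\<psi>) auto
  have "ip ?g f = (\<Sum>i<d. ip f (\<psi> i) * ip (\<psi> i) f)" by (intro ip_sum_left n\<psi> f) auto
  then have gf: "ip ?g f = (\<Sum>i<d. (ip f (\<psi> i))\<^sup>2)" by (simp add: ip_sym[of "\<psi> _"] power2_eq_square)
  have gg: "ip ?g ?g = (\<Sum>i<d. (ip f (\<psi> i))\<^sup>2)"
    using orthonormal_norm[OF on, of ?g] by (simp add: ip_def power2_eq_square)
  have "0 \<le> ip (\<lambda>z. f z - ?g z) (\<lambda>z. f z - ?g z)" unfolding ip_def by (intro Bochner_Integration.integral_nonneg) simp
  also have "\<dots> = ip (\<lambda>z. f z - ?g z) f - ip (\<lambda>z. f z - ?g z) ?g"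
    unfolding ip_diff_left[OF f g nice_diff[OF f g]] by (simp only: ip_sym[of "\<lambda>z. f z - ?g z"])
  also have "\<dots> = ip f f - ip ?g f - (ip f ?g - ip ?g ?g)"
    unfolding ip_diff_left[OF f g f] ip_diff_left[OF f g g] ..
  finally have "(\<Sum>i<d. (ip f (\<psi> i))\<^sup>2) \<le> ip f f" using gf gg ip_sym[of f ?g] by simp
  then show ?thesis by (simp add: ip_def power2_eq_square)
qed

end

context isometric_coordinates
begin

text \<open>The coordinates of the projection of $q^2$ to $\mathcal M$, where $q$ is the bilinear form
  with coefficient vector $v$.\<close>
definition square_moment :: "real vec \<Rightarrow> real vec" where
  "square_moment v = Matrix.vec D (\<lambda>k. \<integral>z. (\<Sum>l<n * n. v $ l * pair_coord l z)\<^sup>2 * \<Phi> k z \<partial>\<sigma>)"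

lemma square_moment_carrier [simp]: "square_moment v \<in> carrier_vec D"
  by (simp add: square_moment_def)

lemma nice_form: "nice (\<lambda>z. \<Sum>l<n * n. v $ l * pair_coord l z)"
  by (intro nice_sum nice_cmult nice_pair_coord) auto

lemma square_moment_scalar:
  assumes w: "w \<in> carrier_vec D"
  shows "square_moment v \<bullet> w = (\<integral>z. (\<Sum>l<n * n. v $ l * pair_coord l z)\<^sup>2 * (w \<bullet> pt z) \<partial>\<sigma>)"
proof -
  let ?q = "\<lambda>z. (\<Sum>l<n * n. v $ l * pair_coord l z)\<^sup>2"
  have q: "nice ?q" by (intro nice_power nice_form)
  have "(\<integral>z. ?q z * (w \<bullet> pt z) \<partial>\<sigma>) = ip (\<lambda>z. \<Sum>i<D. w $ i * \<Phi> i z) ?q"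
    by (simp add: ip_def scalar_pt mult.commute)
  also have "\<dots> = (\<Sum>i<D. w $ i * ip (\<Phi> i) ?q)" by (intro ip_sum_left nice_\<Phi> q) auto
  also have "\<dots> = square_moment v \<bullet> w"
    unfolding scalar_prod_sum[OF w] by (intro sum.cong refl) (simp add: square_moment_def ip_def mult.commute)
  finally show ?thesis ..
qed

text \<open>Bessel's inequality and the fourth moment bound.\<close>
lemma square_moment_norm:
  assumes v: "v \<in> vball (n * n) (0\<^sub>v (n * n)) 1"
  shows "square_moment v \<bullet> square_moment v \<le> (3 / (real n * (real n - 1)))\<^sup>2"
proof -
  let ?q = "\<lambda>z. \<Sum>l<n * n. v $ l * pair_coord l z"
  have vc: "v \<in> carrier_vec (n * n)" "v \<bullet> v \<le> 1" using v by (auto simp: vball_0_iff)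
  have nn: "real n * (real n - 1) > 0" using n3 by simp
  have "square_moment v \<bullet> square_moment v = (\<Sum>i<D. (ip (\<lambda>z. (?q z)\<^sup>2) (\<Phi> i))\<^sup>2)"
    by (simp add: scalar_prod_sum[of _ D] square_moment_def ip_def power2_eq_square)
  also have "\<dots> \<le> (\<integral>z. ((?q z)\<^sup>2)\<^sup>2 \<partial>\<sigma>)" by (rule bessel[OF orthonormal_\<Phi> nice_power[OF nice_form]])
  also have "\<dots> = (\<integral>z. (bilform n (form_of_vec v) z) ^ 4 \<partial>\<sigma>)"
    using bilform_vec[of _ "form_of_vec v"] vec_of_form_of_vec[OF vc(1)]
    by (intro Bochner_Integration.integral_cong) (auto simp flip: power_mult)
  also have "\<dots> \<le> (3 * frob n (form_of_vec v) / (real n * (real n - 1)))\<^sup>2" by (rule bilform_fourth_moment)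
  also have "\<dots> \<le> (3 / (real n * (real n - 1)))\<^sup>2"
    using vc nn frob_nonneg[of n "form_of_vec v"]
    by (intro power_mono divide_right_mono divide_nonneg_pos) (auto simp: frob_vec vec_of_form_of_vec)
  finally show ?thesis .
qed

text \<open>Integrating $f+1=\sum_l q_l^2$ over $T$ gives $\sum_l\int q_l^2=1$, which bounds the
  sum of the squared Frobenius norms. Pairing $f$ with a mean zero biform is the same as pairing
  $\sum_l q_l^2$ with it.\<close>
lemma Sos_trace_bound:
  assumes u: "u \<in> carrier_vec D" and S: "\<phi> u \<in> Sos_tilde n"
  obtains K :: nat and b where "(\<Sum>l<K. b l \<bullet> b l) \<le> real n * (real n - 1) / (1 - 2 / real n)"
    "\<And>l. l < K \<Longrightarrow> b l \<in> carrier_vec (n * n)"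
    "\<And>w. w \<in> carrier_vec D \<Longrightarrow> u \<bullet> w = (\<Sum>l<K. square_moment (b l) \<bullet> w)"
proof -
  obtain K q where q: "\<And>l. l < (K :: nat) \<Longrightarrow> q l \<in> biforms n 1 1"
    "\<And>z. z \<in> T \<Longrightarrow> u \<bullet> pt z + 1 = (\<Sum>l<K. (poly_eval (q l) z)\<^sup>2)"
    by (rule Sos_preimageE[OF u S]) (rule that)
  have "\<forall>l\<in>{..<K}. \<exists>a. (\<Sum>i<n. a i i) = 0 \<and> (\<forall>z\<in>T. poly_eval (q l) z = bilform n a z)"
  proof
    fix l assume "l \<in> {..<K}"
    then have "q l \<in> biforms n 1 1" using q(1) by simp
    then obtain a where "(\<Sum>i<n. a i i) = 0" "\<And>z. z \<in> T \<Longrightarrow> poly_eval (q l) z = bilform n a z" by (rule biform11_traceless) (rule that)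
    then show "\<exists>a. (\<Sum>i<n. a i i) = 0 \<and> (\<forall>z\<in>T. poly_eval (q l) z = bilform n a z)" by (intro exI[of _ a]) auto
  qed
  then obtain a where a: "\<forall>l\<in>{..<K}. (\<Sum>i<n. a l i i) = 0 \<and> (\<forall>z\<in>T. poly_eval (q l) z = bilform n (a l) z)"
    unfolding bchoice_iff by (elim exE)
  define b where "b l = vec_of_form (a l)" for l
  let ?q = "\<lambda>l z. \<Sum>k<n * n. b l $ k * pair_coord k z"
  have e: "poly_eval (q l) z = ?q l z" if "l < K" "z \<in> T" for l z
    using a that bilform_vec[of z "a l"] by (simp add: b_def)
  have Fq: "u \<bullet> pt z + 1 = (\<Sum>l<K. (?q l z)\<^sup>2)" if "z \<in> T" for z
    unfolding q(2)[OF that] using e that by (intro sum.cong) auto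
  let ?t = "1 - 2 / real n"
  have t: "?t > 0" using n3 by simp
  have I: "(\<Sum>l<K. \<integral>z. (?q l z)\<^sup>2 \<partial>\<sigma>) = 1"
  proof -
    have "(\<Sum>l<K. \<integral>z. (?q l z)\<^sup>2 \<partial>\<sigma>) = (\<integral>z. (\<Sum>l<K. (?q l z)\<^sup>2) \<partial>\<sigma>)"
      by (subst Bochner_Integration.integral_sum) (auto intro!: nice_integrable nice_power nice_form)
    also have "\<dots> = (\<integral>z. u \<bullet> pt z + 1 \<partial>\<sigma>)" by (intro Bochner_Integration.integral_cong) (auto simp: Fq)
    also have "\<dots> = 1" using pt_mean[of u] nice_integrable[OF nice_pt[of u]] S.prob_space by simp
    finally show ?thesis .
  qed
  \<comment> \<open>The second moment bound for traceless forms.\<close>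
  have fr: "?t * (b l \<bullet> b l) \<le> real n * (real n - 1) * (\<integral>z. (?q l z)\<^sup>2 \<partial>\<sigma>)" if l: "l < K" for l
  proof -
    have "(\<integral>z. (bilform n (a l) z)\<^sup>2 \<partial>\<sigma>) = (\<integral>z. (?q l z)\<^sup>2 \<partial>\<sigma>)"
      using bilform_vec[of _ "a l"] by (intro Bochner_Integration.integral_cong) (auto simp: b_def)
    then show ?thesis using bilform_second_moment_lower[of "a l"] a l by (simp add: b_def frob_vec)
  qed
  have "?t * (\<Sum>l<K. b l \<bullet> b l) \<le> (\<Sum>l<K. real n * (real n - 1) * (\<integral>z. (?q l z)\<^sup>2 \<partial>\<sigma>))"
    unfolding sum_distrib_left by (intro sum_mono fr) simp
  also have "\<dots> = real n * (real n - 1)" using I by (simp flip: sum_distrib_left)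
  finally have "(\<Sum>l<K. b l \<bullet> b l) * ?t \<le> real n * (real n - 1)" by (simp only: mult.commute)
  then have B: "(\<Sum>l<K. b l \<bullet> b l) \<le> real n * (real n - 1) / ?t" by (simp only: pos_le_divide_eq[OF t])
  show thesis
  proof (rule that[OF B])
    fix w :: "real vec" assume w: "w \<in> carrier_vec D"
    have np: "nice (\<lambda>z. (?q l z)\<^sup>2 * (w \<bullet> pt z))" for l by (intro nice_mult nice_power nice_form nice_pt)
    have "(\<Sum>l<K. square_moment (b l) \<bullet> w) = (\<integral>z. (\<Sum>l<K. (?q l z)\<^sup>2 * (w \<bullet> pt z)) \<partial>\<sigma>)"
      unfolding square_moment_scalar[OF w] by (subst Bochner_Integration.integral_sum) (auto intro!: nice_integrable np)
    also have "\<dots> = (\<integral>z. (w \<bullet> pt z) * (u \<bullet> pt z) + w \<bullet> pt z \<partial>\<sigma>)"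
    proof (intro Bochner_Integration.integral_cong refl)
      fix z assume "z \<in> space \<sigma>"
      then have "z \<in> T" by simp
      then show "(\<Sum>l<K. (?q l z)\<^sup>2 * (w \<bullet> pt z)) = (w \<bullet> pt z) * (u \<bullet> pt z) + w \<bullet> pt z"
        unfolding sum_distrib_right[symmetric] by (subst Fq[symmetric]) (simp_all add: algebra_simps)
    qed
    also have "\<dots> = (\<integral>z. (w \<bullet> pt z) * (u \<bullet> pt z) \<partial>\<sigma>) + (\<integral>z. w \<bullet> pt z \<partial>\<sigma>)"
      by (intro Bochner_Integration.integral_add nice_integrable nice_mult nice_pt)
    also have "\<dots> = ip (\<lambda>z. w \<bullet> pt z) (\<lambda>z. u \<bullet> pt z)" by (simp add: pt_mean ip_def)
    also have "\<dots> = ip (\<lambda>z. \<Sum>i<D. w $ i * \<Phi> i z) (\<lambda>z. u \<bullet> pt z)" unfolding scalar_pt[of w] ..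
    also have "\<dots> = (\<Sum>i<D. w $ i * ip (\<Phi> i) (\<lambda>z. u \<bullet> pt z))" by (intro ip_sum_left nice_\<Phi> nice_pt) auto
    also have "\<dots> = (\<Sum>i<D. w $ i * u $ i)"
      using orthonormal_coeff[OF orthonormal_\<Phi>, of "\<lambda>z. u \<bullet> pt z" "\<lambda>i. u $ i"]
      by (intro sum.cong refl) (simp add: scalar_pt ip_sym[of "\<Phi> _"])
    also have "\<dots> = u \<bullet> w" by (simp add: scalar_prod_sum[OF w] mult.commute)
    finally show "u \<bullet> w = (\<Sum>l<K. square_moment (b l) \<bullet> w)" ..
  qed (simp add: b_def)
qed

text \<open>Pairing with a fixed $w$ makes $q\mapsto\langle q^2,w\rangle$ a quadratic form on the
  bilinear forms, so the net bound applies; the factor $5/4=1/(1-2d)$ for a net of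
  fineness $d=1/10$ enters the vertices, which are taken with both signs because the quadratic form
  has no definite sign.\<close>
lemma Sos_volume_upper_bound:
  assumes m: "m \<ge> 1"
  shows "emeasure (lebesgue_vec D) (\<phi> -` Sos_tilde n \<inter> carrier_vec D)
    \<le> ennreal ((2 * 21 ^ (n * n)) ^ m * (unit_ball_vol D * (15 / 4 / (1 - 2 / real n) / sqrt m) ^ D))"
proof -
  let ?N = "n * n" and ?\<beta> = "real n * (real n - 1) / (1 - 2 / real n)" and ?R = "15 / 4 / (1 - 2 / real n)"
  have t: "1 - 2 / real n > 0" using n3 by simp
  have nn: "real n * (real n - 1) > 0" using n3 by simp
  obtain X0 where X0: "finite X0" "X0 \<subseteq> vball ?N (0\<^sub>v ?N) 1" "real (card X0) \<le> (1 + 2 / (1 / 10)) ^ ?N"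
    "\<And>u. u \<in> vball ?N (0\<^sub>v ?N) 1 \<Longrightarrow> \<exists>x\<in>X0. vnorm (u - x) \<le> 1 / 10"
    by (rule net_exists[of "1 / 10" ?N]) (simp, rule that)
  define X where "X = (\<lambda>(s, v). (s * (5 / 4 * ?\<beta>)) \<cdot>\<^sub>v square_moment v) ` ({1, -1} \<times> X0)"
  have Xf: "finite X" unfolding X_def using X0(1) by simp
  have Xc: "X \<subseteq> carrier_vec D" by (auto simp: X_def)
  have "card X \<le> card ({1, -1 :: real} \<times> X0)" unfolding X_def by (rule card_image_le) (use X0(1) in simp)
  also have "\<dots> = 2 * card X0" by (simp add: card_cartesian_product)
  finally have "real (card X) \<le> 2 * real (card X0)" by linarith
  moreover have "1 + 2 / (1 / 10) = (21 :: real)" by simp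
  ultimately have card: "real (card X) \<le> 2 * 21 ^ ?N" using X0(3) by (simp only:)
  have XR: "x \<bullet> x \<le> ?R\<^sup>2" if x: "x \<in> X" for x
  proof -
    obtain s v where sv: "s \<in> {1, -1 :: real}" "v \<in> X0" "x = (s * (5 / 4 * ?\<beta>)) \<cdot>\<^sub>v square_moment v" using x by (auto simp: X_def)
    have "x \<bullet> x = s\<^sup>2 * ((5 / 4 * ?\<beta>)\<^sup>2 * (square_moment v \<bullet> square_moment v))"
      unfolding sv(3) by (simp add: smult_scalar_prod_distrib[of _ D] scalar_prod_smult_distrib[of _ D] power2_eq_square)
    also have "s\<^sup>2 = 1" using sv(1) by auto
    also have "1 * ((5 / 4 * ?\<beta>)\<^sup>2 * (square_moment v \<bullet> square_moment v)) \<le> (5 / 4 * ?\<beta>)\<^sup>2 * (3 / (real n * (real n - 1)))\<^sup>2"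
      unfolding mult_1 using sv(2) X0(2) by (intro mult_left_mono square_moment_norm) auto
    also have "\<dots> = (5 / 4 * ?\<beta> * (3 / (real n * (real n - 1))))\<^sup>2" by (rule power_mult_distrib[symmetric])
    also have "5 / 4 * ?\<beta> * (3 / (real n * (real n - 1))) = ?R"
    proof -
      have cancel: "5 / 4 * (c / t) * (3 / c) = 15 / 4 / t" if "c \<noteq> 0" for c t :: real using that by simp
      show ?thesis by (rule cancel) (rule less_imp_neq[OF nn, symmetric])
    qed
    finally show ?thesis .
  qed
  have sup: "\<exists>x\<in>X. x \<bullet> w \<le> u \<bullet> w" if u: "u \<in> \<phi> -` Sos_tilde n \<inter> carrier_vec D" and w: "w \<in> carrier_vec D" for u w
  proof -
    have u': "u \<in> carrier_vec D" "\<phi> u \<in> Sos_tilde n" using u by auto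
    define A where "A i j = (\<integral>z. pair_coord i z * pair_coord j z * (w \<bullet> pt z) \<partial>\<sigma>)" for i j
    have Q: "(\<Sum>i<?N. \<Sum>j<?N. A i j * (v $ i * v $ j)) = square_moment v \<bullet> w" for v
    proof -
      have np: "nice (\<lambda>z. pair_coord i z * pair_coord j z * (w \<bullet> pt z))" if "i < ?N" "j < ?N" for i j
        using that by (intro nice_mult nice_pair_coord nice_pt)
      have "square_moment v \<bullet> w = (\<integral>z. (\<Sum>i<?N. \<Sum>j<?N. v $ i * v $ j * (pair_coord i z * pair_coord j z * (w \<bullet> pt z))) \<partial>\<sigma>)"
        unfolding square_moment_scalar[OF w]
      proof (intro Bochner_Integration.integral_cong refl)
        fix z
        have "(\<Sum>l<?N. v $ l * pair_coord l z)\<^sup>2 = (\<Sum>i<?N. \<Sum>j<?N. (v $ i * pair_coord i z) * (v $ j * pair_coord j z))"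
          by (simp only: power2_eq_square sum_product)
        then show "(\<Sum>l<?N. v $ l * pair_coord l z)\<^sup>2 * (w \<bullet> pt z)
          = (\<Sum>i<?N. \<Sum>j<?N. v $ i * v $ j * (pair_coord i z * pair_coord j z * (w \<bullet> pt z)))"
          by (simp only: sum_distrib_right) (intro sum.cong refl, simp only: mult_ac)
      qed
      also have "\<dots> = (\<Sum>i<?N. \<integral>z. (\<Sum>j<?N. v $ i * v $ j * (pair_coord i z * pair_coord j z * (w \<bullet> pt z))) \<partial>\<sigma>)"
        by (rule Bochner_Integration.integral_sum) (intro nice_integrable nice_sum nice_cmult np, auto)
      also have "\<dots> = (\<Sum>i<?N. \<Sum>j<?N. \<integral>z. v $ i * v $ j * (pair_coord i z * pair_coord j z * (w \<bullet> pt z)) \<partial>\<sigma>)"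
        by (intro sum.cong refl Bochner_Integration.integral_sum nice_integrable nice_cmult np) auto
      also have "\<dots> = (\<Sum>i<?N. \<Sum>j<?N. A i j * (v $ i * v $ j))"
        unfolding A_def integral_mult_right_zero by (intro sum.cong refl) (simp only: mult_ac)
      finally show ?thesis ..
    qed
    have "\<exists>x\<in>X0. \<forall>v\<in>carrier_vec ?N. \<bar>\<Sum>i<?N. \<Sum>j<?N. A i j * (v $ i * v $ j)\<bar>
        \<le> \<bar>\<Sum>i<?N. \<Sum>j<?N. A i j * (x $ i * x $ j)\<bar> / (1 - 2 * (1 / 10)) * (v \<bullet> v)"
      by (rule quadratic_form_net[OF X0(1,2) _ _ X0(4)]) auto
    then obtain v0 where v0: "v0 \<in> X0"
      and le': "\<forall>v\<in>carrier_vec ?N. \<bar>square_moment v \<bullet> w\<bar> \<le> \<bar>square_moment v0 \<bullet> w\<bar> / (1 - 2 * (1 / 10)) * (v \<bullet> v)"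
      unfolding Q by blast
    have le: "\<bar>square_moment v \<bullet> w\<bar> \<le> 5 / 4 * \<bar>square_moment v0 \<bullet> w\<bar> * (v \<bullet> v)" if "v \<in> carrier_vec ?N" for v
      using le'[rule_format, OF that] by simp
    obtain K :: nat and b where b: "(\<Sum>l<K. b l \<bullet> b l) \<le> ?\<beta>" "\<And>l. l < K \<Longrightarrow> b l \<in> carrier_vec ?N"
      "\<And>w. w \<in> carrier_vec D \<Longrightarrow> u \<bullet> w = (\<Sum>l<K. square_moment (b l) \<bullet> w)"
      by (rule Sos_trace_bound[OF u']) (rule that)
    let ?s = "square_moment v0 \<bullet> w"
    have "- (u \<bullet> w) = (\<Sum>l<K. - (square_moment (b l) \<bullet> w))" using b(3)[OF w] by (simp add: sum_negf)
    also have "\<dots> \<le> (\<Sum>l<K. 5 / 4 * \<bar>?s\<bar> * (b l \<bullet> b l))" using le b(2) by (intro sum_mono) (meson abs_le_D2 lessThan_iff)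
    also have "\<dots> = 5 / 4 * \<bar>?s\<bar> * (\<Sum>l<K. b l \<bullet> b l)" by (rule sum_distrib_left[symmetric])
    also have "\<dots> \<le> 5 / 4 * \<bar>?s\<bar> * ?\<beta>" by (intro mult_left_mono b(1)) auto
    finally have uw: "- (5 / 4 * ?\<beta> * \<bar>?s\<bar>) \<le> u \<bullet> w" by (simp only: mult_ac)
    \<comment> \<open>The sign for which the vertex pairs negatively with $w$.\<close>
    define s where "s = (if ?s \<le> 0 then 1 else -1 :: real)"
    have "((s * (5 / 4 * ?\<beta>)) \<cdot>\<^sub>v square_moment v0) \<bullet> w = - (5 / 4 * ?\<beta> * \<bar>?s\<bar>)"
      using w by (simp add: s_def smult_scalar_prod_distrib[of _ D])
    moreover have "(s * (5 / 4 * ?\<beta>)) \<cdot>\<^sub>v square_moment v0 \<in> X"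
      unfolding X_def using v0 by (intro image_eqI[of _ _ "(s, v0)"]) (auto simp: s_def)
    ultimately show ?thesis using uw by (intro bexI[of _ "(s * (5 / 4 * ?\<beta>)) \<cdot>\<^sub>v square_moment v0"]) auto
  qed
  have "emeasure (lebesgue_vec D) (\<phi> -` Sos_tilde n \<inter> carrier_vec D)
    \<le> ennreal (real (card X) ^ m * (unit_ball_vol D * (?R / sqrt m) ^ D))"
    unfolding lebesgue_vec_eq using t by (intro greedy_volume_bound[OF Xc Xf _ XR m _ sup]) auto
  also have "\<dots> \<le> ennreal ((2 * 21 ^ ?N) ^ m * (unit_ball_vol D * (?R / sqrt m) ^ D))"
    using card t by (intro ennreal_leI mult_right_mono power_mono mult_nonneg_nonneg zero_le_power divide_nonneg_nonneg unit_ball_vol_nonneg) auto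
  finally show ?thesis .
qed

end

section \<open>Comparison of the two volumes\<close>

context isometric_coordinates
begin

lemma Sos_subset_Pos: "Sos_tilde n \<subseteq> Pos_tilde n"
proof
  fix f assume f: "f \<in> Sos_tilde n"
  then obtain p where p: "p \<in> B22" "f = cls p" by (auto simp: Sos_tilde_def quotient_iff)
  have pN: "p + norm_poly \<in> B22" using p norm_poly_biform by (intro biforms_add)
  have H: "Q_add n f (norm_biform n) \<in> H_plane n" using f by (simp add: Sos_tilde_def)
  obtain k q where q: "\<And>i. i < (k :: nat) \<Longrightarrow> q i \<in> biforms n 1 1"
    "\<And>z. z \<in> T \<Longrightarrow> poly_eval p z + 1 = (\<Sum>i<k. (poly_eval (q i) z)\<^sup>2)"
    by (rule Sos_tildeE[OF p(1) f[unfolded p(2)]]) (rule that)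
  have ge: "poly_eval (p + norm_poly) z \<ge> 0" if "z \<in> T" for z
    using q(2)[OF that] poly_eval_norm_poly[OF that] by (simp add: poly_eval_add sum_nonneg)
  have "Q_eval (cls (p + norm_poly)) z \<ge> 0" if z: "z \<in> ortho_variety n" for z
    using nonneg_on_variety[OF pN ge z] Q_eval_cls[OF pN z] by simp
  then have "cls (p + norm_poly) \<in> Pos_Q n" using pN by (auto simp: Pos_Q_def quotient_iff)
  moreover have "Q_add n f (norm_biform n) = cls (p + norm_poly)"
    using p norm_poly_biform by (simp add: norm_biform_cls Q_add_cls)
  ultimately show "f \<in> Pos_tilde n" using f H by (simp add: Pos_tilde_def Sos_tilde_def)
qed

abbreviation volume :: "rpoly set set \<Rightarrow> real" where
  "volume A \<equiv> measure (lebesgue_vec D) (\<phi> -` A \<inter> carrier_vec D)"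

lemma measure_nonzeroD:
  assumes "measure M A \<noteq> 0"
  shows "A \<in> sets M" "emeasure M A = ennreal (measure M A)" "measure M A > 0"
proof -
  show "A \<in> sets M" using assms measure_notin_sets by blast
  have "emeasure M A \<noteq> \<infinity>" using assms by (auto simp: measure_def)
  then show "emeasure M A = ennreal (measure M A)" by (simp add: emeasure_eq_ennreal_measure)
  show "measure M A > 0" using assms by (simp add: zero_less_measure_iff)
qed

text \<open>A ratio with zero denominator is $0$; this covers the case that the preimage in the
  denominator has infinite measure or is not measurable.\<close>
lemma ratio_le_1: "volume (Sos_tilde n) / volume (Pos_tilde n) \<le> 1"
proof (cases "volume (Pos_tilde n) = 0")
  case False
  note P = measure_nonzeroD[OF False]
  have "emeasure (lebesgue_vec D) (\<phi> -` Sos_tilde n \<inter> carrier_vec D) \<le> emeasure (lebesgue_vec D) (\<phi> -` Pos_tilde n \<inter> carrier_vec D)"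
    using Sos_subset_Pos by (intro emeasure_mono P(1)) auto
  then have "volume (Sos_tilde n) \<le> volume (Pos_tilde n)"
    unfolding P(2) measure_def[of _ "\<phi> -` Sos_tilde n \<inter> carrier_vec D"] by (intro enn2real_leI) auto
  then show ?thesis using P(3) by simp
qed simp

lemma ratio_le:
  assumes m: "m \<ge> 1" and D: "D \<ge> 1"
  shows "volume (Sos_tilde n) / volume (Pos_tilde n)
    \<le> 2 * (2 * 21 ^ (n * n)) ^ m * (15 / 4 / (1 - 2 / real n) * 8 * (sqrt (real n + 1) / sqrt m)) ^ D"
proof (cases "volume (Pos_tilde n) = 0")
  case True
  have "1 - 2 / real n > 0" using n3 by simp
  then have "0 \<le> 2 * (2 * 21 ^ (n * n)) ^ m * (15 / 4 / (1 - 2 / real n) * 8 * (sqrt (real n + 1) / sqrt m)) ^ D"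
    by (intro mult_nonneg_nonneg zero_le_power divide_nonneg_nonneg) auto
  then show ?thesis using True by simp
next
  case False
  note P = measure_nonzeroD[OF False]
  let ?w = "unit_ball_vol D" and ?r = "1 / (8 * sqrt (real n + 1))" and ?R = "15 / 4 / (1 - 2 / real n)"
  have w: "?w > 0" by simp
  have r: "?r > 0" by simp
  have "1 - 2 / real n > 0" using n3 by simp
  then have R: "?R > 0" by (intro divide_pos_pos) auto
  have "ennreal (?w * ?r ^ D / 2) \<le> ennreal (volume (Pos_tilde n))"
    using Pos_volume_lower_bound[OF D P(1)] unfolding P(2) .
  then have lo: "?w * ?r ^ D / 2 \<le> volume (Pos_tilde n)" by (simp add: ennreal_le_iff)
  have hi: "volume (Sos_tilde n) \<le> (2 * 21 ^ (n * n)) ^ m * (?w * (?R / sqrt m) ^ D)"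
    unfolding measure_def[of _ "\<phi> -` Sos_tilde n \<inter> carrier_vec D"] using R w
    by (intro enn2real_leI Sos_volume_upper_bound[OF m]) auto
  have "volume (Sos_tilde n) / volume (Pos_tilde n) \<le> ((2 * 21 ^ (n * n)) ^ m * (?w * (?R / sqrt m) ^ D)) / (?w * ?r ^ D / 2)"
    using hi lo w r R by (intro frac_le) auto
  also have "\<dots> = 2 * (2 * 21 ^ (n * n)) ^ m * ((?R / sqrt m) ^ D / ?r ^ D)"
  proof -
    have cancel: "A * (w * X) / (w * Y / 2) = 2 * A * (X / Y)" if "w \<noteq> 0" for A w X Y :: real using that by simp
    show ?thesis by (rule cancel) (rule less_imp_neq[OF w, symmetric])
  qed
  also have "(?R / sqrt m) ^ D / ?r ^ D = (?R / sqrt m / ?r) ^ D" by (rule power_divide[symmetric])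
  also have "?R / sqrt m / ?r = ?R * 8 * (sqrt (real n + 1) / sqrt m)" by simp
  finally show ?thesis .
qed

end

text \<open>Elementary estimates: $10^2\ge(16/10)^9$ and $3^3\le(52/10)^2$.\<close>
lemma base_gt: "(2 ^ 5 * 2 powr (1/2) * 5 ^ 2 * 10 powr (2/9)) / (3 powr (3/2) * sqrt x) > 340 / sqrt x"
  if "x > 0" for x :: real
proof -
  have a: "2 powr (1/2) \<ge> (14 / 10 :: real)"
    unfolding powr_half_sqrt[of 2, simplified] by (intro real_le_rsqrt) (simp add: power2_eq_square)
  have b: "10 powr (2/9) \<ge> (16 / 10 :: real)"
  proof (rule ccontr)
    assume "\<not> 10 powr (2/9) \<ge> (16 / 10 :: real)"
    then have "(10 powr (2/9)) ^ 9 < (16 / 10 :: real) ^ 9" by (intro power_strict_mono) auto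
    moreover have "(10 powr (2/9)) ^ 9 = (10 :: real) ^ 2" by (simp add: powr_powr flip: powr_realpow)
    ultimately show False by (simp add: power_divide)
  qed
  have c: "3 powr (3/2) \<le> (52 / 10 :: real)"
  proof (rule ccontr)
    assume "\<not> 3 powr (3/2) \<le> (52 / 10 :: real)"
    then have "(3 powr (3/2)) ^ 2 > (52 / 10 :: real) ^ 2" by (intro power_strict_mono) auto
    moreover have "(3 powr (3/2)) ^ 2 = (3 :: real) ^ 3" by (simp add: powr_powr flip: powr_realpow)
    ultimately show False by (simp add: power_divide)
  qed
  have "340 * (3 powr (3/2)) \<le> 340 * (52 / 10 :: real)" using c by simp
  also have "\<dots> < 800 * (14 / 10 * (16 / 10))" by simp
  also have "\<dots> \<le> 800 * (2 powr (1/2) * 10 powr (2/9))" using a b by (intro mult_left_mono mult_mono) auto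
  finally have "340 * (3 powr (3/2)) < 2 ^ 5 * 2 powr (1/2) * 5 ^ 2 * 10 powr (2/9 :: real)" by (simp add: mult_ac)
  then have "340 < (2 ^ 5 * 2 powr (1/2) * 5 ^ 2 * 10 powr (2/9)) / 3 powr (3/2 :: real)" by (simp add: pos_less_divide_eq)
  then have "340 / sqrt x < (2 ^ 5 * 2 powr (1/2) * 5 ^ 2 * 10 powr (2/9)) / 3 powr (3/2) / sqrt x"
    using that by (intro divide_strict_right_mono) auto
  then show ?thesis by simp
qed

text \<open>With $m=\lfloor n^2/24\rfloor$ one has $6n^2m\le n^4/4\le D$, so the number of balls is at
  most $22^{n^2m}\le(17/10)^{6n^2m}\le(17/10)^D$. Moreover $n(n+1)\le 25m$, so the remaining base is at
  most $8\cdot 3.83\cdot 5/\sqrt n$; the factor $2$ is absorbed by $(13/10)^D$.\<close>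
lemma ratio_bound_numeric:
  fixes n D :: nat
  assumes n: "n \<ge> 100" and D: "int D = (int ((n + 1) choose 2))\<^sup>2 - (int n)\<^sup>2 - 1"
  shows "\<exists>m\<ge>1. 2 * (2 * 21 ^ (n * n)) ^ m * (15 / 4 / (1 - 2 / real n) * 8 * (sqrt (real n + 1) / sqrt (real m))) ^ D < (340 / sqrt (real n)) ^ D"
proof -
  define m where "m = n * n div 24"
  have nn: "n * n \<ge> 100 * n" using n by simp
  have m24: "24 * m \<le> n * n" "n * n \<le> 24 * m + 23" by (auto simp: m_def)
  have m: "m \<ge> 1" using nn n m24 by linarith
  have nm: "n * (n + 1) \<le> 25 * m"
  proof -
    have "25 * (n * n) \<le> 600 * m + 575" using m24(2) by linarith
    moreover have "24 * (n * n) + 24 * n + 575 \<le> 25 * (n * n)" using nn n by linarith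
    ultimately show ?thesis by simp
  qed
  have c2: "2 * int ((n + 1) choose 2) = int n * (int n + 1)"
  proof -
    have "2 * ((n + 1) choose 2) = n * (n + 1)" by (simp add: choose_two)
    then have "int (2 * ((n + 1) choose 2)) = int (n * (n + 1))" by (rule arg_cong)
    then show ?thesis by (simp add: algebra_simps)
  qed
  have D6: "6 * (n * n * m) \<le> D"
  proof -
    have "4 * int D = (2 * int ((n + 1) choose 2))\<^sup>2 - 4 * (int n)\<^sup>2 - 4" unfolding D by (simp add: power2_eq_square)
    also have "\<dots> = (int n * (int n + 1))\<^sup>2 - 4 * (int n)\<^sup>2 - 4" unfolding c2 ..
    also have "\<dots> = (int n * int n) * (int n * int n) + (2 * int n * (int n * int n) - 3 * (int n * int n) - 4)"
      by (simp add: power2_eq_square algebra_simps)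
    finally have "4 * int D = (int n * int n) * (int n * int n) + (2 * int n * (int n * int n) - 3 * (int n * int n) - 4)" .
    moreover have "2 * int n * (int n * int n) \<ge> 4 * (int n * int n)" using n by (intro mult_right_mono) auto
    moreover have "int n * int n \<ge> 100 * 100" using n by (intro mult_mono) auto
    ultimately have "(int n * int n) * (int n * int n) \<le> 4 * int D" by linarith
    moreover have "(int n * int n) * (24 * int m) \<le> (int n * int n) * (int n * int n)"
    proof (rule mult_left_mono)
      have "int (24 * m) \<le> int (n * n)" using m24(1) by (simp only: of_nat_le_iff)
      then show "24 * int m \<le> int n * int n" by simp
    qed simp
    ultimately have "int (6 * (n * n * m)) \<le> int D" by simp
    then show ?thesis by (simp only: of_nat_le_iff)
  qed
  have "n * n * m \<ge> 1" using n m by simp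
  then have D3: "D \<ge> 3" using D6 by linarith
  let ?b = "15 / 4 / (1 - 2 / real n) * 8 * (sqrt (real n + 1) / sqrt (real m))"
  have sn: "sqrt (real n) > 0" using n by simp
  have net: "(2 * 21 ^ (n * n)) ^ m \<le> (17 / 10 :: real) ^ D"
  proof -
    have "(2 :: real) \<le> (22 / 21) ^ 15" by (simp add: power_divide)
    also have "\<dots> \<le> (22 / 21) ^ (n * n)"
    proof (rule power_increasing)
      show "15 \<le> n * n" using nn n by linarith
    qed simp
    finally have "2 * 21 ^ (n * n) \<le> (22 / 21 :: real) ^ (n * n) * 21 ^ (n * n)" by (intro mult_right_mono) auto
    also have "\<dots> = 22 ^ (n * n)" by (simp add: power_divide)
    also have "\<dots> \<le> ((17 / 10) ^ 6) ^ (n * n)" by (intro power_mono) (simp_all add: power_divide)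
    finally have "(2 * 21 ^ (n * n)) ^ m \<le> (((17 / 10 :: real) ^ 6) ^ (n * n)) ^ m" by (intro power_mono) auto
    also have "\<dots> = (17 / 10) ^ (6 * (n * n * m))" by (simp only: power_mult mult.assoc)
    also have "\<dots> \<le> (17 / 10) ^ D" using D6 by (intro power_increasing) auto
    finally show ?thesis .
  qed
  have "?b \<le> (383 / 100) * 8 * (5 / sqrt (real n))"
  proof (intro mult_mono)
    have "2 / real n \<le> 2 / 100" using n by (intro divide_left_mono) auto
    then have "15 / 4 / (1 - 2 / real n) \<le> 15 / 4 / (98 / 100 :: real)" by (intro divide_left_mono) auto
    then show "15 / 4 / (1 - 2 / real n) \<le> (383 / 100 :: real)" by simp
    have "real n * (real n + 1) \<le> 5\<^sup>2 * real m"
    proof -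
      have "real (n * (n + 1)) \<le> real (25 * m)" using nm by (simp only: of_nat_le_iff)
      then show ?thesis by (simp add: algebra_simps)
    qed
    then have "sqrt (real n * (real n + 1)) \<le> sqrt (5\<^sup>2 * real m)" by (rule real_sqrt_le_mono)
    then have "sqrt (real n + 1) * sqrt (real n) \<le> 5 * sqrt (real m)" by (simp add: real_sqrt_mult mult.commute)
    then show "sqrt (real n + 1) / sqrt (real m) \<le> 5 / sqrt (real n)" using sn m by (simp add: divide_simps)
  qed (use n in auto)
  then have b: "?b \<le> (1532 / 10) / sqrt (real n)" by simp
  have "1 - 2 / real n > 0" using n by simp
  then have b0: "?b \<ge> 0" by (intro mult_nonneg_nonneg divide_nonneg_nonneg) auto
  have "2 * (2 * 21 ^ (n * n)) ^ m * ?b ^ D \<le> 2 * (17 / 10) ^ D * ((1532 / 10) / sqrt (real n)) ^ D"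
    using net b b0 by (intro mult_mono power_mono) auto
  also have "\<dots> = 2 * (17 / 10 * ((1532 / 10) / sqrt (real n))) ^ D" by (simp only: power_mult_distrib mult.assoc)
  also have "\<dots> < (13 / 10) ^ D * (17 / 10 * ((1532 / 10) / sqrt (real n))) ^ D"
  proof (rule mult_strict_right_mono)
    have "2 < (13 / 10 :: real) ^ 3" by (simp add: power_divide)
    also have "\<dots> \<le> (13 / 10) ^ D" using D3 by (intro power_increasing) auto
    finally show "2 < (13 / 10 :: real) ^ D" .
  qed (use sn in auto)
  also have "\<dots> = (13 / 10 * (17 / 10 * ((1532 / 10) / sqrt (real n)))) ^ D" by (simp only: power_mult_distrib)
  also have "\<dots> \<le> (340 / sqrt (real n)) ^ D" using sn by (intro power_mono) (auto simp: divide_simps)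
  finally show ?thesis using m by blast
qed

lemma dimension_ge_1:
  assumes n: "n \<ge> 3" and D: "int D = (int ((n + 1) choose 2))\<^sup>2 - (int n)\<^sup>2 - 1"
  shows "D \<ge> 1"
proof -
  have "2 * ((n + 1) choose 2) = n * (n + 1)" by (simp add: choose_two)
  moreover have "n * 4 \<le> n * (n + 1)" using n by (intro mult_left_mono) auto
  ultimately have "2 * n \<le> (n + 1) choose 2" by linarith
  then have "(int (2 * n))\<^sup>2 \<le> (int ((n + 1) choose 2))\<^sup>2" by (intro power_mono) auto
  moreover have "(int n)\<^sup>2 \<ge> 3\<^sup>2" using n by (intro power_mono) auto
  ultimately have "int D \<ge> 1" unfolding D by (simp add: power_mult_distrib)
  then show ?thesis by simp
qed

lemma ccp_prob_bound:
  assumes n: "n \<ge> 3"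
  shows "0 \<le> ccp_prob n"
    and "ccp_prob n < ((2 ^ 5 * 2 powr (1/2) * 5 ^ 2 * 10 powr (2/9)) / (3 powr (3/2) * sqrt (real n))) ^ dim_M n"
    and "int (dim_M n) = (int ((n + 1) choose 2))\<^sup>2 - (int n)\<^sup>2 - 1"
proof -
  interpret S: stiefel n by standard (rule n)
  define \<phi> where "\<phi> = (SOME \<phi>. is_linear_isometry n \<phi>)"
  have "is_linear_isometry n \<phi>" unfolding \<phi>_def by (rule someI_ex[OF conjunct2[OF S.isometry_and_dim]])
  then interpret I: isometric_coordinates n \<phi> by unfold_locales
  show dim: "int (dim_M n) = (int ((n + 1) choose 2))\<^sup>2 - (int n)\<^sup>2 - 1"
    using S.dimM_formula S.isometry_and_dim by simp
  have p: "ccp_prob n = I.volume (Sos_tilde n) / I.volume (Pos_tilde n)"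
    by (simp add: ccp_prob_def Vol_def \<phi>_def Let_def)
  show "0 \<le> ccp_prob n" by (simp add: p)
  have D0: "dim_M n \<ge> 1" by (rule dimension_ge_1[OF n dim])
  have sn: "sqrt (real n) > 0" using n by simp
  have "ccp_prob n < (340 / sqrt (real n)) ^ dim_M n"
  proof (cases "n \<ge> 100")
    case True
    obtain m :: nat where "m \<ge> 1" and lt: "2 * (2 * 21 ^ (n * n)) ^ m
        * (15 / 4 / (1 - 2 / real n) * 8 * (sqrt (real n + 1) / sqrt (real m))) ^ dim_M n < (340 / sqrt (real n)) ^ dim_M n"
      using ratio_bound_numeric[OF True dim] by blast
    show ?thesis unfolding p by (rule order.strict_trans1[OF I.ratio_le[OF \<open>m \<ge> 1\<close> D0] lt])
  next
    case False
    then have "sqrt (real n) < sqrt (10\<^sup>2)" by (intro real_sqrt_less_mono) simp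
    then have "1 < 340 / sqrt (real n)" using sn by simp
    then have "1 < (340 / sqrt (real n)) ^ dim_M n" using D0 by (intro one_less_power) auto
    then show ?thesis using I.ratio_le_1 unfolding p by linarith
  qed
  also have "\<dots> \<le> ((2 ^ 5 * 2 powr (1/2) * 5 ^ 2 * 10 powr (2/9)) / (3 powr (3/2) * sqrt (real n))) ^ dim_M n"
    by (intro power_mono order_less_imp_le[OF base_gt]) (use n in auto)
  finally show "ccp_prob n < ((2 ^ 5 * 2 powr (1/2) * 5 ^ 2 * 10 powr (2/9)) / (3 powr (3/2) * sqrt (real n))) ^ dim_M n" .
qed

theorem corollary4p8:
  shows "(\<forall>n::nat. n \<ge> 3 \<longrightarrow>
           ccp_prob n < ((2 ^ 5 * 2 powr (1/2) * 5 ^ 2 * 10 powr (2/9)) /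
                         (3 powr (3/2) * sqrt (real n))) ^ dim_M n \<and>
           int (dim_M n) = (int ((n + 1) choose 2))\<^sup>2 - (int n)\<^sup>2 - 1) \<and>
         ccp_prob \<longlonglongrightarrow> 0"
proof (intro conjI allI impI)
  let ?C = "(2 ^ 5 * 2 powr (1/2) * 5 ^ 2 * 10 powr (2/9)) / (3 powr (3/2)) :: real"
  have lim: "(\<lambda>n. ?C / sqrt (real n)) \<longlonglongrightarrow> 0"
    by (intro real_tendsto_divide_at_top[where c = ?C] tendsto_const filterlim_compose[OF sqrt_at_top filterlim_real_sequentially])
  \<comment> \<open>Once the base is below $1$, its power is at most the base itself.\<close>
  have lt: "\<forall>\<^sub>F n in sequentially. ?C / sqrt (real n) < 1" by (rule order_tendstoD[OF lim]) simp
  show "ccp_prob \<longlonglongrightarrow> 0"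
  proof (rule tendsto_sandwich[OF _ _ tendsto_const lim])
    show "\<forall>\<^sub>F n in sequentially. 0 \<le> ccp_prob n"
      using eventually_ge_at_top[of 3] by eventually_elim (rule ccp_prob_bound)
    show "\<forall>\<^sub>F n in sequentially. ccp_prob n \<le> ?C / sqrt (real n)"
      using eventually_ge_at_top[of 3] lt
    proof eventually_elim
      case (elim n)
      let ?x = "?C / sqrt (real n)"
      have "ccp_prob n < ?x ^ dim_M n" using ccp_prob_bound(2)[OF elim(1)] by simp
      also have "?x ^ dim_M n \<le> ?x ^ 1"
        using elim(2) dimension_ge_1[OF elim(1) ccp_prob_bound(3)[OF elim(1)]] by (intro power_decreasing) auto
      finally show ?case by simp
    qed
  qed
qed (use ccp_prob_bound in auto)

end
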